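(* The category $\overline{\mathscr{D}} = \operatorname{add}\{\Sigma^i X_n, \mathsf{E}_m \mid i,m\in\mathbb{Z},\ n\in\mathbb{N}_0\}$ is a triangulated subcategory of $\mathsf{D}(R)$.
   Context: Let $k$ be an algebraically closed field and let $R=k[T]$ be viewed as a DG algebra with zero differential, with $T$ in cohomological degree $-1$. Let $\mathsf{D}(R)$ be the derived category of right DG $R$-modules, with suspension $\Sigma$ (so $(\Sigma M)^i=M^{i+1}$ on underlying graded modules), and let $\mathscr{D}=\mathsf{D}^f(R)$ be its full subcategory of DG modules whose total cohomology is finite-dimensional over $k$. For $n\in\mathbb{N}_0=\{0,1,2,\dots\}$ the object $X_n$ is defined by a distinguished triangle $\Sigma^{n+1}R\xrightarrow{\cdot T^{n+1}}R\to X_n\to$. Up to isomorphism, the indecomposable objects of $\mathscr{D}$ are the $\Sigma^iX_n$ with $i\in\mathbb{Z}$, $n\in\mathbb{N}_0$, and the space of morphisms $\Sigma^{n-i}X_i\to\Sigma^{n-i-1}X_{i+1}$ is one-dimensional over $k$ for all $n \in \mathbb{Z}$, $i\in\mathbb{N}_0$. For $n\in\mathbb{Z}$, $\mathsf{E}_n=\operatorname{hocolim}_i(\Sigma^{n-i}X_i)\in\mathsf{D}(R)$ denotes the homotopy colimit (mapping cone of $\mathrm{id}-\mathrm{shift}$ on $\coprod_i\Sigma^{n-i}X_i$) of the direct system $\Sigma^nX_0\to\Sigma^{n-1}X_1\to\Sigma^{n-2}X_2\to\cdots$ of nonzero (irreducible) morphisms; this system is determined up to isomorphism. Here $\operatorname{add}$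 denotes the full subcategory of $\mathsf{D}(R)$ consisting of all direct summands of finite direct sums of the listed objects (closed under isomorphism). *)

theory Defs
  imports
    "HOL-Library.Function_Algebras"
    "HOL-Library.Infinite_Typeclass"
    "HOL-Computational_Algebra.Polynomial"
begin

text \<open>
  Vector spaces over the field 'k are taken to be subspaces of spaces 'u \<Rightarrow> 'k of functions, with
  pointwise operations; every vector space over 'k is isomorphic to one of these for a large
  enough 'u.  A fixed infinite type 'u plays the role of the universe (a bound on size) in which
  the derived category is formed: for such 'u, the DG modules over ('k, 'u) contain copies of
  cones and of countable direct sums of DG modules over ('k, 'u).  The type 'u is otherwise
  arbitrary.
\<close>

definition fscale :: "'k::field \<Rightarrow> ('u \<Rightarrow> 'k) \<Rightarrow> ('u \<Rightarrow> 'k)" where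
  "fscale c x = (\<lambda>u. c * x u)"

interpretation fvec: vector_space "fscale :: 'k::field \<Rightarrow> ('u \<Rightarrow> 'k) \<Rightarrow> ('u \<Rightarrow> 'k)"
  by unfold_locales (auto simp: fscale_def fun_eq_iff algebra_simps)


section \<open>DG modules over k[T]\<close>

text \<open>
  R = k[T] has zero differential and T has degree -1.  A right DG R-module M consists of the
  spaces cpt M i, the differential dif M i from degree i to degree i + 1 and the right
  multiplication tact M i by T from degree i to degree i - 1.  A right action of k[T] is the same
  as the single operator T, and the Leibniz rule
  d (m T) = d m T + (-1)^i m d T reads d (m T) = d m T.
  Only the values of dif M i and tact M i on cpt M i matter; the same convention is used for
  graded maps.
\<close>

record ('k, 'u) dgm =
  cpt :: "int \<Rightarrow> ('u \<Rightarrow> 'k) set"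
  dif :: "int \<Rightarrow> ('u \<Rightarrow> 'k) \<Rightarrow> ('u \<Rightarrow> 'k)"
  tact :: "int \<Rightarrow> ('u \<Rightarrow> 'k) \<Rightarrow> ('u \<Rightarrow> 'k)"

type_synonym ('k, 'u, 'w) gmap = "int \<Rightarrow> ('u \<Rightarrow> 'k) \<Rightarrow> ('w \<Rightarrow> 'k)"

definition lin_maps ::
  "(int \<Rightarrow> ('u \<Rightarrow> 'k::field) set) \<Rightarrow> (int \<Rightarrow> ('w \<Rightarrow> 'k) set) \<Rightarrow> int \<Rightarrow> ('k, 'u, 'w) gmap set" where
  "lin_maps A B n = {f. \<forall>i.
      (\<forall>x\<in>A i. f i x \<in> B (i + n)) \<and>
      (\<forall>x\<in>A i. \<forall>y\<in>A i. f i (x + y) = f i x + f i y) \<and>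
      (\<forall>c. \<forall>x\<in>A i. f i (fscale c x) = fscale c (f i x))}"

definition dg_module :: "('k::field, 'u) dgm \<Rightarrow> bool" where
  "dg_module M \<longleftrightarrow>
     (\<forall>i. fvec.subspace (cpt M i)) \<and>
     dif M \<in> lin_maps (cpt M) (cpt M) 1 \<and>
     tact M \<in> lin_maps (cpt M) (cpt M) (- 1) \<and>
     (\<forall>i. \<forall>x\<in>cpt M i. dif M (i + 1) (dif M i x) = 0) \<and>
     (\<forall>i. \<forall>x\<in>cpt M i. dif M (i - 1) (tact M i x) = tact M (i + 1) (dif M i x))"

text \<open>Graded R-linear maps of degree n; for right modules R-linearity carries no sign.\<close>

definition rlin :: "('k::field, 'u) dgm \<Rightarrow> ('k, 'w) dgm \<Rightarrow> int \<Rightarrow> ('k, 'u, 'w) gmap set" where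
  "rlin M N n = {f \<in> lin_maps (cpt M) (cpt N) n.
      \<forall>i. \<forall>x\<in>cpt M i. f (i - 1) (tact M i x) = tact N (i + n) (f i x)}"

definition dg_hom :: "('k::field, 'u) dgm \<Rightarrow> ('k, 'w) dgm \<Rightarrow> ('k, 'u, 'w) gmap set" where
  "dg_hom M N = {f \<in> rlin M N 0. \<forall>i. \<forall>x\<in>cpt M i. f (i + 1) (dif M i x) = dif N i (f i x)}"

definition dg_iso :: "('k::field, 'u) dgm \<Rightarrow> ('k, 'w) dgm \<Rightarrow> ('k, 'u, 'w) gmap set" where
  "dg_iso M N = {f \<in> dg_hom M N. \<forall>i. bij_betw (f i) (cpt M i) (cpt N i)}"

definition gid :: "('k, 'u, 'u) gmap" where
  "gid = (\<lambda>i x. x)"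

definition gcomp :: "('k, 'v, 'w) gmap \<Rightarrow> ('k, 'u, 'v) gmap \<Rightarrow> ('k, 'u, 'w) gmap" where
  "gcomp g f = (\<lambda>i x. g i (f i x))"

definition homotopic ::
  "('k::field, 'u) dgm \<Rightarrow> ('k, 'w) dgm \<Rightarrow> ('k, 'u, 'w) gmap \<Rightarrow> ('k, 'u, 'w) gmap \<Rightarrow> bool" where
  "homotopic M N f g \<longleftrightarrow> (\<exists>h\<in>rlin M N (- 1). \<forall>i. \<forall>x\<in>cpt M i.
      f i x - g i x = dif N (i - 1) (h i x) + h (i + 1) (dif M i x))"

definition cocycles :: "('k::field, 'u) dgm \<Rightarrow> int \<Rightarrow> ('u \<Rightarrow> 'k) set" where
  "cocycles M i = {x \<in> cpt M i. dif M i x = 0}"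

definition coboundaries :: "('k::field, 'u) dgm \<Rightarrow> int \<Rightarrow> ('u \<Rightarrow> 'k) set" where
  "coboundaries M i = dif M (i - 1) ` cpt M (i - 1)"

definition cohomology :: "('k::field, 'u) dgm \<Rightarrow> int \<Rightarrow> ('u \<Rightarrow> 'k) set set" where
  "cohomology M i = cocycles M i //
     {(x, y). x \<in> cocycles M i \<and> y \<in> cocycles M i \<and> x - y \<in> coboundaries M i}"

text \<open>The map induced by f on cohomology, sending the class of x to the class of f x.\<close>

definition cohomology_map ::
  "('k::field, 'w) dgm \<Rightarrow> ('k, 'u, 'w) gmap \<Rightarrow> int \<Rightarrow> ('u \<Rightarrow> 'k) set \<Rightarrow> ('w \<Rightarrow> 'k) set" where
  "cohomology_map N f i A = {y \<in> cocycles N i. \<exists>x\<in>A. y - f i x \<in> coboundaries N i}"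

definition quasi_iso :: "('k::field, 'u) dgm \<Rightarrow> ('k, 'w) dgm \<Rightarrow> ('k, 'u, 'w) gmap set" where
  "quasi_iso M N = {f \<in> dg_hom M N.
      \<forall>i. bij_betw (cohomology_map N f i) (cohomology M i) (cohomology N i)}"

text \<open>The iterated suspension, for an arbitrary integer n; the differential is multiplied by (-1)^n.\<close>

definition shift :: "int \<Rightarrow> ('k::field, 'u) dgm \<Rightarrow> ('k, 'u) dgm" where
  "shift n M =
     \<lparr>cpt = (\<lambda>i. cpt M (i + n)),
      dif = (\<lambda>i x. if even n then dif M (i + n) x else - dif M (i + n) x),
      tact = (\<lambda>i. tact M (i + n))\<rparr>"

definition shift_map :: "int \<Rightarrow> ('k, 'u, 'w) gmap \<Rightarrow> ('k, 'u, 'w) gmap" where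
  "shift_map n f = (\<lambda>i. f (i + n))"

text \<open>
  The mapping cone of f from M to N, with N^i \<oplus> M^(i+1) in degree i and
  d (y, x) = (d y + f x, - d x).  The pair (y, x) is encoded as the function case_sum y x.
\<close>

definition cone :: "('k::field, 'u) dgm \<Rightarrow> ('k, 'w) dgm \<Rightarrow> ('k, 'u, 'w) gmap \<Rightarrow> ('k, 'w + 'u) dgm" where
  "cone M N f =
     \<lparr>cpt = (\<lambda>i. {case_sum y x |y x. y \<in> cpt N i \<and> x \<in> cpt M (i + 1)}),
      dif = (\<lambda>i z. case_sum (dif N i (z \<circ> Inl) + f (i + 1) (z \<circ> Inr)) (- dif M (i + 1) (z \<circ> Inr))),
      tact = (\<lambda>i z. case_sum (tact N i (z \<circ> Inl)) (tact M (i + 1) (z \<circ> Inr)))\<rparr>"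

text \<open>
  C is, up to isomorphism of DG modules, the mapping cone of f, with \<iota> the canonical map from N
  and \<pi> the canonical map to the suspension of M.
\<close>

definition is_cone :: "('k::field, 'u) dgm \<Rightarrow> ('k, 'u) dgm \<Rightarrow> ('k, 'u, 'u) gmap \<Rightarrow>
    ('k, 'u) dgm \<Rightarrow> ('k, 'u, 'u) gmap \<Rightarrow> ('k, 'u, 'u) gmap \<Rightarrow> bool" where
  "is_cone M N f C \<iota> \<pi> \<longleftrightarrow> dg_module C \<and> (\<exists>j\<in>dg_iso (cone M N f) C.
      (\<forall>i. \<forall>y\<in>cpt N i. \<iota> i y = j i (case_sum y 0)) \<and>
      (\<forall>i. \<forall>y\<in>cpt N i. \<forall>x\<in>cpt M (i + 1). \<pi> i (j i (case_sum y x)) = x))"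

text \<open>
  The direct sum of the Y i for i in I.  Its elements are the functions z on 'i \<times> 'w for which
  every section u \<mapsto> z (i, u) is in Y i and almost all sections vanish.
\<close>

definition dsum :: "'i set \<Rightarrow> ('i \<Rightarrow> ('k::field, 'w) dgm) \<Rightarrow> ('k, 'i \<times> 'w) dgm" where
  "dsum I Y =
     \<lparr>cpt = (\<lambda>n. {z. (\<forall>i\<in>I. (\<lambda>u. z (i, u)) \<in> cpt (Y i) n) \<and>
                     (\<forall>i. i \<notin> I \<longrightarrow> (\<lambda>u. z (i, u)) = 0) \<and>
                     finite {i. (\<lambda>u. z (i, u)) \<noteq> 0}}),
      dif = (\<lambda>n z (i, u). if i \<in> I then dif (Y i) n (\<lambda>v. z (i, v)) u else 0),
      tact = (\<lambda>n z (i, u). if i \<in> I then tact (Y i) n (\<lambda>v. z (i, v)) u else 0)\<rparr>"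

definition dsum_incl :: "'i \<Rightarrow> ('k::field, 'w, 'i \<times> 'w) gmap" where
  "dsum_incl i = (\<lambda>n x (j, u). if j = i then x u else 0)"

text \<open>
  B is, up to isomorphism of DG modules, the direct sum of the Y i, with canonical inclusions \<iota> i.
  Direct sums of DG modules are the coproducts of the derived category.
\<close>

definition is_dsum :: "'i set \<Rightarrow> ('i \<Rightarrow> ('k::field, 'u) dgm) \<Rightarrow> ('k, 'u) dgm \<Rightarrow>
    ('i \<Rightarrow> ('k, 'u, 'u) gmap) \<Rightarrow> bool" where
  "is_dsum I Y B \<iota> \<longleftrightarrow> dg_module B \<and> (\<exists>j\<in>dg_iso (dsum I Y) B.
      \<forall>i\<in>I. \<forall>n. \<forall>x\<in>cpt (Y i) n. \<iota> i n x = j n (dsum_incl i n x))"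

text \<open>
  The DG algebra R as a module over itself, a polynomial being represented by its coefficient
  function.  In degree i it consists of the scalar multiples of T^(-i).
\<close>

definition mult_T :: "nat \<Rightarrow> (nat \<Rightarrow> 'k::field) \<Rightarrow> (nat \<Rightarrow> 'k)" where
  "mult_T m x = coeff (Abs_poly x * monom 1 m)"

definition dg_R :: "('k::field, nat) dgm" where
  "dg_R =
     \<lparr>cpt = (\<lambda>i. {coeff p |p. \<forall>n. coeff p n \<noteq> 0 \<longrightarrow> int n = - i}),
      dif = (\<lambda>i x. 0),
      tact = (\<lambda>i. mult_T 1)\<rparr>"


section \<open>The derived category\<close>

text \<open>
  The objects are the DG modules over ('k, 'u).  Morphisms are the equivalence classes of
  roofs X \<leftarrow> W \<rightarrow> Y, with the left leg a quasi-isomorphism: this is the localisation of the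
  homotopy category at the quasi-isomorphisms.
\<close>

record ('k, 'u) roof =
  apex :: "('k, 'u) dgm"
  den :: "('k, 'u, 'u) gmap"
  num :: "('k, 'u, 'u) gmap"

definition roofs :: "('k::field, 'u) dgm \<Rightarrow> ('k, 'u) dgm \<Rightarrow> ('k, 'u) roof set" where
  "roofs X Y = {r. dg_module (apex r) \<and> den r \<in> quasi_iso (apex r) X \<and> num r \<in> dg_hom (apex r) Y}"

definition roof_rel ::
  "('k::field, 'u) dgm \<Rightarrow> ('k, 'u) dgm \<Rightarrow> (('k, 'u) roof \<times> ('k, 'u) roof) set" where
  "roof_rel X Y = {(r, r'). r \<in> roofs X Y \<and> r' \<in> roofs X Y \<and>
      (\<exists>(W :: ('k, 'u) dgm) p q. dg_module W \<and> p \<in> dg_hom W (apex r) \<and> q \<in> dg_hom W (apex r') \<and>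
         gcomp (den r) p \<in> quasi_iso W X \<and>
         homotopic W X (gcomp (den r) p) (gcomp (den r') q) \<and>
         homotopic W Y (gcomp (num r) p) (gcomp (num r') q))}"

type_synonym ('k, 'u) dmor = "('k, 'u) roof set"

definition D_hom :: "('k::field, 'u) dgm \<Rightarrow> ('k, 'u) dgm \<Rightarrow> ('k, 'u) dmor set" where
  "D_hom X Y = roofs X Y // roof_rel X Y"

text \<open>The localisation functor on morphisms.\<close>

definition D_of :: "('k::field, 'u) dgm \<Rightarrow> ('k, 'u) dgm \<Rightarrow> ('k, 'u, 'u) gmap \<Rightarrow> ('k, 'u) dmor" where
  "D_of X Y f = roof_rel X Y `` {\<lparr>apex = X, den = gid, num = f\<rparr>}"

definition D_id :: "('k::field, 'u) dgm \<Rightarrow> ('k, 'u) dmor" where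
  "D_id X = D_of X X gid"

definition D_zero :: "('k::field, 'u) dgm \<Rightarrow> ('k, 'u) dgm \<Rightarrow> ('k, 'u) dmor" where
  "D_zero X Y = D_of X Y (\<lambda>i x. 0)"

text \<open>
  The composite of \<phi> from X to Y and \<psi> from Y to Z is the set of all roofs equivalent to one
  obtained by completing a square over roofs representing \<phi> and \<psi>; all these roofs form a
  single equivalence class.  In the same way, the difference of two morphisms is computed on
  representatives with a common left leg.
\<close>

definition D_comp :: "('k::field, 'u) dgm \<Rightarrow> ('k, 'u) dgm \<Rightarrow> ('k, 'u) dgm \<Rightarrow>
    ('k, 'u) dmor \<Rightarrow> ('k, 'u) dmor \<Rightarrow> ('k, 'u) dmor" where
  "D_comp X Y Z \<psi> \<phi> = {c. \<exists>r\<in>\<phi>. \<exists>s\<in>\<psi>. \<exists>W u g.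
      dg_module W \<and> u \<in> quasi_iso W (apex r) \<and> g \<in> dg_hom W (apex s) \<and>
      homotopic W Y (gcomp (num r) u) (gcomp (den s) g) \<and>
      (\<lparr>apex = W, den = gcomp (den r) u, num = gcomp (num s) g\<rparr>, c) \<in> roof_rel X Z}"

definition D_minus :: "('k::field, 'u) dgm \<Rightarrow> ('k, 'u) dgm \<Rightarrow>
    ('k, 'u) dmor \<Rightarrow> ('k, 'u) dmor \<Rightarrow> ('k, 'u) dmor" where
  "D_minus X Y \<phi> \<psi> = {c. \<exists>W s f g.
      \<lparr>apex = W, den = s, num = f\<rparr> \<in> \<phi> \<and> \<lparr>apex = W, den = s, num = g\<rparr> \<in> \<psi> \<and>
      (\<lparr>apex = W, den = s, num = (\<lambda>i x. f i x - g i x)\<rparr>, c) \<in> roof_rel X Y}"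

definition D_iso :: "('k::field, 'u) dgm \<Rightarrow> ('k, 'u) dgm \<Rightarrow> ('k, 'u) dmor set" where
  "D_iso X Y = {\<phi> \<in> D_hom X Y. \<exists>\<psi>\<in>D_hom Y X.
      D_comp X Y X \<psi> \<phi> = D_id X \<and> D_comp Y X Y \<phi> \<psi> = D_id Y}"

definition isomorphic_D :: "('k::field, 'u) dgm \<Rightarrow> ('k, 'u) dgm \<Rightarrow> bool" where
  "isomorphic_D X Y \<longleftrightarrow> D_iso X Y \<noteq> {}"

text \<open>
  The suspension functor on morphisms.  It is invertible on roofs, so the image of an equivalence
  class is an equivalence class.
\<close>

definition D_shift :: "int \<Rightarrow> ('k::field, 'u) dmor \<Rightarrow> ('k, 'u) dmor" where
  "D_shift n \<phi> =
     (\<lambda>r. \<lparr>apex = shift n (apex r), den = shift_map n (den r), num = shift_map n (num r)\<rparr>) ` \<phi>"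

text \<open>The distinguished triangles are those isomorphic to the triangle of a mapping cone.\<close>

definition dist_triangle :: "('k::field, 'u) dgm \<Rightarrow> ('k, 'u) dgm \<Rightarrow> ('k, 'u) dgm \<Rightarrow>
    ('k, 'u) dmor \<Rightarrow> ('k, 'u) dmor \<Rightarrow> ('k, 'u) dmor \<Rightarrow> bool" where
  "dist_triangle X Y Z \<phi> \<psi> \<chi> \<longleftrightarrow>
     dg_module X \<and> dg_module Y \<and> dg_module Z \<and>
     \<phi> \<in> D_hom X Y \<and> \<psi> \<in> D_hom Y Z \<and> \<chi> \<in> D_hom Z (shift 1 X) \<and>
     (\<exists>M N C f \<iota> \<pi>. dg_module M \<and> dg_module N \<and> f \<in> dg_hom M N \<and> is_cone M N f C \<iota> \<pi> \<and>
       (\<exists>a\<in>D_iso X M. \<exists>b\<in>D_iso Y N. \<exists>c\<in>D_iso Z C.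
          D_comp X Y N b \<phi> = D_comp X M N (D_of M N f) a \<and>
          D_comp Y Z C c \<psi> = D_comp Y N C (D_of N C \<iota>) b \<and>
          D_comp Z (shift 1 X) (shift 1 M) (D_shift 1 a) \<chi> =
            D_comp Z C (shift 1 M) (D_of C (shift 1 M) \<pi>) c))"

text \<open>
  Y 0 \<rightarrow> Y 1 \<rightarrow> \<dots> is a direct system in the derived category with transition morphisms \<phi> i, the
  DG module B is the coproduct of the Y i, and \<theta> is the endomorphism id - shift of B, determined by
  its restrictions to the Y i.
\<close>

definition is_hocolim ::
  "(nat \<Rightarrow> ('k::field, 'u) dgm) \<Rightarrow> (nat \<Rightarrow> ('k, 'u) dmor) \<Rightarrow> ('k, 'u) dgm \<Rightarrow> bool" where
  "is_hocolim Y \<phi> E \<longleftrightarrow>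
     (\<forall>i. dg_module (Y i) \<and> \<phi> i \<in> D_hom (Y i) (Y (Suc i))) \<and>
     (\<exists>B \<iota> \<theta> \<psi> \<chi>. is_dsum UNIV Y B \<iota> \<and> \<theta> \<in> D_hom B B \<and>
       (\<forall>i. D_comp (Y i) B B \<theta> (D_of (Y i) B (\<iota> i)) =
          D_minus (Y i) B (D_of (Y i) B (\<iota> i))
            (D_comp (Y i) (Y (Suc i)) B (D_of (Y (Suc i)) B (\<iota> (Suc i))) (\<phi> i))) \<and>
       dist_triangle B B E \<theta> \<psi> \<chi>)"

definition zero_object :: "('k::field, 'u) dgm \<Rightarrow> bool" where
  "zero_object Z \<longleftrightarrow> dg_module Z \<and> D_id Z = D_zero Z Z"

text \<open>Full subcategories are given by their sets of objects.\<close>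

definition triangulated_subcategory :: "('k::field, 'u) dgm set \<Rightarrow> bool" where
  "triangulated_subcategory S \<longleftrightarrow>
     (\<forall>X\<in>S. dg_module X) \<and>
     (\<forall>X\<in>S. \<forall>Y. dg_module Y \<and> isomorphic_D X Y \<longrightarrow> Y \<in> S) \<and>
     (\<exists>Z\<in>S. zero_object Z) \<and>
     (\<forall>X\<in>S. \<forall>Y\<in>S. \<exists>B\<in>S. \<exists>\<iota>. is_dsum UNIV (\<lambda>b. if b then X else Y) B \<iota>) \<and>
     (\<forall>X. dg_module X \<longrightarrow> (shift 1 X \<in> S \<longleftrightarrow> X \<in> S)) \<and>
     (\<forall>X\<in>S. \<forall>Y\<in>S. \<forall>Z \<phi> \<psi> \<chi>. dist_triangle X Y Z \<phi> \<psi> \<chi> \<longrightarrow> Z \<in> S)"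

text \<open>
  The direct summands in the derived category of finite direct sums of objects of S: some
  direct sum of X and X' is isomorphic to a direct sum of n objects A i of S.
\<close>

definition add_closure :: "('k::field, 'u) dgm set \<Rightarrow> ('k, 'u) dgm set" where
  "add_closure S = {X. dg_module X \<and> (\<exists>X' P \<iota> n A B \<kappa>. dg_module X' \<and>
      is_dsum UNIV (\<lambda>b. if b then X else X') P \<iota> \<and>
      (\<forall>i<n. A i \<in> S) \<and> is_dsum {..<(n::nat)} A B \<kappa> \<and> isomorphic_D P B)}"


section \<open>The objects of interest\<close>

text \<open>
  The objects X_n and E_n are determined only up to isomorphism and are
  therefore described by predicates.  Here P is a copy of R, \<rho> the identification of R with P
  and \<tau> the map of multiplication by T^(n+1).
\<close>

definition is_X :: "nat \<Rightarrow> ('k::field, 'u) dgm \<Rightarrow> bool" where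
  "is_X n X \<longleftrightarrow> (\<exists>P \<rho> \<tau> \<psi> \<chi>. dg_module P \<and> \<rho> \<in> dg_iso dg_R P \<and>
      \<tau> \<in> dg_hom (shift (int n + 1) P) P \<and>
      (\<forall>i. \<forall>x\<in>cpt dg_R (i + (int n + 1)). \<tau> i (\<rho> (i + (int n + 1)) x) = \<rho> i (mult_T (n + 1) x)) \<and>
      dist_triangle (shift (int n + 1) P) P X (D_of (shift (int n + 1) P) P \<tau>) \<psi> \<chi>)"

definition is_E :: "int \<Rightarrow> ('k::field, 'u) dgm \<Rightarrow> bool" where
  "is_E n E \<longleftrightarrow> (\<exists>X Y \<phi>. (\<forall>i. is_X i (X i) \<and> Y i = shift (n - int i) (X i)) \<and>
      (\<forall>i. \<phi> i \<in> D_hom (Y i) (Y (Suc i)) \<and> \<phi> i \<noteq> D_zero (Y i) (Y (Suc i))) \<and>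
      is_hocolim Y \<phi> E)"

definition Dbar :: "('k::field, 'u) dgm set" where
  "Dbar = add_closure ({shift i X |i n X. is_X n X} \<union> {E. \<exists>m. is_E m E})"

end

theory Submission
  imports Defs
begin

text \<open>Let H denote total cohomology, viewed as a graded module over k[T] with T in degree -1.
  The proof rests on an intrinsic description of the class: a DG module lies in \<open>Dbar\<close>
  if and only if its cohomology is an Artinian graded k[T]-module, that is, H vanishes in very
  negative degrees, is finite-dimensional in each degree, and T acts bijectively in all high degrees
  (\<open>artinian\<close>, \<open>Dbar_iff\<close>). This condition is stable under isomorphism and
  suspension, and the third vertex of a triangle inherits it by the long exact sequence and the five
  lemma (\<open>artinian_cone\<close>, \<open>artinian_dist_triangle\<close>).

  The generators are Artinian. Multiplication by T^(n+1) is injective on R, so H(X_n) is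
  k[T]/(T^(n+1)) (\<open>is_X_coh\<close>). For E_m, the map id - shift is injective on the
  cohomology of the coproduct, so H(E_m) is a direct limit of modules that are at most
  one-dimensional in each degree (\<open>hocolim_artinian\<close>). The property passes to finite
  direct sums and to direct summands (\<open>artinian_add_closure\<close>).

  Conversely, every graded k[T]-module S has a cofree resolution of length one. This makes every DG
  module formal: M is joined to its cohomology S, taken with zero differential, by
  quasi-isomorphisms M -> \<open>cof S\<close> <- S (\<open>formality\<close>). An Artinian graded
  module splits into finitely many interval modules \<open>bar J\<close> with J = {a..b} or J =
  {a..} (\<open>ex_bar_decomposition\<close>): a chain through the lowest nonzero degree that
  reaches up as far as possible is a direct summand, and its complement is smaller. Bounded
  intervals are suspensions of models of X_n and rays are models of E_m (\<open>is_X_bar\<close>,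
  \<open>is_E_bar\<close>).

  Since morphisms are equivalence classes of roofs, a calculus of fractions has to be built as well:
  \<open>ore\<close> and \<open>cancel_null\<close> yield that the relation on roofs is an
  equivalence (\<open>equiv_roof_rel\<close>) and that composites can be computed from any completed
  square (\<open>D_comp_cls\<close>). Cohomology is handled throughout by cocycles modulo
  coboundaries. A morphism of the derived category induces the relation \<open>D_coh\<close> between
  cocycles, and \<open>D_iso_roof\<close> represents every isomorphism by a roof of two
  quasi-isomorphisms, along which properties of cohomology are transported.\<close>

declare plus_fun_apply [simp del] zero_fun_apply [simp del] uminus_apply [simp del] minus_apply [simp del]

text \<open>Elements of DG modules are functions but are meant to behave as opaque vectors, so the
  pointwise rules are taken out of the simplifier. These copies are supplied where values at a point
  matter.\<close>

lemma pointwise: "(f + g) x = f x + g x" "(f - g) x = f x - g x" "(- f) x = - f x" "(0 :: _ \<Rightarrow> _) x = 0"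
  for f g :: "'a \<Rightarrow> 'b::ab_group_add"
  by (simp_all add: plus_fun_def minus_apply uminus_apply zero_fun_def)

section \<open>Calculus of DG modules over k[T], their graded maps and homotopies\<close>

section \<open>Linear maps and DG modules\<close>

lemma lin_mapsI:
  assumes "\<And>i x. x \<in> A i \<Longrightarrow> f i x \<in> B (i + n)"
    and "\<And>i x y. x \<in> A i \<Longrightarrow> y \<in> A i \<Longrightarrow> f i (x + y) = f i x + f i y"
    and "\<And>i c x. x \<in> A i \<Longrightarrow> f i (fscale c x) = fscale c (f i x)"
  shows "f \<in> lin_maps A B n"
  using assms by (auto simp: lin_maps_def)

lemma lin_maps_mem: "f \<in> lin_maps A B n \<Longrightarrow> x \<in> A i \<Longrightarrow> j = i + n \<Longrightarrow> f i x \<in> B j"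
  and lin_maps_add: "f \<in> lin_maps A B n \<Longrightarrow> x \<in> A i \<Longrightarrow> y \<in> A i \<Longrightarrow> f i (x + y) = f i x + f i y"
  and lin_maps_scale: "f \<in> lin_maps A B n \<Longrightarrow> x \<in> A i \<Longrightarrow> f i (fscale c x) = fscale c (f i x)"
  by (auto simp: lin_maps_def)

lemma fscale_simps [simp]:
  "fscale 0 x = 0" "fscale c 0 = 0" "fscale 1 x = x" "fscale (- c) x = - fscale c x"
  "fscale c (fscale d x) = fscale (c * d) x"
  by (auto simp: fscale_def fun_eq_iff pointwise)

lemma fscale_minus_one: "fscale (- 1) x = - x"
  by simp

lemma fscale_distribs:
  "fscale c (x + y) = fscale c x + fscale c y" "fscale c (x - y) = fscale c x - fscale c y"
  "fscale c (- x) = - fscale c x" "fscale (a + b) x = fscale a x + fscale b x"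
  by (auto simp: fscale_def fun_eq_iff pointwise algebra_simps)

lemma fscale_sum: "fscale c (\<Sum>a\<in>A. g a) = (\<Sum>a\<in>A. fscale c (g a))"
  by (rule fvec.scale_sum_right)

lemma cpt_subspace: "dg_module M \<Longrightarrow> fvec.subspace (cpt M i)"
  by (auto simp: dg_module_def)

lemma cpt_zero [simp]: "dg_module M \<Longrightarrow> 0 \<in> cpt M i"
  and cpt_add [simp]: "dg_module M \<Longrightarrow> x \<in> cpt M i \<Longrightarrow> y \<in> cpt M i \<Longrightarrow> x + y \<in> cpt M i"
  and cpt_diff [simp]: "dg_module M \<Longrightarrow> x \<in> cpt M i \<Longrightarrow> y \<in> cpt M i \<Longrightarrow> x - y \<in> cpt M i"
  and cpt_neg [simp]: "dg_module M \<Longrightarrow> x \<in> cpt M i \<Longrightarrow> - x \<in> cpt M i"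
  and cpt_scale [simp]: "dg_module M \<Longrightarrow> x \<in> cpt M i \<Longrightarrow> fscale c x \<in> cpt M i"
  by (auto dest: cpt_subspace[of M i] intro: fvec.subspace_0 fvec.subspace_add fvec.subspace_diff
      fvec.subspace_neg fvec.subspace_scale)

lemma cpt_sum: "dg_module M \<Longrightarrow> (\<And>a. a \<in> A \<Longrightarrow> g a \<in> cpt M i) \<Longrightarrow> (\<Sum>a\<in>A. g a) \<in> cpt M i"
  by (meson cpt_subspace fvec.subspace_sum)

lemma lin_maps_zero: "f \<in> lin_maps (cpt M) B n \<Longrightarrow> dg_module M \<Longrightarrow> f i 0 = 0"
  using lin_maps_scale[of f "cpt M" B n 0 i 0] by simp

lemma lin_maps_neg: "f \<in> lin_maps (cpt M) B n \<Longrightarrow> dg_module M \<Longrightarrow> x \<in> cpt M i \<Longrightarrow> f i (- x) = - f i x"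
  using lin_maps_scale[of f "cpt M" B n x i "- 1"] by simp

lemma lin_maps_diff: "f \<in> lin_maps (cpt M) B n \<Longrightarrow> dg_module M \<Longrightarrow> x \<in> cpt M i \<Longrightarrow> y \<in> cpt M i \<Longrightarrow>
    f i (x - y) = f i x - f i y"
  using lin_maps_add[of f "cpt M" B n x i "- y"] by (simp add: lin_maps_neg)

lemma lin_maps_sum: "f \<in> lin_maps (cpt M) B n \<Longrightarrow> dg_module M \<Longrightarrow> (\<And>a. a \<in> A \<Longrightarrow> g a \<in> cpt M i) \<Longrightarrow>
    f i (\<Sum>a\<in>A. g a) = (\<Sum>a\<in>A. f i (g a))"
  by (induction A rule: infinite_finite_induct) (simp_all add: lin_maps_zero lin_maps_add cpt_sum)

lemma dif_lin: "dg_module M \<Longrightarrow> dif M \<in> lin_maps (cpt M) (cpt M) 1"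
  and tact_lin: "dg_module M \<Longrightarrow> tact M \<in> lin_maps (cpt M) (cpt M) (- 1)"
  by (auto simp: dg_module_def)

lemma dif_mem [simp]: "dg_module M \<Longrightarrow> x \<in> cpt M i \<Longrightarrow> j = i + 1 \<Longrightarrow> dif M i x \<in> cpt M j"
  and dif_add [simp]: "dg_module M \<Longrightarrow> x \<in> cpt M i \<Longrightarrow> y \<in> cpt M i \<Longrightarrow> dif M i (x + y) = dif M i x + dif M i y"
  and dif_diff [simp]: "dg_module M \<Longrightarrow> x \<in> cpt M i \<Longrightarrow> y \<in> cpt M i \<Longrightarrow> dif M i (x - y) = dif M i x - dif M i y"
  and dif_neg [simp]: "dg_module M \<Longrightarrow> x \<in> cpt M i \<Longrightarrow> dif M i (- x) = - dif M i x"
  and dif_scale [simp]: "dg_module M \<Longrightarrow> x \<in> cpt M i \<Longrightarrow> dif M i (fscale c x) = fscale c (dif M i x)"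
  and dif_zero [simp]: "dg_module M \<Longrightarrow> dif M i 0 = 0"
  using dif_lin[of M] by (auto simp: lin_maps_mem lin_maps_add lin_maps_diff lin_maps_neg lin_maps_scale
    lin_maps_zero)

lemma dif_dif [simp]: "dg_module M \<Longrightarrow> x \<in> cpt M i \<Longrightarrow> j = i + 1 \<Longrightarrow> dif M j (dif M i x) = 0"
  unfolding dg_module_def by blast

lemma tact_mem [simp]: "dg_module M \<Longrightarrow> x \<in> cpt M i \<Longrightarrow> j = i - 1 \<Longrightarrow> tact M i x \<in> cpt M j"
  and tact_add [simp]: "dg_module M \<Longrightarrow> x \<in> cpt M i \<Longrightarrow> y \<in> cpt M i \<Longrightarrow> tact M i (x + y) = tact M i x + tact M i y"
  and tact_diff [simp]: "dg_module M \<Longrightarrow> x \<in> cpt M i \<Longrightarrow> y \<in> cpt M i \<Longrightarrow> tact M i (x - y) = tact M i x - tact M i y"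
  and tact_neg [simp]: "dg_module M \<Longrightarrow> x \<in> cpt M i \<Longrightarrow> tact M i (- x) = - tact M i x"
  and tact_scale [simp]: "dg_module M \<Longrightarrow> x \<in> cpt M i \<Longrightarrow> tact M i (fscale c x) = fscale c (tact M i x)"
  and tact_zero [simp]: "dg_module M \<Longrightarrow> tact M i 0 = 0"
  using tact_lin[of M] by (auto simp: lin_maps_mem lin_maps_add lin_maps_diff lin_maps_neg lin_maps_scale
    lin_maps_zero)

lemma dif_tact [simp]: "dg_module M \<Longrightarrow> x \<in> cpt M i \<Longrightarrow> j = i - 1 \<Longrightarrow> dif M j (tact M i x) = tact M (i + 1) (dif M i x)"
  unfolding dg_module_def by blast

lemma dif_sum: "dg_module M \<Longrightarrow> (\<And>a. a \<in> A \<Longrightarrow> g a \<in> cpt M i) \<Longrightarrow>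
    dif M i (\<Sum>a\<in>A. g a) = (\<Sum>a\<in>A. dif M i (g a))"
  by (rule lin_maps_sum[OF dif_lin])

lemma dg_moduleI:
  assumes "\<And>i. fvec.subspace (cpt M i)"
    and "\<And>i x. x \<in> cpt M i \<Longrightarrow> dif M i x \<in> cpt M (i + 1)"
    and "\<And>i x y. x \<in> cpt M i \<Longrightarrow> y \<in> cpt M i \<Longrightarrow> dif M i (x + y) = dif M i x + dif M i y"
    and "\<And>i c x. x \<in> cpt M i \<Longrightarrow> dif M i (fscale c x) = fscale c (dif M i x)"
    and "\<And>i x. x \<in> cpt M i \<Longrightarrow> tact M i x \<in> cpt M (i - 1)"
    and "\<And>i x y. x \<in> cpt M i \<Longrightarrow> y \<in> cpt M i \<Longrightarrow> tact M i (x + y) = tact M i x + tact M i y"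
    and "\<And>i c x. x \<in> cpt M i \<Longrightarrow> tact M i (fscale c x) = fscale c (tact M i x)"
    and "\<And>i x. x \<in> cpt M i \<Longrightarrow> dif M (i + 1) (dif M i x) = 0"
    and "\<And>i x. x \<in> cpt M i \<Longrightarrow> dif M (i - 1) (tact M i x) = tact M (i + 1) (dif M i x)"
  shows "dg_module M"
  using assms unfolding dg_module_def by (auto intro!: lin_mapsI)

lemma subspaceI:
  fixes S :: "('u \<Rightarrow> 'k::field) set"
  assumes "0 \<in> S" "\<And>x y. x \<in> S \<Longrightarrow> y \<in> S \<Longrightarrow> x + y \<in> S" "\<And>c x. x \<in> S \<Longrightarrow> fscale c x \<in> S"
  shows "fvec.subspace S"
  using assms by (auto simp: fvec.subspace_def)

section \<open>Maps of DG modules\<close>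

lemma rlin_lin: "f \<in> rlin M N n \<Longrightarrow> f \<in> lin_maps (cpt M) (cpt N) n"
  and hom_rlin: "f \<in> dg_hom M N \<Longrightarrow> f \<in> rlin M N 0"
  by (auto simp: rlin_def dg_hom_def)

lemma rlinI:
  assumes "\<And>i x. x \<in> cpt M i \<Longrightarrow> f i x \<in> cpt N (i + n)"
    and "\<And>i x y. x \<in> cpt M i \<Longrightarrow> y \<in> cpt M i \<Longrightarrow> f i (x + y) = f i x + f i y"
    and "\<And>i c x. x \<in> cpt M i \<Longrightarrow> f i (fscale c x) = fscale c (f i x)"
    and "\<And>i x. x \<in> cpt M i \<Longrightarrow> f (i - 1) (tact M i x) = tact N (i + n) (f i x)"
  shows "f \<in> rlin M N n"
  using assms unfolding rlin_def by (auto intro!: lin_mapsI)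

lemma dg_homI:
  assumes "\<And>i x. x \<in> cpt M i \<Longrightarrow> f i x \<in> cpt N i"
    and "\<And>i x y. x \<in> cpt M i \<Longrightarrow> y \<in> cpt M i \<Longrightarrow> f i (x + y) = f i x + f i y"
    and "\<And>i c x. x \<in> cpt M i \<Longrightarrow> f i (fscale c x) = fscale c (f i x)"
    and "\<And>i x. x \<in> cpt M i \<Longrightarrow> f (i - 1) (tact M i x) = tact N i (f i x)"
    and "\<And>i x. x \<in> cpt M i \<Longrightarrow> f (i + 1) (dif M i x) = dif N i (f i x)"
  shows "f \<in> dg_hom M N"
  using assms unfolding dg_hom_def by (auto intro!: rlinI)

lemma rlin_mem: "f \<in> rlin M N n \<Longrightarrow> x \<in> cpt M i \<Longrightarrow> j = i + n \<Longrightarrow> f i x \<in> cpt N j"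
  and rlin_add: "f \<in> rlin M N n \<Longrightarrow> x \<in> cpt M i \<Longrightarrow> y \<in> cpt M i \<Longrightarrow> f i (x + y) = f i x + f i y"
  and rlin_diff: "f \<in> rlin M N n \<Longrightarrow> dg_module M \<Longrightarrow> x \<in> cpt M i \<Longrightarrow> y \<in> cpt M i \<Longrightarrow> f i (x - y) = f i x - f i y"
  and rlin_neg: "f \<in> rlin M N n \<Longrightarrow> dg_module M \<Longrightarrow> x \<in> cpt M i \<Longrightarrow> f i (- x) = - f i x"
  and rlin_scale: "f \<in> rlin M N n \<Longrightarrow> x \<in> cpt M i \<Longrightarrow> f i (fscale c x) = fscale c (f i x)"
  and rlin_zero: "f \<in> rlin M N n \<Longrightarrow> dg_module M \<Longrightarrow> f i 0 = 0"
  and rlin_tact: "f \<in> rlin M N n \<Longrightarrow> x \<in> cpt M i \<Longrightarrow> j = i - 1 \<Longrightarrow> f j (tact M i x) = tact N (i + n) (f i x)"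
  using rlin_lin[of f M N n] by (auto simp: lin_maps_mem lin_maps_add lin_maps_diff lin_maps_neg lin_maps_scale
    lin_maps_zero rlin_def)

lemmas rlin_simps = rlin_mem rlin_add rlin_diff rlin_neg rlin_scale rlin_zero rlin_tact

lemma hom_mem [simp]: "f \<in> dg_hom M N \<Longrightarrow> x \<in> cpt M i \<Longrightarrow> f i x \<in> cpt N i"
  and hom_add [simp]: "f \<in> dg_hom M N \<Longrightarrow> x \<in> cpt M i \<Longrightarrow> y \<in> cpt M i \<Longrightarrow> f i (x + y) = f i x + f i y"
  and hom_diff [simp]: "f \<in> dg_hom M N \<Longrightarrow> dg_module M \<Longrightarrow> x \<in> cpt M i \<Longrightarrow> y \<in> cpt M i \<Longrightarrow> f i (x - y) = f i x - f i y"
  and hom_neg [simp]: "f \<in> dg_hom M N \<Longrightarrow> dg_module M \<Longrightarrow> x \<in> cpt M i \<Longrightarrow> f i (- x) = - f i x"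
  and hom_scale [simp]: "f \<in> dg_hom M N \<Longrightarrow> x \<in> cpt M i \<Longrightarrow> f i (fscale c x) = fscale c (f i x)"
  and hom_zero [simp]: "f \<in> dg_hom M N \<Longrightarrow> dg_module M \<Longrightarrow> f i 0 = 0"
  and hom_tact [simp]: "f \<in> dg_hom M N \<Longrightarrow> x \<in> cpt M i \<Longrightarrow> j = i - 1 \<Longrightarrow> f j (tact M i x) = tact N i (f i x)"
  and hom_dif [simp]: "f \<in> dg_hom M N \<Longrightarrow> x \<in> cpt M i \<Longrightarrow> j = i + 1 \<Longrightarrow> f j (dif M i x) = dif N i (f i x)"
  using hom_rlin[of f M N] by (auto simp: dg_hom_def rlin_simps)

lemma hom_sum: "f \<in> dg_hom M N \<Longrightarrow> dg_module M \<Longrightarrow> (\<And>a. a \<in> A \<Longrightarrow> g a \<in> cpt M i) \<Longrightarrow>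
    f i (\<Sum>a\<in>A. g a) = (\<Sum>a\<in>A. f i (g a))"
  by (rule lin_maps_sum[OF rlin_lin[OF hom_rlin]])

lemma gid_app [simp]: "gid i x = x"
  and gcomp_app [simp]: "gcomp g f i x = g i (f i x)"
  by (simp_all add: gid_def gcomp_def)

lemma gcomp_gid [simp]: "gcomp f gid = f" "gcomp gid f = f"
  and gcomp_assoc: "gcomp (gcomp h g) f = gcomp h (gcomp g f)"
  by (simp_all add: gid_def gcomp_def)

lemma gid_hom [simp]: "gid \<in> dg_hom M M"
  by (auto intro!: dg_homI)

lemma gcomp_hom [simp]: "f \<in> dg_hom L M \<Longrightarrow> g \<in> dg_hom M N \<Longrightarrow> gcomp g f \<in> dg_hom L N"
  by (auto intro!: dg_homI)

lemma zero_hom [simp]: "dg_module N \<Longrightarrow> (\<lambda>i x. 0) \<in> dg_hom M N"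
  by (auto intro!: dg_homI)

lemma diff_hom [simp]: "dg_module N \<Longrightarrow> f \<in> dg_hom M N \<Longrightarrow> g \<in> dg_hom M N \<Longrightarrow> (\<lambda>i x. f i x - g i x) \<in> dg_hom M N"
  by (auto intro!: dg_homI simp: fscale_distribs)

lemma homotopicI:
  assumes "h \<in> rlin M N (- 1)"
    and "\<And>i x. x \<in> cpt M i \<Longrightarrow> f i x - g i x = dif N (i - 1) (h i x) + h (i + 1) (dif M i x)"
  shows "homotopic M N f g"
  using assms by (auto simp: homotopic_def)

lemma homotopic_eqI:
  assumes "dg_module N" "\<And>i x. x \<in> cpt M i \<Longrightarrow> f i x = g i x"
  shows "homotopic M N f g"
  using assms by (intro homotopicI[of "\<lambda>i x. 0"]) (auto intro!: rlinI simp: rlin_simps)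

lemma homotopic_refl [simp]: "dg_module N \<Longrightarrow> homotopic M N f f"
  by (rule homotopic_eqI) auto

lemma homotopic_sym:
  assumes "dg_module M" "dg_module N" "homotopic M N f g"
  shows "homotopic M N g f"
proof -
  obtain h where h: "h \<in> rlin M N (- 1)"
    and eq: "\<And>i x. x \<in> cpt M i \<Longrightarrow> f i x - g i x = dif N (i - 1) (h i x) + h (i + 1) (dif M i x)"
    using assms by (auto simp: homotopic_def)
  show ?thesis
  proof (rule homotopicI)
    show "(\<lambda>i x. - h i x) \<in> rlin M N (- 1)"
      using h assms by (auto intro!: rlinI simp: fscale_distribs rlin_simps)
    show "g i x - f i x = dif N (i - 1) (- h i x) + - h (i + 1) (dif M i x)" if "x \<in> cpt M i" for i x
      using eq[OF that] h that assms by (simp add: algebra_simps rlin_simps)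
  qed
qed

lemma homotopic_diff:
  assumes "dg_module M" "dg_module N" "homotopic M N f g" "homotopic M N f' g'"
  shows "homotopic M N (\<lambda>i x. f i x - f' i x) (\<lambda>i x. g i x - g' i x)"
proof -
  obtain h where h: "h \<in> rlin M N (- 1)"
    and eq: "\<And>i x. x \<in> cpt M i \<Longrightarrow> f i x - g i x = dif N (i - 1) (h i x) + h (i + 1) (dif M i x)"
    using assms by (auto simp: homotopic_def)
  obtain h' where h': "h' \<in> rlin M N (- 1)"
    and eq': "\<And>i x. x \<in> cpt M i \<Longrightarrow> f' i x - g' i x = dif N (i - 1) (h' i x) + h' (i + 1) (dif M i x)"
    using assms by (auto simp: homotopic_def)
  show ?thesis
  proof (rule homotopicI)
    show "(\<lambda>i x. h i x - h' i x) \<in> rlin M N (- 1)"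
      using h h' assms by (auto intro!: rlinI simp: fscale_distribs rlin_simps)
    show "f i x - f' i x - (g i x - g' i x) = dif N (i - 1) (h i x - h' i x) + (h (i + 1) (dif M i x) - h' (i + 1) (dif M i x))"
      if "x \<in> cpt M i" for i x
    proof -
      have "f i x - f' i x - (g i x - g' i x) = (f i x - g i x) - (f' i x - g' i x)" by simp
      then show ?thesis
        unfolding eq[OF that] eq'[OF that] using h h' that assms by (simp add: algebra_simps rlin_simps)
    qed
  qed
qed

text \<open>Being homotopic depends only on the difference of the two maps, and f - (k - g) minus g
  - (g - g) is f - k. Transitivity is therefore an instance of subtracting homotopies.\<close>

lemma homotopic_trans:
  assumes "dg_module M" "dg_module N" "homotopic M N f g" "homotopic M N g k"
  shows "homotopic M N f k"
  using homotopic_diff[OF assms(1,2,3) homotopic_sym[OF assms(1,2) homotopic_diff[OF assms(1,2,4) homotopic_refl[of N M g, OF assms(2)]]]]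
  by (simp add: homotopic_def)

lemma homotopic_comp_left:
  assumes "dg_module M" "dg_module N" "dg_module L" "homotopic M N f g" "k \<in> dg_hom N L"
    "f \<in> dg_hom M N" "g \<in> dg_hom M N"
  shows "homotopic M L (gcomp k f) (gcomp k g)"
proof -
  obtain h where h: "h \<in> rlin M N (- 1)"
    and eq: "\<And>i x. x \<in> cpt M i \<Longrightarrow> f i x - g i x = dif N (i - 1) (h i x) + h (i + 1) (dif M i x)"
    using assms by (auto simp: homotopic_def)
  show ?thesis
  proof (rule homotopicI)
    show "(\<lambda>i x. k (i - 1) (h i x)) \<in> rlin M L (- 1)"
      using h assms by (auto intro!: rlinI simp: rlin_simps)
    show "gcomp k f i x - gcomp k g i x = dif L (i - 1) (k (i - 1) (h i x)) + k (i + 1 - 1) (h (i + 1) (dif M i x))"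
      if x: "x \<in> cpt M i" for i x
    proof -
      have "gcomp k f i x - gcomp k g i x = k i (f i x - g i x)"
        using x assms by simp
      also have "\<dots> = k i (dif N (i - 1) (h i x)) + k i (h (i + 1) (dif M i x))"
        unfolding eq[OF x] using h x assms by (simp add: rlin_simps)
      also have "k i (dif N (i - 1) (h i x)) = dif L (i - 1) (k (i - 1) (h i x))"
        using h x assms by (simp add: rlin_simps)
      finally show ?thesis by simp
    qed
  qed
qed

lemma homotopic_comp_right:
  assumes "homotopic M N f g" "k \<in> dg_hom L M"
  shows "homotopic L N (gcomp f k) (gcomp g k)"
proof -
  obtain h where h: "h \<in> rlin M N (- 1)"
    and eq: "\<And>i x. x \<in> cpt M i \<Longrightarrow> f i x - g i x = dif N (i - 1) (h i x) + h (i + 1) (dif M i x)"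
    using assms by (auto simp: homotopic_def)
  show ?thesis
  proof (rule homotopicI)
    show "(\<lambda>i x. h i (k i x)) \<in> rlin L N (- 1)"
      using h assms by (auto intro!: rlinI simp: rlin_simps)
    show "gcomp f k i x - gcomp g k i x = dif N (i - 1) (h i (k i x)) + h (i + 1) (k (i + 1) (dif L i x))"
      if x: "x \<in> cpt L i" for i x
      using eq[of "k i x" i] x assms by simp
  qed
qed

section \<open>Cohomology and quasi-isomorphisms in terms of cocycles and coboundaries\<close>

section \<open>Cohomology\<close>

lemma cocycles_mem: "x \<in> cocycles M i \<longleftrightarrow> x \<in> cpt M i \<and> dif M i x = 0"
  by (simp add: cocycles_def)

lemma coboundary_iff: "x \<in> coboundaries M i \<longleftrightarrow> (\<exists>w\<in>cpt M (i - 1). x = dif M (i - 1) w)"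
  by (auto simp: coboundaries_def)

lemma coboundaryI [intro]: "w \<in> cpt M (i - 1) \<Longrightarrow> dif M (i - 1) w \<in> coboundaries M i"
  by (auto simp: coboundaries_def)

lemma coboundaryE:
  assumes "x \<in> coboundaries M i"
  obtains w where "w \<in> cpt M (i - 1)" "x = dif M (i - 1) w"
  using assms by (auto simp: coboundaries_def)

lemma cob_cocycle: "dg_module M \<Longrightarrow> x \<in> coboundaries M i \<Longrightarrow> x \<in> cocycles M i"
  by (auto simp: coboundaries_def cocycles_def)

lemma cob_cpt: "dg_module M \<Longrightarrow> x \<in> coboundaries M i \<Longrightarrow> x \<in> cpt M i"
  by (auto simp: coboundaries_def)

lemma cocycles_subspace: "dg_module M \<Longrightarrow> fvec.subspace (cocycles M i)"
  by (intro subspaceI) (auto simp: cocycles_def)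

lemma coboundaries_subspace: "dg_module M \<Longrightarrow> fvec.subspace (coboundaries M i)"
  by (intro subspaceI) (auto simp: coboundary_iff
     intro: bexI[of _ 0] cpt_zero bexI[of _ "_ + _"] cpt_add bexI[of _ "fscale _ _"] cpt_scale
      simp flip: dif_add dif_scale)

lemma cocycles_closed [simp]:
  assumes "dg_module M"
  shows "0 \<in> cocycles M i" "x \<in> cocycles M i \<Longrightarrow> y \<in> cocycles M i \<Longrightarrow> x + y \<in> cocycles M i"
    "x \<in> cocycles M i \<Longrightarrow> y \<in> cocycles M i \<Longrightarrow> x - y \<in> cocycles M i"
    "x \<in> cocycles M i \<Longrightarrow> - x \<in> cocycles M i" "x \<in> cocycles M i \<Longrightarrow> fscale c x \<in> cocycles M i"
    "x \<in> cocycles M i \<Longrightarrow> j = i - 1 \<Longrightarrow> tact M i x \<in> cocycles M j"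
  using assms by (auto simp: cocycles_def)

lemma cob_closed [simp]:
  assumes "dg_module M"
  shows "0 \<in> coboundaries M i" "x \<in> coboundaries M i \<Longrightarrow> y \<in> coboundaries M i \<Longrightarrow> x + y \<in> coboundaries M i"
    "x \<in> coboundaries M i \<Longrightarrow> y \<in> coboundaries M i \<Longrightarrow> x - y \<in> coboundaries M i"
    "x \<in> coboundaries M i \<Longrightarrow> - x \<in> coboundaries M i" "x \<in> coboundaries M i \<Longrightarrow> fscale c x \<in> coboundaries M i"
    "x \<in> coboundaries M i \<Longrightarrow> j = i - 1 \<Longrightarrow> tact M i x \<in> coboundaries M j"
proof -
  note s = coboundaries_subspace[OF assms, of i]
  show "0 \<in> coboundaries M i" "x \<in> coboundaries M i \<Longrightarrow> y \<in> coboundaries M i \<Longrightarrow> x + y \<in> coboundaries M i"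
    "x \<in> coboundaries M i \<Longrightarrow> y \<in> coboundaries M i \<Longrightarrow> x - y \<in> coboundaries M i"
    "x \<in> coboundaries M i \<Longrightarrow> - x \<in> coboundaries M i" "x \<in> coboundaries M i \<Longrightarrow> fscale c x \<in> coboundaries M i"
    using s by (auto intro: fvec.subspace_0 fvec.subspace_add fvec.subspace_diff
      fvec.subspace_neg fvec.subspace_scale)
  show "x \<in> coboundaries M i \<Longrightarrow> j = i - 1 \<Longrightarrow> tact M i x \<in> coboundaries M j"
  proof (elim coboundaryE)
    fix w assume w: "w \<in> cpt M (i - 1)" "x = dif M (i - 1) w" "j = i - 1"
    then have "tact M i x = dif M (j - 1) (tact M j w)" using assms by simp
    then show "tact M i x \<in> coboundaries M j" using w assms coboundaryI[of "tact M j w" M j] by simp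
  qed
qed

lemma cocycle_cpt [simp]: "x \<in> cocycles M i \<Longrightarrow> x \<in> cpt M i"
  and cocycle_dif [simp]: "x \<in> cocycles M i \<Longrightarrow> dif M i x = 0"
  by (simp_all add: cocycles_def)

lemma dif_cob [simp]: "dg_module M \<Longrightarrow> x \<in> cpt M j \<Longrightarrow> i = j + 1 \<Longrightarrow> dif M j x \<in> coboundaries M i"
  using coboundaryI[of x M i] by simp

lemma cob_add_cong: 
  assumes "dg_module M" "x - x' \<in> coboundaries M i" "y - y' \<in> coboundaries M i"
  shows "(x + y) - (x' + y') \<in> coboundaries M i" "(x - y) - (x' - y') \<in> coboundaries M i"
  using cob_closed(2,3)[OF assms] by (simp_all add: algebra_simps)

lemma cob_diff_sym: "dg_module M \<Longrightarrow> x - y \<in> coboundaries M i \<Longrightarrow> y - x \<in> coboundaries M i"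
  using cob_closed(4)[of M "x - y" i] by simp

lemma cob_diff_trans: "dg_module M \<Longrightarrow> x - y \<in> coboundaries M i \<Longrightarrow> y - z \<in> coboundaries M i \<Longrightarrow> x - z \<in> coboundaries M i"
  using cob_closed(2)[of M "x - y" i "y - z"] by simp

lemma cob_diff_mem: "dg_module M \<Longrightarrow> x - y \<in> coboundaries M i \<Longrightarrow> y \<in> coboundaries M i \<Longrightarrow> x \<in> coboundaries M i"
  using cob_closed(2)[of M "x - y" i "y"] by simp

lemma hom_cocycle [simp]: "f \<in> dg_hom M N \<Longrightarrow> dg_module M \<Longrightarrow> x \<in> cocycles M i \<Longrightarrow> f i x \<in> cocycles N i"
  using hom_dif[of f M N x i "i + 1"] by (auto simp: cocycles_mem simp del: hom_dif cocycle_cpt cocycle_dif)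

lemma hom_cob: "f \<in> dg_hom M N \<Longrightarrow> x \<in> coboundaries M i \<Longrightarrow> f i x \<in> coboundaries N i"
  by (auto simp: coboundary_iff intro!: bexI)

lemma homotopic_cob:
  assumes "dg_module M" "dg_module N" "homotopic M N f g" "x \<in> cocycles M i"
  shows "f i x - g i x \<in> coboundaries N i"
proof -
  obtain h where h: "h \<in> rlin M N (- 1)"
    and eq: "\<And>i x. x \<in> cpt M i \<Longrightarrow> f i x - g i x = dif N (i - 1) (h i x) + h (i + 1) (dif M i x)"
    using assms by (auto simp: homotopic_def)
  show ?thesis
    using eq[of x i] assms h by (auto simp: coboundary_iff rlin_simps intro!: bexI[of _ "h i x"])
qed

text \<open>The induced map on classes is additive, so its injectivity is a statement about its
  kernel, and surjectivity can be read on representatives. From here on no quotient sets are needed: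
  all arguments about cohomology use cocycles modulo coboundaries.\<close>

lemma quasi_iso_iff:
  assumes M: "dg_module M" and N: "dg_module N"
  shows "f \<in> quasi_iso M N \<longleftrightarrow> f \<in> dg_hom M N \<and>
    (\<forall>i. \<forall>z\<in>cocycles M i. f i z \<in> coboundaries N i \<longrightarrow> z \<in> coboundaries M i) \<and>
    (\<forall>i. \<forall>y\<in>cocycles N i. \<exists>z\<in>cocycles M i. y - f i z \<in> coboundaries N i)"
proof (cases "f \<in> dg_hom M N")
  case f: True
  define RM where "RM i = {(x, y). x \<in> cocycles M i \<and> y \<in> cocycles M i \<and> x - y \<in> coboundaries M i}" for i
  define RN where "RN i = {(x, y). x \<in> cocycles N i \<and> y \<in> cocycles N i \<and> x - y \<in> coboundaries N i}" for i
  have cob_sym: "u - v \<in> coboundaries N i \<longleftrightarrow> v - u \<in> coboundaries N i" for u v i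
    using cob_diff_sym[OF N] by blast
  have eqM: "equiv (cocycles M i) (RM i)" for i
    by (rule equivI) (auto simp: RM_def refl_on_def sym_def trans_def M dest: cob_diff_sym[OF M] cob_diff_trans[OF M])
  have eqN: "equiv (cocycles N i) (RN i)" for i
    by (rule equivI) (auto simp: RN_def refl_on_def sym_def trans_def N dest: cob_diff_sym[OF N] cob_diff_trans[OF N])
  have cM: "cohomology M i = cocycles M i // RM i" and cN: "cohomology N i = cocycles N i // RN i" for i
    by (simp_all add: cohomology_def RM_def RN_def)
  \<comment> \<open>\<open>cohomology_map\<close> collects the targets of all representatives of a
    class, so it has to be seen that any two of them give the same class in N.\<close>
  have map: "cohomology_map N f i (RM i `` {x}) = RN i `` {f i x}" if x: "x \<in> cocycles M i" for i x
  proof -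
    have "y - f i x' \<in> coboundaries N i \<longleftrightarrow> y - f i x \<in> coboundaries N i"
      if "x' \<in> cocycles M i" "x - x' \<in> coboundaries M i" for x' y
    proof -
      have "f i x - f i x' \<in> coboundaries N i"
        using hom_cob[OF f that(2)] that x f M by simp
      then show ?thesis
        using cob_diff_trans[OF N] cob_diff_sym[OF N] by metis
    qed
    then have *: "y - f i x' \<in> coboundaries N i \<longleftrightarrow> f i x - y \<in> coboundaries N i"
      if "x' \<in> cocycles M i" "x - x' \<in> coboundaries M i" for x' y
      using that cob_sym[of "f i x" y i] by blast
    have x': "x \<in> RM i `` {x}"
      unfolding RM_def Image_singleton mem_Collect_eq case_prod_conv using x cob_closed(1)[OF M] by simp
    have fx: "f i x \<in> cocycles N i" using f M x by simp
    show ?thesis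
    proof (rule set_eqI)
      fix y
      have "y \<in> cohomology_map N f i (RM i `` {x}) \<longleftrightarrow>
          y \<in> cocycles N i \<and> (\<exists>x'\<in>RM i `` {x}. y - f i x' \<in> coboundaries N i)"
        by (simp only: cohomology_map_def mem_Collect_eq)
      also have "\<dots> \<longleftrightarrow> y \<in> cocycles N i \<and> f i x - y \<in> coboundaries N i"
        using x' * unfolding RM_def Image_singleton mem_Collect_eq case_prod_conv by blast
      also have "\<dots> \<longleftrightarrow> y \<in> RN i `` {f i x}"
        using fx unfolding RN_def Image_singleton mem_Collect_eq case_prod_conv by blast
      finally show "y \<in> cohomology_map N f i (RM i `` {x}) \<longleftrightarrow> y \<in> RN i `` {f i x}" .
    qed
  qed
  have inj: "inj_on (cohomology_map N f i) (cohomology M i) \<longleftrightarrow>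
      (\<forall>z\<in>cocycles M i. f i z \<in> coboundaries N i \<longrightarrow> z \<in> coboundaries M i)" (is "?L \<longleftrightarrow> ?R") for i
  proof
    assume L: ?L
    show ?R
    proof (intro ballI impI)
      fix z assume z: "z \<in> cocycles M i" "f i z \<in> coboundaries N i"
      have "(f i z, f i 0) \<in> RN i" using z f M N by (auto simp: RN_def cob_cocycle)
      then have "cohomology_map N f i (RM i `` {z}) = cohomology_map N f i (RM i `` {0})"
        using z f M N equiv_class_eq[OF eqN] by (simp add: map)
      then have "RM i `` {z} = RM i `` {0}"
        using inj_onD[OF L, of "RM i `` {z}" "RM i `` {0}"] z M by (simp add: cM quotientI)
      then have "(z, 0) \<in> RM i" using eq_equiv_class_iff[OF eqM, of z i 0] z M by simp
      then show "z \<in> coboundaries M i" by (simp add: RM_def)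
    qed
  next
    assume R: ?R
    show ?L
    proof (rule inj_onI)
      fix A B assume "A \<in> cohomology M i" "B \<in> cohomology M i"
        and eq: "cohomology_map N f i A = cohomology_map N f i B"
      then obtain x y where xy: "x \<in> cocycles M i" "y \<in> cocycles M i" "A = RM i `` {x}" "B = RM i `` {y}"
        unfolding cM by (auto elim!: quotientE)
      then have "RN i `` {f i x} = RN i `` {f i y}" using eq map by simp
      then have "(f i x, f i y) \<in> RN i"
        using xy f M eq_equiv_class_iff[OF eqN] by simp
      then have "f i (x - y) \<in> coboundaries N i" using xy f M by (simp add: RN_def)
      then have "x - y \<in> coboundaries M i" using R xy M by simp
      then have "(x, y) \<in> RM i" using xy by (simp add: RM_def)
      then show "A = B" using equiv_class_eq[OF eqM] xy by simp
    qed
  qed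
  have im: "cohomology_map N f i ` cohomology M i = {RN i `` {f i x} | x. x \<in> cocycles M i}" for i
    unfolding cM by (auto elim!: quotientE simp: map intro!: rev_image_eqI quotientI)
  have surj: "cohomology_map N f i ` cohomology M i = cohomology N i \<longleftrightarrow>
      (\<forall>y\<in>cocycles N i. \<exists>z\<in>cocycles M i. y - f i z \<in> coboundaries N i)" (is "?L \<longleftrightarrow> ?R") for i
  proof
    assume L: ?L
    show ?R
    proof
      fix y assume y: "y \<in> cocycles N i"
      then have "RN i `` {y} \<in> cohomology N i" by (simp add: cN quotientI)
      then obtain x where "x \<in> cocycles M i" "RN i `` {y} = RN i `` {f i x}"
        unfolding L[symmetric] im by blast
      then show "\<exists>z\<in>cocycles M i. y - f i z \<in> coboundaries N i"
        using y f M eq_equiv_class_iff[OF eqN, of y i "f i x"] by (auto simp: RN_def)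
    qed
  next
    assume R: ?R
    show ?L unfolding im
    proof (intro equalityI subsetI)
      fix A assume "A \<in> cohomology N i"
      then obtain y where y: "y \<in> cocycles N i" "A = RN i `` {y}"
        unfolding cN by (auto elim!: quotientE)
      with R obtain z where "z \<in> cocycles M i" "y - f i z \<in> coboundaries N i" by blast
      then have "z \<in> cocycles M i" "(y, f i z) \<in> RN i" using y f M by (auto simp: RN_def)
      then show "A \<in> {RN i `` {f i x} | x. x \<in> cocycles M i}"
        using y equiv_class_eq[OF eqN] by blast
    qed (use f M in \<open>auto simp: cN intro: quotientI\<close>)
  qed
  show ?thesis
    using f inj surj by (simp add: quasi_iso_def bij_betw_def all_conj_distrib)
qed (simp add: quasi_iso_def)

lemma quasi_iso_hom [simp]: "f \<in> quasi_iso M N \<Longrightarrow> f \<in> dg_hom M N"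
  by (simp add: quasi_iso_def)

lemma quasi_isoI:
  assumes "dg_module M" "dg_module N" "f \<in> dg_hom M N"
    and "\<And>i z. z \<in> cocycles M i \<Longrightarrow> f i z \<in> coboundaries N i \<Longrightarrow> z \<in> coboundaries M i"
    and "\<And>i y. y \<in> cocycles N i \<Longrightarrow> \<exists>z\<in>cocycles M i. y - f i z \<in> coboundaries N i"
  shows "f \<in> quasi_iso M N"
  using assms by (simp add: quasi_iso_iff)

lemma quasi_iso_inj:
  assumes "f \<in> quasi_iso M N" "dg_module M" "dg_module N" "z \<in> cocycles M i" "f i z \<in> coboundaries N i"
  shows "z \<in> coboundaries M i"
  using assms by (auto simp: quasi_iso_iff)

lemma quasi_iso_surj:
  assumes "f \<in> quasi_iso M N" "dg_module M" "dg_module N" "y \<in> cocycles N i"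
  obtains z where "z \<in> cocycles M i" "y - f i z \<in> coboundaries N i"
  using assms unfolding quasi_iso_iff[OF assms(2,3)] by blast

lemma quasi_iso_comp:
  assumes L: "dg_module L" and M: "dg_module M" and N: "dg_module N"
    and f: "f \<in> quasi_iso L M" and g: "g \<in> quasi_iso M N"
  shows "gcomp g f \<in> quasi_iso L N"
proof (rule quasi_isoI[OF L N gcomp_hom[OF quasi_iso_hom[OF f] quasi_iso_hom[OF g]]])
  note f' = quasi_iso_hom[OF f] and g' = quasi_iso_hom[OF g]
  fix i y assume "y \<in> cocycles N i"
  then obtain z where z: "z \<in> cocycles M i" "y - g i z \<in> coboundaries N i"
    using quasi_iso_surj[OF g M N] by metis
  then obtain x where x: "x \<in> cocycles L i" "z - f i x \<in> coboundaries M i"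
    using quasi_iso_surj[OF f L M] by metis
  have "g i z - g i (f i x) \<in> coboundaries N i"
    using hom_cob[OF g' x(2)] x z f' g' L M by simp
  then show "\<exists>z\<in>cocycles L i. y - gcomp g f i z \<in> coboundaries N i"
    unfolding gcomp_app by (intro bexI[OF _ x(1)]) (rule cob_diff_trans[OF N z(2)])
next
  fix i z assume z: "z \<in> cocycles L i" "gcomp g f i z \<in> coboundaries N i"
  then show "z \<in> coboundaries L i"
    using quasi_iso_inj[OF f L M z(1)] quasi_iso_inj[OF g M N] hom_cocycle[OF quasi_iso_hom[OF f] L z(1)] by simp
qed

text \<open>One part of the two-out-of-three property; the other parts are
  \<open>quasi_iso_comp\<close> and \<open>quasi_iso_cancel_right\<close>.\<close>

lemma quasi_iso_cancel_left:
  assumes L: "dg_module L" and M: "dg_module M" and N: "dg_module N"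
    and f: "f \<in> dg_hom L M" and g: "g \<in> quasi_iso M N" and gf: "gcomp g f \<in> quasi_iso L N"
  shows "f \<in> quasi_iso L M"
proof (rule quasi_isoI)
  show "z \<in> coboundaries L i" if "z \<in> cocycles L i" "f i z \<in> coboundaries M i" for i z
    using quasi_iso_inj[OF gf L N that(1)] hom_cob[OF quasi_iso_hom[OF g] that(2)] by simp
  fix i y assume y: "y \<in> cocycles M i"
  then have "g i y \<in> cocycles N i" using quasi_iso_hom[OF g] M by simp
  then obtain z where z: "z \<in> cocycles L i" "g i y - g i (f i z) \<in> coboundaries N i"
    using quasi_iso_surj[OF gf L N] by (metis gcomp_app)
  then have "g i (y - f i z) \<in> coboundaries N i" using y f quasi_iso_hom[OF g] L M by simp
  then have "y - f i z \<in> coboundaries M i"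
    using quasi_iso_inj[OF g M N] y z f L M by simp
  then show "\<exists>z\<in>cocycles L i. y - f i z \<in> coboundaries M i" using z(1) by (rule bexI)
qed (use assms in auto)

lemma quasi_iso_cancel_right:
  assumes L: "dg_module L" and M: "dg_module M" and N: "dg_module N"
    and f: "f \<in> quasi_iso L M" and g: "g \<in> dg_hom M N" and gf: "gcomp g f \<in> quasi_iso L N"
  shows "g \<in> quasi_iso M N"
proof (rule quasi_isoI)
  fix i z assume z: "z \<in> cocycles M i" "g i z \<in> coboundaries N i"
  then obtain x where x: "x \<in> cocycles L i" "z - f i x \<in> coboundaries M i"
    using quasi_iso_surj[OF f L M] by metis
  have "g i z - g i (f i x) \<in> coboundaries N i"
    using hom_cob[OF g x(2)] x z quasi_iso_hom[OF f] g L M by simp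
  then have "g i (f i x) \<in> coboundaries N i"
    using cob_diff_mem[OF N cob_diff_sym[OF N]] z(2) by blast
  then have "x \<in> coboundaries L i"
    using quasi_iso_inj[OF gf L N x(1)] by simp
  then show "z \<in> coboundaries M i"
    using x cob_diff_mem[OF M] hom_cob[OF quasi_iso_hom[OF f]] by blast
next
  fix i y assume "y \<in> cocycles N i"
  then obtain z where z: "z \<in> cocycles L i" "y - g i (f i z) \<in> coboundaries N i"
    using quasi_iso_surj[OF gf L N] by (metis gcomp_app)
  then show "\<exists>z\<in>cocycles M i. y - g i z \<in> coboundaries N i"
    using quasi_iso_hom[OF f] L by (auto intro!: bexI[of _ "f i z"])
qed (use assms in auto)

text \<open>On cocycles, homotopic maps differ by coboundaries and hence act equally on
  cohomology.\<close>

lemma quasi_iso_homotopic: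
  assumes M: "dg_module M" and N: "dg_module N"
    and f: "f \<in> quasi_iso M N" and g: "g \<in> dg_hom M N" and h: "homotopic M N f g"
  shows "g \<in> quasi_iso M N"
proof (rule quasi_isoI[OF M N g])
  fix i z assume z: "z \<in> cocycles M i" "g i z \<in> coboundaries N i"
  then have "f i z \<in> coboundaries N i"
    using homotopic_cob[OF M N h z(1)] cob_diff_mem[OF N] by blast
  then show "z \<in> coboundaries M i" using quasi_iso_inj[OF f M N z(1)] by simp
next
  fix i y assume "y \<in> cocycles N i"
  then obtain z where z: "z \<in> cocycles M i" "y - f i z \<in> coboundaries N i"
    using quasi_iso_surj[OF f M N] by metis
  then show "\<exists>z\<in>cocycles M i. y - g i z \<in> coboundaries N i"
    by (intro bexI[OF _ z(1)]) (rule cob_diff_trans[OF N z(2) homotopic_cob[OF M N h z(1)]])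
qed

lemma dg_iso_hom: "f \<in> dg_iso M N \<Longrightarrow> f \<in> dg_hom M N"
  by (simp add: dg_iso_def)

lemma dg_isoI:
  assumes "f \<in> dg_hom M N" "\<And>i x. x \<in> cpt N i \<Longrightarrow> g i x \<in> cpt M i"
    "\<And>i x. x \<in> cpt M i \<Longrightarrow> g i (f i x) = x" "\<And>i x. x \<in> cpt N i \<Longrightarrow> f i (g i x) = x"
  shows "f \<in> dg_iso M N"
proof -
  have "bij_betw (f i) (cpt M i) (cpt N i)" for i
    by (rule bij_betw_byWitness[where f' = "g i"]) (intro ballI image_subsetI assms(2-4) hom_mem[OF assms(1)]; assumption)+
  then show ?thesis using assms(1) by (simp add: dg_iso_def)
qed

lemma dg_iso_inverse:
  assumes f: "f \<in> dg_iso M N" and M: "dg_module M"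
  obtains g where "g \<in> dg_iso N M" "\<And>i x. x \<in> cpt M i \<Longrightarrow> g i (f i x) = x"
    "\<And>i x. x \<in> cpt N i \<Longrightarrow> f i (g i x) = x"
proof -
  define g where "g i = inv_into (cpt M i) (f i)" for i
  have b: "bij_betw (f i) (cpt M i) (cpt N i)" for i using f by (simp add: dg_iso_def)
  have gm: "g i x \<in> cpt M i" and fg: "f i (g i x) = x" if "x \<in> cpt N i" for i x
    using bij_betw_inv_into_right[OF b that] bij_betw_apply[OF bij_betw_inv_into[OF b] that]
    by (simp_all add: g_def)
  have gf: "g i (f i x) = x" if "x \<in> cpt M i" for i x
    using b[of i] that unfolding g_def bij_betw_def by auto
  have eqI: "a = b" if "a \<in> cpt M i" "b \<in> cpt M i" "f i a = f i b" for a b i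
    using b[of i] that unfolding bij_betw_def inj_on_def by auto
  note f' = dg_iso_hom[OF f]
  have "g \<in> dg_hom N M"
  proof (rule dg_homI)
    fix i x y assume x: "x \<in> cpt N i" and y: "y \<in> cpt N i"
    show "g i (x + y) = g i x + g i y"
      using gf[of "g i x + g i y" i] f' M x y by (simp add: gm fg)
  next
    fix i c x assume x: "x \<in> cpt N i"
    show "g i (fscale c x) = fscale c (g i x)"
      using gf[of "fscale c (g i x)" i] f' M x by (simp add: gm fg)
    show "g (i - 1) (tact N i x) = tact M i (g i x)"
      using gf[of "tact M i (g i x)" "i - 1"] f' M x by (simp add: gm fg)
    show "g (i + 1) (dif N i x) = dif M i (g i x)"
      using gf[of "dif M i (g i x)" "i + 1"] f' M x by (simp add: gm fg)
  qed (simp add: gm)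
  then have "g \<in> dg_iso N M" using dg_isoI[of g N M f] gm fg gf f' by simp
  then show ?thesis using that gf fg by blast
qed

lemma dg_iso_quasi_iso:
  assumes f: "f \<in> dg_iso M N" and M: "dg_module M" and N: "dg_module N"
  shows "f \<in> quasi_iso M N"
proof -
  obtain g where g: "g \<in> dg_iso N M" "\<And>i x. x \<in> cpt M i \<Longrightarrow> g i (f i x) = x"
    "\<And>i x. x \<in> cpt N i \<Longrightarrow> f i (g i x) = x" using dg_iso_inverse[OF f M] by metis
  show ?thesis
  proof (rule quasi_isoI[OF M N dg_iso_hom[OF f]])
    fix i z assume "z \<in> cocycles M i" "f i z \<in> coboundaries N i"
    then show "z \<in> coboundaries M i" using hom_cob[OF dg_iso_hom[OF g(1)]] g(2) by (metis cocycle_cpt)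
  next
    fix i y assume "y \<in> cocycles N i"
    then show "\<exists>z\<in>cocycles M i. y - f i z \<in> coboundaries N i"
      using g(3) dg_iso_hom[OF g(1)] N by (intro bexI[of _ "g i y"]) auto
  qed
qed

lemma dg_iso_comp:
  assumes "f \<in> dg_iso L M" "g \<in> dg_iso M N"
  shows "gcomp g f \<in> dg_iso L N"
proof -
  have "bij_betw (g i \<circ> f i) (cpt L i) (cpt N i)" for i
    using assms by (intro bij_betw_trans[of _ _ "cpt M i"]) (simp_all add: dg_iso_def)
  then show ?thesis
    using gcomp_hom[OF assms[THEN dg_iso_hom]] by (simp add: dg_iso_def gcomp_def comp_def)
qed

section \<open>Suspensions, mapping cones and transport into the universe \<open>'u\<close>\<close>

section \<open>Suspensions, cones and copies\<close>

lemma shift_sel [simp]: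
  "cpt (shift n M) i = cpt M (i + n)"
  "dif (shift n M) i x = (if even n then dif M (i + n) x else - dif M (i + n) x)"
  "tact (shift n M) i = tact M (i + n)"
  by (simp_all add: shift_def)

lemma dg_module_shift [simp]:
  assumes "dg_module M" shows "dg_module (shift n M)"
  by (rule dg_moduleI) (use assms in \<open>auto simp: cpt_subspace fscale_distribs algebra_simps
     dif_tact[of M _ "i + n" for i]\<close>)

lemma shift_shift: "shift a (shift b M) = shift (a + b) M"
  by (auto simp: shift_def fun_eq_iff add.assoc)

lemma shift_0 [simp]: "shift 0 M = M"
  by (simp add: shift_def)

lemma cocycles_shift [simp]: "cocycles (shift n M) i = cocycles M (i + n)"
  by (auto simp: cocycles_def simp del: cocycle_cpt cocycle_dif)

text \<open>The sign of the suspended differential does not change its image, because the components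
  are closed under negation.\<close>

lemma coboundaries_shift [simp]:
  assumes "dg_module M" shows "coboundaries (shift n M) i = coboundaries M (i + n)"
proof -
  have *: "i - 1 + n = i + n - 1" by simp
  have "(\<lambda>x. - dif M (i + n - 1) x) ` cpt M (i + n - 1) = dif M (i + n - 1) ` cpt M (i + n - 1)" (is "?A = ?B")
  proof
    show "?A \<subseteq> ?B"
    proof (intro image_subsetI)
      fix x assume x: "x \<in> cpt M (i + n - 1)"
      show "- dif M (i + n - 1) x \<in> ?B"
        using dif_neg[OF assms x] cpt_neg[OF assms x] by (rule image_eqI[OF sym])
    qed
    show "?B \<subseteq> ?A"
    proof (intro image_subsetI)
      fix x assume x: "x \<in> cpt M (i + n - 1)"
      then have "dif M (i + n - 1) x = - dif M (i + n - 1) (- x)" using assms by simp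
      then show "dif M (i + n - 1) x \<in> ?A" using cpt_neg[OF assms x] by (rule image_eqI)
    qed
  qed
  then show ?thesis unfolding coboundaries_def shift_sel * by simp
qed

lemma case_sum_arith:
  fixes y y' :: "'a \<Rightarrow> 'k::field" and x x' :: "'b \<Rightarrow> 'k"
  shows "case_sum y x + case_sum y' x' = case_sum (y + y') (x + x')"
    "case_sum y x - case_sum y' x' = case_sum (y - y') (x - x')"
    "- case_sum y x = case_sum (- y) (- x)"
    "fscale c (case_sum y x) = case_sum (fscale c y) (fscale c x)"
    "(0 :: 'a + 'b \<Rightarrow> 'k) = case_sum 0 0"
  by (auto simp: fun_eq_iff pointwise fscale_def split: sum.split)

lemma case_sum_inject: "case_sum y x = case_sum y' x' \<longleftrightarrow> y = y' \<and> x = x'"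
  by (metis case_sum_o_inj)

lemma comp_arith:
  fixes y z :: "'a \<Rightarrow> 'k::field"
  shows "(y + z) \<circ> e = (y \<circ> e) + (z \<circ> e)" "(y - z) \<circ> e = (y \<circ> e) - (z \<circ> e)" "(- z) \<circ> e = - (z \<circ> e)"
    "fscale c y \<circ> e = fscale c (y \<circ> e)" "(0 :: 'a \<Rightarrow> 'k) \<circ> e = 0"
  by (auto simp: fun_eq_iff pointwise fscale_def)

lemma case_sum_comp [simp]: "case_sum y x \<circ> Inl = y" "case_sum y x \<circ> Inr = x"
  by (auto simp: fun_eq_iff)

lemma cone_cpt: "z \<in> cpt (cone M N f) i \<longleftrightarrow> (\<exists>y x. z = case_sum y x \<and> y \<in> cpt N i \<and> x \<in> cpt M (i + 1))"
  by (auto simp: cone_def)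

lemma cone_cptE:
  assumes "z \<in> cpt (cone M N f) i"
  obtains y x where "z = case_sum y x" "y \<in> cpt N i" "x \<in> cpt M (i + 1)"
  using assms by (auto simp: cone_def)

lemma cone_sel [simp]:
  "case_sum y x \<in> cpt (cone M N f) i \<longleftrightarrow> y \<in> cpt N i \<and> x \<in> cpt M (i + 1)"
  "dif (cone M N f) i (case_sum y x) = case_sum (dif N i y + f (i + 1) x) (- dif M (i + 1) x)"
  "tact (cone M N f) i (case_sum y x) = case_sum (tact N i y) (tact M (i + 1) x)"
  by (auto simp: cone_def case_sum_inject)

lemma dg_module_cone:
  assumes M: "dg_module M" and N: "dg_module N" and f: "f \<in> dg_hom M N"
  shows "dg_module (cone M N f)"
proof (rule dg_moduleI)
  show "fvec.subspace (cpt (cone M N f) i)" for i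
    by (rule subspaceI; (elim cone_cptE)?) (use M N in \<open>simp_all add: case_sum_arith\<close>)
qed (elim cone_cptE; use M N f in \<open>simp add: case_sum_arith case_sum_inject fscale_distribs\<close>)+

definition acyclic :: "('k::field, 'u) dgm \<Rightarrow> bool" where
  "acyclic K \<longleftrightarrow> (\<forall>i. \<forall>z\<in>cocycles K i. z \<in> coboundaries K i)"

lemma acyclic_shift: "dg_module K \<Longrightarrow> acyclic K \<Longrightarrow> acyclic (shift n K)"
  by (simp add: acyclic_def)

lemma acyclicE:
  assumes "acyclic K" "z \<in> cpt K i" "dif K i z = 0"
  obtains w where "w \<in> cpt K (i - 1)" "dif K (i - 1) w = z"
proof -
  have "z \<in> cocycles K i" using assms by (simp add: cocycles_mem del: cocycle_cpt cocycle_dif)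
  then have "z \<in> coboundaries K i" using assms(1) unfolding acyclic_def by blast
  then show ?thesis using that by (auto elim: coboundaryE)
qed

text \<open>Both halves of being a quasi-isomorphism enter: injectivity on cohomology bounds the
  B-component b, and surjectivity bounds what then remains in Y.\<close>

lemma acyclic_cone:
  assumes B: "dg_module B" and Y: "dg_module Y" and s: "s \<in> quasi_iso B Y"
  shows "acyclic (cone B Y s)"
  unfolding acyclic_def
proof (intro allI ballI)
  fix i z assume "z \<in> cocycles (cone B Y s) i"
  then have z: "z \<in> cpt (cone B Y s) i" "dif (cone B Y s) i z = 0" by simp_all
  note s' = quasi_iso_hom[OF s]
  obtain y b where yb: "z = case_sum y b" "y \<in> cpt Y i" "b \<in> cpt B (i + 1)"
    using z(1) by (rule cone_cptE)
  have e: "dif Y i y + s (i + 1) b = 0" "dif B (i + 1) b = 0"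
    using z(2) yb by (simp_all add: case_sum_arith case_sum_inject)
  have "s (i + 1) b = dif Y i (- y)" using e(1) yb Y by (simp add: eq_neg_iff_add_eq_0 add.commute)
  also have "\<dots> \<in> coboundaries Y (i + 1)" using yb Y by (intro dif_cob) simp_all
  finally have "b \<in> coboundaries B (i + 1)"
    using quasi_iso_inj[OF s B Y, of b "i + 1"] e yb by (simp add: cocycles_mem del: cocycle_cpt cocycle_dif)
  then obtain b1 where b1: "b1 \<in> cpt B i" "b = dif B i b1" by (auto elim: coboundaryE)
  have "y + s i b1 \<in> cocycles Y i"
    using e yb b1 B Y s' by (simp add: cocycles_mem del: cocycle_cpt cocycle_dif)
  then obtain b2 where b2: "b2 \<in> cocycles B i" "(y + s i b1) - s i b2 \<in> coboundaries Y i"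
    using quasi_iso_surj[OF s B Y] by metis
  then obtain y2 where y2: "y2 \<in> cpt Y (i - 1)" "(y + s i b1) - s i b2 = dif Y (i - 1) y2"
    by (auto elim: coboundaryE)
  \<comment> \<open>With b = d b1 and y + s b1 - s b2 = d y2, the cone differential of (y2, b2 - b1)
    is (y, b): the terms in s cancel and d b2 = 0.\<close>
  have "z = dif (cone B Y s) (i - 1) (case_sum y2 (b2 - b1))"
    using yb b1 b2 y2(1) B Y s' by (simp add: case_sum_inject flip: y2(2))
  moreover have "case_sum y2 (b2 - b1) \<in> cpt (cone B Y s) (i - 1)" using y2 b2 b1 B by simp
  ultimately show "z \<in> coboundaries (cone B Y s) i" using coboundaryI by metis
qed

text \<open>Extension by zero along an injection, with precomposition by e as left inverse. Cones
  and direct sums live over sum and product types; \<open>push\<close> uses this map to copy them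
  back into the fixed universe.\<close>

definition enc :: "('v \<Rightarrow> 'u) \<Rightarrow> ('v \<Rightarrow> 'k::field) \<Rightarrow> 'u \<Rightarrow> 'k" where
  "enc e x = (\<lambda>u. if u \<in> range e then x (inv e u) else 0)"

definition push :: "('v \<Rightarrow> 'u) \<Rightarrow> ('k::field, 'v) dgm \<Rightarrow> ('k, 'u) dgm" where
  "push e M = \<lparr>cpt = (\<lambda>i. enc e ` cpt M i), dif = (\<lambda>i y. enc e (dif M i (y \<circ> e))),
     tact = (\<lambda>i y. enc e (tact M i (y \<circ> e)))\<rparr>"

lemma enc_comp [simp]: "inj e \<Longrightarrow> enc e x \<circ> e = x"
  by (auto simp: enc_def fun_eq_iff)

lemma enc_arith:
  "enc e (x + y) = enc e x + enc e y" "enc e (fscale c x) = fscale c (enc e x)" "enc e 0 = 0"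
  by (auto simp: enc_def fun_eq_iff pointwise fscale_def)

lemma dg_module_push:
  assumes "inj e" "dg_module M" shows "dg_module (push e M)"
proof (rule dg_moduleI)
  show "fvec.subspace (cpt (push e M) i)" for i
  proof (rule subspaceI)
    show "0 \<in> cpt (push e M) i"
      unfolding push_def dgm.simps by (rule image_eqI[of _ _ 0]) (simp_all add: enc_arith assms)
  qed (use assms in \<open>auto simp: push_def simp flip: enc_arith\<close>)
qed (use assms in \<open>auto simp: push_def comp_arith enc_arith\<close>)

lemma dg_iso_push:
  assumes "inj e" "dg_module M"
  shows "(\<lambda>i. enc e) \<in> dg_iso M (push e M)" "(\<lambda>i y. y \<circ> e) \<in> dg_iso (push e M) M"
proof -
  have 1: "(\<lambda>i. enc e) \<in> dg_hom M (push e M)"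
    by (rule dg_homI) (use assms in \<open>auto simp: push_def enc_arith\<close>)
  have 2: "(\<lambda>i y. y \<circ> e) \<in> dg_hom (push e M) M"
    by (rule dg_homI) (use assms in \<open>auto simp: push_def comp_arith\<close>)
  show "(\<lambda>i. enc e) \<in> dg_iso M (push e M)"
    by (rule dg_isoI[OF 1, where g = "\<lambda>i y. y \<circ> e"]) (use assms in \<open>auto simp: push_def\<close>)
  show "(\<lambda>i y. y \<circ> e) \<in> dg_iso (push e M) M"
    by (rule dg_isoI[OF 2, where g = "\<lambda>i. enc e"]) (use assms in \<open>auto simp: push_def\<close>)
qed

lemma push_cpt: "y \<in> cpt (push e M) i \<longleftrightarrow> (\<exists>x\<in>cpt M i. y = enc e x)"
  by (auto simp: push_def)

lemma push_dif [simp]: "inj e \<Longrightarrow> dif (push e M) i (enc e x) = enc e (dif M i x)"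
  and push_tact [simp]: "inj e \<Longrightarrow> tact (push e M) i (enc e x) = enc e (tact M i x)"
  by (simp_all add: push_def)

text \<open>Cardinal arithmetic: the sum of two cardinals bounded by an infinite one is bounded by
  it. Together with the version for products, this gives room in \<open>'u\<close> for cones and for
  countable direct sums.\<close>

lemma ex_inj_sum:
  fixes f :: "'a \<Rightarrow> 'u::infinite" and g :: "'b \<Rightarrow> 'u"
  assumes "inj f" "inj g"
  shows "\<exists>e :: 'a + 'b \<Rightarrow> 'u. inj e"
proof -
  have "(card_of (UNIV :: 'a set), card_of (UNIV :: 'u set)) \<in> ordLeq"
    "(card_of (UNIV :: 'b set), card_of (UNIV :: 'u set)) \<in> ordLeq"
    using assms card_of_ordLeq by (metis subset_UNIV)+
  then have "(card_of ((UNIV :: 'a set) <+> (UNIV :: 'b set)), card_of (UNIV :: 'u set)) \<in> ordLeq"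
    using card_of_Plus_ordLeq_infinite_Field[OF _ _ _ card_of_Card_order, of "UNIV :: 'u set"]
    by (simp add: Field_card_of infinite_UNIV del: UNIV_Plus_UNIV UNIV_Times_UNIV)
  from iffD2[OF card_of_ordLeq this] show ?thesis unfolding UNIV_Plus_UNIV by (elim exE conjE) (rule exI)
qed

lemma ex_inj_prod:
  fixes f :: "'a \<Rightarrow> 'u::infinite" and g :: "'b \<Rightarrow> 'u"
  assumes "inj f" "inj g"
  shows "\<exists>e :: 'a \<times> 'b \<Rightarrow> 'u. inj e"
proof -
  have "(card_of (UNIV :: 'a set), card_of (UNIV :: 'u set)) \<in> ordLeq"
    "(card_of (UNIV :: 'b set), card_of (UNIV :: 'u set)) \<in> ordLeq"
    using assms card_of_ordLeq by (metis subset_UNIV)+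
  then have "(card_of ((UNIV :: 'a set) \<times> (UNIV :: 'b set)), card_of (UNIV :: 'u set)) \<in> ordLeq"
    using card_of_Times_ordLeq_infinite_Field[OF _ _ _ card_of_Card_order, of "UNIV :: 'u set"]
    by (simp add: Field_card_of infinite_UNIV del: UNIV_Plus_UNIV UNIV_Times_UNIV)
  from iffD2[OF card_of_ordLeq this] show ?thesis unfolding UNIV_Times_UNIV by (elim exE conjE) (rule exI)
qed

lemma ex_inj_nat: "\<exists>e :: nat \<Rightarrow> 'u::infinite. inj e"
  using infinite_countable_subset[OF infinite_UNIV] by blast

lemma ex_inj_bool: "\<exists>e :: bool \<Rightarrow> 'u::infinite. inj e"
proof -
  obtain e :: "nat \<Rightarrow> 'u" where "inj e" using ex_inj_nat by blast
  then have "inj (\<lambda>b. e (if b then 0 else 1))" by (auto simp: inj_def split: if_splits)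
  then show ?thesis by blast
qed

section \<open>Calculus of fractions: the Ore condition and cancellation up to homotopy\<close>

section \<open>Ore squares and cancellation up to homotopy\<close>

text \<open>The kernel of t is (up to suspension) the acyclic module K, and t is universal for killing g
  up to homotopy.\<close>

lemma null_homotopic_after_quasi_iso:
  fixes A :: "('k::field, 'u::infinite) dgm" and K :: "('k, 'w) dgm" and e :: "'w \<Rightarrow> 'u"
  assumes A: "dg_module A" and K: "dg_module K" and ac: "acyclic K" and g: "g \<in> dg_hom A K" and e: "inj e"
  obtains W :: "('k, 'u) dgm" and t where "dg_module W" "t \<in> quasi_iso W A"
    "homotopic W K (gcomp g t) (\<lambda>i x. 0)"
proof -
  \<comment> \<open>The homotopy fibre of g: in degree i it consists of pairs (k, a) with k in K of
    degree i - 1 and a in A of degree i. The projection t0 to A is a quasi-isomorphism because K is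
    acyclic, and (k, a) \<mapsto> - k is a null homotopy of g t0.\<close>
  define W0 where "W0 = shift (- 1) (cone A K g)"
  define t0 where "t0 = (\<lambda>(i::int) (z :: 'w + 'u \<Rightarrow> 'k). z \<circ> Inr)"
  have C: "dg_module (cone A K g)" using dg_module_cone A K g by blast
  then have W0: "dg_module W0" by (simp add: W0_def)
  have el: "\<exists>k a. z = case_sum k a \<and> k \<in> cpt K (i - 1) \<and> a \<in> cpt A i" if "z \<in> cpt W0 i" for z i
    using that by (auto simp: W0_def cone_cpt)
  have mem: "case_sum k a \<in> cpt W0 i \<longleftrightarrow> k \<in> cpt K (i - 1) \<and> a \<in> cpt A i" for k a i
    by (simp add: W0_def)
  have d: "dif W0 i (case_sum k a) = case_sum (- dif K (i - 1) k - g i a) (dif A i a)" for i k a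
    by (simp add: W0_def case_sum_arith)
  have t: "tact W0 i (case_sum k a) = case_sum (tact K (i - 1) k) (tact A i a)" for i k a
    by (simp add: W0_def)
  have t0: "t0 \<in> dg_hom W0 A"
    by (rule dg_homI; drule el) (auto simp: t0_def comp_arith d t dest: el)
  have q: "t0 \<in> quasi_iso W0 A"
  proof (rule quasi_isoI[OF W0 A t0])
    fix i z assume "z \<in> cocycles W0 i" and cob: "t0 i z \<in> coboundaries A i"
    then have z: "z \<in> cpt W0 i" "dif W0 i z = 0" by simp_all
    obtain k a where ka: "z = case_sum k a" "k \<in> cpt K (i - 1)" "a \<in> cpt A i" using el[OF z(1)] by blast
    have e1: "- dif K (i - 1) k - g i a = 0" using z(2) by (simp add: ka d case_sum_arith case_sum_inject)
    obtain a1 where a1: "a1 \<in> cpt A (i - 1)" "a = dif A (i - 1) a1"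
      using cob by (auto simp: t0_def ka elim: coboundaryE)
    \<comment> \<open>Once a = d a1 is known, the cocycle equation - d k = g a says that k + g a1 is
      a cocycle of K, and acyclicity supplies the remaining component of a primitive.\<close>
    have "dif K (i - 1) (k + g (i - 1) a1) = - (- dif K (i - 1) k - g i a)"
      using ka a1 A K g by simp
    also have "\<dots> = 0" using e1 by simp
    finally have "dif K (i - 1) (k + g (i - 1) a1) = 0" .
    then obtain k1 where k1: "k1 \<in> cpt K (i - 2)" "dif K (i - 2) k1 = k + g (i - 1) a1"
      using acyclicE[OF ac, of "k + g (i - 1) a1" "i - 1"] ka a1 K g by auto
    have "z = dif W0 (i - 1) (case_sum (- k1) a1)"
      using ka a1 k1 K by (simp add: d case_sum_inject)
    moreover have "case_sum (- k1) a1 \<in> cpt W0 (i - 1)" using k1 a1 K by (simp add: mem)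
    ultimately show "z \<in> coboundaries W0 i" using coboundaryI by metis
  next
    fix i a assume a: "a \<in> cocycles A i"
    have "g i a \<in> cpt K i" "dif K i (g i a) = 0" using hom_cocycle[OF g A a] by simp_all
    then obtain k where k: "k \<in> cpt K (i - 1)" "dif K (i - 1) k = g i a" using acyclicE[OF ac] by metis
    have "case_sum (- k) a \<in> cocycles W0 i"
      using k a K by (simp add: cocycles_mem mem d case_sum_arith del: cocycle_cpt cocycle_dif)
    then show "\<exists>z\<in>cocycles W0 i. a - t0 i z \<in> coboundaries A i"
      using A by (intro bexI[of _ "case_sum (- k) a"]) (simp_all add: t0_def)
  qed
  have h: "homotopic W0 K (gcomp g t0) (\<lambda>i x. 0)"
  proof (rule homotopicI)
    show "(\<lambda>i z. - (z \<circ> Inl)) \<in> rlin W0 K (- 1)"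
      by (rule rlinI; drule el) (use K in \<open>auto simp: comp_arith t fscale_distribs dest: el\<close>)
    show "gcomp g t0 i z - 0 = dif K (i - 1) (- (z \<circ> Inl)) + - (dif W0 i z \<circ> Inl)" if "z \<in> cpt W0 i" for i z
      using el[OF that] K by (auto simp: d t0_def)
  qed
  \<comment> \<open>The fibre lives over a sum type; it is replaced by a copy over \<open>'u\<close>
    so that it can serve as the apex of a roof.\<close>
  have "inj (\<lambda>x :: 'u. x)" by simp
  then obtain e' :: "'w + 'u \<Rightarrow> 'u" where e': "inj e'" using ex_inj_sum[OF e] by blast
  let ?W = "push e' W0" and ?c = "\<lambda>(i::int) y. y \<circ> e'"
  have c: "?c \<in> dg_iso ?W W0" and W: "dg_module ?W"
    using dg_iso_push(2)[OF e' W0] dg_module_push[OF e' W0] by auto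
  show ?thesis
  proof
    show "dg_module ?W" by fact
    show "gcomp t0 ?c \<in> quasi_iso ?W A"
      using quasi_iso_comp[OF W W0 A dg_iso_quasi_iso[OF c W W0] q] .
    show "homotopic ?W K (gcomp g (gcomp t0 ?c)) (\<lambda>i x. 0)"
      using homotopic_comp_right[OF h dg_iso_hom[OF c]] by (simp add: gcomp_def)
  qed
qed

text \<open>The composite of f with Y -> cone(s) lands in an acyclic module, so it becomes
  null-homotopic after a quasi-isomorphism t. The two components of the null homotopy are the
  missing edge g of the square and the homotopy between f t and s g.\<close>

lemma ore:
  fixes A B Y :: "('k::field, 'u::infinite) dgm"
  assumes A: "dg_module A" and B: "dg_module B" and Y: "dg_module Y"
    and f: "f \<in> dg_hom A Y" and s: "s \<in> quasi_iso B Y"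
  obtains W :: "('k, 'u) dgm" and t g where "dg_module W" "t \<in> quasi_iso W A" "g \<in> dg_hom W B"
    "homotopic W Y (gcomp f t) (gcomp s g)"
proof -
  note s' = quasi_iso_hom[OF s]
  let ?K = "cone B Y s"
  have K: "dg_module ?K" using dg_module_cone[OF B Y s'] .
  have g0: "(\<lambda>i a. case_sum (f i a) 0) \<in> dg_hom A ?K" (is "?g \<in> _")
    by (rule dg_homI) (use f A B Y s' in \<open>auto simp: case_sum_arith case_sum_inject\<close>)
  obtain e :: "'u + 'u \<Rightarrow> 'u" where e: "inj e" using ex_inj_sum[of "\<lambda>x. x" "\<lambda>x. x"] by auto
  obtain W :: "('k, 'u) dgm" and t where W: "dg_module W" and t: "t \<in> quasi_iso W A" and h: "homotopic W ?K (gcomp ?g t) (\<lambda>i x. 0)"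
    by (rule null_homotopic_after_quasi_iso[OF A K acyclic_cone[OF B Y s] g0 e])
  note t' = quasi_iso_hom[OF t]
  obtain h where h: "h \<in> rlin W ?K (- 1)"
    and eq: "\<And>i x. x \<in> cpt W i \<Longrightarrow> case_sum (f i (t i x)) 0 = dif ?K (i - 1) (h i x) + h (i + 1) (dif W i x)"
    using h by (auto simp: homotopic_def)
  \<comment> \<open>The null homotopy takes values in cone(s), that is in pairs. Its Y-component has
    degree -1 and becomes the homotopy of the square; its B-component has degree 0 because of the
    shift in the cone, and it is a chain map.\<close>
  define hy where "hy = (\<lambda>i x. h i x \<circ> Inl)"
  define hb where "hb = (\<lambda>i x. h i x \<circ> Inr)"
  have hh: "h i x = case_sum (hy i x) (hb i x)" for i x
    by (auto simp: hy_def hb_def fun_eq_iff split: sum.split)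
  have hy: "hy i x \<in> cpt Y (i - 1)" and hb: "hb i x \<in> cpt B i" if "x \<in> cpt W i" for i x
    using rlin_mem[OF h that] hh[of i x] by auto
  have E: "f i (t i x) = dif Y (i - 1) (hy i x) + s i (hb i x) + hy (i + 1) (dif W i x)"
    "hb (i + 1) (dif W i x) = dif B i (hb i x)" if "x \<in> cpt W i" for i x
    using eq[OF that] by (auto simp: hh case_sum_arith case_sum_inject)
  have lin: "hy i (x + y) = hy i x + hy i y" "hb i (x + y) = hb i x + hb i y" if "x \<in> cpt W i" "y \<in> cpt W i" for i x y
    using rlin_add[OF h that] by (auto simp: hh case_sum_arith case_sum_inject)
  have sc: "hy i (fscale c x) = fscale c (hy i x)" "hb i (fscale c x) = fscale c (hb i x)" if "x \<in> cpt W i" for i x c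
    using rlin_scale[OF h that] by (auto simp: hh case_sum_arith case_sum_inject)
  have ta: "hy (i - 1) (tact W i x) = tact Y (i - 1) (hy i x)" "hb (i - 1) (tact W i x) = tact B i (hb i x)"
    if "x \<in> cpt W i" for i x
    using rlin_tact[OF h that, of "i - 1"] by (auto simp: hh case_sum_arith case_sum_inject)
  have hb': "hb \<in> dg_hom W B" using hb lin sc ta E by (intro dg_homI) auto
  moreover have "homotopic W Y (gcomp f t) (gcomp s hb)"
  proof (rule homotopicI)
    show "hy \<in> rlin W Y (- 1)" using hy lin sc ta by (intro rlinI) auto
    show "gcomp f t i x - gcomp s hb i x = dif Y (i - 1) (hy i x) + hy (i + 1) (dif W i x)" if "x \<in> cpt W i" for i x
      using E(1)[OF that] by simp
  qed
  ultimately show ?thesis using that W t by blast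
qed

text \<open>A null homotopy of s f lifts f to the homotopy fibre of s, which is acyclic. After a
  quasi-isomorphism the lift is null-homotopic, and the B-component of that homotopy is a null
  homotopy of f itself.\<close>

lemma cancel_null:
  fixes A B Y :: "('k::field, 'u::infinite) dgm"
  assumes A: "dg_module A" and B: "dg_module B" and Y: "dg_module Y"
    and f: "f \<in> dg_hom A B" and s: "s \<in> quasi_iso B Y" and hom: "homotopic A Y (gcomp s f) (\<lambda>i x. 0)"
  obtains W :: "('k, 'u) dgm" and t where "dg_module W" "t \<in> quasi_iso W A"
    "homotopic W B (gcomp f t) (\<lambda>i x. 0)"
proof -
  note s' = quasi_iso_hom[OF s]
  let ?K = "shift (- 1) (cone B Y s)"
  have C: "dg_module (cone B Y s)" using dg_module_cone[OF B Y s'] .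
  then have K: "dg_module ?K" by simp
  obtain h where h: "h \<in> rlin A Y (- 1)"
    and eq: "\<And>i x. x \<in> cpt A i \<Longrightarrow> s i (f i x) = dif Y (i - 1) (h i x) + h (i + 1) (dif A i x)"
    using hom by (auto simp: homotopic_def)
  \<comment> \<open>The lift of f to the fibre determined by h; the sign of h matches the sign of
    the desuspended cone differential.\<close>
  have g0: "(\<lambda>i a. case_sum (- h i a) (f i a)) \<in> dg_hom A ?K" (is "?g \<in> _")
    by (rule dg_homI) (use f h A B Y s' in \<open>auto simp: rlin_simps case_sum_arith case_sum_inject fscale_distribs eq\<close>)
  obtain e :: "'u + 'u \<Rightarrow> 'u" where e: "inj e" using ex_inj_sum[of "\<lambda>x. x" "\<lambda>x. x"] by auto
  obtain W :: "('k, 'u) dgm" and t where W: "dg_module W" and t: "t \<in> quasi_iso W A" and hh: "homotopic W ?K (gcomp ?g t) (\<lambda>i x. 0)"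
    by (rule null_homotopic_after_quasi_iso[OF A K acyclic_shift[OF C acyclic_cone[OF B Y s]] g0 e])
  obtain k where k: "k \<in> rlin W ?K (- 1)"
    and eqk: "\<And>i x. x \<in> cpt W i \<Longrightarrow> case_sum (- h i (t i x)) (f i (t i x)) = dif ?K (i - 1) (k i x) + k (i + 1) (dif W i x)"
    using hh by (auto simp: homotopic_def)
  define ky where "ky = (\<lambda>i x. k i x \<circ> Inl)"
  define kb where "kb = (\<lambda>i x. k i x \<circ> Inr)"
  have kk: "k i x = case_sum (ky i x) (kb i x)" for i x
    by (auto simp: ky_def kb_def fun_eq_iff split: sum.split)
  have "homotopic W B (gcomp f t) (\<lambda>i x. 0)"
  proof (rule homotopicI)
    show "kb \<in> rlin W B (- 1)"
    proof (rule rlinI)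
      show "kb i x \<in> cpt B (i + - 1)" if "x \<in> cpt W i" for i x
        using rlin_mem[OF k that] kk[of i x] by auto
      show "kb i (x + y) = kb i x + kb i y" if "x \<in> cpt W i" "y \<in> cpt W i" for i x y
        using rlin_add[OF k that] by (auto simp: kk case_sum_arith case_sum_inject)
      show "kb i (fscale c x) = fscale c (kb i x)" if "x \<in> cpt W i" for i x c
        using rlin_scale[OF k that] by (auto simp: kk case_sum_arith case_sum_inject)
      show "kb (i - 1) (tact W i x) = tact B (i + - 1) (kb i x)" if "x \<in> cpt W i" for i x
        using rlin_tact[OF k that, of "i - 1"] by (auto simp: kk case_sum_arith case_sum_inject)
    qed
    show "gcomp f t i x - 0 = dif B (i - 1) (kb i x) + kb (i + 1) (dif W i x)" if "x \<in> cpt W i" for i x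
      using eqk[OF that] by (auto simp: kk case_sum_arith case_sum_inject)
  qed
  then show ?thesis using that W t by blast
qed

section \<open>Maps that become homotopic after a quasi-isomorphism\<close>

text \<open>Two chain maps are related if they become equal in the derived category.\<close>

definition evq :: "('k::field, 'u) dgm \<Rightarrow> ('k, 'u) dgm \<Rightarrow> ('k, 'u, 'u) gmap \<Rightarrow> ('k, 'u, 'u) gmap \<Rightarrow> bool" where
  "evq A Y f g \<longleftrightarrow> (\<exists>(W :: ('k, 'u) dgm) t. dg_module W \<and> t \<in> quasi_iso W A \<and>
     homotopic W Y (gcomp f t) (gcomp g t))"

lemma evqI:
  fixes W A Y :: "('k::field, 'u) dgm"
  shows "dg_module W \<Longrightarrow> t \<in> quasi_iso W A \<Longrightarrow> homotopic W Y (gcomp f t) (gcomp g t) \<Longrightarrow> evq A Y f g"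
  unfolding evq_def by (intro exI[of _ W] exI[of _ t] conjI)

lemma evqE:
  fixes A Y :: "('k::field, 'u) dgm"
  assumes "evq A Y f g"
  obtains W :: "('k, 'u) dgm" and t where "dg_module W" "t \<in> quasi_iso W A" "homotopic W Y (gcomp f t) (gcomp g t)"
  using assms unfolding evq_def by (elim exE conjE) (erule (2) that)

lemma gid_quasi_iso: "dg_module M \<Longrightarrow> gid \<in> quasi_iso M M"
proof (rule quasi_isoI)
  fix i y assume "dg_module M" "y \<in> cocycles M i"
  then show "\<exists>z\<in>cocycles M i. y - gid i z \<in> coboundaries M i" by (intro bexI[of _ y]) simp_all
qed simp_all

lemma evq_homotopic:
  assumes "dg_module A" "homotopic A Y f g" shows "evq A Y f g"
  by (rule evqI[OF assms(1) gid_quasi_iso[OF assms(1)]]) (simp add: assms(2))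

lemma evq_refl: "dg_module A \<Longrightarrow> dg_module Y \<Longrightarrow> evq A Y f f"
  by (rule evq_homotopic) simp_all

lemma evq_sym:
  fixes A Y :: "('k::field, 'u) dgm"
  assumes "dg_module Y" "evq A Y f g" shows "evq A Y g f"
  using assms(2)
proof (rule evqE)
  fix W :: "('k, 'u) dgm" and t assume W: "dg_module W" "t \<in> quasi_iso W A" "homotopic W Y (gcomp f t) (gcomp g t)"
  show ?thesis using W(1,2) homotopic_sym[OF W(1) assms(1) W(3)] by (rule evqI)
qed

text \<open>A quasi-isomorphism t equalising f and g is pulled back along u by an Ore square; the
  square commutes only up to homotopy, which is absorbed by transitivity.\<close>

lemma evq_right:
  fixes A C Y :: "('k::field, 'u::infinite) dgm"
  assumes A: "dg_module A" and C: "dg_module C" and Y: "dg_module Y" and e: "evq A Y f g"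
    and f: "f \<in> dg_hom A Y" and g: "g \<in> dg_hom A Y" and u: "u \<in> dg_hom C A"
  shows "evq C Y (gcomp f u) (gcomp g u)"
  using e
proof (rule evqE)
  fix W :: "('k, 'u) dgm" and t assume W: "dg_module W" "t \<in> quasi_iso W A" "homotopic W Y (gcomp f t) (gcomp g t)"
  obtain V :: "('k, 'u) dgm" and c b where V: "dg_module V" and c: "c \<in> quasi_iso V C" and b: "b \<in> dg_hom V W"
    and h: "homotopic V A (gcomp u c) (gcomp t b)"
    by (rule ore[OF C W(1) A u W(2)])
  note t' = quasi_iso_hom[OF W(2)] and c' = quasi_iso_hom[OF c]
  note uc = gcomp_hom[OF c' u] and tb = gcomp_hom[OF b t']
  have 1: "homotopic V Y (gcomp f (gcomp u c)) (gcomp f (gcomp t b))"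
    by (rule homotopic_comp_left[OF V A Y h f uc tb])
  have 2: "homotopic V Y (gcomp g (gcomp u c)) (gcomp g (gcomp t b))"
    by (rule homotopic_comp_left[OF V A Y h g uc tb])
  have 3: "homotopic V Y (gcomp f (gcomp t b)) (gcomp g (gcomp t b))"
    using homotopic_comp_right[OF W(3) b] by (simp only: gcomp_assoc)
  have "homotopic V Y (gcomp f (gcomp u c)) (gcomp g (gcomp u c))"
    by (rule homotopic_trans[OF V Y 1 homotopic_trans[OF V Y 3 homotopic_sym[OF V Y 2]]])
  then show ?thesis by (intro evqI[OF V c]) (simp only: gcomp_assoc)
qed

lemma evq_left:
  fixes A Y Z :: "('k::field, 'u) dgm"
  assumes A: "dg_module A" and Y: "dg_module Y" and Z: "dg_module Z" and e: "evq A Y f g"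
    and f: "f \<in> dg_hom A Y" and g: "g \<in> dg_hom A Y" and k: "k \<in> dg_hom Y Z"
  shows "evq A Z (gcomp k f) (gcomp k g)"
  using e
proof (rule evqE)
  fix W :: "('k, 'u) dgm" and t assume W: "dg_module W" "t \<in> quasi_iso W A" "homotopic W Y (gcomp f t) (gcomp g t)"
  note t' = quasi_iso_hom[OF W(2)]
  have "homotopic W Z (gcomp k (gcomp f t)) (gcomp k (gcomp g t))"
    by (rule homotopic_comp_left[OF W(1) Y Z W(3) k gcomp_hom[OF t' f] gcomp_hom[OF t' g]])
  then show ?thesis by (intro evqI[OF W(1,2)]) (simp only: gcomp_assoc)
qed

lemma evq_cancel_right:
  fixes A B Y :: "('k::field, 'u) dgm"
  assumes A: "dg_module A" and B: "dg_module B" and t: "t \<in> quasi_iso B A"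
    and e: "evq B Y (gcomp f t) (gcomp g t)"
  shows "evq A Y f g"
  using e
proof (rule evqE)
  fix W :: "('k, 'u) dgm" and s assume W: "dg_module W" "s \<in> quasi_iso W B" "homotopic W Y (gcomp (gcomp f t) s) (gcomp (gcomp g t) s)"
  show ?thesis
    by (rule evqI[OF W(1) quasi_iso_comp[OF W(1) B A W(2) t]]) (use W(3) in \<open>simp only: gcomp_assoc\<close>)
qed

lemma evq_trans:
  fixes A Y :: "('k::field, 'u::infinite) dgm"
  assumes A: "dg_module A" and Y: "dg_module Y" and e: "evq A Y f g" and e': "evq A Y g k"
    and f: "f \<in> dg_hom A Y" and g: "g \<in> dg_hom A Y" and k: "k \<in> dg_hom A Y"
  shows "evq A Y f k"
  using e
proof (rule evqE)
  fix W :: "('k, 'u) dgm" and t assume W: "dg_module W" "t \<in> quasi_iso W A" "homotopic W Y (gcomp f t) (gcomp g t)"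
  have "evq W Y (gcomp g t) (gcomp k t)"
    by (rule evq_right[OF A W(1) Y e' g k quasi_iso_hom[OF W(2)]])
  then show ?thesis
  proof (rule evqE)
    fix V :: "('k, 'u) dgm" and s assume V: "dg_module V" "s \<in> quasi_iso V W" "homotopic V Y (gcomp (gcomp g t) s) (gcomp (gcomp k t) s)"
    have "homotopic V Y (gcomp (gcomp f t) s) (gcomp (gcomp k t) s)"
      by (rule homotopic_trans[OF V(1) Y homotopic_comp_right[OF W(3) quasi_iso_hom[OF V(2)]] V(3)])
    then have "evq W Y (gcomp f t) (gcomp k t)" by (rule evqI[OF V(1,2)])
    then show ?thesis by (rule evq_cancel_right[OF A W(1,2)])
  qed
qed

lemma gcomp_diff:
  assumes "k \<in> dg_hom N L" "dg_module N" "f \<in> dg_hom M N" "g \<in> dg_hom M N" "x \<in> cpt M i"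
  shows "gcomp k (\<lambda>i x. f i x - g i x) i x = gcomp k f i x - gcomp k g i x"
  using assms by simp

lemma homotopic_diff_zero:
  assumes M: "dg_module M" and N: "dg_module N"
  shows "homotopic M N (\<lambda>i x. f i x - g i x) (\<lambda>i x. 0) \<longleftrightarrow> homotopic M N f g"
  by (simp add: homotopic_def)

text \<open>After passing to W, the difference of the two maps is killed by s up to homotopy, and
  \<open>cancel_null\<close> removes s at the cost of a further quasi-isomorphism.\<close>

lemma evq_cancel_left:
  fixes A Y Z :: "('k::field, 'u::infinite) dgm"
  assumes A: "dg_module A" and Y: "dg_module Y" and Z: "dg_module Z"
    and f: "f \<in> dg_hom A Y" and g: "g \<in> dg_hom A Y" and s: "s \<in> quasi_iso Y Z"
    and e: "evq A Z (gcomp s f) (gcomp s g)"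
  shows "evq A Y f g"
  using e
proof (rule evqE)
  fix W :: "('k, 'u) dgm" and t assume W: "dg_module W" "t \<in> quasi_iso W A" "homotopic W Z (gcomp (gcomp s f) t) (gcomp (gcomp s g) t)"
  let ?d = "\<lambda>i x. gcomp f t i x - gcomp g t i x"
  note t' = quasi_iso_hom[OF W(2)] and s' = quasi_iso_hom[OF s]
  note ft = gcomp_hom[OF t' f] and gt = gcomp_hom[OF t' g]
  have d: "?d \<in> dg_hom W Y" by (rule diff_hom[OF Y ft gt])
  have 1: "homotopic W Z (gcomp s ?d) (\<lambda>i x. gcomp s (gcomp f t) i x - gcomp s (gcomp g t) i x)"
    by (rule homotopic_eqI[OF Z gcomp_diff[OF s' Y ft gt]])
  have 2: "homotopic W Z (\<lambda>i x. gcomp s (gcomp f t) i x - gcomp s (gcomp g t) i x) (\<lambda>i x. 0)"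
    unfolding homotopic_diff_zero[OF W(1) Z] using W(3) by (simp only: gcomp_assoc)
  obtain V :: "('k, 'u) dgm" and r where V: "dg_module V" and r: "r \<in> quasi_iso V W"
    and h: "homotopic V Y (gcomp ?d r) (\<lambda>i x. 0)"
    by (rule cancel_null[OF W(1) Y Z d s homotopic_trans[OF W(1) Z 1 2]])
  have "homotopic V Y (gcomp (gcomp f t) r) (gcomp (gcomp g t) r)"
    by (rule iffD1[OF homotopic_diff_zero[OF V Y]]) (use h in \<open>simp add: gcomp_def\<close>)
  then have "evq W Y (gcomp f t) (gcomp g t)" by (rule evqI[OF V r])
  then show ?thesis by (rule evq_cancel_right[OF A W(1,2)])
qed

lemma evq_diff:
  fixes A Y :: "('k::field, 'u::infinite) dgm"
  assumes A: "dg_module A" and Y: "dg_module Y" and e: "evq A Y f g" and e': "evq A Y f' g'"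
    and f: "f' \<in> dg_hom A Y" and g: "g' \<in> dg_hom A Y"
  shows "evq A Y (\<lambda>i x. f i x - f' i x) (\<lambda>i x. g i x - g' i x)"
  using e
proof (rule evqE)
  fix W :: "('k, 'u) dgm" and t assume W: "dg_module W" "t \<in> quasi_iso W A" "homotopic W Y (gcomp f t) (gcomp g t)"
  have "evq W Y (gcomp f' t) (gcomp g' t)"
    by (rule evq_right[OF A W(1) Y e' f g quasi_iso_hom[OF W(2)]])
  then show ?thesis
  proof (rule evqE)
    fix V :: "('k, 'u) dgm" and s assume V: "dg_module V" "s \<in> quasi_iso V W" "homotopic V Y (gcomp (gcomp f' t) s) (gcomp (gcomp g' t) s)"
    note h = homotopic_diff[OF V(1) Y homotopic_comp_right[OF W(3) quasi_iso_hom[OF V(2)]] V(3)]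
    show ?thesis
      by (rule evqI[OF V(1) quasi_iso_comp[OF V(1) W(1) A V(2) W(2)]]) (use h in \<open>simp add: gcomp_def\<close>)
  qed
qed

section \<open>The derived category: equivalence of roofs, and composition of their classes\<close>

section \<open>Roofs\<close>

lemma roof_eta [simp]: "\<lparr>apex = apex r, den = den r, num = num r\<rparr> = r" for r :: "('k, 'u) roof"
  by (cases r) simp

lemma roofsI: "dg_module W \<Longrightarrow> s \<in> quasi_iso W X \<Longrightarrow> f \<in> dg_hom W Y \<Longrightarrow> \<lparr>apex = W, den = s, num = f\<rparr> \<in> roofs X Y"
  by (simp add: roofs_def)

lemma roofsD:
  assumes "r \<in> roofs X Y"
  shows "dg_module (apex r)" "den r \<in> quasi_iso (apex r) X" "num r \<in> dg_hom (apex r) Y"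
    "den r \<in> dg_hom (apex r) X"
  using assms by (simp_all add: roofs_def)

text \<open>\<open>roof_rel\<close> asks for homotopies on a single apex. Refining W twice turns
  both \<open>evq\<close> conditions into homotopies at once, so equivalences of roofs may be
  checked up to \<open>evq\<close>.\<close>

lemma roof_relI:
  fixes X Y :: "('k::field, 'u::infinite) dgm"
  assumes X: "dg_module X" and Y: "dg_module Y" and r: "r \<in> roofs X Y" and r': "r' \<in> roofs X Y"
    and W: "dg_module W" and p: "p \<in> dg_hom W (apex r)" and q: "q \<in> dg_hom W (apex r')"
    and dp: "gcomp (den r) p \<in> quasi_iso W X"
    and e1: "evq W X (gcomp (den r) p) (gcomp (den r') q)" and e2: "evq W Y (gcomp (num r) p) (gcomp (num r') q)"
  shows "(r, r') \<in> roof_rel X Y"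
  using e1
proof (rule evqE)
  note R = roofsD[OF r] and R' = roofsD[OF r']
  fix V :: "('k, 'u) dgm" and t assume V: "dg_module V" "t \<in> quasi_iso V W"
    "homotopic V X (gcomp (gcomp (den r) p) t) (gcomp (gcomp (den r') q) t)"
  note t' = quasi_iso_hom[OF V(2)]
  have "evq V Y (gcomp (gcomp (num r) p) t) (gcomp (gcomp (num r') q) t)"
    by (rule evq_right[OF W V(1) Y e2 gcomp_hom[OF p R(3)] gcomp_hom[OF q R'(3)] t'])
  then show ?thesis
  proof (rule evqE)
    fix U :: "('k, 'u) dgm" and s assume U: "dg_module U" "s \<in> quasi_iso U V"
      "homotopic U Y (gcomp (gcomp (gcomp (num r) p) t) s) (gcomp (gcomp (gcomp (num r') q) t) s)"
    note s' = quasi_iso_hom[OF U(2)]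
    let ?p = "gcomp p (gcomp t s)" and ?q = "gcomp q (gcomp t s)"
    have 1: "?p \<in> dg_hom U (apex r)" "?q \<in> dg_hom U (apex r')"
      using gcomp_hom[OF gcomp_hom[OF s' t'] p] gcomp_hom[OF gcomp_hom[OF s' t'] q] by simp_all
    have 2: "gcomp (den r) ?p \<in> quasi_iso U X"
      using quasi_iso_comp[OF U(1) W X quasi_iso_comp[OF U(1) V(1) W U(2) V(2)] dp] by (simp only: gcomp_assoc)
    have 3: "homotopic U X (gcomp (den r) ?p) (gcomp (den r') ?q)"
      using homotopic_comp_right[OF V(3) s'] by (simp only: gcomp_assoc)
    have 4: "homotopic U Y (gcomp (num r) ?p) (gcomp (num r') ?q)"
      using U(3) by (simp only: gcomp_assoc)
    show ?thesis
      unfolding roof_rel_def mem_Collect_eq case_prod_conv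
      by (intro conjI r r' exI[of _ U] exI[of _ ?p] exI[of _ ?q] U(1) 1 2 3 4)
  qed
qed

text \<open>Both legs of a comparison of roofs are quasi-isomorphisms by two-out-of-three, although
  the definition demands this only of one composite.\<close>

lemma roof_relE:
  fixes X Y :: "('k::field, 'u::infinite) dgm"
  assumes "(r, r') \<in> roof_rel X Y" and X: "dg_module X"
  obtains W :: "('k, 'u) dgm" and p q where "r \<in> roofs X Y" "r' \<in> roofs X Y" "dg_module W" "p \<in> quasi_iso W (apex r)"
    "q \<in> quasi_iso W (apex r')" "homotopic W X (gcomp (den r) p) (gcomp (den r') q)"
    "homotopic W Y (gcomp (num r) p) (gcomp (num r') q)"
    "gcomp (den r) p \<in> quasi_iso W X" "gcomp (den r') q \<in> quasi_iso W X"
  using assms(1) unfolding roof_rel_def mem_Collect_eq case_prod_conv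
proof (elim conjE exE)
  fix W :: "('k, 'u) dgm" and p q
  assume r: "r \<in> roofs X Y" and r': "r' \<in> roofs X Y" and W: "dg_module W" and p: "p \<in> dg_hom W (apex r)"
    and q: "q \<in> dg_hom W (apex r')"
    and dp: "gcomp (den r) p \<in> quasi_iso W X"
    and e1: "homotopic W X (gcomp (den r) p) (gcomp (den r') q)"
    and e2: "homotopic W Y (gcomp (num r) p) (gcomp (num r') q)"
  note R = roofsD[OF r] and R' = roofsD[OF r']
  have dq: "gcomp (den r') q \<in> quasi_iso W X"
    by (rule quasi_iso_homotopic[OF W X dp gcomp_hom[OF q R'(4)] e1])
  have p': "p \<in> quasi_iso W (apex r)" by (rule quasi_iso_cancel_left[OF W R(1) X p R(2) dp])
  have q': "q \<in> quasi_iso W (apex r')" by (rule quasi_iso_cancel_left[OF W R'(1) X q R'(2) dq])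
  show thesis by (rule that[OF r r' W p' q' e1 e2 dp dq])
qed

text \<open>Makes equivalent roofs comparable over an arbitrary test object V instead of the
  particular apex that witnesses their equivalence: wherever the left legs agree, so do the right
  legs. Transitivity and well-definedness of composites and differences reduce to this.\<close>

lemma roof_rel_test:
  fixes X Y :: "('k::field, 'u::infinite) dgm"
  assumes rel: "(r, r') \<in> roof_rel X Y" and X: "dg_module X" and Y: "dg_module Y" and V: "dg_module V"
    and p: "p \<in> dg_hom V (apex r)" and q: "q \<in> dg_hom V (apex r')"
    and e: "evq V X (gcomp (den r) p) (gcomp (den r') q)"
  shows "evq V Y (gcomp (num r) p) (gcomp (num r') q)"
  using rel X
proof (rule roof_relE)
  fix W :: "('k, 'u) dgm" and p0 q0 assume r: "r \<in> roofs X Y" and r': "r' \<in> roofs X Y" and W: "dg_module W"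
    and p0: "p0 \<in> quasi_iso W (apex r)" and q0: "q0 \<in> quasi_iso W (apex r')"
    and h1: "homotopic W X (gcomp (den r) p0) (gcomp (den r') q0)"
    and h2: "homotopic W Y (gcomp (num r) p0) (gcomp (num r') q0)"
  note R = roofsD[OF r] and R' = roofsD[OF r'] and p0' = quasi_iso_hom[OF p0] and q0' = quasi_iso_hom[OF q0]
  \<comment> \<open>W carries the given equivalence and V the test maps; U maps to both, compatibly
    with the two maps into the apex of r.\<close>
  obtain U :: "('k, 'u) dgm" and b a where U: "dg_module U" and b: "b \<in> quasi_iso U V" and a: "a \<in> dg_hom U W"
    and h: "homotopic U (apex r) (gcomp p b) (gcomp p0 a)"
    by (rule ore[OF V W R(1) p p0])
  note b' = quasi_iso_hom[OF b]
  note pb = gcomp_hom[OF b' p] and qb = gcomp_hom[OF b' q] and pa = gcomp_hom[OF a p0'] and qa = gcomp_hom[OF a q0']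
  note tr = evq_trans[OF U X] and trY = evq_trans[OF U Y]
  have 1: "evq U X (gcomp (den r') (gcomp q b)) (gcomp (den r) (gcomp p b))"
    using evq_sym[OF X evq_right[OF V U X e gcomp_hom[OF p R(4)] gcomp_hom[OF q R'(4)] b']] by (simp only: gcomp_assoc)
  have 2: "evq U X (gcomp (den r) (gcomp p b)) (gcomp (den r) (gcomp p0 a))"
    by (rule evq_homotopic[OF U homotopic_comp_left[OF U R(1) X h R(4) pb pa]])
  have 3: "evq U X (gcomp (den r) (gcomp p0 a)) (gcomp (den r') (gcomp q0 a))"
    using evq_homotopic[OF U homotopic_comp_right[OF h1 a]] by (simp only: gcomp_assoc)
  note d = gcomp_hom[OF pb R(4)] gcomp_hom[OF qb R'(4)] gcomp_hom[OF pa R(4)] gcomp_hom[OF qa R'(4)]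
  have "evq U X (gcomp (den r') (gcomp q b)) (gcomp (den r') (gcomp q0 a))"
    by (rule tr[OF 1 tr[OF 2 3 d(1,3,4)] d(2,1,4)])
  \<comment> \<open>The maps q b and q0 a agree after composing with the left leg of r', and that
    leg is a quasi-isomorphism and can be cancelled.\<close>
  then have 4: "evq U (apex r') (gcomp q b) (gcomp q0 a)"
    by (rule evq_cancel_left[OF U R'(1) X qb qa R'(2)])
  note n = gcomp_hom[OF pb R(3)] gcomp_hom[OF qb R'(3)] gcomp_hom[OF pa R(3)] gcomp_hom[OF qa R'(3)]
  have 5: "evq U Y (gcomp (num r) (gcomp p b)) (gcomp (num r) (gcomp p0 a))"
    by (rule evq_homotopic[OF U homotopic_comp_left[OF U R(1) Y h R(3) pb pa]])
  have 6: "evq U Y (gcomp (num r) (gcomp p0 a)) (gcomp (num r') (gcomp q0 a))"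
    using evq_homotopic[OF U homotopic_comp_right[OF h2 a]] by (simp only: gcomp_assoc)
  have 7: "evq U Y (gcomp (num r') (gcomp q0 a)) (gcomp (num r') (gcomp q b))"
    by (rule evq_sym[OF Y evq_left[OF U R'(1) Y 4 qb qa R'(3)]])
  have "evq U Y (gcomp (num r) (gcomp p b)) (gcomp (num r') (gcomp q b))"
    by (rule trY[OF 5 trY[OF 6 7 n(3,4,2)] n(1,3,2)])
  then have "evq U Y (gcomp (gcomp (num r) p) b) (gcomp (gcomp (num r') q) b)" by (simp only: gcomp_assoc)
  then show ?thesis by (rule evq_cancel_right[OF V U b])
qed

lemma roof_rel_refl:
  fixes X Y :: "('k::field, 'u::infinite) dgm"
  assumes X: "dg_module X" and Y: "dg_module Y" and r: "r \<in> roofs X Y"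
  shows "(r, r) \<in> roof_rel X Y"
  using roofsD[OF r] by (intro roof_relI[OF X Y r r, of "apex r" gid gid] evq_refl X Y) simp_all

lemma roof_rel_sym:
  fixes X Y :: "('k::field, 'u::infinite) dgm"
  assumes X: "dg_module X" and Y: "dg_module Y" and r: "(r, r') \<in> roof_rel X Y"
  shows "(r', r) \<in> roof_rel X Y"
  using r X
proof (rule roof_relE)
  fix W :: "('k, 'u) dgm" and p q assume r: "r \<in> roofs X Y" and r': "r' \<in> roofs X Y" and W: "dg_module W"
    and p: "p \<in> quasi_iso W (apex r)" and q: "q \<in> quasi_iso W (apex r')"
    and h1: "homotopic W X (gcomp (den r) p) (gcomp (den r') q)"
    and h2: "homotopic W Y (gcomp (num r) p) (gcomp (num r') q)"
    and d: "gcomp (den r') q \<in> quasi_iso W X"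
  show ?thesis
    by (rule roof_relI[OF X Y r' r W quasi_iso_hom[OF q] quasi_iso_hom[OF p] d
         evq_sym[OF X evq_homotopic[OF W h1]] evq_sym[OF Y evq_homotopic[OF W h2]]])
qed

text \<open>The apex comparing r with r' is joined to the apex of r'' by an Ore square over X. On
  the resulting module the left legs of r' and r'' agree, so the test lemma equates their right
  legs.\<close>

lemma roof_rel_trans:
  fixes X Y :: "('k::field, 'u::infinite) dgm"
  assumes X: "dg_module X" and Y: "dg_module Y" and rel: "(r, r') \<in> roof_rel X Y" and rel': "(r', r'') \<in> roof_rel X Y"
  shows "(r, r'') \<in> roof_rel X Y"
  using rel X
proof (rule roof_relE)
  fix W :: "('k, 'u) dgm" and p q assume r: "r \<in> roofs X Y" and r': "r' \<in> roofs X Y" and W: "dg_module W"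
    and p: "p \<in> quasi_iso W (apex r)" and q: "q \<in> quasi_iso W (apex r')"
    and h1: "homotopic W X (gcomp (den r) p) (gcomp (den r') q)"
    and h2: "homotopic W Y (gcomp (num r) p) (gcomp (num r') q)"
    and d: "gcomp (den r) p \<in> quasi_iso W X"
  have r'': "r'' \<in> roofs X Y" using rel' by (simp add: roof_rel_def)
  note R = roofsD[OF r] and R' = roofsD[OF r'] and R'' = roofsD[OF r'']
  note p' = quasi_iso_hom[OF p] and q' = quasi_iso_hom[OF q]
  obtain V :: "('k, 'u) dgm" and t g where V: "dg_module V" and t: "t \<in> quasi_iso V W" and g: "g \<in> dg_hom V (apex r'')"
    and h: "homotopic V X (gcomp (gcomp (den r) p) t) (gcomp (den r'') g)"
    by (rule ore[OF W R''(1) X gcomp_hom[OF p' R(4)] R''(2)])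
  note t' = quasi_iso_hom[OF t]
  note pt = gcomp_hom[OF t' p'] and qt = gcomp_hom[OF t' q']
  have a: "evq V X (gcomp (den r) (gcomp p t)) (gcomp (den r'') g)"
    using evq_homotopic[OF V h] by (simp only: gcomp_assoc)
  have "evq V X (gcomp (den r) (gcomp p t)) (gcomp (den r') (gcomp q t))"
    using evq_homotopic[OF V homotopic_comp_right[OF h1 t']] by (simp only: gcomp_assoc)
  then have "evq V X (gcomp (den r') (gcomp q t)) (gcomp (den r'') g)"
    by (rule evq_trans[OF V X evq_sym[OF X] a gcomp_hom[OF qt R'(4)] gcomp_hom[OF pt R(4)] gcomp_hom[OF g R''(4)]])
  then have b: "evq V Y (gcomp (num r') (gcomp q t)) (gcomp (num r'') g)"
    by (rule roof_rel_test[OF rel' X Y V qt g])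
  have "evq V Y (gcomp (num r) (gcomp p t)) (gcomp (num r') (gcomp q t))"
    using evq_homotopic[OF V homotopic_comp_right[OF h2 t']] by (simp only: gcomp_assoc)
  then have c: "evq V Y (gcomp (num r) (gcomp p t)) (gcomp (num r'') g)"
    by (rule evq_trans[OF V Y _ b gcomp_hom[OF pt R(3)] gcomp_hom[OF qt R'(3)] gcomp_hom[OF g R''(3)]])
  have "gcomp (den r) (gcomp p t) \<in> quasi_iso V X"
    using quasi_iso_comp[OF V W X t d] by (simp only: gcomp_assoc)
  then show ?thesis
    by (rule roof_relI[OF X Y r r'' V pt g _ a c])
qed

lemma equiv_roof_rel:
  fixes X Y :: "('k::field, 'u::infinite) dgm"
  assumes X: "dg_module X" and Y: "dg_module Y"
  shows "equiv (roofs X Y) (roof_rel X Y)"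
proof (rule equivI)
  show "roof_rel X Y \<subseteq> roofs X Y \<times> roofs X Y" by (auto simp: roof_rel_def)
  show "refl_on (roofs X Y) (roof_rel X Y)" by (intro refl_onI roof_rel_refl X Y)
  show "sym (roof_rel X Y)" by (intro symI) (rule roof_rel_sym[OF X Y])
  show "trans (roof_rel X Y)" by (intro transI) (rule roof_rel_trans[OF X Y])
qed

abbreviation cls :: "('k::field, 'u) dgm \<Rightarrow> ('k, 'u) dgm \<Rightarrow> ('k, 'u) roof \<Rightarrow> ('k, 'u) dmor" where
  "cls X Y r \<equiv> roof_rel X Y `` {r}"

context
  fixes X Y :: "('k::field, 'u::infinite) dgm"
  assumes X: "dg_module X" and Y: "dg_module Y"
begin

lemma cls_hom: "r \<in> roofs X Y \<Longrightarrow> cls X Y r \<in> D_hom X Y"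
  by (simp add: D_hom_def quotientI)

lemma cls_self: "r \<in> roofs X Y \<Longrightarrow> r \<in> cls X Y r"
  using roof_rel_refl[OF X Y] by simp

lemma cls_eq: "(r, r') \<in> roof_rel X Y \<Longrightarrow> cls X Y r = cls X Y r'"
  by (rule equiv_class_eq[OF equiv_roof_rel[OF X Y]])

lemma D_homE:
  assumes "\<phi> \<in> D_hom X Y"
  obtains r where "r \<in> roofs X Y" "\<phi> = cls X Y r"
  using assms unfolding D_hom_def by (rule quotientE)

lemma D_hom_mem:
  assumes "\<phi> \<in> D_hom X Y" "r \<in> \<phi>"
  shows "r \<in> roofs X Y" "\<phi> = cls X Y r"
proof -
  obtain r0 where r0: "r0 \<in> roofs X Y" "\<phi> = cls X Y r0" using D_homE[OF assms(1)] .
  then have "(r0, r) \<in> roof_rel X Y" using assms(2) by simp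
  then show "r \<in> roofs X Y" "\<phi> = cls X Y r" using cls_eq r0(2) by (auto simp: roof_rel_def)
qed

end

section \<open>Composition in the derived category\<close>

text \<open>\<open>D_comp\<close> is defined as a union over all representatives and all completing
  squares. Any two of the resulting roofs are compared over an Ore square of their left legs; the
  test lemma is applied over Y for the first factor and over Z for the second.\<close>

lemma D_comp_cls:
  fixes X Y Z :: "('k::field, 'u::infinite) dgm"
  assumes X: "dg_module X" and Y: "dg_module Y" and Z: "dg_module Z"
    and r: "r \<in> roofs X Y" and s: "s \<in> roofs Y Z" and W: "dg_module W" and u: "u \<in> quasi_iso W (apex r)"
    and g: "g \<in> dg_hom W (apex s)" and e: "evq W Y (gcomp (num r) u) (gcomp (den s) g)"
  shows "\<lparr>apex = W, den = gcomp (den r) u, num = gcomp (num s) g\<rparr> \<in> roofs X Z" (is "?c \<in> _")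
    and "D_comp X Y Z (cls Y Z s) (cls X Y r) = cls X Z \<lparr>apex = W, den = gcomp (den r) u, num = gcomp (num s) g\<rparr>"
proof -
  note R = roofsD[OF r] and S = roofsD[OF s] and u' = quasi_iso_hom[OF u]
  have comp: "\<lparr>apex = W, den = gcomp (den r) u, num = gcomp (num s) g\<rparr> \<in> roofs X Z"
    if "r \<in> roofs X Y" "s \<in> roofs Y Z" "dg_module W" "u \<in> quasi_iso W (apex r)" "g \<in> dg_hom W (apex s)"
    for r s :: "('k, 'u) roof" and W u g
    using roofsD[OF that(1)] roofsD[OF that(2)] that(3-5)
    by (intro roofsI quasi_iso_comp[of _ "apex r"] gcomp_hom[of _ _ "apex s"] X)
  show c: "?c \<in> roofs X Z" by (rule comp[OF r s W u g])
  show "D_comp X Y Z (cls Y Z s) (cls X Y r) = cls X Z ?c"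
  proof (intro equalityI subsetI)
    fix c assume "c \<in> cls X Z ?c"
    then have cc: "(?c, c) \<in> roof_rel X Z" by simp
    show "c \<in> D_comp X Y Z (cls Y Z s) (cls X Y r)"
      using e
    proof (rule evqE)
      fix V :: "('k, 'u) dgm" and t assume V: "dg_module V" and t: "t \<in> quasi_iso V W"
        and h: "homotopic V Y (gcomp (gcomp (num r) u) t) (gcomp (gcomp (den s) g) t)"
      note t' = quasi_iso_hom[OF t]
      have ut: "gcomp u t \<in> quasi_iso V (apex r)" by (rule quasi_iso_comp[OF V W R(1) t u])
      have gt: "gcomp g t \<in> dg_hom V (apex s)" by (rule gcomp_hom[OF t' g])
      let ?c' = "\<lparr>apex = V, den = gcomp (den r) (gcomp u t), num = gcomp (num s) (gcomp g t)\<rparr>"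
      have c': "?c' \<in> roofs X Z" by (rule comp[OF r s V ut gt])
      have "(?c', ?c) \<in> roof_rel X Z"
        by (rule roof_relI[OF X Z c' c V, of gid t])
          (use t' roofsD[OF c'] in \<open>simp_all add: gcomp_assoc evq_refl V X Z\<close>)
      then have rel: "(?c', c) \<in> roof_rel X Z" by (rule roof_rel_trans[OF X Z _ cc])
      have h': "homotopic V Y (gcomp (num r) (gcomp u t)) (gcomp (den s) (gcomp g t))"
        using h by (simp only: gcomp_assoc)
      show ?thesis unfolding D_comp_def mem_Collect_eq
        by (intro bexI[of _ r] bexI[of _ s] exI[of _ V] exI[of _ "gcomp u t"] exI[of _ "gcomp g t"] conjI
            V ut gt h' rel cls_self X Y Z r s)
    qed
  next
    fix c assume "c \<in> D_comp X Y Z (cls Y Z s) (cls X Y r)"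
    then show "c \<in> cls X Z ?c" unfolding D_comp_def mem_Collect_eq
    proof (elim bexE exE conjE)
      fix r' s' :: "('k, 'u) roof" and W' :: "('k, 'u) dgm" and u' g'
      assume "r' \<in> cls X Y r" and "s' \<in> cls Y Z s" and W': "dg_module W'" and v: "u' \<in> quasi_iso W' (apex r')"
        and g': "g' \<in> dg_hom W' (apex s')"
        and h: "homotopic W' Y (gcomp (num r') u') (gcomp (den s') g')"
        and rel: "(\<lparr>apex = W', den = gcomp (den r') u', num = gcomp (num s') g'\<rparr>, c) \<in> roof_rel X Z"
      then have rr: "(r, r') \<in> roof_rel X Y" and ss: "(s, s') \<in> roof_rel Y Z" by simp_all
      then have r': "r' \<in> roofs X Y" and s': "s' \<in> roofs Y Z" by (simp_all add: roof_rel_def)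
      note R' = roofsD[OF r'] and S' = roofsD[OF s'] and v' = quasi_iso_hom[OF v]
      let ?c' = "\<lparr>apex = W', den = gcomp (den r') u', num = gcomp (num s') g'\<rparr>"
      have c': "?c' \<in> roofs X Z" by (rule comp[OF r' s' W' v g'])
      \<comment> \<open>Over V the left legs of the two candidate composites agree, which is where
        both test arguments take place.\<close>
      obtain V :: "('k, 'u) dgm" and t b where V: "dg_module V" and t: "t \<in> quasi_iso V W" and b: "b \<in> dg_hom V W'"
        and hh: "homotopic V X (gcomp (gcomp (den r) u) t) (gcomp (gcomp (den r') u') b)"
        by (rule ore[OF W W' X gcomp_hom[OF u' R(4)] quasi_iso_comp[OF W' R'(1) X v R'(2)]])
      note t' = quasi_iso_hom[OF t]
      note ut = gcomp_hom[OF t' u'] and vb = gcomp_hom[OF b v'] and gt = gcomp_hom[OF t' g] and gb = gcomp_hom[OF b g']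
      have 1: "evq V X (gcomp (den r) (gcomp u t)) (gcomp (den r') (gcomp u' b))"
        using evq_homotopic[OF V hh] by (simp only: gcomp_assoc)
      have 2: "evq V Y (gcomp (num r) (gcomp u t)) (gcomp (num r') (gcomp u' b))"
        by (rule roof_rel_test[OF rr X Y V ut vb 1])
      have 3: "evq V Y (gcomp (den s) (gcomp g t)) (gcomp (num r) (gcomp u t))"
        using evq_sym[OF Y evq_right[OF W V Y e gcomp_hom[OF u' R(3)] gcomp_hom[OF g S(4)] t']]
        by (simp only: gcomp_assoc)
      have 4: "evq V Y (gcomp (num r') (gcomp u' b)) (gcomp (den s') (gcomp g' b))"
        using evq_homotopic[OF V homotopic_comp_right[OF h b]] by (simp only: gcomp_assoc)
      note n = gcomp_hom[OF gt S(4)] gcomp_hom[OF ut R(3)] gcomp_hom[OF vb R'(3)] gcomp_hom[OF gb S'(4)]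
      have "evq V Y (gcomp (den s) (gcomp g t)) (gcomp (den s') (gcomp g' b))"
        by (rule evq_trans[OF V Y 3 evq_trans[OF V Y 2 4 n(2,3,4)] n(1,2,4)])
      then have 5: "evq V Z (gcomp (num s) (gcomp g t)) (gcomp (num s') (gcomp g' b))"
        by (rule roof_rel_test[OF ss Y Z V gt gb])
      have 6: "gcomp (gcomp (den r) u) t \<in> quasi_iso V X"
        by (rule quasi_iso_comp[OF V W X t quasi_iso_comp[OF W R(1) X u R(2)]])
      have "(?c, ?c') \<in> roof_rel X Z"
        by (rule roof_relI[OF X Z c c' V, of t b]) (use t' b 6 1 5 in \<open>simp_all add: gcomp_assoc\<close>)
      then have "(?c, c) \<in> roof_rel X Z" using rel by (rule roof_rel_trans[OF X Z])
      then show ?thesis by simp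
    qed
  qed
qed

lemma D_comp_square:
  fixes X Y Z :: "('k::field, 'u::infinite) dgm"
  assumes X: "dg_module X" and Y: "dg_module Y" and Z: "dg_module Z"
    and r: "r \<in> roofs X Y" and s: "s \<in> roofs Y Z"
  obtains W :: "('k, 'u) dgm" and u g where "dg_module W" "u \<in> quasi_iso W (apex r)" "g \<in> dg_hom W (apex s)"
    "homotopic W Y (gcomp (num r) u) (gcomp (den s) g)"
    "\<lparr>apex = W, den = gcomp (den r) u, num = gcomp (num s) g\<rparr> \<in> roofs X Z"
    "D_comp X Y Z (cls Y Z s) (cls X Y r) = cls X Z \<lparr>apex = W, den = gcomp (den r) u, num = gcomp (num s) g\<rparr>"
proof -
  note R = roofsD[OF r] and S = roofsD[OF s]
  obtain W :: "('k, 'u) dgm" and u g where W: "dg_module W" and u: "u \<in> quasi_iso W (apex r)"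
    and g: "g \<in> dg_hom W (apex s)" and h: "homotopic W Y (gcomp (num r) u) (gcomp (den s) g)"
    by (rule ore[OF R(1) S(1) Y R(3) S(2)])
  show thesis
    by (rule that[OF W u g h D_comp_cls[OF X Y Z r s W u g evq_homotopic[OF W h]]])
qed

lemma D_comp_hom:
  fixes X Y Z :: "('k::field, 'u::infinite) dgm"
  assumes X: "dg_module X" and Y: "dg_module Y" and Z: "dg_module Z"
    and f: "\<phi> \<in> D_hom X Y" and g: "\<psi> \<in> D_hom Y Z"
  shows "D_comp X Y Z \<psi> \<phi> \<in> D_hom X Z"
proof -
  obtain r where r: "r \<in> roofs X Y" "\<phi> = cls X Y r" by (rule D_homE[OF X Y f])
  obtain s where s: "s \<in> roofs Y Z" "\<psi> = cls Y Z s" by (rule D_homE[OF Y Z g])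
  show ?thesis
    by (rule D_comp_square[OF X Y Z r(1) s(1)]) (simp add: r(2) s(2) cls_hom[OF X Z])
qed

lemma D_of_roof: "dg_module X \<Longrightarrow> f \<in> dg_hom X Y \<Longrightarrow> \<lparr>apex = X, den = gid, num = f\<rparr> \<in> roofs X Y"
  by (intro roofsI gid_quasi_iso)

lemma D_of_hom: 
  fixes X Y :: "('k::field, 'u::infinite) dgm"
  shows "dg_module X \<Longrightarrow> dg_module Y \<Longrightarrow> f \<in> dg_hom X Y \<Longrightarrow> D_of X Y f \<in> D_hom X Y"
  unfolding D_of_def by (intro cls_hom D_of_roof)

lemma D_of_eq:
  fixes X Y :: "('k::field, 'u::infinite) dgm"
  assumes X: "dg_module X" and Y: "dg_module Y" and f: "f \<in> dg_hom X Y" and g: "g \<in> dg_hom X Y"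
    and e: "evq X Y f g"
  shows "D_of X Y f = D_of X Y g"
  unfolding D_of_def
  by (rule cls_eq[OF X Y], rule roof_relI[OF X Y D_of_roof[OF X f] D_of_roof[OF X g] X, of gid gid])
    (simp_all add: e evq_refl X gid_quasi_iso)

lemma D_of_cong:
  fixes X Y :: "('k::field, 'u::infinite) dgm"
  assumes X: "dg_module X" and Y: "dg_module Y" and f: "f \<in> dg_hom X Y" and g: "g \<in> dg_hom X Y"
    and e: "\<And>i x. x \<in> cpt X i \<Longrightarrow> f i x = g i x"
  shows "D_of X Y f = D_of X Y g"
  by (rule D_of_eq[OF X Y f g evq_homotopic[OF X homotopic_eqI[OF Y e]]])

lemma D_comp_of:
  fixes X Y Z :: "('k::field, 'u::infinite) dgm"
  assumes X: "dg_module X" and Y: "dg_module Y" and Z: "dg_module Z" and f: "f \<in> dg_hom X Y" and g: "g \<in> dg_hom Y Z"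
  shows "D_comp X Y Z (D_of Y Z g) (D_of X Y f) = D_of X Z (gcomp g f)"
  unfolding D_of_def
  using D_comp_cls(2)[OF X Y Z D_of_roof[OF X f] D_of_roof[OF Y g] X, of gid f]
  by (simp add: gid_quasi_iso X f evq_refl Y)

text \<open>A representative of the class of f with left leg s has right leg equal to f s up to
  \<open>evq\<close>, and likewise for g. Every difference formed on a common left leg is therefore
  equivalent to f - g.\<close>

lemma D_minus_of:
  fixes X Y :: "('k::field, 'u::infinite) dgm"
  assumes X: "dg_module X" and Y: "dg_module Y" and f: "f \<in> dg_hom X Y" and g: "g \<in> dg_hom X Y"
  shows "D_minus X Y (D_of X Y f) (D_of X Y g) = D_of X Y (\<lambda>i x. f i x - g i x)"
proof (intro equalityI subsetI)
  let ?d = "\<lambda>i x. f i x - g i x"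
  have d: "?d \<in> dg_hom X Y" by (rule diff_hom[OF Y f g])
  {
    fix c assume "c \<in> D_of X Y ?d"
    then show "c \<in> D_minus X Y (D_of X Y f) (D_of X Y g)"
      unfolding D_of_def D_minus_def mem_Collect_eq
      by (intro exI[of _ X] exI[of _ gid] exI[of _ f] exI[of _ g] conjI cls_self[OF X Y] D_of_roof X f g) simp
  }
  fix c assume "c \<in> D_minus X Y (D_of X Y f) (D_of X Y g)"
  then show "c \<in> D_of X Y ?d" unfolding D_of_def D_minus_def mem_Collect_eq
  proof (elim exE conjE)
    fix W :: "('k, 'u) dgm" and s f' g'
    let ?f = "\<lparr>apex = W, den = s, num = f'\<rparr>" and ?g = "\<lparr>apex = W, den = s, num = g'\<rparr>"
      and ?m = "\<lparr>apex = W, den = s, num = \<lambda>i x. f' i x - g' i x\<rparr>"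
    assume "?f \<in> cls X Y \<lparr>apex = X, den = gid, num = f\<rparr>" and "?g \<in> cls X Y \<lparr>apex = X, den = gid, num = g\<rparr>"
      and rel: "(?m, c) \<in> roof_rel X Y"
    then have F: "(\<lparr>apex = X, den = gid, num = f\<rparr>, ?f) \<in> roof_rel X Y" and G: "(\<lparr>apex = X, den = gid, num = g\<rparr>, ?g) \<in> roof_rel X Y"
      by simp_all
    then have ff: "?f \<in> roofs X Y" and gg: "?g \<in> roofs X Y" by (simp_all add: roof_rel_def)
    have W: "dg_module W" and s: "s \<in> quasi_iso W X" and f': "f' \<in> dg_hom W Y" and g': "g' \<in> dg_hom W Y"
      using roofsD[OF ff] roofsD[OF gg] by simp_all
    note s' = quasi_iso_hom[OF s]
    have m: "?m \<in> roofs X Y" by (rule roofsI[OF W s diff_hom[OF Y f' g']])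
    have 1: "evq W Y (gcomp f s) f'"
      using roof_rel_test[OF F X Y W, of s gid] s' by (simp add: evq_refl W X)
    have 2: "evq W Y (gcomp g s) g'"
      using roof_rel_test[OF G X Y W, of s gid] s' by (simp add: evq_refl W X)
    have 3: "evq W Y (gcomp ?d s) (\<lambda>i x. f' i x - g' i x)"
      using evq_diff[OF W Y 1 2 gcomp_hom[OF s' g] g'] by (simp add: gcomp_def)
    have "(\<lparr>apex = X, den = gid, num = ?d\<rparr>, ?m) \<in> roof_rel X Y"
      by (rule roof_relI[OF X Y D_of_roof[OF X d] m W, of s gid]) (use s s' 3 in \<open>simp_all add: evq_refl W X\<close>)
    then have "(\<lparr>apex = X, den = gid, num = ?d\<rparr>, c) \<in> roof_rel X Y" using rel by (rule roof_rel_trans[OF X Y])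
    then show "c \<in> cls X Y \<lparr>apex = X, den = gid, num = ?d\<rparr>" by simp
  qed
qed

lemma D_id_hom: 
  fixes X :: "('k::field, 'u::infinite) dgm"
  shows "dg_module X \<Longrightarrow> D_id X \<in> D_hom X X"
  unfolding D_id_def by (intro D_of_hom) simp_all

lemma D_comp_id:
  fixes X Y :: "('k::field, 'u::infinite) dgm"
  assumes X: "dg_module X" and Y: "dg_module Y" and f: "\<phi> \<in> D_hom X Y"
  shows "D_comp X X Y \<phi> (D_id X) = \<phi>" and "D_comp X Y Y (D_id Y) \<phi> = \<phi>"
proof -
  obtain r where r: "r \<in> roofs X Y" "\<phi> = cls X Y r" by (rule D_homE[OF X Y f])
  note R = roofsD[OF r(1)]
  show "D_comp X X Y \<phi> (D_id X) = \<phi>"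
    using D_comp_cls(2)[OF X X Y D_of_roof[OF X gid_hom] r(1) R(1), of "den r" gid] R
    by (simp add: evq_refl X r(2) D_id_def D_of_def)
  show "D_comp X Y Y (D_id Y) \<phi> = \<phi>"
    using D_comp_cls(2)[OF X Y Y r(1) D_of_roof[OF Y gid_hom] R(1), of gid "num r"] R
    by (simp add: evq_refl Y r(2) D_id_def D_of_def gid_quasi_iso)
qed

text \<open>The inverse is the same roof read backwards: the composite has both legs equal to s and
  so represents the identity.\<close>

lemma roof_iso:
  fixes X Y :: "('k::field, 'u::infinite) dgm"
  assumes X: "dg_module X" and Y: "dg_module Y" and W: "dg_module W" and s: "s \<in> quasi_iso W X" and t: "t \<in> quasi_iso W Y"
  shows "cls X Y \<lparr>apex = W, den = s, num = t\<rparr> \<in> D_iso X Y"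
proof -
  have main: "D_comp X Y X (cls Y X \<lparr>apex = W, den = t, num = s\<rparr>) (cls X Y \<lparr>apex = W, den = s, num = t\<rparr>) = D_id X"
    if X: "dg_module X" and Y: "dg_module Y" and s: "s \<in> quasi_iso W X" and t: "t \<in> quasi_iso W Y"
    for X Y :: "('k, 'u) dgm" and s t
  proof -
    note s' = quasi_iso_hom[OF s] and t' = quasi_iso_hom[OF t]
    have r: "\<lparr>apex = W, den = s, num = t\<rparr> \<in> roofs X Y" by (rule roofsI[OF W s t'])
    have r': "\<lparr>apex = W, den = t, num = s\<rparr> \<in> roofs Y X" by (rule roofsI[OF W t s'])
    have "D_comp X Y X (cls Y X \<lparr>apex = W, den = t, num = s\<rparr>) (cls X Y \<lparr>apex = W, den = s, num = t\<rparr>) =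
        cls X X \<lparr>apex = W, den = s, num = s\<rparr>"
      using D_comp_cls(2)[OF X Y X r r' W, of gid gid] by (simp add: gid_quasi_iso W evq_refl Y)
    also have "\<dots> = D_id X"
      unfolding D_id_def D_of_def
      by (rule cls_eq[OF X X], rule roof_relI[OF X X roofsI[OF W s s'] D_of_roof[OF X gid_hom] W, of gid s])
        (simp_all add: s s' evq_refl W X)
    finally show ?thesis .
  qed
  note s' = quasi_iso_hom[OF s] and t' = quasi_iso_hom[OF t]
  show ?thesis unfolding D_iso_def mem_Collect_eq
    by (intro conjI bexI[of _ "cls Y X \<lparr>apex = W, den = t, num = s\<rparr>"] main X Y s t cls_hom roofsI W s' t')
qed

declare quasi_iso_hom [simp del]

section \<open>The cohomology functor on the derived category, as relations between cocycles\<close>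

section \<open>Cohomology of morphisms in the derived category\<close>

text \<open>The graph of the map that a roof induces on cohomology, on the level of cocycles.\<close>

definition cohrel :: "('k::field, 'u) dgm \<Rightarrow> ('k, 'u) dgm \<Rightarrow> ('k, 'u) roof \<Rightarrow> int \<Rightarrow> ('u \<Rightarrow> 'k) \<Rightarrow> ('u \<Rightarrow> 'k) \<Rightarrow> bool" where
  "cohrel X Y r i x y \<longleftrightarrow> x \<in> cocycles X i \<and> y \<in> cocycles Y i \<and>
     (\<exists>w\<in>cocycles (apex r) i. x - den r i w \<in> coboundaries X i \<and> y - num r i w \<in> coboundaries Y i)"

definition D_coh :: "('k::field, 'u) dgm \<Rightarrow> ('k, 'u) dgm \<Rightarrow> ('k, 'u) dmor \<Rightarrow> int \<Rightarrow> ('u \<Rightarrow> 'k) \<Rightarrow> ('u \<Rightarrow> 'k) \<Rightarrow> bool" where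
  "D_coh X Y \<phi> i x y \<longleftrightarrow> (\<exists>r\<in>\<phi>. cohrel X Y r i x y)"

lemma cohrelI:
  "x \<in> cocycles X i \<Longrightarrow> y \<in> cocycles Y i \<Longrightarrow> w \<in> cocycles (apex r) i \<Longrightarrow> x - den r i w \<in> coboundaries X i \<Longrightarrow>
    y - num r i w \<in> coboundaries Y i \<Longrightarrow> cohrel X Y r i x y"
  unfolding cohrel_def by (intro conjI bexI[of _ w])

lemma cohrelE:
  assumes "cohrel X Y r i x y"
  obtains w where "x \<in> cocycles X i" "y \<in> cocycles Y i" "w \<in> cocycles (apex r) i"
    "x - den r i w \<in> coboundaries X i" "y - num r i w \<in> coboundaries Y i"
  using assms unfolding cohrel_def by (elim conjE bexE) (rule that)

lemma hom_cob_diff: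
  assumes "f \<in> dg_hom M N" "dg_module M" "x \<in> cpt M i" "y \<in> cpt M i" "x - y \<in> coboundaries M i"
  shows "f i x - f i y \<in> coboundaries N i"
  using hom_cob[OF assms(1,5)] hom_diff[OF assms(1-4)] by simp

lemma quasi_iso_diff:
  assumes f: "f \<in> quasi_iso M N" and M: "dg_module M" and N: "dg_module N"
    and x: "x \<in> cocycles M i" and y: "y \<in> cocycles M i" and d: "f i x - f i y \<in> coboundaries N i"
  shows "x - y \<in> coboundaries M i"
proof (rule quasi_iso_inj[OF f M N])
  show "x - y \<in> cocycles M i" using x y M by simp
  show "f i (x - y) \<in> coboundaries N i"
    using d hom_diff[OF quasi_iso_hom[OF f] M cocycle_cpt[OF x] cocycle_cpt[OF y]] by simp
qed

text \<open>The witness w is moved within its cohomology class until it comes from the common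
  refinement W, where the two roofs agree up to homotopy.\<close>

lemma cohrel_cong:
  fixes X Y :: "('k::field, 'u::infinite) dgm"
  assumes X: "dg_module X" and Y: "dg_module Y" and rel: "(r, r') \<in> roof_rel X Y" and c: "cohrel X Y r i x y"
  shows "cohrel X Y r' i x y"
  using rel X
proof (rule roof_relE)
  fix W :: "('k, 'u) dgm" and p q assume r: "r \<in> roofs X Y" and r': "r' \<in> roofs X Y" and W: "dg_module W"
    and p: "p \<in> quasi_iso W (apex r)" and q: "q \<in> quasi_iso W (apex r')"
    and h1: "homotopic W X (gcomp (den r) p) (gcomp (den r') q)"
    and h2: "homotopic W Y (gcomp (num r) p) (gcomp (num r') q)"
  note R = roofsD[OF r] and R' = roofsD[OF r'] and p' = quasi_iso_hom[OF p] and q' = quasi_iso_hom[OF q]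
  obtain w where w: "x \<in> cocycles X i" "y \<in> cocycles Y i" "w \<in> cocycles (apex r) i"
    "x - den r i w \<in> coboundaries X i" "y - num r i w \<in> coboundaries Y i"
    using c by (rule cohrelE)
  obtain v where v: "v \<in> cocycles W i" "w - p i v \<in> coboundaries (apex r) i"
    by (rule quasi_iso_surj[OF p W R(1) w(3)])
  have pv: "p i v \<in> cocycles (apex r) i" by (rule hom_cocycle[OF p' W v(1)])
  note k = hom_cob_diff[OF _ R(1) cocycle_cpt[OF w(3)] cocycle_cpt[OF pv] v(2)]
  have 1: "den r i (p i v) - den r' i (q i v) \<in> coboundaries X i"
    using homotopic_cob[OF W X h1 v(1)] by simp
  have 2: "num r i (p i v) - num r' i (q i v) \<in> coboundaries Y i"
    using homotopic_cob[OF W Y h2 v(1)] by simp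
  show ?thesis
    by (rule cohrelI[OF w(1,2) hom_cocycle[OF q' W v(1)]
      cob_diff_trans[OF X w(4) cob_diff_trans[OF X k[OF R(4)] 1]]
      cob_diff_trans[OF Y w(5) cob_diff_trans[OF Y k[OF R(3)] 2]]])
qed

lemma D_coh_cls:
  fixes X Y :: "('k::field, 'u::infinite) dgm"
  assumes X: "dg_module X" and Y: "dg_module Y" and r: "r \<in> roofs X Y"
  shows "D_coh X Y (cls X Y r) i x y \<longleftrightarrow> cohrel X Y r i x y"
proof
  assume "D_coh X Y (cls X Y r) i x y"
  then obtain r' where "(r, r') \<in> roof_rel X Y" "cohrel X Y r' i x y" by (auto simp: D_coh_def)
  then show "cohrel X Y r i x y" using cohrel_cong[OF X Y roof_rel_sym[OF X Y]] by blast
next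
  assume "cohrel X Y r i x y"
  then show "D_coh X Y (cls X Y r) i x y"
    unfolding D_coh_def by (rule bexI[OF _ cls_self[OF X Y r]])
qed

lemma D_coh_cocycles:
  assumes "D_coh X Y \<phi> i x y" shows "x \<in> cocycles X i" "y \<in> cocycles Y i"
  using assms by (auto simp: D_coh_def cohrel_def)

context
  fixes X Y :: "('k::field, 'u::infinite) dgm" and \<phi>
  assumes X: "dg_module X" and Y: "dg_module Y" and \<phi>: "\<phi> \<in> D_hom X Y"
begin

lemma D_coh_total:
  assumes x: "x \<in> cocycles X i"
  obtains y where "D_coh X Y \<phi> i x y"
proof -
  obtain r where r: "r \<in> roofs X Y" "\<phi> = cls X Y r" by (rule D_homE[OF X Y \<phi>])
  note R = roofsD[OF r(1)]
  obtain w where w: "w \<in> cocycles (apex r) i" "x - den r i w \<in> coboundaries X i"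
    by (rule quasi_iso_surj[OF R(2,1) X x])
  have "cohrel X Y r i x (num r i w)"
    by (rule cohrelI[OF x hom_cocycle[OF R(3,1) w(1)] w]) (simp add: Y)
  then show thesis using that r(2) D_coh_cls[OF X Y r(1)] by blast
qed

lemma D_coh_add:
  assumes "D_coh X Y \<phi> i x y" "D_coh X Y \<phi> i x' y'"
  shows "D_coh X Y \<phi> i (x + x') (y + y')"
proof -
  obtain r where r: "r \<in> roofs X Y" "\<phi> = cls X Y r" by (rule D_homE[OF X Y \<phi>])
  note R = roofsD[OF r(1)] and dc = D_coh_cls[OF X Y r(1)]
  obtain w where w: "x \<in> cocycles X i" "y \<in> cocycles Y i" "w \<in> cocycles (apex r) i"
    "x - den r i w \<in> coboundaries X i" "y - num r i w \<in> coboundaries Y i"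
    using assms(1) unfolding r(2) dc by (rule cohrelE)
  obtain w' where w': "x' \<in> cocycles X i" "y' \<in> cocycles Y i" "w' \<in> cocycles (apex r) i"
    "x' - den r i w' \<in> coboundaries X i" "y' - num r i w' \<in> coboundaries Y i"
    using assms(2) unfolding r(2) dc by (rule cohrelE)
  note a = hom_add[OF R(4) cocycle_cpt[OF w(3)] cocycle_cpt[OF w'(3)]]
    hom_add[OF R(3) cocycle_cpt[OF w(3)] cocycle_cpt[OF w'(3)]]
  have "cohrel X Y r i (x + x') (y + y')"
    by (rule cohrelI[of _ _ _ _ _ "w + w'"])
      (use w w' R X Y cob_add_cong(1)[OF X w(4) w'(4)] cob_add_cong(1)[OF Y w(5) w'(5)] in \<open>simp_all add: a\<close>)
  then show ?thesis unfolding r(2) dc .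
qed

lemma D_coh_scale:
  assumes "D_coh X Y \<phi> i x y"
  shows "D_coh X Y \<phi> i (fscale c x) (fscale c y)"
proof -
  obtain r where r: "r \<in> roofs X Y" "\<phi> = cls X Y r" by (rule D_homE[OF X Y \<phi>])
  note R = roofsD[OF r(1)] and dc = D_coh_cls[OF X Y r(1)]
  obtain w where w: "x \<in> cocycles X i" "y \<in> cocycles Y i" "w \<in> cocycles (apex r) i"
    "x - den r i w \<in> coboundaries X i" "y - num r i w \<in> coboundaries Y i"
    using assms(1) unfolding r(2) dc by (rule cohrelE)
  note a = hom_scale[OF R(4) cocycle_cpt[OF w(3)]] hom_scale[OF R(3) cocycle_cpt[OF w(3)]]
  have "cohrel X Y r i (fscale c x) (fscale c y)"
    by (rule cohrelI[of _ _ _ _ _ "fscale c w"])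
      (use w R X Y cob_closed(5)[OF X w(4), of c] cob_closed(5)[OF Y w(5), of c] in \<open>simp_all add: a fscale_distribs\<close>)
  then show ?thesis unfolding r(2) dc .
qed

lemma D_coh_diff:
  assumes "D_coh X Y \<phi> i x y" "D_coh X Y \<phi> i x' y'"
  shows "D_coh X Y \<phi> i (x - x') (y - y')"
  using D_coh_add[OF assms(1) D_coh_scale[OF assms(2), of "- 1"]] by simp

lemma D_coh_tact:
  assumes "D_coh X Y \<phi> i x y"
  shows "D_coh X Y \<phi> (i - 1) (tact X i x) (tact Y i y)"
proof -
  obtain r where r: "r \<in> roofs X Y" "\<phi> = cls X Y r" by (rule D_homE[OF X Y \<phi>])
  note R = roofsD[OF r(1)] and dc = D_coh_cls[OF X Y r(1)]
  obtain w where w: "x \<in> cocycles X i" "y \<in> cocycles Y i" "w \<in> cocycles (apex r) i"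
    "x - den r i w \<in> coboundaries X i" "y - num r i w \<in> coboundaries Y i"
    using assms(1) unfolding r(2) dc by (rule cohrelE)
  have m: "den r i w \<in> cpt X i" "num r i w \<in> cpt Y i" using w(3) R(3,4) by simp_all
  have t: "den r (i - 1) (tact (apex r) i w) = tact X i (den r i w)"
    "num r (i - 1) (tact (apex r) i w) = tact Y i (num r i w)"
    using hom_tact[OF R(4) cocycle_cpt[OF w(3)]] hom_tact[OF R(3) cocycle_cpt[OF w(3)]] by simp_all
  have "cohrel X Y r (i - 1) (tact X i x) (tact Y i y)"
  proof (rule cohrelI[of _ _ _ _ _ "tact (apex r) i w"])
    show "tact X i x - den r (i - 1) (tact (apex r) i w) \<in> coboundaries X (i - 1)"
      using cob_closed(6)[OF X w(4), of "i - 1"] tact_diff[OF X cocycle_cpt[OF w(1)] m(1)] by (simp add: t)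
    show "tact Y i y - num r (i - 1) (tact (apex r) i w) \<in> coboundaries Y (i - 1)"
      using cob_closed(6)[OF Y w(5), of "i - 1"] tact_diff[OF Y cocycle_cpt[OF w(2)] m(2)] by (simp add: t)
  qed (use w R X Y in simp_all)
  then show ?thesis unfolding r(2) dc .
qed

lemma D_coh_cob:
  assumes "D_coh X Y \<phi> i x y" and x: "x \<in> coboundaries X i"
  shows "y \<in> coboundaries Y i"
proof -
  obtain r where r: "r \<in> roofs X Y" "\<phi> = cls X Y r" by (rule D_homE[OF X Y \<phi>])
  note R = roofsD[OF r(1)] and dc = D_coh_cls[OF X Y r(1)]
  obtain w where w: "x \<in> cocycles X i" "y \<in> cocycles Y i" "w \<in> cocycles (apex r) i"
    "x - den r i w \<in> coboundaries X i" "y - num r i w \<in> coboundaries Y i"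
    using assms(1) unfolding r(2) dc by (rule cohrelE)
  have "den r i w \<in> coboundaries X i" by (rule cob_diff_mem[OF X cob_diff_sym[OF X w(4)] x])
  then have "w \<in> coboundaries (apex r) i" by (rule quasi_iso_inj[OF R(2,1) X w(3)])
  then show ?thesis by (rule cob_diff_mem[OF Y w(5) hom_cob[OF R(3)]])
qed

lemma D_coh_cong:
  assumes "D_coh X Y \<phi> i x y" and x: "x' \<in> cocycles X i" "x' - x \<in> coboundaries X i"
    and y: "y' \<in> cocycles Y i" "y' - y \<in> coboundaries Y i"
  shows "D_coh X Y \<phi> i x' y'"
proof -
  obtain r where r: "r \<in> roofs X Y" "\<phi> = cls X Y r" by (rule D_homE[OF X Y \<phi>])
  note dc = D_coh_cls[OF X Y r(1)]
  obtain w where w: "x \<in> cocycles X i" "y \<in> cocycles Y i" "w \<in> cocycles (apex r) i"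
    "x - den r i w \<in> coboundaries X i" "y - num r i w \<in> coboundaries Y i"
    using assms(1) unfolding r(2) dc by (rule cohrelE)
  show ?thesis unfolding r(2) dc
    by (rule cohrelI[OF x(1) y(1) w(3) cob_diff_trans[OF X x(2) w(4)] cob_diff_trans[OF Y y(2) w(5)]])
qed

end

lemma D_coh_of:
  fixes X Y :: "('k::field, 'u::infinite) dgm"
  assumes X: "dg_module X" and Y: "dg_module Y" and f: "f \<in> dg_hom X Y"
  shows "D_coh X Y (D_of X Y f) i x y \<longleftrightarrow> x \<in> cocycles X i \<and> y \<in> cocycles Y i \<and> y - f i x \<in> coboundaries Y i"
  unfolding D_of_def D_coh_cls[OF X Y D_of_roof[OF X f]]
proof
  assume "cohrel X Y \<lparr>apex = X, den = gid, num = f\<rparr> i x y"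
  then obtain w where w: "x \<in> cocycles X i" "y \<in> cocycles Y i" "w \<in> cocycles X i"
    "x - w \<in> coboundaries X i" "y - f i w \<in> coboundaries Y i"
    by (rule cohrelE) simp
  have "f i w - f i x \<in> coboundaries Y i"
    by (rule hom_cob_diff[OF f X cocycle_cpt[OF w(3)] cocycle_cpt[OF w(1)] cob_diff_sym[OF X w(4)]])
  then show "x \<in> cocycles X i \<and> y \<in> cocycles Y i \<and> y - f i x \<in> coboundaries Y i"
    using w(1,2) cob_diff_trans[OF Y w(5)] by blast
next
  assume a: "x \<in> cocycles X i \<and> y \<in> cocycles Y i \<and> y - f i x \<in> coboundaries Y i"
  show "cohrel X Y \<lparr>apex = X, den = gid, num = f\<rparr> i x y"
    by (rule cohrelI[of _ _ _ _ _ x]) (use a X in simp_all)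
qed

text \<open>Functoriality of cohomology, read on one completed square. The delicate direction lifts
  the witness w1 to the apex W and compares it with w2 inside Y, where the left leg of s is
  injective on cohomology.\<close>

lemma D_coh_comp:
  fixes X Y Z :: "('k::field, 'u::infinite) dgm"
  assumes X: "dg_module X" and Y: "dg_module Y" and Z: "dg_module Z"
    and \<phi>: "\<phi> \<in> D_hom X Y" and \<psi>: "\<psi> \<in> D_hom Y Z"
  shows "D_coh X Z (D_comp X Y Z \<psi> \<phi>) i x z \<longleftrightarrow> (\<exists>y. D_coh X Y \<phi> i x y \<and> D_coh Y Z \<psi> i y z)"
proof -
  obtain r where r: "r \<in> roofs X Y" "\<phi> = cls X Y r" by (rule D_homE[OF X Y \<phi>])
  obtain s where s: "s \<in> roofs Y Z" "\<psi> = cls Y Z s" by (rule D_homE[OF Y Z \<psi>])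
  note R = roofsD[OF r(1)] and S = roofsD[OF s(1)]
  obtain W :: "('k, 'u) dgm" and u g where W: "dg_module W" and u: "u \<in> quasi_iso W (apex r)" and g: "g \<in> dg_hom W (apex s)"
    and h: "homotopic W Y (gcomp (num r) u) (gcomp (den s) g)"
    and c: "\<lparr>apex = W, den = gcomp (den r) u, num = gcomp (num s) g\<rparr> \<in> roofs X Z" (is "?c \<in> _")
    and eq: "D_comp X Y Z (cls Y Z s) (cls X Y r) = cls X Z \<lparr>apex = W, den = gcomp (den r) u, num = gcomp (num s) g\<rparr>"
    by (rule D_comp_square[OF X Y Z r(1) s(1)])
  note u' = quasi_iso_hom[OF u]
  show ?thesis unfolding r(2) s(2) eq D_coh_cls[OF X Z c] D_coh_cls[OF X Y r(1)] D_coh_cls[OF Y Z s(1)]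
  proof
    assume "cohrel X Z ?c i x z"
    then obtain w where w: "x \<in> cocycles X i" "z \<in> cocycles Z i" "w \<in> cocycles W i"
      "x - den r i (u i w) \<in> coboundaries X i" "z - num s i (g i w) \<in> coboundaries Z i"
      by (rule cohrelE) simp
    have uw: "u i w \<in> cocycles (apex r) i" and gw: "g i w \<in> cocycles (apex s) i"
      using hom_cocycle[OF u' W w(3)] hom_cocycle[OF g W w(3)] .
    have y: "num r i (u i w) \<in> cocycles Y i" by (rule hom_cocycle[OF R(3,1) uw])
    have "cohrel X Y r i x (num r i (u i w))"
      by (rule cohrelI[OF w(1) y uw w(4)]) (simp add: Y)
    moreover have "cohrel Y Z s i (num r i (u i w)) z"
      by (rule cohrelI[OF y w(2) gw _ w(5)]) (use homotopic_cob[OF W Y h w(3)] in simp)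
    ultimately show "\<exists>y. cohrel X Y r i x y \<and> cohrel Y Z s i y z" by blast
  next
    assume "\<exists>y. cohrel X Y r i x y \<and> cohrel Y Z s i y z"
    then obtain y where a: "cohrel X Y r i x y" and b: "cohrel Y Z s i y z" by blast
    obtain w1 where w1: "x \<in> cocycles X i" "y \<in> cocycles Y i" "w1 \<in> cocycles (apex r) i"
      "x - den r i w1 \<in> coboundaries X i" "y - num r i w1 \<in> coboundaries Y i"
      using a by (rule cohrelE)
    obtain w2 where w2: "y \<in> cocycles Y i" "z \<in> cocycles Z i" "w2 \<in> cocycles (apex s) i"
      "y - den s i w2 \<in> coboundaries Y i" "z - num s i w2 \<in> coboundaries Z i"
      using b by (rule cohrelE)
    obtain w where w: "w \<in> cocycles W i" "w1 - u i w \<in> coboundaries (apex r) i"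
      by (rule quasi_iso_surj[OF u W R(1) w1(3)])
    have uw: "u i w \<in> cocycles (apex r) i" and gw: "g i w \<in> cocycles (apex s) i"
      using hom_cocycle[OF u' W w(1)] hom_cocycle[OF g W w(1)] .
    note k = hom_cob_diff[OF _ R(1) cocycle_cpt[OF w1(3)] cocycle_cpt[OF uw] w(2)]
    have "den s i w2 - y \<in> coboundaries Y i" by (rule cob_diff_sym[OF Y w2(4)])
    also note w1(5)
    finally (cob_diff_trans[OF Y]) have "den s i w2 - num r i w1 \<in> coboundaries Y i" .
    also note k[OF R(3)]
    finally (cob_diff_trans[OF Y]) have "den s i w2 - num r i (u i w) \<in> coboundaries Y i" .
    also have "num r i (u i w) - den s i (g i w) \<in> coboundaries Y i"
      using homotopic_cob[OF W Y h w(1)] by simp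
    finally (cob_diff_trans[OF Y]) have "den s i w2 - den s i (g i w) \<in> coboundaries Y i" .
    then have "w2 - g i w \<in> coboundaries (apex s) i" by (rule quasi_iso_diff[OF S(2,1) Y w2(3) gw])
    then have "num s i w2 - num s i (g i w) \<in> coboundaries Z i"
      by (rule hom_cob_diff[OF S(3,1) cocycle_cpt[OF w2(3)] cocycle_cpt[OF gw]])
    then have z: "z - num s i (g i w) \<in> coboundaries Z i" by (rule cob_diff_trans[OF Z w2(5)])
    have x: "x - den r i (u i w) \<in> coboundaries X i" by (rule cob_diff_trans[OF X w1(4) k[OF R(4)]])
    show "cohrel X Z ?c i x z"
      by (rule cohrelI[of _ _ _ _ _ w]) (use w1(1) w2(2) w(1) x z in simp_all)
  qed
qed

lemma D_coh_id:
  fixes X :: "('k::field, 'u::infinite) dgm"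
  assumes X: "dg_module X"
  shows "D_coh X X (D_id X) i x y \<longleftrightarrow> x \<in> cocycles X i \<and> y \<in> cocycles X i \<and> y - x \<in> coboundaries X i"
  unfolding D_id_def using D_coh_of[OF X X gid_hom] by simp

text \<open>An inverse in the derived category induces an inverse on cohomology, so the right leg of
  any representing roof acts bijectively on cohomology. Isomorphic objects are thus joined by two
  quasi-isomorphisms.\<close>

lemma D_iso_roof:
  fixes X Y :: "('k::field, 'u::infinite) dgm"
  assumes X: "dg_module X" and Y: "dg_module Y" and \<phi>: "\<phi> \<in> D_iso X Y"
  obtains W :: "('k, 'u) dgm" and s t where "dg_module W" "s \<in> quasi_iso W X" "t \<in> quasi_iso W Y"
    "\<phi> = cls X Y \<lparr>apex = W, den = s, num = t\<rparr>"
proof -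
  obtain \<psi> where f: "\<phi> \<in> D_hom X Y" and g: "\<psi> \<in> D_hom Y X" and gf: "D_comp X Y X \<psi> \<phi> = D_id X"
    and fg: "D_comp Y X Y \<phi> \<psi> = D_id Y"
    using \<phi> by (auto simp: D_iso_def)
  obtain r where r: "r \<in> roofs X Y" "\<phi> = cls X Y r" by (rule D_homE[OF X Y f])
  note R = roofsD[OF r(1)]
  have "num r \<in> quasi_iso (apex r) Y"
  proof (rule quasi_isoI[OF R(1) Y R(3)])
    fix i w assume w: "w \<in> cocycles (apex r) i" and c: "num r i w \<in> coboundaries Y i"
    let ?x = "den r i w"
    have x: "?x \<in> cocycles X i" by (rule hom_cocycle[OF R(4,1) w])
    \<comment> \<open>The class of ?x is sent to zero by \<phi>; since \<psi> undoes \<phi> on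
      cohomology, ?x is a coboundary, and the left leg then forces w to be one.\<close>
    have "D_coh X Y \<phi> i ?x 0" unfolding r(2) D_coh_cls[OF X Y r(1)]
      by (rule cohrelI[of _ _ _ _ _ w]) (use x w c X Y in simp_all)
    moreover have "D_coh Y X \<psi> i 0 0"
    proof -
      obtain y where y: "D_coh Y X \<psi> i 0 y" by (rule D_coh_total[OF Y X g, of 0]) (simp add: Y)
      show ?thesis using D_coh_scale[OF Y X g y, of 0] by simp
    qed
    ultimately have "D_coh X X (D_comp X Y X \<psi> \<phi>) i ?x 0" using D_coh_comp[OF X Y X f g] by blast
    then have "- ?x \<in> coboundaries X i" unfolding gf D_coh_id[OF X] by simp
    then have "?x \<in> coboundaries X i" using cob_closed(4)[OF X, of "- ?x" i] by simp
    then show "w \<in> coboundaries (apex r) i" by (rule quasi_iso_inj[OF R(2,1) X w])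
  next
    fix i y assume y: "y \<in> cocycles Y i"
    obtain x where x: "D_coh Y X \<psi> i y x" by (rule D_coh_total[OF Y X g y])
    obtain y' where y': "D_coh X Y \<phi> i x y'" by (rule D_coh_total[OF X Y f D_coh_cocycles(2)[OF x]])
    have "D_coh Y Y (D_comp Y X Y \<phi> \<psi>) i y y'" using x y' D_coh_comp[OF Y X Y g f] by blast
    then have 1: "y - y' \<in> coboundaries Y i" unfolding fg D_coh_id[OF Y] using cob_diff_sym[OF Y] by blast
    obtain w where w: "w \<in> cocycles (apex r) i" "y' - num r i w \<in> coboundaries Y i"
      using y' unfolding r(2) D_coh_cls[OF X Y r(1)] by (rule cohrelE)
    show "\<exists>z\<in>cocycles (apex r) i. y - num r i z \<in> coboundaries Y i"
      by (rule bexI[OF _ w(1)]) (rule cob_diff_trans[OF Y 1 w(2)])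
  qed
  then show thesis using that[OF R(1,2)] r(2) by simp
qed

lemma D_iso_hom: "\<phi> \<in> D_iso X Y \<Longrightarrow> \<phi> \<in> D_hom X Y"
  by (simp add: D_iso_def)

lemma D_iso_coh_inj:
  fixes X Y :: "('k::field, 'u::infinite) dgm"
  assumes X: "dg_module X" and Y: "dg_module Y" and \<phi>: "\<phi> \<in> D_iso X Y"
    and c: "D_coh X Y \<phi> i x y" and y: "y \<in> coboundaries Y i"
  shows "x \<in> coboundaries X i"
  using X Y \<phi>
proof (rule D_iso_roof)
  fix W :: "('k, 'u) dgm" and s t
  assume W: "dg_module W" and s: "s \<in> quasi_iso W X" and t: "t \<in> quasi_iso W Y"
    and eq: "\<phi> = cls X Y \<lparr>apex = W, den = s, num = t\<rparr>"
  have r: "\<lparr>apex = W, den = s, num = t\<rparr> \<in> roofs X Y" by (rule roofsI[OF W s quasi_iso_hom[OF t]])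
  obtain w where w: "w \<in> cocycles W i" "x - s i w \<in> coboundaries X i" "y - t i w \<in> coboundaries Y i"
    using c unfolding eq D_coh_cls[OF X Y r] by (rule cohrelE) simp
  have "t i w \<in> coboundaries Y i" by (rule cob_diff_mem[OF Y cob_diff_sym[OF Y w(3)] y])
  then have "w \<in> coboundaries W i" by (rule quasi_iso_inj[OF t W Y w(1)])
  then show ?thesis by (rule cob_diff_mem[OF X w(2) hom_cob[OF quasi_iso_hom[OF s]]])
qed

lemma D_iso_coh_surj:
  fixes X Y :: "('k::field, 'u::infinite) dgm"
  assumes X: "dg_module X" and Y: "dg_module Y" and \<phi>: "\<phi> \<in> D_iso X Y" and y: "y \<in> cocycles Y i"
  obtains x where "D_coh X Y \<phi> i x y"
  using X Y \<phi>
proof (rule D_iso_roof)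
  fix W :: "('k, 'u) dgm" and s t
  assume W: "dg_module W" and s: "s \<in> quasi_iso W X" and t: "t \<in> quasi_iso W Y"
    and eq: "\<phi> = cls X Y \<lparr>apex = W, den = s, num = t\<rparr>"
  have r: "\<lparr>apex = W, den = s, num = t\<rparr> \<in> roofs X Y" by (rule roofsI[OF W s quasi_iso_hom[OF t]])
  obtain w where w: "w \<in> cocycles W i" "y - t i w \<in> coboundaries Y i" by (rule quasi_iso_surj[OF t W Y y])
  have "cohrel X Y \<lparr>apex = W, den = s, num = t\<rparr> i (s i w) y"
    by (rule cohrelI[of _ _ _ _ _ w]) (use w y hom_cocycle[OF quasi_iso_hom[OF s] W w(1)] X in simp_all)
  then show thesis using that unfolding eq D_coh_cls[OF X Y r] by blast
qed

section \<open>Suspension of roofs, and distinguished triangles from cones\<close>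

section \<open>Suspension of morphisms and cone triangles\<close>

lemma shift_hom:
  assumes M: "dg_module M" and f: "f \<in> dg_hom M N" shows "shift_map n f \<in> dg_hom (shift n M) (shift n N)"
proof (rule dg_homI)
  fix i x assume x: "x \<in> cpt (shift n M) i"
  then have x': "x \<in> cpt M (i + n)" by simp
  show "shift_map n f (i - 1) (tact (shift n M) i x) = tact (shift n N) i (shift_map n f i x)"
    using hom_tact[OF f x', of "i - 1 + n"] by (simp add: shift_map_def)
  show "shift_map n f (i + 1) (dif (shift n M) i x) = dif (shift n N) i (shift_map n f i x)"
    using hom_dif[OF f x', of "i + 1 + n"] hom_neg[OF f M dif_mem[OF M x', of "i + 1 + n"]]
    by (simp add: shift_map_def)
qed (use f in \<open>simp_all add: shift_map_def\<close>)

lemma shift_quasi_iso: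
  assumes M: "dg_module M" and N: "dg_module N" and f: "f \<in> quasi_iso M N"
  shows "shift_map n f \<in> quasi_iso (shift n M) (shift n N)"
proof (rule quasi_isoI)
  show "z \<in> coboundaries (shift n M) i" if "z \<in> cocycles (shift n M) i" "shift_map n f i z \<in> coboundaries (shift n N) i" for i z
    using quasi_iso_inj[OF f M N, of z "i + n"] that M N by (simp add: shift_map_def)
  show "\<exists>z\<in>cocycles (shift n M) i. y - shift_map n f i z \<in> coboundaries (shift n N) i" if y: "y \<in> cocycles (shift n N) i" for i y
  proof -
    obtain z where "z \<in> cocycles M (i + n)" "y - f (i + n) z \<in> coboundaries N (i + n)"
      by (rule quasi_iso_surj[OF f M N, of y "i + n"]) (use y in simp)
    then show ?thesis by (intro bexI[of _ z]) (simp_all add: shift_map_def N)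
  qed
qed (use assms in \<open>simp_all add: shift_hom quasi_iso_hom\<close>)

lemma shift_homotopic:
  assumes M: "dg_module M" and N: "dg_module N" and h: "homotopic M N f g"
  shows "homotopic (shift n M) (shift n N) (shift_map n f) (shift_map n g)"
proof -
  obtain h where h: "h \<in> rlin M N (- 1)"
    and eq: "\<And>i x. x \<in> cpt M i \<Longrightarrow> f i x - g i x = dif N (i - 1) (h i x) + h (i + 1) (dif M i x)"
    using h by (auto simp: homotopic_def)
  \<comment> \<open>The differential of the n-th suspension carries the sign (-1)^n, and the
    homotopy has to carry the same sign.\<close>
  define k where "k = (\<lambda>i x. if even n then h (i + n) x else - h (i + n) x)"
  show ?thesis
  proof (rule homotopicI)
    show "k \<in> rlin (shift n M) (shift n N) (- 1)"
    proof (rule rlinI)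
      fix i x assume x: "x \<in> cpt (shift n M) i"
      then show "k i x \<in> cpt (shift n N) (i + - 1)" using h N by (auto simp: k_def rlin_simps)
      show "k (i - 1) (tact (shift n M) i x) = tact (shift n N) (i + - 1) (k i x)"
        using rlin_tact[OF h, of x "i + n" "i + n - 1"] rlin_mem[OF h, of x "i + n" "i + n - 1"] x N
        by (simp add: k_def algebra_simps)
    qed (use h N in \<open>auto simp: k_def rlin_simps fscale_distribs\<close>)
    fix i x assume "x \<in> cpt (shift n M) i"
    then have x: "x \<in> cpt M (i + n)" by simp
    have a: "i - 1 + n = i + n - 1" "i + 1 + n = i + n + 1" by simp_all
    have "h (i + n) x \<in> cpt N (i + n - 1)" "dif M (i + n) x \<in> cpt M (i + n + 1)"
      using rlin_mem[OF h x] M x by simp_all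
    then show "shift_map n f i x - shift_map n g i x =
        dif (shift n N) (i - 1) (k i x) + k (i + 1) (dif (shift n M) i x)"
      using eq[OF x] N M rlin_neg[OF h M] by (simp add: shift_map_def k_def a)
  qed
qed

definition shift_roof :: "int \<Rightarrow> ('k::field, 'u) roof \<Rightarrow> ('k, 'u) roof" where
  "shift_roof n r = \<lparr>apex = shift n (apex r), den = shift_map n (den r), num = shift_map n (num r)\<rparr>"

lemma D_shift_eq: "D_shift n \<phi> = shift_roof n ` \<phi>"
  by (simp add: D_shift_def shift_roof_def)

lemma shift_map_gcomp: "shift_map n (gcomp g f) = gcomp (shift_map n g) (shift_map n f)"
  by (simp add: shift_map_def gcomp_def)

lemma shift_roof_rel:
  fixes X Y :: "('k::field, 'u::infinite) dgm"
  assumes X: "dg_module X" and Y: "dg_module Y" and rel: "(r, r') \<in> roof_rel X Y"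
  shows "(shift_roof n r, shift_roof n r') \<in> roof_rel (shift n X) (shift n Y)"
  using rel X
proof (rule roof_relE)
  fix W :: "('k, 'u) dgm" and p q assume r: "r \<in> roofs X Y" and r': "r' \<in> roofs X Y" and W: "dg_module W"
    and p: "p \<in> quasi_iso W (apex r)" and q: "q \<in> quasi_iso W (apex r')"
    and h1: "homotopic W X (gcomp (den r) p) (gcomp (den r') q)"
    and h2: "homotopic W Y (gcomp (num r) p) (gcomp (num r') q)"
    and d: "gcomp (den r) p \<in> quasi_iso W X"
  have sr: "shift_roof n r \<in> roofs (shift n X) (shift n Y)" if "r \<in> roofs X Y" for r
    using roofsD[OF that] X Y unfolding shift_roof_def
    by (intro roofsI dg_module_shift shift_quasi_iso shift_hom)
  have W': "dg_module (shift n W)" by (simp add: W)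
  show ?thesis
    by (rule roof_relI[OF dg_module_shift[OF X] dg_module_shift[OF Y] sr[OF r] sr[OF r'] W', of "shift_map n p" "shift_map n q"])
      (use shift_hom[OF W quasi_iso_hom[OF p], of n] shift_hom[OF W quasi_iso_hom[OF q], of n] shift_quasi_iso[OF W X d, of n]
        evq_homotopic[OF W' shift_homotopic[OF W X h1]] evq_homotopic[OF W' shift_homotopic[OF W Y h2]]
       in \<open>simp_all add: shift_roof_def shift_map_gcomp\<close>)
qed

text \<open>Suspension acts on roofs with the opposite suspension as inverse, so the image of a
  whole equivalence class is a whole equivalence class and not merely contained in one.\<close>

lemma D_shift_id:
  fixes X :: "('k::field, 'u::infinite) dgm"
  assumes X: "dg_module X"
  shows "D_shift n (D_id X) = D_id (shift n X)"
proof -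
  have inv: "shift_roof n (shift_roof m r) = r" if "n + m = 0" for n m and r :: "('k, 'u) roof"
  proof -
    have i: "i + n + m = i" for i using that by simp
    show ?thesis using that by (simp add: shift_roof_def shift_shift shift_map_def i)
  qed
  have id: "shift_roof m \<lparr>apex = X, den = gid, num = gid\<rparr> = \<lparr>apex = shift m X, den = gid, num = gid\<rparr>" for m and X :: "('k, 'u) dgm"
    by (simp add: shift_roof_def shift_map_def gid_def)
  show ?thesis
  proof (intro equalityI subsetI)
    fix c assume "c \<in> D_shift n (D_id X)"
    then obtain r where r: "(\<lparr>apex = X, den = gid, num = gid\<rparr>, r) \<in> roof_rel X X" "c = shift_roof n r"
      by (auto simp: D_shift_eq D_id_def D_of_def)
    show "c \<in> D_id (shift n X)"
      using shift_roof_rel[OF X X r(1), of n] r(2) by (simp add: id D_id_def D_of_def)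
  next
    fix c assume "c \<in> D_id (shift n X)"
    then have "(\<lparr>apex = shift n X, den = gid, num = gid\<rparr>, c) \<in> roof_rel (shift n X) (shift n X)"
      by (simp add: D_id_def D_of_def)
    from shift_roof_rel[OF dg_module_shift[OF X] dg_module_shift[OF X] this, of "- n"]
    have "shift_roof (- n) c \<in> D_id X" by (simp add: id D_id_def D_of_def shift_shift)
    then have "shift_roof n (shift_roof (- n) c) \<in> D_shift n (D_id X)"
      unfolding D_shift_eq by (rule imageI)
    then show "c \<in> D_shift n (D_id X)" by (simp add: inv)
  qed
qed

lemma D_id_iso:
  fixes X :: "('k::field, 'u::infinite) dgm"
  shows "dg_module X \<Longrightarrow> D_id X \<in> D_iso X X"
  unfolding D_id_def D_of_def by (intro roof_iso gid_quasi_iso)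

text \<open>Lets an explicit DG module Z stand in for the cone of f. The definition of triangles
  requires a cone inside the universe, so the cone is copied to C, and the inverse of the
  quasi-isomorphism p from C to Z gives the comparison of third vertices.\<close>

lemma cone_triangle:
  fixes M N Z :: "('k::field, 'u::infinite) dgm"
  assumes M: "dg_module M" and N: "dg_module N" and Z: "dg_module Z" and f: "f \<in> dg_hom M N"
    and q: "q \<in> quasi_iso (cone M N f) Z"
  shows "\<exists>\<psi> \<chi>. dist_triangle M N Z (D_of M N f) \<psi> \<chi>"
proof -
  let ?C0 = "cone M N f" and ?SM = "shift 1 M"
  have C0: "dg_module ?C0" by (rule dg_module_cone[OF M N f])
  have SM: "dg_module ?SM" by (simp add: M)
  obtain e :: "'u + 'u \<Rightarrow> 'u" where e: "inj e" using ex_inj_sum[of "\<lambda>x. x" "\<lambda>x. x"] by auto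
  define C where "C = push e ?C0"
  have C: "dg_module C" unfolding C_def by (rule dg_module_push[OF e C0])
  have j: "(\<lambda>i. enc e) \<in> dg_iso ?C0 C" and k: "(\<lambda>i y. y \<circ> e) \<in> dg_iso C ?C0"
    unfolding C_def using dg_iso_push[OF e C0] .
  define \<iota> where "\<iota> = (\<lambda>(i::int) y. enc e (case_sum y (0 :: 'u \<Rightarrow> 'k)))"
  define \<pi> where "\<pi> = (\<lambda>(i::int) (z :: 'u \<Rightarrow> 'k). (z \<circ> e) \<circ> Inr)"
  define p where "p = gcomp q (\<lambda>i y. y \<circ> e)"
  have p: "p \<in> quasi_iso C Z"
    unfolding p_def by (rule quasi_iso_comp[OF C C0 Z dg_iso_quasi_iso[OF k C C0] q])
  have i0: "(\<lambda>i y. case_sum y 0) \<in> dg_hom N ?C0"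
    by (rule dg_homI) (use M N f in \<open>simp_all add: case_sum_arith case_sum_inject\<close>)
  have \<iota>: "\<iota> \<in> dg_hom N C"
    using gcomp_hom[OF i0 dg_iso_hom[OF j]] by (simp add: \<iota>_def gcomp_def)
  have p0: "(\<lambda>i z. z \<circ> Inr) \<in> dg_hom ?C0 ?SM"
    by (rule dg_homI; elim cone_cptE) (simp_all add: case_sum_arith)
  have \<pi>: "\<pi> \<in> dg_hom C ?SM"
    using gcomp_hom[OF dg_iso_hom[OF k] p0] by (simp add: \<pi>_def gcomp_def comp_def)
  have cone: "is_cone M N f C \<iota> \<pi>"
    unfolding is_cone_def using C j by (intro conjI bexI[OF _ j]) (simp_all add: \<iota>_def \<pi>_def e)
  \<comment> \<open>The roof ?c has left leg p and identity right leg, so it represents the inverse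
    of p; following it by \<pi> gives the connecting morphism ?x.\<close>
  let ?c = "\<lparr>apex = C, den = p, num = gid\<rparr>" and ?x = "\<lparr>apex = C, den = p, num = \<pi>\<rparr>"
  let ?\<psi> = "D_of N Z (gcomp p \<iota>)" and ?\<chi> = "cls Z ?SM ?x"
  note p' = quasi_iso_hom[OF p]
  have c: "?c \<in> roofs Z C" by (rule roofsI[OF C p gid_hom])
  have x: "?x \<in> roofs Z ?SM" by (rule roofsI[OF C p \<pi>])
  have f': "D_of M N f \<in> D_hom M N" by (rule D_of_hom[OF M N f])
  have psi: "?\<psi> \<in> D_hom N Z" by (rule D_of_hom[OF N Z gcomp_hom[OF \<iota> p']])
  have chi: "?\<chi> \<in> D_hom Z ?SM" by (rule cls_hom[OF Z SM x])
  have 1: "D_comp M N N (D_id N) (D_of M N f) = D_comp M M N (D_of M N f) (D_id M)"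
    by (simp add: D_comp_id[OF M N f'])
  have 2: "D_comp N Z C (cls Z C ?c) ?\<psi> = D_comp N N C (D_of N C \<iota>) (D_id N)"
  proof -
    have "D_comp N Z C (cls Z C ?c) ?\<psi> = D_of N C \<iota>"
      unfolding D_of_def
      using D_comp_cls(2)[OF N Z C D_of_roof[OF N gcomp_hom[OF \<iota> p']] c N, of gid \<iota>] \<iota>
      by (simp add: gid_quasi_iso N evq_refl Z)
    then show ?thesis by (simp add: D_comp_id[OF N C D_of_hom[OF N C \<iota>]])
  qed
  have 3: "D_comp Z ?SM ?SM (D_shift 1 (D_id M)) ?\<chi> = D_comp Z C ?SM (D_of C ?SM \<pi>) (cls Z C ?c)"
  proof -
    have "D_comp Z C ?SM (D_of C ?SM \<pi>) (cls Z C ?c) = ?\<chi>"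
      unfolding D_of_def
      using D_comp_cls(2)[OF Z C SM c D_of_roof[OF C \<pi>] C, of gid gid]
      by (simp add: gid_quasi_iso C evq_refl)
    then show ?thesis by (simp add: D_shift_id[OF M] D_comp_id[OF Z SM chi])
  qed
  have "dist_triangle M N Z (D_of M N f) ?\<psi> ?\<chi>"
    unfolding dist_triangle_def
    by (intro conjI exI[of _ M] exI[of _ N] exI[of _ C] exI[of _ f] exI[of _ \<iota>] exI[of _ \<pi>]
        bexI[of _ "D_id M"] bexI[of _ "D_id N"] bexI[of _ "cls Z C ?c"]
        M N Z f cone f' psi chi 1 2 3 D_id_iso roof_iso C p gid_quasi_iso)
  then show ?thesis by blast
qed

section \<open>Finiteness conditions on cohomology and their invariance\<close>

section \<open>Linear dependence modulo a subspace\<close>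

text \<open>For subspaces V of Z this says that Z/V has dimension less than n. Stated with families
  of vectors, it needs neither quotient spaces nor bases; for n = 0 it is false.\<close>

definition dep_mod :: "('u \<Rightarrow> 'k::field) set \<Rightarrow> ('u \<Rightarrow> 'k) set \<Rightarrow> nat \<Rightarrow> bool" where
  "dep_mod Z V n \<longleftrightarrow> (\<forall>z. (\<forall>j<n. z j \<in> Z) \<longrightarrow>
     (\<exists>c. (\<exists>j<n. c j \<noteq> 0) \<and> (\<Sum>j<n. fscale (c j) (z j)) \<in> V))"

lemma dep_modI:
  assumes "\<And>z. (\<And>j. j < n \<Longrightarrow> z j \<in> Z) \<Longrightarrow> \<exists>c. (\<exists>j<n. c j \<noteq> 0) \<and> (\<Sum>j<n. fscale (c j) (z j)) \<in> V"
  shows "dep_mod Z V n"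
  using assms unfolding dep_mod_def by blast

lemma dep_modE:
  assumes "dep_mod Z V n" "\<And>j. j < n \<Longrightarrow> z j \<in> Z"
  obtains c j where "j < n" "c j \<noteq> 0" "(\<Sum>j<n. fscale (c j) (z j)) \<in> V"
  using assms unfolding dep_mod_def by blast

text \<open>A family of n * m vectors is cut into n blocks of length m. Each block has a nontrivial
  combination in U, and these n combinations have a nontrivial combination in V. The bound is crude,
  but only finiteness matters.\<close>

lemma dep_mod_trans:
  assumes ZU: "dep_mod Z U m" and UV: "dep_mod U V n"
  shows "dep_mod Z V (n * m)"
proof (rule dep_modI)
  fix z assume z: "\<And>j. j < n * m \<Longrightarrow> z j \<in> Z"
  have lt: "p * m + q < n * m" if "p < n" "q < m" for p q
  proof -
    have "p * m + q < p * m + m" using that by simp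
    also have "\<dots> = Suc p * m" by simp
    also have "\<dots> \<le> n * m" using that by (intro mult_le_mono1) simp
    finally show ?thesis .
  qed
  have "\<exists>e. (\<exists>q<m. e q \<noteq> 0) \<and> (\<Sum>q<m. fscale (e q) (z (p * m + q))) \<in> U" if "p < n" for p
    using ZU lt[OF that] z unfolding dep_mod_def by simp
  then obtain e where e: "\<And>p. p < n \<Longrightarrow> (\<exists>q<m. e p q \<noteq> 0) \<and> (\<Sum>q<m. fscale (e p q) (z (p * m + q))) \<in> U"
    by metis
  obtain g p where g: "p < n" "g p \<noteq> 0"
    "(\<Sum>p<n. fscale (g p) (\<Sum>q<m. fscale (e p q) (z (p * m + q)))) \<in> V"
    by (rule dep_modE[OF UV]) (use e in blast)
  obtain q where q: "q < m" "e p q \<noteq> 0" using e[OF g(1)] by blast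
  \<comment> \<open>The vector with index p * m + q is weighted by the outer coefficient of its
    block times the inner one; the product of two nonzero coefficients keeps the combination
    nontrivial.\<close>
  define h where "h j = g (j div m) * e (j div m) (j mod m)" for j
  have h: "h (p * m + q) = g p * e p q" if "q < m" for p q
    using that by (simp add: h_def)
  have "(\<Sum>j<n * m. fscale (h j) (z j)) = (\<Sum>p<n. \<Sum>j=p * m..<p * m + m. fscale (h j) (z j))"
    by (rule sum.nat_group[symmetric])
  also have "\<dots> = (\<Sum>p<n. \<Sum>q<m. fscale (h (p * m + q)) (z (p * m + q)))"
  proof (rule sum.cong[OF refl])
    show "(\<Sum>j=p * m..<p * m + m. fscale (h j) (z j)) = (\<Sum>q<m. fscale (h (p * m + q)) (z (p * m + q)))" for p
      using sum.shift_bounds_nat_ivl[of "\<lambda>j. fscale (h j) (z j)" 0 "p * m" m]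
      by (simp add: atLeast0LessThan ac_simps)
  qed
  also have "\<dots> = (\<Sum>p<n. fscale (g p) (\<Sum>q<m. fscale (e p q) (z (p * m + q))))"
    by (simp add: h fscale_sum)
  finally have "(\<Sum>j<n * m. fscale (h j) (z j)) \<in> V" using g(3) by simp
  moreover have "h (p * m + q) \<noteq> 0" using h[OF q(1)] g(2) q(2) by simp
  ultimately show "\<exists>c. (\<exists>j<n * m. c j \<noteq> 0) \<and> (\<Sum>j<n * m. fscale (c j) (z j)) \<in> V"
    using lt[OF g(1) q(1)] by blast
qed

lemma lincomb_diff_cob:
  assumes M: "dg_module M" and d: "\<And>j. j < n \<Longrightarrow> z j - z' j \<in> coboundaries M i"
  shows "(\<Sum>j<n::nat. fscale (c j) (z j)) - (\<Sum>j<n. fscale (c j) (z' j)) \<in> coboundaries M i"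
proof -
  have "(\<Sum>j<n. fscale (c j) (z j)) - (\<Sum>j<n. fscale (c j) (z' j)) = (\<Sum>j<n. fscale (c j) (z j - z' j))"
    by (simp add: fscale_distribs sum_subtractf)
  also have "\<dots> \<in> coboundaries M i"
    by (rule fvec.subspace_sum[OF coboundaries_subspace[OF M]]) (use d M in simp)
  finally show ?thesis .
qed

lemma hom_lincomb:
  assumes f: "f \<in> dg_hom M N" and M: "dg_module M" and z: "\<And>j. j < n \<Longrightarrow> z j \<in> cpt M i"
  shows "f i (\<Sum>j<n::nat. fscale (c j) (z j)) = (\<Sum>j<n. fscale (c j) (f i (z j)))"
proof -
  have "f i (\<Sum>j<n. fscale (c j) (z j)) = (\<Sum>j<n. f i (fscale (c j) (z j)))"
    by (rule hom_sum[OF f M]) (use z M in simp)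
  also have "\<dots> = (\<Sum>j<n. fscale (c j) (f i (z j)))"
    by (rule sum.cong) (use z hom_scale[OF f] in simp_all)
  finally show ?thesis .
qed

lemma cocycle_lincomb:
  assumes M: "dg_module M" and z: "\<And>j. j < n \<Longrightarrow> z j \<in> cocycles M i"
  shows "(\<Sum>j<n::nat. fscale (c j) (z j)) \<in> cocycles M i"
  by (rule fvec.subspace_sum[OF cocycles_subspace[OF M]]) (use z M in simp)

section \<open>DG modules with Artinian cohomology\<close>

definition coh_zero :: "('k::field, 'u) dgm \<Rightarrow> int \<Rightarrow> bool" where
  "coh_zero M i \<longleftrightarrow> (\<forall>z\<in>cocycles M i. z \<in> coboundaries M i)"

definition coh_dep :: "('k::field, 'u) dgm \<Rightarrow> int \<Rightarrow> bool" where
  "coh_dep M i \<longleftrightarrow> (\<exists>n. dep_mod (cocycles M i) (coboundaries M i) n)"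

text \<open>Bijectivity of T on cohomology, indexed by the target degree i: T maps degree i + 1 to
  degree i.\<close>

definition tact_bij :: "('k::field, 'u) dgm \<Rightarrow> int \<Rightarrow> bool" where
  "tact_bij M i \<longleftrightarrow>
     (\<forall>z\<in>cocycles M (i + 1). tact M (i + 1) z \<in> coboundaries M i \<longrightarrow> z \<in> coboundaries M (i + 1)) \<and>
     (\<forall>y\<in>cocycles M i. \<exists>z\<in>cocycles M (i + 1). y - tact M (i + 1) z \<in> coboundaries M i)"

text \<open>A graded k[T]-module is Artinian if and only if it has these properties.\<close>

definition artinian :: "('k::field, 'u) dgm \<Rightarrow> bool" where
  "artinian M \<longleftrightarrow> (\<exists>N. \<forall>i. (i < - N \<longrightarrow> coh_zero M i) \<and> coh_dep M i \<and> (i \<ge> N \<longrightarrow> tact_bij M i))"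

lemma artinianI:
  assumes "\<And>i. i < - N \<Longrightarrow> coh_zero M i" "\<And>i. coh_dep M i" "\<And>i. i \<ge> N \<Longrightarrow> tact_bij M i"
  shows "artinian M"
  using assms unfolding artinian_def by blast

lemma artinianE:
  assumes "artinian M"
  obtains N where "N \<ge> k" "\<forall>i. i < - N \<longrightarrow> coh_zero M i" "\<forall>i. coh_dep M i" "\<forall>i. i \<ge> N \<longrightarrow> tact_bij M i"
proof -
  obtain N where N: "\<And>i. (i < - N \<longrightarrow> coh_zero M i) \<and> coh_dep M i \<and> (i \<ge> N \<longrightarrow> tact_bij M i)"
    using assms unfolding artinian_def by blast
  show thesis by (rule that[of "max N k"]) (use N in simp_all)
qed

lemma tact_bij_inj:
  assumes "tact_bij M i" "z \<in> cocycles M j" "tact M j z \<in> coboundaries M i" "j = i + 1"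
  shows "z \<in> coboundaries M j"
  using assms unfolding tact_bij_def by blast

lemma tact_bij_surj:
  assumes "tact_bij M i" "y \<in> cocycles M i" "j = i + 1"
  obtains z where "z \<in> cocycles M j" "y - tact M j z \<in> coboundaries M i"
  using assms unfolding tact_bij_def by blast

lemma tact_bijI:
  assumes "\<And>z. z \<in> cocycles M (i + 1) \<Longrightarrow> tact M (i + 1) z \<in> coboundaries M i \<Longrightarrow> z \<in> coboundaries M (i + 1)"
    and "\<And>y. y \<in> cocycles M i \<Longrightarrow> \<exists>z\<in>cocycles M (i + 1). y - tact M (i + 1) z \<in> coboundaries M i"
  shows "tact_bij M i"
  using assms unfolding tact_bij_def by blast

lemma coh_zero_dep: "coh_zero M i \<Longrightarrow> coh_dep M i"
  unfolding coh_dep_def coh_zero_def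
  by (rule exI[of _ 1], rule dep_modI, rule exI[of _ "\<lambda>_. 1"]) simp

lemma coh_zero_tact_bij:
  assumes "dg_module M" "coh_zero M i" "coh_zero M (i + 1)" shows "tact_bij M i"
proof (rule tact_bijI)
  fix y assume "y \<in> cocycles M i"
  then show "\<exists>z\<in>cocycles M (i + 1). y - tact M (i + 1) z \<in> coboundaries M i"
    using assms by (intro bexI[of _ 0]) (simp_all add: coh_zero_def)
qed (use assms in \<open>simp add: coh_zero_def\<close>)

lemma tact_cob_diff:
  assumes "dg_module M" "x \<in> cpt M i" "y \<in> cpt M i" "x - y \<in> coboundaries M i" "j = i - 1"
  shows "tact M i x - tact M i y \<in> coboundaries M j"
  using cob_closed(6)[OF assms(1,4,5)] tact_diff[OF assms(1-3)] by simp

context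
  fixes M :: "('k::field, 'u) dgm" and P :: "('k, 'w) dgm" and f
  assumes M: "dg_module M" and P: "dg_module P" and f: "f \<in> dg_hom M P"
    and inj: "\<And>i z. z \<in> cocycles M i \<Longrightarrow> f i z \<in> coboundaries P i \<Longrightarrow> z \<in> coboundaries M i"
begin

lemma coh_zero_inj: "coh_zero P i \<Longrightarrow> coh_zero M i"
  unfolding coh_zero_def using inj hom_cocycle[OF f M] by blast

lemma coh_dep_inj:
  assumes "coh_dep P i" shows "coh_dep M i"
proof -
  obtain n where n: "dep_mod (cocycles P i) (coboundaries P i) n" using assms unfolding coh_dep_def by blast
  have "dep_mod (cocycles M i) (coboundaries M i) n"
  proof (rule dep_modI)
    fix z assume z: "\<And>j. j < n \<Longrightarrow> z j \<in> cocycles M i"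
    obtain c j where c: "j < n" "c j \<noteq> 0" "(\<Sum>j<n. fscale (c j) (f i (z j))) \<in> coboundaries P i"
      by (rule dep_modE[OF n, of "\<lambda>j. f i (z j)"]) (use z hom_cocycle[OF f M] in blast)
    have "f i (\<Sum>j<n. fscale (c j) (z j)) = (\<Sum>j<n. fscale (c j) (f i (z j)))"
      by (rule hom_lincomb[OF f M]) (rule cocycle_cpt[OF z])
    then have "f i (\<Sum>j<n. fscale (c j) (z j)) \<in> coboundaries P i" using c(3) by simp
    moreover have "(\<Sum>j<n. fscale (c j) (z j)) \<in> cocycles M i" by (rule cocycle_lincomb[OF M z])
    ultimately have "(\<Sum>j<n. fscale (c j) (z j)) \<in> coboundaries M i" by (intro inj)
    then show "\<exists>c. (\<exists>j<n. c j \<noteq> 0) \<and> (\<Sum>j<n. fscale (c j) (z j)) \<in> coboundaries M i"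
      using c(1,2) by blast
  qed
  then show ?thesis unfolding coh_dep_def by blast
qed

lemma tact_cob_inj:
  assumes b: "tact_bij P i" and z: "z \<in> cocycles M (i + 1)" "tact M (i + 1) z \<in> coboundaries M i"
  shows "z \<in> coboundaries M (i + 1)"
proof (rule inj[OF z(1)])
  have "f i (tact M (i + 1) z) = tact P (i + 1) (f (i + 1) z)"
    by (rule hom_tact[OF f cocycle_cpt[OF z(1)]]) simp
  then have "tact P (i + 1) (f (i + 1) z) \<in> coboundaries P i" using hom_cob[OF f z(2)] by simp
  then show "f (i + 1) z \<in> coboundaries P (i + 1)"
    by (rule tact_bij_inj[OF b hom_cocycle[OF f M z(1)]]) simp
qed

end

text \<open>The cohomology of M is a direct summand of that of P. Injectivity arguments only use f;
  a preimage under T is found in P and brought back by p.\<close>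

lemma artinian_retract:
  assumes M: "dg_module M" and P: "dg_module P" and f: "f \<in> dg_hom M P" and p: "p \<in> dg_hom P M"
    and pf: "\<And>i x. x \<in> cpt M i \<Longrightarrow> p i (f i x) = x" and art: "artinian P"
  shows "artinian M"
proof -
  have inj: "z \<in> coboundaries M i" if "z \<in> cocycles M i" "f i z \<in> coboundaries P i" for i z
    using hom_cob[OF p that(2)] pf[OF cocycle_cpt[OF that(1)]] by simp
  obtain N where "N \<ge> 0" and N': "\<forall>i. i < - N \<longrightarrow> coh_zero P i" "\<forall>i. coh_dep P i" "\<forall>i. i \<ge> N \<longrightarrow> tact_bij P i"
    by (rule artinianE[OF art, of 0])
  note N = N'[rule_format]
  show ?thesis
  proof (rule artinianI[of N])
    fix i assume i: "i \<ge> N"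
    show "tact_bij M i"
    proof (rule tact_bijI)
      show "z \<in> coboundaries M (i + 1)" if "z \<in> cocycles M (i + 1)" "tact M (i + 1) z \<in> coboundaries M i" for z
        by (rule tact_cob_inj[OF M P f inj N(3)[OF i] that])
      fix y assume y: "y \<in> cocycles M i"
      obtain z where z: "z \<in> cocycles P (i + 1)" "f i y - tact P (i + 1) z \<in> coboundaries P i"
        by (rule tact_bij_surj[OF N(3)[OF i] hom_cocycle[OF f M y] refl])
      have t: "tact P (i + 1) z \<in> cpt P i" using z(1) P by simp
      have "p i (f i y) - p i (tact P (i + 1) z) \<in> coboundaries M i"
        by (rule hom_cob_diff[OF p P _ t z(2)]) (use y f in simp)
      moreover have "p i (tact P (i + 1) z) = tact M (i + 1) (p (i + 1) z)"
        by (rule hom_tact[OF p cocycle_cpt[OF z(1)]]) simp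
      ultimately have "y - tact M (i + 1) (p (i + 1) z) \<in> coboundaries M i" using pf[OF cocycle_cpt[OF y]] by simp
      then show "\<exists>z\<in>cocycles M (i + 1). y - tact M (i + 1) z \<in> coboundaries M i"
        by (rule bexI[OF _ hom_cocycle[OF p P z(1)]])
    qed
  qed (use coh_zero_inj[OF M P f inj N(1)] coh_dep_inj[OF M P f inj N(2)] in blast)+
qed

text \<open>All three conditions concern only cohomology as a graded k[T]-module, on which q induces
  an isomorphism. They are transported on representatives, correcting by coboundaries at each
  stage.\<close>

lemma artinian_quasi_iso:
  assumes M: "dg_module M" and P: "dg_module P" and q: "q \<in> quasi_iso M P"
  shows "artinian M \<longleftrightarrow> artinian P"
proof
  note f = quasi_iso_hom[OF q]
  note inj = quasi_iso_inj[OF q M P]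
  {
    assume art: "artinian P"
    obtain N where "N \<ge> 0" and N': "\<forall>i. i < - N \<longrightarrow> coh_zero P i" "\<forall>i. coh_dep P i" "\<forall>i. i \<ge> N \<longrightarrow> tact_bij P i"
      by (rule artinianE[OF art, of 0])
    note N = N'[rule_format]
    show "artinian M"
    proof (rule artinianI[of N])
      fix i assume i: "i \<ge> N"
      show "tact_bij M i"
      proof (rule tact_bijI)
        show "z \<in> coboundaries M (i + 1)" if "z \<in> cocycles M (i + 1)" "tact M (i + 1) z \<in> coboundaries M i" for z
          by (rule tact_cob_inj[OF M P f inj N(3)[OF i] that])
        fix y assume y: "y \<in> cocycles M i"
        obtain z where z: "z \<in> cocycles P (i + 1)" "q i y - tact P (i + 1) z \<in> coboundaries P i"
          by (rule tact_bij_surj[OF N(3)[OF i] hom_cocycle[OF f M y] refl])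
        obtain w where w: "w \<in> cocycles M (i + 1)" "z - q (i + 1) w \<in> coboundaries P (i + 1)"
          by (rule quasi_iso_surj[OF q M P z(1)])
        have "tact P (i + 1) z - tact P (i + 1) (q (i + 1) w) \<in> coboundaries P i"
          by (rule tact_cob_diff[OF P cocycle_cpt[OF z(1)] _ w(2)]) (use f w(1) in simp_all)
        then have "q i y - tact P (i + 1) (q (i + 1) w) \<in> coboundaries P i"
          by (rule cob_diff_trans[OF P z(2)])
        moreover have "q i (tact M (i + 1) w) = tact P (i + 1) (q (i + 1) w)"
          by (rule hom_tact[OF f cocycle_cpt[OF w(1)]]) simp
        ultimately have "q i y - q i (tact M (i + 1) w) \<in> coboundaries P i" by simp
        then have "y - tact M (i + 1) w \<in> coboundaries M i"
          by (rule quasi_iso_diff[OF q M P y, rotated]) (use w(1) M in simp)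
        then show "\<exists>z\<in>cocycles M (i + 1). y - tact M (i + 1) z \<in> coboundaries M i"
          by (rule bexI[OF _ w(1)])
      qed
    qed (use coh_zero_inj[OF M P f inj N(1)] coh_dep_inj[OF M P f inj N(2)] in blast)+
  }
  assume art: "artinian M"
  obtain N where "N \<ge> 0" and N': "\<forall>i. i < - N \<longrightarrow> coh_zero M i" "\<forall>i. coh_dep M i" "\<forall>i. i \<ge> N \<longrightarrow> tact_bij M i"
    by (rule artinianE[OF art, of 0])
  note N = N'[rule_format]
  show "artinian P"
  proof (rule artinianI[of N])
    fix i assume i: "i < - N"
    show "coh_zero P i" unfolding coh_zero_def
    proof
      fix y assume y: "y \<in> cocycles P i"
      obtain z where z: "z \<in> cocycles M i" "y - q i z \<in> coboundaries P i" by (rule quasi_iso_surj[OF q M P y])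
      have "z \<in> coboundaries M i" using N(1)[OF i] z(1) unfolding coh_zero_def by blast
      then show "y \<in> coboundaries P i" by (rule cob_diff_mem[OF P z(2) hom_cob[OF f]])
    qed
  next
    fix i
    obtain n where n: "dep_mod (cocycles M i) (coboundaries M i) n" using N(2)[of i] unfolding coh_dep_def by blast
    have "dep_mod (cocycles P i) (coboundaries P i) n"
    proof (rule dep_modI)
      fix z assume z: "\<And>j. j < n \<Longrightarrow> z j \<in> cocycles P i"
      have "\<exists>w. w \<in> cocycles M i \<and> z j - q i w \<in> coboundaries P i" if "j < n" for j
        using quasi_iso_surj[OF q M P z[OF that]] by blast
      then obtain w where w: "\<And>j. j < n \<Longrightarrow> w j \<in> cocycles M i" "\<And>j. j < n \<Longrightarrow> z j - q i (w j) \<in> coboundaries P i"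
        by metis
      obtain c j where c: "j < n" "c j \<noteq> 0" "(\<Sum>j<n. fscale (c j) (w j)) \<in> coboundaries M i"
        by (rule dep_modE[OF n w(1)])
      have "q i (\<Sum>j<n. fscale (c j) (w j)) = (\<Sum>j<n. fscale (c j) (q i (w j)))"
        by (rule hom_lincomb[OF f M]) (rule cocycle_cpt[OF w(1)])
      then have "(\<Sum>j<n. fscale (c j) (q i (w j))) \<in> coboundaries P i"
        using hom_cob[OF f c(3)] by simp
      moreover have "(\<Sum>j<n. fscale (c j) (z j)) - (\<Sum>j<n. fscale (c j) (q i (w j))) \<in> coboundaries P i"
        by (rule lincomb_diff_cob[OF P]) (rule w(2))
      ultimately have "(\<Sum>j<n. fscale (c j) (z j)) \<in> coboundaries P i"
        using cob_diff_mem[OF P] by metis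
      then show "\<exists>c. (\<exists>j<n. c j \<noteq> 0) \<and> (\<Sum>j<n. fscale (c j) (z j)) \<in> coboundaries P i"
        using c(1,2) by blast
    qed
    then show "coh_dep P i" unfolding coh_dep_def by blast
  next
    fix i assume i: "i \<ge> N"
    show "tact_bij P i"
    proof (rule tact_bijI)
      fix y assume y: "y \<in> cocycles P (i + 1)" "tact P (i + 1) y \<in> coboundaries P i"
      obtain z where z: "z \<in> cocycles M (i + 1)" "y - q (i + 1) z \<in> coboundaries P (i + 1)"
        by (rule quasi_iso_surj[OF q M P y(1)])
      have qz: "q (i + 1) z \<in> cpt P (i + 1)" using f z(1) by simp
      have "tact P (i + 1) y - tact P (i + 1) (q (i + 1) z) \<in> coboundaries P i"
        by (rule tact_cob_diff[OF P cocycle_cpt[OF y(1)] qz z(2)]) simp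
      then have "tact P (i + 1) (q (i + 1) z) \<in> coboundaries P i"
        by (rule cob_diff_mem[OF P cob_diff_sym[OF P] y(2)])
      moreover have "q i (tact M (i + 1) z) = tact P (i + 1) (q (i + 1) z)"
        by (rule hom_tact[OF f cocycle_cpt[OF z(1)]]) simp
      ultimately have "tact M (i + 1) z \<in> coboundaries M i"
        using inj[of "tact M (i + 1) z" i] z(1) M by simp
      then have "z \<in> coboundaries M (i + 1)" by (rule tact_bij_inj[OF N(3)[OF i] z(1) _ refl])
      then show "y \<in> coboundaries P (i + 1)" by (rule cob_diff_mem[OF P z(2) hom_cob[OF f]])
    next
      fix y assume y: "y \<in> cocycles P i"
      obtain z where z: "z \<in> cocycles M i" "y - q i z \<in> coboundaries P i" by (rule quasi_iso_surj[OF q M P y])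
      obtain w where w: "w \<in> cocycles M (i + 1)" "z - tact M (i + 1) w \<in> coboundaries M i"
        by (rule tact_bij_surj[OF N(3)[OF i] z(1) refl])
      have "q i z - q i (tact M (i + 1) w) \<in> coboundaries P i"
        by (rule hom_cob_diff[OF f M cocycle_cpt[OF z(1)] _ w(2)]) (use w(1) M in simp)
      moreover have "q i (tact M (i + 1) w) = tact P (i + 1) (q (i + 1) w)"
        by (rule hom_tact[OF f cocycle_cpt[OF w(1)]]) simp
      ultimately have "y - tact P (i + 1) (q (i + 1) w) \<in> coboundaries P i"
        using cob_diff_trans[OF P z(2)] by metis
      then show "\<exists>z\<in>cocycles P (i + 1). y - tact P (i + 1) z \<in> coboundaries P i"
        by (rule bexI[OF _ hom_cocycle[OF f M w(1)]])
    qed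
  qed
qed

lemma artinian_isomorphic_D:
  fixes X Y :: "('k::field, 'u::infinite) dgm"
  assumes X: "dg_module X" and Y: "dg_module Y" and \<phi>: "\<phi> \<in> D_iso X Y"
  shows "artinian X \<longleftrightarrow> artinian Y"
  using X Y \<phi>
proof (rule D_iso_roof)
  fix W :: "('k, 'u) dgm" and s t
  assume W: "dg_module W" and s: "s \<in> quasi_iso W X" and t: "t \<in> quasi_iso W Y"
  show ?thesis using artinian_quasi_iso[OF W X s] artinian_quasi_iso[OF W Y t] by simp
qed

lemma artinian_shift:
  assumes M: "dg_module M" and art: "artinian M" shows "artinian (shift n M)"
proof -
  obtain N where "N \<ge> 0" and N': "\<forall>i. i < - N \<longrightarrow> coh_zero M i" "\<forall>i. coh_dep M i" "\<forall>i. i \<ge> N \<longrightarrow> tact_bij M i"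
    by (rule artinianE[OF art, of 0])
  note N = N'[rule_format]
  have *: "i + 1 + n = i + n + 1" for i by simp
  show ?thesis
  proof (rule artinianI[of "N + \<bar>n\<bar>"])
    fix i assume "i < - (N + \<bar>n\<bar>)"
    then have "i + n < - N" by simp
    then show "coh_zero (shift n M) i" using N(1)[of "i + n"] M by (simp add: coh_zero_def)
  next
    fix i show "coh_dep (shift n M) i" using N(2)[of "i + n"] M by (simp add: coh_dep_def)
  next
    fix i assume "i \<ge> N + \<bar>n\<bar>"
    then have "i + n \<ge> N" by simp
    then show "tact_bij (shift n M) i" using N(3)[of "i + n"] M unfolding tact_bij_def by (simp add: *)
  qed
qed

section \<open>Cohomology of cones: the long exact sequence and the five lemma\<close>

section \<open>Cohomology of cones\<close>

lemma coboundary_SucE: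
  assumes "x \<in> coboundaries M (i + 1)"
  obtains w where "w \<in> cpt M i" "x = dif M i w"
  using assms by (auto elim: coboundaryE)

context
  fixes M N :: "('k::field, 'u) dgm" and f
  assumes M: "dg_module M" and N: "dg_module N" and f: "f \<in> dg_hom M N"
begin

lemma cone_dg [simp]: "dg_module (cone M N f)"
  by (rule dg_module_cone[OF M N f])

lemma cone_cocycle:
  "case_sum y x \<in> cocycles (cone M N f) i \<longleftrightarrow> y \<in> cpt N i \<and> x \<in> cocycles M (i + 1) \<and> dif N i y = - f (i + 1) x"
  by (auto simp: cocycles_mem case_sum_arith case_sum_inject eq_neg_iff_add_eq_0
      simp del: cocycle_cpt cocycle_dif)

lemma cone_cocycleE:
  assumes "z \<in> cocycles (cone M N f) i"
  obtains y x where "z = case_sum y x" "y \<in> cpt N i" "x \<in> cocycles M (i + 1)" "dif N i y = - f (i + 1) x"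
proof -
  have "z \<in> cpt (cone M N f) i" using assms by (rule cocycle_cpt)
  then obtain y x where yx: "z = case_sum y x" by (rule cone_cptE)
  show thesis using assms that[OF yx] unfolding yx cone_cocycle by blast
qed

lemma cone_cob_incl:
  assumes "y \<in> coboundaries N i" shows "case_sum y 0 \<in> coboundaries (cone M N f) i"
proof -
  obtain w where w: "w \<in> cpt N (i - 1)" "y = dif N (i - 1) w" using assms by (rule coboundaryE)
  have "case_sum y 0 = dif (cone M N f) (i - 1) (case_sum w 0)" using w M f by (simp add: case_sum_inject)
  moreover have "case_sum w 0 \<in> cpt (cone M N f) (i - 1)" using w M by simp
  ultimately show ?thesis using coboundaryI by metis
qed

lemma cone_cob_f:
  assumes "x \<in> cpt M i" shows "case_sum (f i x) (- dif M i x) \<in> coboundaries (cone M N f) i"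
proof -
  have "case_sum (f i x) (- dif M i x) = dif (cone M N f) (i - 1) (case_sum 0 x)" using assms N by (simp add: case_sum_inject)
  moreover have "case_sum 0 x \<in> cpt (cone M N f) (i - 1)" using assms N by simp
  ultimately show ?thesis using coboundaryI by metis
qed

text \<open>Exactness at the cohomology of the cone: since the cone differential of (0, x1) is (f
  x1, - d x1), a cocycle whose M-component is a coboundary is cohomologous to one coming from
  N.\<close>

lemma cone_cob_reduce:
  assumes y: "y \<in> cpt N i" and x: "x1 \<in> cpt M i" "x = dif M i x1" and dy: "dif N i y = - f (i + 1) x"
  shows "y + f i x1 \<in> cocycles N i" "case_sum y x - case_sum (y + f i x1) 0 \<in> coboundaries (cone M N f) i"
proof -
  have "dif N i (f i x1) = f (i + 1) x" using hom_dif[OF f x(1) refl] x(2) by simp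
  then show "y + f i x1 \<in> cocycles N i"
    using y x(1) dy N f by (simp add: cocycles_mem del: cocycle_cpt cocycle_dif)
  have "case_sum y x - case_sum (y + f i x1) 0 = - case_sum (f i x1) (- dif M i x1)"
    using x(2) by (simp add: case_sum_arith)
  also have "\<dots> \<in> coboundaries (cone M N f) i" by (rule cob_closed(4)[OF cone_dg cone_cob_f[OF x(1)]])
  finally show "case_sum y x - case_sum (y + f i x1) 0 \<in> coboundaries (cone M N f) i" .
qed

text \<open>By exactness: injectivity of f one degree higher makes every class come from N, and
  surjectivity of f makes such classes vanish.\<close>

lemma cone_coh_zero:
  assumes inj: "\<And>x. x \<in> cocycles M (i + 1) \<Longrightarrow> f (i + 1) x \<in> coboundaries N (i + 1) \<Longrightarrow> x \<in> coboundaries M (i + 1)"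
    and surj: "\<And>y. y \<in> cocycles N i \<Longrightarrow> \<exists>x\<in>cocycles M i. y - f i x \<in> coboundaries N i"
  shows "coh_zero (cone M N f) i"
  unfolding coh_zero_def
proof
  fix z assume "z \<in> cocycles (cone M N f) i"
  then obtain y x where z: "z = case_sum y x" "y \<in> cpt N i" "x \<in> cocycles M (i + 1)" "dif N i y = - f (i + 1) x"
    by (rule cone_cocycleE)
  have "f (i + 1) x = dif N i (- y)" using z(2,4) N by simp
  also have "\<dots> \<in> coboundaries N (i + 1)" by (rule dif_cob[OF N]) (use z(2) N in simp_all)
  finally obtain x1 where x1: "x1 \<in> cpt M i" "x = dif M i x1"
    using inj[OF z(3)] by (auto elim: coboundaryE)
  note red = cone_cob_reduce[OF z(2) x1 z(4)]
  obtain x2 where x2: "x2 \<in> cocycles M i" "y + f i x1 - f i x2 \<in> coboundaries N i" using surj[OF red(1)] by blast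
  have "case_sum (f i x2) 0 \<in> coboundaries (cone M N f) i" using cone_cob_f[OF cocycle_cpt[OF x2(1)]] x2(1) by simp
  moreover have "case_sum (y + f i x1) 0 - case_sum (f i x2) 0 \<in> coboundaries (cone M N f) i"
    using cone_cob_incl[OF x2(2)] by (simp add: case_sum_arith)
  ultimately have "case_sum (y + f i x1) 0 \<in> coboundaries (cone M N f) i" by (rule cob_diff_mem[OF cone_dg, rotated])
  then show "z \<in> coboundaries (cone M N f) i" unfolding z(1) by (rule cob_diff_mem[OF cone_dg red(2)])
qed

text \<open>The cohomology of the cone is filtered by the classes coming from N. The quotient embeds
  into the cohomology of M one degree higher, and the filtration step is a quotient of the
  cohomology of N.\<close>

lemma cone_coh_dep:
  assumes "coh_dep N i" "coh_dep M (i + 1)" shows "coh_dep (cone M N f) i"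
proof -
  obtain n where n: "dep_mod (cocycles N i) (coboundaries N i) n" using assms(1) unfolding coh_dep_def by blast
  obtain m where m: "dep_mod (cocycles M (i + 1)) (coboundaries M (i + 1)) m" using assms(2) unfolding coh_dep_def by blast
  \<comment> \<open>U is the preimage, among cocycles of the cone, of the image of the cohomology of
    N.\<close>
  define U where "U = {z \<in> cocycles (cone M N f) i. \<exists>y\<in>cocycles N i. z - case_sum y 0 \<in> coboundaries (cone M N f) i}"
  have incl: "(\<lambda>i y. case_sum y 0) \<in> dg_hom N (cone M N f)"
    by (rule dg_homI) (use M N f in \<open>simp_all add: case_sum_arith case_sum_inject\<close>)
  have "dep_mod (cocycles (cone M N f) i) U m"
  proof (rule dep_modI)
    fix z assume z: "\<And>j. j < m \<Longrightarrow> z j \<in> cocycles (cone M N f) i"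
    have "z j \<circ> Inr \<in> cocycles M (i + 1)" if "j < m" for j
      using z[OF that] by (rule cone_cocycleE) simp
    then obtain c j where c: "j < m" "c j \<noteq> 0" "(\<Sum>j<m. fscale (c j) (z j \<circ> Inr)) \<in> coboundaries M (i + 1)"
      by (rule dep_modE[OF m])
    let ?s = "\<Sum>j<m. fscale (c j) (z j)"
    have s: "?s \<in> cocycles (cone M N f) i" by (rule cocycle_lincomb[OF cone_dg z])
    then obtain y x where yx: "?s = case_sum y x" "y \<in> cpt N i" "x \<in> cocycles M (i + 1)" "dif N i y = - f (i + 1) x"
      by (rule cone_cocycleE)
    have *: "(\<Sum>j<k. fscale (c j) (z j)) \<circ> Inr = (\<Sum>j<k. fscale (c j) (z j \<circ> Inr))" for k
    proof (induction k)
      case (Suc k)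
      then show ?case unfolding sum.lessThan_Suc comp_arith by (simp only:)
    qed (simp add: comp_arith)
    have "x = (\<Sum>j<m. fscale (c j) (z j \<circ> Inr))" using arg_cong[OF yx(1), of "\<lambda>z. z \<circ> Inr"] * by simp
    then obtain x1 where x1: "x1 \<in> cpt M i" "x = dif M i x1" using c(3) by (auto elim: coboundaryE)
    note red = cone_cob_reduce[OF yx(2) x1 yx(4)]
    have "?s \<in> U" unfolding U_def mem_Collect_eq
      by (intro conjI s bexI[OF _ red(1)]) (use red(2) yx(1) in simp)
    then show "\<exists>c. (\<exists>j<m. c j \<noteq> 0) \<and> (\<Sum>j<m. fscale (c j) (z j)) \<in> U" using c(1,2) by blast
  qed
  moreover have "dep_mod U (coboundaries (cone M N f) i) n"
  proof (rule dep_modI)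
    fix z assume z: "\<And>j. j < n \<Longrightarrow> z j \<in> U"
    have "\<exists>y. y \<in> cocycles N i \<and> z j - case_sum y 0 \<in> coboundaries (cone M N f) i" if "j < n" for j
      using z[OF that] unfolding U_def by blast
    then obtain y where y: "\<And>j. j < n \<Longrightarrow> y j \<in> cocycles N i" "\<And>j. j < n \<Longrightarrow> z j - case_sum (y j) 0 \<in> coboundaries (cone M N f) i"
      by metis
    obtain c j where c: "j < n" "c j \<noteq> 0" "(\<Sum>j<n. fscale (c j) (y j)) \<in> coboundaries N i"
      by (rule dep_modE[OF n y(1)])
    have "case_sum (\<Sum>j<n. fscale (c j) (y j)) (0 :: 'u \<Rightarrow> 'k) = (\<Sum>j<n. fscale (c j) (case_sum (y j) 0))"
      by (rule hom_lincomb[OF incl N, of n y i c]) (rule cocycle_cpt[OF y(1)])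
    then have 1: "(\<Sum>j<n. fscale (c j) (case_sum (y j) 0)) \<in> coboundaries (cone M N f) i"
      using cone_cob_incl[OF c(3)] by simp
    have "(\<Sum>j<n. fscale (c j) (z j)) - (\<Sum>j<n. fscale (c j) (case_sum (y j) 0)) \<in> coboundaries (cone M N f) i"
      by (rule lincomb_diff_cob[OF cone_dg]) (rule y(2))
    then have "(\<Sum>j<n. fscale (c j) (z j)) \<in> coboundaries (cone M N f) i"
      by (rule cob_diff_mem[OF cone_dg _ 1])
    then show "\<exists>c. (\<exists>j<n. c j \<noteq> 0) \<and> (\<Sum>j<n. fscale (c j) (z j)) \<in> coboundaries (cone M N f) i" using c(1,2) by blast
  qed
  ultimately show ?thesis unfolding coh_dep_def using dep_mod_trans by blast
qed

text \<open>The five lemma for T acting on the long exact sequence. The four hypotheses concern the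
  terms next to the cone in degrees i and i + 1, and each half of the proof is one of the two
  four-lemma chases.\<close>

lemma cone_tact_bij:
  assumes bM: "tact_bij M i" "tact_bij M (i + 1)" and bN: "tact_bij N i" "tact_bij N (i + 1)"
  shows "tact_bij (cone M N f) i"
proof (rule tact_bijI)
  fix z assume "z \<in> cocycles (cone M N f) (i + 1)" and cob: "tact (cone M N f) (i + 1) z \<in> coboundaries (cone M N f) i"
  then obtain y x where z: "z = case_sum y x" "y \<in> cpt N (i + 1)" "x \<in> cocycles M (i + 1 + 1)" "dif N (i + 1) y = - f (i + 1 + 1) x"
    by (elim cone_cocycleE)
  have "case_sum (tact N (i + 1) y) (tact M (i + 1 + 1) x) \<in> coboundaries (cone M N f) i" using cob unfolding z(1) by simp
  then obtain w where "w \<in> cpt (cone M N f) (i - 1)" and dw: "case_sum (tact N (i + 1) y) (tact M (i + 1 + 1) x) = dif (cone M N f) (i - 1) w"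
    by (rule coboundaryE)
  then obtain v u where w: "w = case_sum v u" "v \<in> cpt N (i - 1)" "u \<in> cpt M (i - 1 + 1)" by (elim cone_cptE)
  have u: "u \<in> cpt M i" using w(3) by simp
  have T: "tact N (i + 1) y = dif N (i - 1) v + f i u" "tact M (i + 1 + 1) x = - dif M i u"
    using dw unfolding w(1) by (simp_all add: case_sum_inject)
  have "tact M (i + 1 + 1) x = dif M i (- u)" unfolding T(2) using u M by simp
  also have "\<dots> \<in> coboundaries M (i + 1)" by (rule dif_cob[OF M]) (use u M in simp_all)
  finally have "x \<in> coboundaries M (i + 1 + 1)" by (rule tact_bij_inj[OF bM(2) z(3) _ refl])
  then obtain x1 where x1: "x1 \<in> cpt M (i + 1)" "x = dif M (i + 1) x1" by (rule coboundary_SucE)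
  note red = cone_cob_reduce[OF z(2) x1 z(4)]
  \<comment> \<open>The class of z is now represented by ?n in N, and ?m is a cocycle of M such that
    T ?n equals f ?m up to the coboundary d v. Lifting ?m along T shows that ?n is in the image of f
    on cohomology, hence zero in the cone.\<close>
  let ?n = "y + f (i + 1) x1" and ?m = "u + tact M (i + 1) x1"
  have tx1: "tact M (i + 1) x1 \<in> cpt M i" using x1(1) M by simp
  have "dif M i (tact M (i + 1) x1) = tact M (i + 1 + 1) x" unfolding x1(2)
    by (rule dif_tact[OF M x1(1)]) simp
  then have m: "?m \<in> cocycles M i" using u tx1 M T(2) by (simp add: cocycles_mem del: cocycle_cpt cocycle_dif)
  obtain m' where m': "m' \<in> cocycles M (i + 1)" "?m - tact M (i + 1) m' \<in> coboundaries M i"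
    by (rule tact_bij_surj[OF bM(1) m refl])
  have fm': "f (i + 1) m' \<in> cocycles N (i + 1)" by (rule hom_cocycle[OF f M m'(1)])
  have a: "f i (tact M (i + 1) x1) = tact N (i + 1) (f (i + 1) x1)" "f i (tact M (i + 1) m') = tact N (i + 1) (f (i + 1) m')"
    using hom_tact[OF f x1(1), of i] hom_tact[OF f cocycle_cpt[OF m'(1)], of i] by simp_all
  have "f i ?m - f i (tact M (i + 1) m') \<in> coboundaries N i"
    by (rule hom_cob_diff[OF f M cocycle_cpt[OF m] _ m'(2)]) (use m'(1) M in simp)
  moreover have "f i ?m = f i u + tact N (i + 1) (f (i + 1) x1)" using hom_add[OF f u tx1] a(1) by simp
  ultimately have b: "f i u + tact N (i + 1) (f (i + 1) x1) - tact N (i + 1) (f (i + 1) m') \<in> coboundaries N i"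
    using a(2) by simp
  have "tact N (i + 1) (?n - f (i + 1) m') = tact N (i + 1) ?n - tact N (i + 1) (f (i + 1) m')"
    by (rule tact_diff[OF N]) (use red(1) fm' in simp_all)
  also have "tact N (i + 1) ?n = tact N (i + 1) y + tact N (i + 1) (f (i + 1) x1)"
    by (rule tact_add[OF N z(2)]) (use f x1 in simp)
  finally have "tact N (i + 1) (?n - f (i + 1) m') =
      dif N (i - 1) v + (f i u + tact N (i + 1) (f (i + 1) x1) - tact N (i + 1) (f (i + 1) m'))"
    unfolding T(1) by simp
  also have "\<dots> \<in> coboundaries N i" by (rule cob_closed(2)[OF N coboundaryI[OF w(2)] b])
  finally have "?n - f (i + 1) m' \<in> coboundaries N (i + 1)"
    by (intro tact_bij_inj[OF bN(1) _ _ refl]) (use red(1) fm' N in simp)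
  then have "case_sum ?n 0 - case_sum (f (i + 1) m') 0 \<in> coboundaries (cone M N f) (i + 1)"
    using cone_cob_incl by (simp add: case_sum_arith)
  moreover have "case_sum (f (i + 1) m') 0 \<in> coboundaries (cone M N f) (i + 1)"
    using cone_cob_f[OF cocycle_cpt[OF m'(1)]] m'(1) by simp
  ultimately have "case_sum ?n 0 \<in> coboundaries (cone M N f) (i + 1)" by (rule cob_diff_mem[OF cone_dg])
  then show "z \<in> coboundaries (cone M N f) (i + 1)" unfolding z(1) by (rule cob_diff_mem[OF cone_dg red(2)])
next
  fix z assume "z \<in> cocycles (cone M N f) i"
  then obtain y x where z: "z = case_sum y x" "y \<in> cpt N i" "x \<in> cocycles M (i + 1)" "dif N i y = - f (i + 1) x"
    by (rule cone_cocycleE)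
  obtain x' where x': "x' \<in> cocycles M (i + 1 + 1)" "x - tact M (i + 1 + 1) x' \<in> coboundaries M (i + 1)"
    by (rule tact_bij_surj[OF bM(2) z(3) refl])
  obtain m where m: "m \<in> cpt M i" "x - tact M (i + 1 + 1) x' = dif M i m"
    using x'(2) by (rule coboundary_SucE)
  have fx': "f (i + 1 + 1) x' \<in> cocycles N (i + 1 + 1)" by (rule hom_cocycle[OF f M x'(1)])
  have tx': "tact M (i + 1 + 1) x' \<in> cpt M (i + 1)" using x'(1) M by simp
  have a: "f (i + 1) (tact M (i + 1 + 1) x') = tact N (i + 1 + 1) (f (i + 1 + 1) x')"
    using hom_tact[OF f cocycle_cpt[OF x'(1)], of "i + 1"] by simp
  have "f (i + 1) x - f (i + 1) (tact M (i + 1 + 1) x') \<in> coboundaries N (i + 1)"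
    by (rule hom_cob_diff[OF f M cocycle_cpt[OF z(3)] tx' x'(2)])
  moreover have "f (i + 1) x \<in> coboundaries N (i + 1)"
  proof -
    have "f (i + 1) x = dif N i (- y)" using z(2,4) N by simp
    also have "\<dots> \<in> coboundaries N (i + 1)" by (rule dif_cob[OF N]) (use z(2) N in simp_all)
    finally show ?thesis .
  qed
  ultimately have "tact N (i + 1 + 1) (f (i + 1 + 1) x') \<in> coboundaries N (i + 1)"
    unfolding a[symmetric] by (rule cob_diff_mem[OF N cob_diff_sym[OF N]])
  \<comment> \<open>T takes f x' to the class of f x, which vanishes because (y, x) is a cone
    cocycle. Injectivity of T on N then lets x' be completed to a cone cocycle (- v, x').\<close>
  then have "f (i + 1 + 1) x' \<in> coboundaries N (i + 1 + 1)" by (rule tact_bij_inj[OF bN(2) fx' _ refl])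
  then obtain v where v: "v \<in> cpt N (i + 1)" "f (i + 1 + 1) x' = dif N (i + 1) v" by (rule coboundary_SucE)
  let ?y' = "- v"
  have y': "case_sum ?y' x' \<in> cocycles (cone M N f) (i + 1)" unfolding cone_cocycle using v x'(1) N by simp
  have ty': "tact N (i + 1) ?y' \<in> cpt N i" using v(1) N by simp
  have "dif N i (y - tact N (i + 1) ?y') = - f (i + 1) (dif M i m)"
  proof -
    have "dif N i (tact N (i + 1) ?y') = tact N (i + 1 + 1) (dif N (i + 1) ?y')"
      by (rule dif_tact[OF N]) (use v N in simp_all)
    also have "\<dots> = - f (i + 1) (tact M (i + 1 + 1) x')" using v(1) fx' N unfolding a v(2) by simp
    finally have "dif N i (y - tact N (i + 1) ?y') = - f (i + 1) x - (- f (i + 1) (tact M (i + 1 + 1) x'))"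
      using z(2,4) ty' N by simp
    then show ?thesis unfolding m(2)[symmetric] using hom_diff[OF f M cocycle_cpt[OF z(3)] tx'] by simp
  qed
  \<comment> \<open>Subtracting T (- v, x') leaves an M-component that is a coboundary, so what
    remains comes from N, where T is surjective.\<close>
  note red = cone_cob_reduce[OF cpt_diff[OF N z(2) ty'] m(1) refl this]
  let ?n = "y - tact N (i + 1) ?y' + f i m"
  obtain n' where n': "n' \<in> cocycles N (i + 1)" "?n - tact N (i + 1) n' \<in> coboundaries N i"
    by (rule tact_bij_surj[OF bN(1) red(1) refl])
  have c: "case_sum (?y' + n') x' \<in> cocycles (cone M N f) (i + 1)"
    unfolding cone_cocycle using v x'(1) n'(1) N by simp
  have "z - tact (cone M N f) (i + 1) (case_sum (?y' + n') x') =
      case_sum (y - tact N (i + 1) ?y') (dif M i m) - case_sum (tact N (i + 1) n') 0"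
    using v(1) n'(1) N unfolding z(1) by (simp add: case_sum_arith case_sum_inject flip: m(2))
  moreover have "case_sum (y - tact N (i + 1) ?y') (dif M i m) - case_sum (tact N (i + 1) n') 0 \<in> coboundaries (cone M N f) i"
    by (rule cob_diff_trans[OF cone_dg red(2)]) (use cone_cob_incl[OF n'(2)] in \<open>simp add: case_sum_arith\<close>)
  ultimately have "z - tact (cone M N f) (i + 1) (case_sum (?y' + n') x') \<in> coboundaries (cone M N f) i" by simp
  then show "\<exists>w\<in>cocycles (cone M N f) (i + 1). z - tact (cone M N f) (i + 1) w \<in> coboundaries (cone M N f) i" by (rule bexI[OF _ c])
qed

lemma artinian_cone:
  assumes "artinian M" "artinian N" shows "artinian (cone M N f)"
proof -
  obtain K where "K \<ge> 0" and K': "\<forall>i. i < - K \<longrightarrow> coh_zero M i" "\<forall>i. coh_dep M i" "\<forall>i. i \<ge> K \<longrightarrow> tact_bij M i"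
    by (rule artinianE[OF assms(1), of 0])
  note K = K'[rule_format]
  obtain L where L': "L \<ge> K" "\<forall>i. i < - L \<longrightarrow> coh_zero N i" "\<forall>i. coh_dep N i" "\<forall>i. i \<ge> L \<longrightarrow> tact_bij N i"
    by (rule artinianE[OF assms(2), of K])
  note L = L'[rule_format]
  show ?thesis
  \<comment> \<open>One more than the common bound L, because degree i of the cone involves degree i
    + 1 of M.\<close>
  proof (rule artinianI[of "L + 1"])
    fix i assume "i < - (L + 1)"
    then have "coh_zero M (i + 1)" "coh_zero N i" using K(1) L(1,2) by simp_all
    then show "coh_zero (cone M N f) i"
      unfolding coh_zero_def[of M] coh_zero_def[of N] using M N f
      by (intro cone_coh_zero bexI[of _ 0]) simp_all
  next
    show "coh_dep (cone M N f) i" for i by (rule cone_coh_dep[OF L(3) K(2)])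
    show "tact_bij (cone M N f) i" if "i \<ge> L + 1" for i
      by (rule cone_tact_bij) (use that K(3) L(1,4) in simp_all)
  qed
qed

end

lemma is_cone_dg: "is_cone M N f C \<iota> \<pi> \<Longrightarrow> dg_module C"
  by (simp add: is_cone_def)

text \<open>Up to isomorphism of the three vertices, every distinguished triangle is a cone
  triangle, and the property is invariant under isomorphism in the derived category.\<close>

lemma artinian_dist_triangle:
  fixes X Y Z :: "('k::field, 'u::infinite) dgm"
  assumes "dist_triangle X Y Z \<phi> \<psi> \<chi>" "artinian X" "artinian Y"
  shows "artinian Z"
  using assms(1) unfolding dist_triangle_def
proof (elim conjE exE bexE)
  fix M N C :: "('k, 'u) dgm" and f \<iota> \<pi> a b c
  assume X: "dg_module X" and Y: "dg_module Y" and Z: "dg_module Z" and M: "dg_module M" and N: "dg_module N"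
    and f: "f \<in> dg_hom M N" and C: "is_cone M N f C \<iota> \<pi>"
    and a: "a \<in> D_iso X M" and b: "b \<in> D_iso Y N" and c: "c \<in> D_iso Z C"
  obtain j where j: "j \<in> dg_iso (cone M N f) C" using C by (auto simp: is_cone_def)
  have "artinian (cone M N f)"
    using assms(2,3) artinian_isomorphic_D[OF X M a] artinian_isomorphic_D[OF Y N b] artinian_cone[OF M N f] by blast
  then have "artinian C"
    using artinian_quasi_iso[OF dg_module_cone[OF M N f] is_cone_dg[OF C] dg_iso_quasi_iso[OF j dg_module_cone[OF M N f] is_cone_dg[OF C]]]
    by blast
  then show ?thesis using artinian_isomorphic_D[OF Z is_cone_dg[OF C] c] by blast
qed

text \<open>Part of the long exact cohomology sequence of a distinguished triangle.\<close>

lemma dist_triangle_coh: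
  fixes X Y Z :: "('k::field, 'u::infinite) dgm"
  assumes "dist_triangle X Y Z \<phi> \<psi> \<chi>"
    and inj: "\<And>i x y. D_coh X Y \<phi> i x y \<Longrightarrow> y \<in> coboundaries Y i \<Longrightarrow> x \<in> coboundaries X i"
  shows "z \<in> cocycles Z i \<Longrightarrow> \<exists>y. D_coh Y Z \<psi> i y z"
    and "D_coh X Y \<phi> i x y \<Longrightarrow> D_coh Y Z \<psi> i y z \<Longrightarrow> z \<in> coboundaries Z i"
proof -
  obtain M N C :: "('k, 'u) dgm" and f \<iota> \<pi> a b c where X: "dg_module X" and Y: "dg_module Y" and Z: "dg_module Z"
    and \<phi>: "\<phi> \<in> D_hom X Y" and \<psi>: "\<psi> \<in> D_hom Y Z" and M: "dg_module M" and N: "dg_module N"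
    and f: "f \<in> dg_hom M N" and cone: "is_cone M N f C \<iota> \<pi>"
    and a: "a \<in> D_iso X M" and b: "b \<in> D_iso Y N" and c: "c \<in> D_iso Z C"
    and sq1: "D_comp X Y N b \<phi> = D_comp X M N (D_of M N f) a"
    and sq2: "D_comp Y Z C c \<psi> = D_comp Y N C (D_of N C \<iota>) b"
    using assms(1) unfolding dist_triangle_def by blast
  note C = is_cone_dg[OF cone] and a' = D_iso_hom[OF a] and b' = D_iso_hom[OF b] and c' = D_iso_hom[OF c]
  obtain j where j: "j \<in> dg_iso (cone M N f) C" and \<iota>: "\<And>i y. y \<in> cpt N i \<Longrightarrow> \<iota> i y = j i (case_sum y 0)"
    using cone unfolding is_cone_def by blast
  note C0 = dg_module_cone[OF M N f] and j' = dg_iso_hom[OF j]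
  have incl: "(\<lambda>i y. case_sum y 0) \<in> dg_hom N (cone M N f)"
    by (rule dg_homI) (use M N f in \<open>simp_all add: case_sum_arith case_sum_inject\<close>)
  have ji: "gcomp j (\<lambda>i y. case_sum y 0) \<in> dg_hom N C" by (rule gcomp_hom[OF incl j'])
  have \<iota>': "\<iota> \<in> dg_hom N C"
  proof (rule dg_homI)
    fix i x assume x: "x \<in> cpt N i"
    show "\<iota> (i - 1) (tact N i x) = tact C i (\<iota> i x)"
      using hom_tact[OF ji x refl] \<iota>[OF x] \<iota>[OF tact_mem[OF N x refl]] by simp
    show "\<iota> (i + 1) (dif N i x) = dif C i (\<iota> i x)"
      using hom_dif[OF ji x refl] \<iota>[OF x] \<iota>[OF dif_mem[OF N x refl]] by simp
    show "\<iota> i x \<in> cpt C i" using hom_mem[OF ji x] \<iota>[OF x] by simp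
    show "\<iota> i (fscale d x) = fscale d (\<iota> i x)" for d
      using hom_scale[OF ji x] \<iota>[OF x] \<iota>[OF cpt_scale[OF N x]] by simp
    show "\<iota> i (x + y) = \<iota> i x + \<iota> i y" if y: "y \<in> cpt N i" for y
      using hom_add[OF ji x y] \<iota>[OF x] \<iota>[OF y] \<iota>[OF cpt_add[OF N x y]] by simp
  qed
  have f': "D_of M N f \<in> D_hom M N" and i': "D_of N C \<iota> \<in> D_hom N C"
    using D_of_hom[OF M N f] D_of_hom[OF N C \<iota>'] .
  note cf = D_coh_of[OF M N f] and ci = D_coh_of[OF N C \<iota>']
  note c1 = D_coh_comp[OF X Y N \<phi> b'] D_coh_comp[OF X M N a' f']
    and c2 = D_coh_comp[OF Y Z C \<psi> c'] D_coh_comp[OF Y N C b' i']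
  have square1: "(\<exists>y. D_coh X Y \<phi> i x y \<and> D_coh Y N b i y n) \<longleftrightarrow> (\<exists>m. D_coh X M a i x m \<and> D_coh M N (D_of M N f) i m n)" for i x n
    using c1 sq1 by simp
  have square2: "(\<exists>z. D_coh Y Z \<psi> i y z \<and> D_coh Z C c i z w) \<longleftrightarrow> (\<exists>n. D_coh Y N b i y n \<and> D_coh N C (D_of N C \<iota>) i n w)" for i y w
    using c2 sq2 by simp
  {
    fix z assume z: "z \<in> cocycles Z i"
    obtain w where w: "D_coh Z C c i z w" by (rule D_coh_total[OF Z C c' z])
    have wc: "w \<in> cocycles C i" by (rule D_coh_cocycles(2)[OF w])
    obtain w0 where w0: "w0 \<in> cocycles (cone M N f) i" "w - j i w0 \<in> coboundaries C i"
      by (rule quasi_iso_surj[OF dg_iso_quasi_iso[OF j C0 C] C0 C wc])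
    obtain n m where nm: "w0 = case_sum n m" "n \<in> cpt N i" "m \<in> cocycles M (i + 1)" "dif N i n = - f (i + 1) m"
      using w0(1) by (rule cone_cocycleE[OF M N f])
    have "f (i + 1) m = dif N i (- n)" using nm(2,4) N by simp
    also have "\<dots> \<in> coboundaries N (i + 1)" by (rule dif_cob[OF N]) (use nm(2) N in simp_all)
    finally have fm: "f (i + 1) m \<in> coboundaries N (i + 1)" .
    \<comment> \<open>The M-component m of the cone cocycle represents its image under the
      connecting map, and f kills its class. Transported along a and b it becomes a class x killed
      by \<phi>, so injectivity of \<phi> on cohomology makes m a coboundary.\<close>
    obtain x where x: "D_coh X M a (i + 1) x m" by (rule D_iso_coh_surj[OF X M a nm(3)])
    have "D_coh M N (D_of M N f) (i + 1) m (f (i + 1) m)"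
      unfolding cf using nm(3) hom_cocycle[OF f M nm(3)] N by simp
    then obtain y where y: "D_coh X Y \<phi> (i + 1) x y" "D_coh Y N b (i + 1) y (f (i + 1) m)"
      using square1 x by blast
    have "y \<in> coboundaries Y (i + 1)" by (rule D_iso_coh_inj[OF Y N b y(2) fm])
    then have "x \<in> coboundaries X (i + 1)" by (rule inj[OF y(1)])
    then have "m \<in> coboundaries M (i + 1)" by (rule D_coh_cob[OF X M a' x])
    then obtain m1 where m1: "m1 \<in> cpt M i" "m = dif M i m1" by (rule coboundary_SucE)
    note red = cone_cob_reduce[OF M N f nm(2) m1 nm(4)]
    let ?n = "n + f i m1"
    obtain y where y: "D_coh Y N b i y ?n" by (rule D_iso_coh_surj[OF Y N b red(1)])
    have in': "\<iota> i ?n \<in> cocycles C i" by (rule hom_cocycle[OF \<iota>' N red(1)])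
    have "D_coh N C (D_of N C \<iota>) i ?n (\<iota> i ?n)" unfolding ci using red(1) in' C by simp
    then obtain z0 where z0: "D_coh Y Z \<psi> i y z0" "D_coh Z C c i z0 (\<iota> i ?n)" using square2 y by blast
    have "j i w0 - j i (case_sum ?n 0) \<in> coboundaries C i"
      by (rule hom_cob_diff[OF j' C0 cocycle_cpt[OF w0(1)]]) (use red nm(1) M in simp_all)
    then have "w - \<iota> i ?n \<in> coboundaries C i"
      using cob_diff_trans[OF C w0(2)] \<iota>[OF cocycle_cpt[OF red(1)]] by simp
    then have "z - z0 \<in> coboundaries Z i"
      by (rule D_iso_coh_inj[OF Z C c D_coh_diff[OF Z C c' w z0(2)]])
    then have "D_coh Y Z \<psi> i y z"
      by (intro D_coh_cong[OF Y Z \<psi> z0(1) D_coh_cocycles(1)[OF z0(1)] _ z]) (simp_all add: Y)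
    then show "\<exists>y. D_coh Y Z \<psi> i y z" by blast
  }
  assume xy: "D_coh X Y \<phi> i x y" and yz: "D_coh Y Z \<psi> i y z"
  obtain w where w: "D_coh Z C c i z w" by (rule D_coh_total[OF Z C c' D_coh_cocycles(2)[OF yz]])
  obtain n where n: "D_coh Y N b i y n" "D_coh N C (D_of N C \<iota>) i n w" using square2 yz w by blast
  obtain m where m: "D_coh X M a i x m" "D_coh M N (D_of M N f) i m n" using square1 xy n(1) by blast
  have n': "n \<in> cocycles N i" "w - \<iota> i n \<in> coboundaries C i" using n(2) unfolding ci by simp_all
  have m': "m \<in> cocycles M i" "n - f i m \<in> coboundaries N i" using m(2) unfolding cf by simp_all
  have fm: "f i m \<in> cocycles N i" by (rule hom_cocycle[OF f M m'(1)])
  have "case_sum (f i m) 0 \<in> coboundaries (cone M N f) i"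
    using cone_cob_f[OF M N f cocycle_cpt[OF m'(1)]] m'(1) by simp
  then have "\<iota> i (f i m) \<in> coboundaries C i"
    using hom_cob[OF j'] \<iota>[OF cocycle_cpt[OF fm]] by simp
  then have "\<iota> i n \<in> coboundaries C i"
    by (rule cob_diff_mem[OF C hom_cob_diff[OF \<iota>' N cocycle_cpt[OF n'(1)] cocycle_cpt[OF fm] m'(2)]])
  then have "w \<in> coboundaries C i" by (rule cob_diff_mem[OF C n'(2)])
  then show "z \<in> coboundaries Z i" by (rule D_iso_coh_inj[OF Z C c w])
qed

section \<open>Direct sums and direct summands\<close>

section \<open>Direct sums\<close>

definition sec :: "('i \<times> 'w \<Rightarrow> 'k) \<Rightarrow> 'i \<Rightarrow> 'w \<Rightarrow> 'k" where
  "sec z i = (\<lambda>u. z (i, u))"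

lemma sec_arith [simp]:
  fixes z z' :: "'i \<times> 'w \<Rightarrow> 'k::field"
  shows "sec (z + z') i = sec z i + sec z' i" "sec (z - z') i = sec z i - sec z' i" "sec (- z) i = - sec z i"
    "sec (fscale c z) i = fscale c (sec z i)" "sec (0 :: 'i \<times> 'w \<Rightarrow> 'k) i = 0"
  by (simp_all add: sec_def fun_eq_iff pointwise fscale_def)

lemma sec_ext: "(\<And>i. sec z i = sec z' i) \<Longrightarrow> z = z'"
  by (auto simp: sec_def fun_eq_iff)

lemma sec_sum:
  fixes g :: "'a \<Rightarrow> 'i \<times> 'w \<Rightarrow> 'k::field"
  shows "sec (\<Sum>a\<in>A. g a) i = (\<Sum>a\<in>A. sec (g a) i)"
  by (induction A rule: infinite_finite_induct) simp_all

lemma dsum_cpt: "z \<in> cpt (dsum I Y) n \<longleftrightarrow>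
    (\<forall>i\<in>I. sec z i \<in> cpt (Y i) n) \<and> (\<forall>i. i \<notin> I \<longrightarrow> sec z i = 0) \<and> finite {i. sec z i \<noteq> 0}"
  by (simp add: dsum_def sec_def)

lemma dsum_sec [simp]:
  "sec (dif (dsum I Y) n z) i = (if i \<in> I then dif (Y i) n (sec z i) else 0)"
  "sec (tact (dsum I Y) n z) i = (if i \<in> I then tact (Y i) n (sec z i) else 0)"
  "sec (dsum_incl i n x) j = (if j = i then x else 0)"
  by (auto simp: dsum_def sec_def dsum_incl_def fun_eq_iff pointwise)

lemma dg_module_dsum:
  fixes Y :: "'i \<Rightarrow> ('k::field, 'w) dgm"
  assumes Y: "\<forall>i\<in>I. dg_module (Y i)"
  shows "dg_module (dsum I Y)"
proof -
  have fin: "finite {i. sec z' i \<noteq> 0}" if "finite {i. sec z i \<noteq> 0}" "\<And>i. sec z i = 0 \<Longrightarrow> sec z' i = 0"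
    for z z' :: "'i \<times> 'w \<Rightarrow> 'k"
    by (rule finite_subset[OF _ that(1)]) (use that(2) in blast)
  show ?thesis
  proof (rule dg_moduleI)
    show "fvec.subspace (cpt (dsum I Y) n)" for n
    proof (rule subspaceI)
      fix z z' assume z: "z \<in> cpt (dsum I Y) n" and z': "z' \<in> cpt (dsum I Y) n"
      have "finite ({i. sec z i \<noteq> 0} \<union> {i. sec z' i \<noteq> 0})" using z z' by (simp add: dsum_cpt)
      then have "finite {i. sec (z + z') i \<noteq> 0}"
        by (rule rev_finite_subset) auto
      then show "z + z' \<in> cpt (dsum I Y) n" using z z' Y by (simp add: dsum_cpt)
    next
      fix c z assume z: "z \<in> cpt (dsum I Y) n"
      show "fscale c z \<in> cpt (dsum I Y) n" using z Y fin[of z "fscale c z"] by (simp add: dsum_cpt)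
    qed (simp add: dsum_cpt Y)
  next
    fix n z assume z: "z \<in> cpt (dsum I Y) n"
    show "dif (dsum I Y) n z \<in> cpt (dsum I Y) (n + 1)"
      using z Y fin[of z "dif (dsum I Y) n z"] by (simp add: dsum_cpt)
    show "tact (dsum I Y) n z \<in> cpt (dsum I Y) (n - 1)"
      using z Y fin[of z "tact (dsum I Y) n z"] by (simp add: dsum_cpt)
    show "dif (dsum I Y) n (fscale c z) = fscale c (dif (dsum I Y) n z)" for c
      by (rule sec_ext) (use z Y in \<open>simp add: dsum_cpt\<close>)
    show "tact (dsum I Y) n (fscale c z) = fscale c (tact (dsum I Y) n z)" for c
      by (rule sec_ext) (use z Y in \<open>simp add: dsum_cpt\<close>)
    show "dif (dsum I Y) (n + 1) (dif (dsum I Y) n z) = 0"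
      by (rule sec_ext) (use z Y in \<open>simp add: dsum_cpt\<close>)
    show "dif (dsum I Y) (n - 1) (tact (dsum I Y) n z) = tact (dsum I Y) (n + 1) (dif (dsum I Y) n z)"
      by (rule sec_ext) (use z Y in \<open>simp add: dsum_cpt\<close>)
    fix z' assume z': "z' \<in> cpt (dsum I Y) n"
    show "dif (dsum I Y) n (z + z') = dif (dsum I Y) n z + dif (dsum I Y) n z'"
      by (rule sec_ext) (use z z' Y in \<open>simp add: dsum_cpt\<close>)
    show "tact (dsum I Y) n (z + z') = tact (dsum I Y) n z + tact (dsum I Y) n z'"
      by (rule sec_ext) (use z z' Y in \<open>simp add: dsum_cpt\<close>)
  qed
qed

context
  fixes I :: "'i set" and Y :: "'i \<Rightarrow> ('k::field, 'w) dgm"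
  assumes Y: "\<forall>i\<in>I. dg_module (Y i)"
begin

lemma dsum_incl_hom:
  assumes "i \<in> I" shows "dsum_incl i \<in> dg_hom (Y i) (dsum I Y)"
proof (rule dg_homI)
  show "dsum_incl i n x \<in> cpt (dsum I Y) n" if "x \<in> cpt (Y i) n" for n x
    using that Y assms by (simp add: dsum_cpt)
qed (use assms Y in \<open>auto intro!: sec_ext\<close>)

lemma dsum_proj_hom:
  assumes "i \<in> I" shows "(\<lambda>n z. sec z i) \<in> dg_hom (dsum I Y) (Y i)"
  by (rule dg_homI) (use assms in \<open>simp_all add: dsum_cpt\<close>)

lemma dsum_cocycle_iff:
  "z \<in> cocycles (dsum I Y) n \<longleftrightarrow> z \<in> cpt (dsum I Y) n \<and> (\<forall>i\<in>I. sec z i \<in> cocycles (Y i) n)"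
proof
  assume z: "z \<in> cocycles (dsum I Y) n"
  then have "sec z i \<in> cocycles (Y i) n" if "i \<in> I" for i
    using hom_cocycle[OF dsum_proj_hom[OF that] dg_module_dsum[OF Y] z] by simp
  then show "z \<in> cpt (dsum I Y) n \<and> (\<forall>i\<in>I. sec z i \<in> cocycles (Y i) n)" using z by simp
next
  assume z: "z \<in> cpt (dsum I Y) n \<and> (\<forall>i\<in>I. sec z i \<in> cocycles (Y i) n)"
  have "dif (dsum I Y) n z = 0" by (rule sec_ext) (use z in simp)
  then show "z \<in> cocycles (dsum I Y) n" using z by (simp add: cocycles_mem del: cocycle_cpt cocycle_dif)
qed

text \<open>Primitives are chosen summand by summand, taking 0 wherever the section is 0, so that
  the family of primitives again has finite support.\<close>

lemma dsum_cob:
  assumes z: "z \<in> cpt (dsum I Y) n" and cob: "\<And>i. i \<in> I \<Longrightarrow> sec z i \<in> coboundaries (Y i) n"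
  shows "z \<in> coboundaries (dsum I Y) n"
proof -
  have "\<exists>w. w \<in> cpt (Y i) (n - 1) \<and> sec z i = dif (Y i) (n - 1) w \<and> (sec z i = 0 \<longrightarrow> w = 0)" if "i \<in> I" for i
  proof (cases "sec z i = 0")
    case True
    then show ?thesis using bspec[OF Y that] by (intro exI[of _ 0]) simp
  next
    case False
    then show ?thesis using cob[OF that] by (auto simp: coboundary_iff)
  qed
  then obtain w where w: "\<And>i. i \<in> I \<Longrightarrow> w i \<in> cpt (Y i) (n - 1)" "\<And>i. i \<in> I \<Longrightarrow> sec z i = dif (Y i) (n - 1) (w i)"
    "\<And>i. i \<in> I \<Longrightarrow> sec z i = 0 \<Longrightarrow> w i = 0" by metis
  define v where "v = (\<lambda>(i, u). if i \<in> I then w i u else 0)"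
  have v: "sec v i = (if i \<in> I then w i else 0)" for i
    by (auto simp: v_def sec_def fun_eq_iff pointwise)
  have "finite {i. sec v i \<noteq> 0}"
    by (rule finite_subset[of _ "{i. sec z i \<noteq> 0}"]) (use w(3) z in \<open>auto simp: v dsum_cpt\<close>)
  then have "v \<in> cpt (dsum I Y) (n - 1)" using w(1) by (simp add: dsum_cpt v)
  moreover have "z = dif (dsum I Y) (n - 1) v"
    by (rule sec_ext) (use w(2) z in \<open>simp add: v dsum_cpt\<close>)
  ultimately show ?thesis by (simp add: coboundary_iff) blast
qed

lemma dsum_decomp:
  assumes z: "z \<in> cpt (dsum I Y) n" and S: "finite S" "\<And>i. sec z i \<noteq> 0 \<Longrightarrow> i \<in> S"
  shows "z = (\<Sum>i\<in>S. dsum_incl i n (sec z i))"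
proof (rule sec_ext)
  fix i
  have "(\<Sum>j\<in>S. if i = j then sec z j else 0) = (if i \<in> S then sec z i else 0)"
    using S(1) by (rule sum.delta')
  then show "sec z i = sec (\<Sum>i\<in>S. dsum_incl i n (sec z i)) i"
    using S(2)[of i] by (auto simp: sec_sum)
qed

lemma coh_zero_dsum:
  assumes "\<And>i. i \<in> I \<Longrightarrow> coh_zero (Y i) n" shows "coh_zero (dsum I Y) n"
  unfolding coh_zero_def
proof
  fix z assume "z \<in> cocycles (dsum I Y) n"
  then have z: "z \<in> cpt (dsum I Y) n" "\<And>i. i \<in> I \<Longrightarrow> sec z i \<in> cocycles (Y i) n" by (simp_all add: dsum_cocycle_iff)
  show "z \<in> coboundaries (dsum I Y) n"
    by (rule dsum_cob[OF z(1)]) (use assms z(2) in \<open>simp add: coh_zero_def\<close>)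
qed

lemma coh_dep_dsum:
  assumes I: "finite I" and dep: "\<And>i. i \<in> I \<Longrightarrow> coh_dep (Y i) n" shows "coh_dep (dsum I Y) n"
proof -
  let ?D = "dsum I Y"
  have D: "dg_module ?D" by (rule dg_module_dsum[OF Y])
  \<comment> \<open>Cocycles whose sections over J are coboundaries. Enlarging J one index at a time
    cuts down by a finite-dimensional amount, and U of all of I consists of coboundaries.\<close>
  define U where "U J = {z \<in> cocycles ?D n. \<forall>i\<in>J. sec z i \<in> coboundaries (Y i) n}" for J
  have "\<exists>m. dep_mod (cocycles ?D n) (U J) m" if "finite J" "J \<subseteq> I" for J
    using that
  proof (induction J rule: finite_induct)
    case empty
    have "dep_mod (cocycles ?D n) (U {}) 1"
      by (rule dep_modI, rule exI[of _ "\<lambda>_. 1"]) (simp add: U_def)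
    then show ?case by blast
  next
    case (insert i J)
    then obtain m where m: "dep_mod (cocycles ?D n) (U J) m" by blast
    have i: "i \<in> I" using insert by simp
    obtain k where k: "dep_mod (cocycles (Y i) n) (coboundaries (Y i) n) k"
      using dep[OF i] unfolding coh_dep_def by blast
    have "dep_mod (U J) (U (insert i J)) k"
    proof (rule dep_modI)
      fix z assume z: "\<And>j. j < k \<Longrightarrow> z j \<in> U J"
      have zc: "z j \<in> cocycles ?D n" if "j < k" for j using z[OF that] by (simp add: U_def)
      have s: "sec (z j) l \<in> cocycles (Y l) n" if "j < k" "l \<in> I" for j l
        using zc[OF that(1)] that(2) by (simp add: dsum_cocycle_iff)
      obtain c j where c: "j < k" "c j \<noteq> 0" "(\<Sum>j<k. fscale (c j) (sec (z j) i)) \<in> coboundaries (Y i) n"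
        by (rule dep_modE[OF k, of "\<lambda>j. sec (z j) i"]) (use s i in blast)
      let ?s = "\<Sum>j<k. fscale (c j) (z j)"
      have sec: "sec ?s l = (\<Sum>j<k. fscale (c j) (sec (z j) l))" for l by (simp add: sec_sum)
      have "?s \<in> cocycles ?D n" by (rule cocycle_lincomb[OF D zc])
      moreover have "sec ?s l \<in> coboundaries (Y l) n" if "l \<in> J" for l
      proof -
        have l: "l \<in> I" using insert that by blast
        show ?thesis unfolding sec
          by (rule fvec.subspace_sum[OF coboundaries_subspace[OF bspec[OF Y l]]]) (use z that bspec[OF Y l] in \<open>simp add: U_def\<close>)
      qed
      ultimately have "?s \<in> U (insert i J)" using c(3) unfolding U_def sec[symmetric] by simp
      then show "\<exists>c. (\<exists>j<k. c j \<noteq> 0) \<and> (\<Sum>j<k. fscale (c j) (z j)) \<in> U (insert i J)" using c(1,2) by blast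
    qed
    then show ?case using dep_mod_trans[OF m] by blast
  qed
  from this[OF I subset_refl] obtain m where m: "dep_mod (cocycles ?D n) (U I) m" by blast
  have "U I \<subseteq> coboundaries ?D n" unfolding U_def using dsum_cob by (auto simp: dsum_cocycle_iff)
  then have "dep_mod (cocycles ?D n) (coboundaries ?D n) m" using m unfolding dep_mod_def by blast
  then show ?thesis unfolding coh_dep_def by blast
qed

lemma tact_bij_dsum:
  assumes bij: "\<And>i. i \<in> I \<Longrightarrow> tact_bij (Y i) n" shows "tact_bij (dsum I Y) n"
proof (rule tact_bijI)
  fix z assume z: "z \<in> cocycles (dsum I Y) (n + 1)" and c: "tact (dsum I Y) (n + 1) z \<in> coboundaries (dsum I Y) n"
  show "z \<in> coboundaries (dsum I Y) (n + 1)"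
  proof (rule dsum_cob)
    fix i assume i: "i \<in> I"
    have "tact (Y i) (n + 1) (sec z i) \<in> coboundaries (Y i) n"
      using hom_cob[OF dsum_proj_hom[OF i] c] i by simp
    then show "sec z i \<in> coboundaries (Y i) (n + 1)"
      by (rule tact_bij_inj[OF bij[OF i], rotated]) (use z i in \<open>simp_all add: dsum_cocycle_iff\<close>)
  qed (use z in simp)
next
  fix y assume y: "y \<in> cocycles (dsum I Y) n"
  have "\<exists>w. w \<in> cocycles (Y i) (n + 1) \<and> sec y i - tact (Y i) (n + 1) w \<in> coboundaries (Y i) n \<and> (sec y i = 0 \<longrightarrow> w = 0)"
    if i: "i \<in> I" for i
  proof (cases "sec y i = 0")
    case True
    then show ?thesis using bspec[OF Y i] by (intro exI[of _ 0]) simp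
  next
    case False
    have "sec y i \<in> cocycles (Y i) n" using y i by (simp add: dsum_cocycle_iff)
    then show ?thesis using False tact_bij_surj[OF bij[OF i]] by metis
  qed
  then obtain w where w: "\<And>i. i \<in> I \<Longrightarrow> w i \<in> cocycles (Y i) (n + 1)"
    "\<And>i. i \<in> I \<Longrightarrow> sec y i - tact (Y i) (n + 1) (w i) \<in> coboundaries (Y i) n"
    "\<And>i. i \<in> I \<Longrightarrow> sec y i = 0 \<Longrightarrow> w i = 0" by metis
  define v where "v = (\<lambda>(i, u). if i \<in> I then w i u else 0)"
  have v: "sec v i = (if i \<in> I then w i else 0)" for i
    by (auto simp: v_def sec_def fun_eq_iff pointwise)
  have "finite {i. sec v i \<noteq> 0}"
    by (rule finite_subset[of _ "{i. sec y i \<noteq> 0}"])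
      (use w(3) cocycle_cpt[OF y] in \<open>auto simp: v dsum_cpt\<close>)
  then have vc: "v \<in> cocycles (dsum I Y) (n + 1)" using w(1) by (simp add: dsum_cocycle_iff dsum_cpt v)
  have "y - tact (dsum I Y) (n + 1) v \<in> coboundaries (dsum I Y) n"
  proof (rule dsum_cob)
    show "y - tact (dsum I Y) (n + 1) v \<in> cpt (dsum I Y) n"
      using y vc dg_module_dsum[OF Y] by simp
    show "sec (y - tact (dsum I Y) (n + 1) v) i \<in> coboundaries (Y i) n" if "i \<in> I" for i
      using w(2)[OF that] that by (simp add: v)
  qed
  then show "\<exists>z\<in>cocycles (dsum I Y) (n + 1). y - tact (dsum I Y) (n + 1) z \<in> coboundaries (dsum I Y) n"
    by (rule bexI[OF _ vc])
qed

lemma artinian_dsum: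
  assumes I: "finite I" and art: "\<And>i. i \<in> I \<Longrightarrow> artinian (Y i)" shows "artinian (dsum I Y)"
proof -
  have "\<exists>N. \<forall>n. (n < - N \<longrightarrow> coh_zero (Y i) n) \<and> coh_dep (Y i) n \<and> (n \<ge> N \<longrightarrow> tact_bij (Y i) n)" if "i \<in> I" for i
    using art[OF that] unfolding artinian_def .
  then obtain N where N: "\<And>i. i \<in> I \<Longrightarrow> \<forall>n. (n < - N i \<longrightarrow> coh_zero (Y i) n) \<and> coh_dep (Y i) n \<and> (n \<ge> N i \<longrightarrow> tact_bij (Y i) n)"
    by metis
  define L where "L = Max (insert 0 (N ` I))"
  have L: "N i \<le> L" if "i \<in> I" for i using I that by (simp add: L_def)
  show ?thesis
  proof (rule artinianI[of L])
    fix n assume n: "n < - L"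
    show "coh_zero (dsum I Y) n"
    proof (rule coh_zero_dsum)
      fix i assume i: "i \<in> I"
      show "coh_zero (Y i) n" using N[OF i] L[OF i] n by simp
    qed
  next
    show "coh_dep (dsum I Y) n" for n by (rule coh_dep_dsum[OF I]) (use N in blast)
  next
    fix n assume n: "n \<ge> L"
    show "tact_bij (dsum I Y) n"
    proof (rule tact_bij_dsum)
      fix i assume i: "i \<in> I"
      show "tact_bij (Y i) n" using N[OF i] L[OF i] n by simp
    qed
  qed
qed

end

text \<open>Inverting the isomorphism hidden in \<open>is_dsum\<close> gives coordinates p on B in
  which the inclusions are the standard ones. The maps \<iota> are prescribed only on components,
  where they agree with chain maps, which suffices for \<open>dg_hom\<close>.\<close>

lemma is_dsumE:
  assumes "is_dsum I Y B \<iota>" and Y: "\<forall>i\<in>I. dg_module (Y i)"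
  obtains p where "dg_module B" "\<And>i. i \<in> I \<Longrightarrow> \<iota> i \<in> dg_hom (Y i) B" "p \<in> dg_iso B (dsum I Y)"
    "\<And>i n x. i \<in> I \<Longrightarrow> x \<in> cpt (Y i) n \<Longrightarrow> p n (\<iota> i n x) = dsum_incl i n x"
proof -
  have B: "dg_module B" using assms(1) by (simp add: is_dsum_def)
  have D: "dg_module (dsum I Y)" by (rule dg_module_dsum[OF Y])
  obtain j where j: "j \<in> dg_iso (dsum I Y) B" and \<iota>: "\<And>i n x. i \<in> I \<Longrightarrow> x \<in> cpt (Y i) n \<Longrightarrow> \<iota> i n x = j n (dsum_incl i n x)"
    using assms(1) unfolding is_dsum_def by blast
  obtain p where p: "p \<in> dg_iso B (dsum I Y)" "\<And>i x. x \<in> cpt (dsum I Y) i \<Longrightarrow> p i (j i x) = x"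
    using dg_iso_inverse[OF j D] by metis
  have pi: "p n (\<iota> i n x) = dsum_incl i n x" if "i \<in> I" "x \<in> cpt (Y i) n" for i n x
    unfolding \<iota>[OF that] by (rule p(2)[OF hom_mem[OF dsum_incl_hom[OF Y that(1)] that(2)]])
  have "\<iota> i \<in> dg_hom (Y i) B" if i: "i \<in> I" for i
  proof -
    have h: "gcomp j (dsum_incl i) \<in> dg_hom (Y i) B"
      by (rule gcomp_hom[OF dsum_incl_hom[OF Y i] dg_iso_hom[OF j]])
    note Yi = bspec[OF Y i]
    show ?thesis
    proof (rule dg_homI)
      fix n x assume x: "x \<in> cpt (Y i) n"
      note \<iota>' = \<iota>[OF i]
      show "\<iota> i (n - 1) (tact (Y i) n x) = tact B n (\<iota> i n x)"
        using hom_tact[OF h x refl] \<iota>'[OF x] \<iota>'[OF tact_mem[OF Yi x refl]] by simp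
      show "\<iota> i (n + 1) (dif (Y i) n x) = dif B n (\<iota> i n x)"
        using hom_dif[OF h x refl] \<iota>'[OF x] \<iota>'[OF dif_mem[OF Yi x refl]] by simp
      show "\<iota> i n x \<in> cpt B n" using hom_mem[OF h x] \<iota>'[OF x] by simp
      show "\<iota> i n (fscale d x) = fscale d (\<iota> i n x)" for d
        using hom_scale[OF h x] \<iota>'[OF x] \<iota>'[OF cpt_scale[OF Yi x]] by simp
      show "\<iota> i n (x + y) = \<iota> i n x + \<iota> i n y" if y: "y \<in> cpt (Y i) n" for y
        using hom_add[OF h x y] \<iota>'[OF x] \<iota>'[OF y] \<iota>'[OF cpt_add[OF Yi x y]] by simp
    qed
  qed
  then show thesis using that B p(1) pi by blast
qed

lemma is_dsum_push:
  fixes Y :: "'i \<Rightarrow> ('k::field, 'u) dgm"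
  assumes Y: "\<forall>i\<in>I. dg_module (Y i)" and e: "inj e"
  shows "is_dsum I Y (push e (dsum I Y)) (\<lambda>i n x. enc e (dsum_incl i n x))"
proof -
  note D = dg_module_dsum[OF Y]
  show ?thesis unfolding is_dsum_def
    by (intro conjI bexI[of _ "\<lambda>i. enc e"] dg_module_push[OF e] D dg_iso_push(1)[OF e]) simp_all
qed

lemma artinian_is_dsum:
  assumes B: "is_dsum I Y B \<iota>" and Y: "\<forall>i\<in>I. dg_module (Y i)" and I: "finite I"
    and art: "\<And>i. i \<in> I \<Longrightarrow> artinian (Y i)"
  shows "artinian B"
  using B
proof (rule is_dsumE)
  fix p assume B: "dg_module B" and p: "p \<in> dg_iso B (dsum I Y)"
  have D: "dg_module (dsum I Y)" by (rule dg_module_dsum[OF Y])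
  show ?thesis using artinian_quasi_iso[OF B D dg_iso_quasi_iso[OF p B D]] artinian_dsum[OF Y I art] by blast
qed (rule Y)

text \<open>Inclusion followed by the coordinate projection is the identity, so a summand is a
  strict retract.\<close>

lemma artinian_summand:
  assumes P: "is_dsum UNIV Y P \<iota>" and Y: "\<forall>i\<in>UNIV. dg_module (Y i)" and art: "artinian P"
  shows "artinian (Y i)"
  using P
proof (rule is_dsumE)
  fix p assume P: "dg_module P" and \<iota>: "\<And>i. i \<in> UNIV \<Longrightarrow> \<iota> i \<in> dg_hom (Y i) P" and p: "p \<in> dg_iso P (dsum UNIV Y)"
    and pi: "\<And>i n x. i \<in> UNIV \<Longrightarrow> x \<in> cpt (Y i) n \<Longrightarrow> p n (\<iota> i n x) = dsum_incl i n x"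
  have s: "gcomp (\<lambda>n z. sec z i) p \<in> dg_hom P (Y i)"
    by (rule gcomp_hom[OF dg_iso_hom[OF p] dsum_proj_hom]) (simp_all add: Y)
  show ?thesis
    by (rule artinian_retract[OF bspec[OF Y UNIV_I] P \<iota>[OF UNIV_I] s _ art]) (simp_all add: pi)
qed (rule Y)

text \<open>The chain is: finite sum of members of S, isomorphism in the derived category, direct
  summand. The Artinian condition survives each link.\<close>

lemma artinian_add_closure:
  fixes S :: "('k::field, 'u::infinite) dgm set"
  assumes S: "\<And>X. X \<in> S \<Longrightarrow> dg_module X \<and> artinian X" and X: "X \<in> add_closure S"
  shows "dg_module X \<and> artinian X"
proof -
  obtain X' P \<iota> n A B \<kappa> where X: "dg_module X" and X': "dg_module X'"
    and P: "is_dsum UNIV (\<lambda>b. if b then X else X') P \<iota>" and A: "\<And>i. i < n \<Longrightarrow> A i \<in> S"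
    and B: "is_dsum {..<(n::nat)} A B \<kappa>" and iso: "isomorphic_D P B"
    using X unfolding add_closure_def by blast
  obtain \<phi> where \<phi>: "\<phi> \<in> D_iso P B" using iso by (auto simp: isomorphic_D_def)
  have "artinian B" by (rule artinian_is_dsum[OF B]) (use A S in auto)
  moreover have Pm: "dg_module P" and Bm: "dg_module B" using P B by (simp_all add: is_dsum_def)
  ultimately have "artinian P" using artinian_isomorphic_D[OF Pm Bm \<phi>] by blast
  then have "artinian (if True then X else X')" by (intro artinian_summand[OF P]) (simp_all add: X X')
  then show ?thesis using X by simp
qed

section \<open>The generators have Artinian cohomology\<close>

section \<open>Cohomology of the generators\<close>

text \<open>For subspaces, the assertion that the quotient has dimension at most one, in a form
  convenient for pairs of cocycles.\<close>

lemma dep_mod_2: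
  fixes Z V :: "('u \<Rightarrow> 'k::field) set"
  shows "dep_mod Z V 2 \<longleftrightarrow> (\<forall>x\<in>Z. \<forall>y\<in>Z. \<exists>a b. (a \<noteq> 0 \<or> b \<noteq> 0) \<and> fscale a x + fscale b y \<in> V)"
proof
  assume d: "dep_mod Z V 2"
  show "\<forall>x\<in>Z. \<forall>y\<in>Z. \<exists>a b. (a \<noteq> 0 \<or> b \<noteq> 0) \<and> fscale a x + fscale b y \<in> V"
  proof (intro ballI)
    fix x y assume "x \<in> Z" "y \<in> Z"
    then obtain c j where c: "j < 2" "c j \<noteq> 0" "(\<Sum>j<2. fscale (c j) (if j = (0::nat) then x else y)) \<in> V"
      by (auto intro: dep_modE[OF d, of "\<lambda>j. if j = 0 then x else y"])
    have "c 0 \<noteq> 0 \<or> c 1 \<noteq> 0" using c(1,2) by (cases "j = 0") (auto simp: less_2_cases_iff)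
    then show "\<exists>a b. (a \<noteq> 0 \<or> b \<noteq> 0) \<and> fscale a x + fscale b y \<in> V"
      using c(3) by (intro exI[of _ "c 0"] exI[of _ "c 1"]) (simp add: numeral_2_eq_2)
  qed
next
  assume d: "\<forall>x\<in>Z. \<forall>y\<in>Z. \<exists>a b. (a \<noteq> 0 \<or> b \<noteq> 0) \<and> fscale a x + fscale b y \<in> V"
  show "dep_mod Z V 2"
  proof (rule dep_modI)
    fix z :: "nat \<Rightarrow> 'u \<Rightarrow> 'k" assume z: "\<And>j. j < 2 \<Longrightarrow> z j \<in> Z"
    have z01: "z 0 \<in> Z" "z 1 \<in> Z" using z[of 0] z[of 1] by simp_all
    obtain a b where ab: "a \<noteq> 0 \<or> b \<noteq> 0" "fscale a (z 0) + fscale b (z 1) \<in> V"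
      using bspec[OF bspec[OF d z01(1)] z01(2)] by (elim exE conjE) (rule that)
    let ?c = "\<lambda>j::nat. if j = 0 then a else b"
    have "?c (if a = 0 then 1 else 0) \<noteq> 0" "(if a = 0 then 1 else 0) < (2::nat)" using ab(1) by simp_all
    then have "\<exists>j<2. ?c j \<noteq> 0" by blast
    moreover have "(\<Sum>j<2. fscale (?c j) (z j)) \<in> V"
      using ab(2) by (simp add: numeral_2_eq_2)
    ultimately show "\<exists>c. (\<exists>j<2. c j \<noteq> 0) \<and> (\<Sum>j<2. fscale (c j) (z j)) \<in> V"
      by (intro exI[of _ ?c] conjI)
  qed
qed

text \<open>A function supported at the single exponent - i has finite support, so it is the
  coefficient function of a polynomial automatically.\<close>

lemma dg_R_cpt: "x \<in> cpt dg_R i \<longleftrightarrow> (\<forall>n. x n \<noteq> 0 \<longrightarrow> int n = - i)"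
proof
  assume "x \<in> cpt dg_R i" then show "\<forall>n. x n \<noteq> 0 \<longrightarrow> int n = - i" by (auto simp: dg_R_def)
next
  assume x: "\<forall>n. x n \<noteq> 0 \<longrightarrow> int n = - i"
  have "x n = 0" if "n > nat (- i)" for n using x[rule_format, of n] that by (cases "x n = 0") auto
  then have "\<forall>\<^sub>\<infinity>n. x n = 0" unfolding MOST_nat by blast
  then have "coeff (Abs_poly x) = x" by (simp add: Abs_poly_inverse)
  then show "x \<in> cpt dg_R i" using x by (auto simp: dg_R_def intro!: exI[of _ "Abs_poly x"])
qed

lemma mult_T_app:
  assumes "x \<in> cpt dg_R i" shows "mult_T m x k = (if k < m then 0 else x (k - m))"
proof -
  obtain p where p: "x = coeff p" using assms by (auto simp: dg_R_def)
  have "mult_T m x = coeff (monom 1 m * p)" by (simp add: mult_T_def p coeff_inverse mult.commute)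
  then show ?thesis by (simp add: p coeff_monom_mult)
qed

lemma mult_T_cpt:
  assumes "x \<in> cpt dg_R (i + int m)" shows "mult_T m x \<in> cpt dg_R i"
  unfolding dg_R_cpt mult_T_app[OF assms]
proof (intro allI impI)
  fix n assume "(if n < m then 0 else x (n - m)) \<noteq> 0"
  then have n: "\<not> n < m" "x (n - m) \<noteq> 0" by (simp_all split: if_splits)
  then have "int (n - m) = - (i + int m)" using assms unfolding dg_R_cpt by blast
  then show "int n = - i" using n(1) by simp
qed

lemma dg_R_sel [simp]: "dif dg_R i x = 0" "tact dg_R i = mult_T 1"
  by (simp_all add: dg_R_def zero_fun_def)

lemma dg_module_dg_R: "dg_module (dg_R :: ('k::field, nat) dgm)"
proof (rule dg_moduleI)
  have sub: "fvec.subspace (cpt (dg_R :: ('k, nat) dgm) i)" for i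
    by (rule subspaceI; unfold dg_R_cpt) (auto simp: pointwise fscale_def, metis add_0)
  then show "fvec.subspace (cpt (dg_R :: ('k, nat) dgm) i)" for i .
  fix i :: int and x :: "nat \<Rightarrow> 'k" assume x: "x \<in> cpt dg_R i"
  show "tact dg_R i x \<in> cpt dg_R (i - 1)" using mult_T_cpt[of x "i - 1" 1] x by simp
  show "tact dg_R i (fscale c x) = fscale c (tact dg_R i x)" for c
    using fvec.subspace_scale[OF sub x, of c] x by (auto simp: fun_eq_iff mult_T_app fscale_def)
  show "tact dg_R i (x + y) = tact dg_R i x + tact dg_R i y" if y: "y \<in> cpt dg_R i" for y
    using fvec.subspace_add[OF sub x y] x y by (auto simp: fun_eq_iff mult_T_app pointwise)
  have "0 \<in> cpt (dg_R :: ('k, nat) dgm) (i + 1)" by (rule fvec.subspace_0[OF sub])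
  then show "dif dg_R (i - 1) (tact dg_R i x) = tact dg_R (i + 1) (dif dg_R i x)"
    by (auto simp: fun_eq_iff mult_T_app pointwise)
qed (auto simp: dg_R_cpt pointwise)

text \<open>The differential of R vanishes and multiplication by T^(n+1) is injective, so by the
  long exact sequence every class of X lifts to R and classes divisible by T^(n+1) become zero. The
  four claims are read off from k[T]/(T^(n+1)), which lives in degrees -n to 0.\<close>

lemma is_X_coh:
  fixes X :: "('k::field, 'u::infinite) dgm"
  assumes "is_X n X"
  shows "dg_module X" and "i > 0 \<or> i < - int n \<Longrightarrow> coh_zero X i"
    and "dep_mod (cocycles X i) (coboundaries X i) 2"
    and "i \<le> 0 \<Longrightarrow> z \<in> cocycles X (i - 1) \<Longrightarrow> \<exists>z'\<in>cocycles X i. z - tact X i z' \<in> coboundaries X (i - 1)"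
proof -
  let ?s = "int n + 1"
  obtain P :: "('k, 'u) dgm" and \<rho> \<tau> \<psi> \<chi> where P: "dg_module P" and \<rho>: "\<rho> \<in> dg_iso dg_R P" and \<tau>: "\<tau> \<in> dg_hom (shift ?s P) P"
    and \<tau>\<rho>: "\<And>i x. x \<in> cpt dg_R (i + ?s) \<Longrightarrow> \<tau> i (\<rho> (i + ?s) x) = \<rho> i (mult_T (n + 1) x)"
    and tri: "dist_triangle (shift ?s P) P X (D_of (shift ?s P) P \<tau>) \<psi> \<chi>"
    using assms unfolding is_X_def by blast
  note R = dg_module_dg_R and \<rho>' = dg_iso_hom[OF \<rho>]
  have X: "dg_module X" and \<psi>: "\<psi> \<in> D_hom P X" using tri by (simp_all add: dist_triangle_def)
  show "dg_module X" by (rule X)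
  let ?S = "shift ?s P"
  have S: "dg_module ?S" using P by simp
  have el: "\<exists>x\<in>cpt dg_R i. y = \<rho> i x" if "y \<in> cpt P i" for y i
  proof -
    have "bij_betw (\<rho> i) (cpt dg_R i) (cpt P i)" using \<rho> by (simp add: dg_iso_def)
    then show ?thesis using that by (auto simp: bij_betw_def)
  qed
  have \<rho>0: "x = 0" if "x \<in> cpt dg_R i" "\<rho> i x = 0" for x i
  proof -
    have "inj_on (\<rho> i) (cpt dg_R i)" using \<rho> by (simp add: dg_iso_def bij_betw_def)
    moreover have "\<rho> i x = \<rho> i 0" using that(2) hom_zero[OF \<rho>' R, of i] by simp
    ultimately show ?thesis by (rule inj_onD[OF _ _ that(1) cpt_zero[OF R]])
  qed
  have dP: "dif P i y = 0" if y: "y \<in> cpt P i" for y i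
  proof -
    obtain x where x: "x \<in> cpt dg_R i" "y = \<rho> i x" using el[OF y] by blast
    show ?thesis using hom_dif[OF \<rho>' x(1) refl] hom_zero[OF \<rho>' R] by (simp add: x(2))
  qed
  have cobP: "y \<in> coboundaries P i \<longleftrightarrow> y = 0" for y i
    using dP[of _ "i - 1"] P by (auto elim: coboundaryE)
  have cocP: "y \<in> cocycles P i \<longleftrightarrow> y \<in> cpt P i" for y i
    using dP by (auto simp: cocycles_mem simp del: cocycle_cpt cocycle_dif)
  have \<tau>inj: "y = 0" if y: "y \<in> cpt P (i + ?s)" and 0: "\<tau> i y = 0" for y i
  proof -
    obtain x where x: "x \<in> cpt dg_R (i + ?s)" "y = \<rho> (i + ?s) x" using el[OF y] by blast
    have m: "mult_T (n + 1) x \<in> cpt dg_R i" using mult_T_cpt[of x i "n + 1"] x(1) by (simp add: algebra_simps)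
    have "mult_T (n + 1) x = 0" by (rule \<rho>0[OF m]) (use \<tau>\<rho>[OF x(1)] 0 x(2) in simp)
    then have "mult_T (n + 1) x (k + (n + 1)) = 0" for k by (simp add: pointwise)
    then have "x = 0" unfolding mult_T_app[OF x(1)] by (auto simp: fun_eq_iff pointwise)
    then show ?thesis using x(2) hom_zero[OF \<rho>' R] by simp
  qed
  have inj: "x \<in> coboundaries ?S i" if "D_coh ?S P (D_of ?S P \<tau>) i x y" "y \<in> coboundaries P i" for i x y
  proof -
    have x: "x \<in> cpt P (i + ?s)" "\<tau> i x = 0"
      using that P unfolding D_coh_of[OF S P \<tau>] by (simp_all add: cobP cocP)
    have "x = 0" by (rule \<tau>inj[OF x])
    then show ?thesis using P by simp
  qed
  have surj: "\<exists>y. D_coh P X \<psi> i y z" if "z \<in> cocycles X i" for i z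
    by (rule dist_triangle_coh(1)[OF tri _ that]) (erule (1) inj)
  have comp: "z \<in> coboundaries X i" if "D_coh ?S P (D_of ?S P \<tau>) i x y" "D_coh P X \<psi> i y z" for i x y z
    by (rule dist_triangle_coh(2)[OF tri _ that]) (erule (1) inj)
  show "coh_zero X i" if i: "i > 0 \<or> i < - int n"
    unfolding coh_zero_def
  proof
    fix z assume "z \<in> cocycles X i"
    from surj[OF this] obtain y where y: "D_coh P X \<psi> i y z" by blast
    then have yP: "y \<in> cpt P i" using D_coh_cocycles(1)[OF y] by simp
    then obtain x where x: "x \<in> cpt dg_R i" "y = \<rho> i x" using el by blast
    show "z \<in> coboundaries X i"
    proof (cases "i > 0")
      case True
      have "x = 0" using x(1) True unfolding dg_R_cpt by (auto simp: fun_eq_iff pointwise)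
      then have "y \<in> coboundaries P i" using x(2) hom_zero[OF \<rho>' R] P by simp
      then show ?thesis by (rule D_coh_cob[OF P X \<psi> y])
    next
      case False
      then have i: "i < - int n" using i by simp
      \<comment> \<open>In degree i < -n the only possible monomial is T^(-i) with -i > n, so x is
        T^(n+1) times x'. It lies in the image of \<tau> and dies in X.\<close>
      define x' where "x' = (\<lambda>k. x (k + (n + 1)))"
      have x': "x' \<in> cpt dg_R (i + ?s)" unfolding dg_R_cpt
      proof (intro allI impI)
        fix k assume "x' k \<noteq> 0"
        then have "int (k + (n + 1)) = - i" using x(1) unfolding dg_R_cpt x'_def by blast
        then show "int k = - (i + ?s)" by simp
      qed
      have "x k = 0" if "k < n + 1" for k
      proof (rule ccontr)
        assume "x k \<noteq> 0"
        then have "int k = - i" using x(1) unfolding dg_R_cpt by blast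
        then show False using i that by simp
      qed
      then have "mult_T (n + 1) x' = x" unfolding fun_eq_iff mult_T_app[OF x'] by (simp add: x'_def)
      then have \<tau>y: "\<tau> i (\<rho> (i + ?s) x') = y" using \<tau>\<rho>[OF x'] x(2) by simp
      have "\<rho> (i + ?s) x' \<in> cpt P (i + ?s)" by (rule hom_mem[OF \<rho>' x'])
      then have "D_coh ?S P (D_of ?S P \<tau>) i (\<rho> (i + ?s) x') y"
        unfolding D_coh_of[OF S P \<tau>] using yP P by (simp add: cocP \<tau>y)
      then show ?thesis using comp y by blast
    qed
  qed
  show "dep_mod (cocycles X i) (coboundaries X i) 2"
    unfolding dep_mod_2
  proof (intro ballI)
    fix z1 z2 assume "z1 \<in> cocycles X i" "z2 \<in> cocycles X i"
    from surj[OF this(1)] surj[OF this(2)] obtain y1 y2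
      where y: "D_coh P X \<psi> i y1 z1" "D_coh P X \<psi> i y2 z2" by blast
    obtain x1 where x1: "x1 \<in> cpt dg_R i" "y1 = \<rho> i x1" using el[of y1 i] D_coh_cocycles(1)[OF y(1)] cocP by blast
    obtain x2 where x2: "x2 \<in> cpt dg_R i" "y2 = \<rho> i x2" using el[of y2 i] D_coh_cocycles(1)[OF y(2)] cocP by blast
    \<comment> \<open>The only exponent that can occur in degree i. A linear relation between the
      two coefficients there is a relation between the two polynomials.\<close>
    let ?k = "nat (- i)"
    obtain a b where ab: "a \<noteq> 0 \<or> b \<noteq> 0" "a * x1 ?k + b * x2 ?k = 0"
    proof (cases "x1 ?k = 0")
      case True then show thesis using that[of 1 0] by simp
    next
      case False then show thesis using that[of "x2 ?k" "- x1 ?k"] by simp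
    qed
    have "fscale a x1 + fscale b x2 = 0"
    proof
      fix k
      have "k = ?k" if "x1 k \<noteq> 0" using x1(1) that unfolding dg_R_cpt by force
      moreover have "k = ?k" if "x2 k \<noteq> 0" using x2(1) that unfolding dg_R_cpt by force
      ultimately have "x1 k = 0 \<and> x2 k = 0" if "k \<noteq> ?k" using that by blast
      then show "(fscale a x1 + fscale b x2) k = 0 k"
        using ab(2) by (cases "k = ?k") (simp_all add: pointwise fscale_def)
    qed
    then have "\<rho> i (fscale a x1 + fscale b x2) = 0" using hom_zero[OF \<rho>' R] by simp
    moreover have "\<rho> i (fscale a x1 + fscale b x2) = fscale a y1 + fscale b y2"
      using hom_add[OF \<rho>' cpt_scale[OF R x1(1)] cpt_scale[OF R x2(1)]] hom_scale[OF \<rho>' x1(1)] hom_scale[OF \<rho>' x2(1)]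
      by (simp add: x1(2) x2(2))
    ultimately have "fscale a y1 + fscale b y2 \<in> coboundaries P i" by (simp add: cobP)
    then have "fscale a z1 + fscale b z2 \<in> coboundaries X i"
      by (rule D_coh_cob[OF P X \<psi> D_coh_add[OF P X \<psi> D_coh_scale[OF P X \<psi> y(1)] D_coh_scale[OF P X \<psi> y(2)]]])
    then show "\<exists>a b. (a \<noteq> 0 \<or> b \<noteq> 0) \<and> fscale a z1 + fscale b z2 \<in> coboundaries X i" using ab(1) by blast
  qed
  show "\<exists>z'\<in>cocycles X i. z - tact X i z' \<in> coboundaries X (i - 1)" if i: "i \<le> 0" and z: "z \<in> cocycles X (i - 1)"
  proof -
    from surj[OF z] obtain y where y: "D_coh P X \<psi> (i - 1) y z" by blast
    obtain x where x: "x \<in> cpt dg_R (i - 1)" "y = \<rho> (i - 1) x" using el[of y "i - 1"] D_coh_cocycles(1)[OF y] cocP by blast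
    define x' where "x' = (\<lambda>k. x (k + 1))"
    have x': "x' \<in> cpt dg_R i" unfolding dg_R_cpt
    proof (intro allI impI)
      fix k assume "x' k \<noteq> 0"
      then have "int (k + 1) = - (i - 1)" using x(1) unfolding dg_R_cpt x'_def by blast
      then show "int k = - i" by simp
    qed
    have "x 0 = 0"
    proof (rule ccontr)
      assume "x 0 \<noteq> 0"
      then have "int 0 = - (i - 1)" using x(1) unfolding dg_R_cpt by blast
      then show False using i by simp
    qed
    then have "mult_T 1 x' = x" unfolding fun_eq_iff mult_T_app[OF x'] by (simp add: x'_def)
    then have "y = tact P i (\<rho> i x')" using hom_tact[OF \<rho>' x' refl] x(2) by simp
    moreover have "\<rho> i x' \<in> cocycles P i" unfolding cocP by (rule hom_mem[OF \<rho>' x'])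
    then obtain z' where z': "D_coh P X \<psi> i (\<rho> i x') z'" by (rule D_coh_total[OF P X \<psi>])
    ultimately have "D_coh P X \<psi> (i - 1) y (tact X i z')" using D_coh_tact[OF P X \<psi> z'] by simp
    then have "z - tact X i z' \<in> coboundaries X (i - 1)"
      by (intro D_coh_cob[OF P X \<psi> D_coh_diff[OF P X \<psi> y]]) (simp_all add: cobP)
    then show ?thesis by (rule bexI[OF _ D_coh_cocycles(2)[OF z']])
  qed
qed

lemma is_X_artinian:
  fixes X :: "('k::field, 'u::infinite) dgm"
  assumes "is_X n X" shows "artinian X"
proof (rule artinianI[of "int n + 1"])
  note c = is_X_coh[OF assms]
  show "coh_zero X i" if "i < - (int n + 1)" for i by (rule c(2)) (use that in simp)
  show "coh_dep X i" for i unfolding coh_dep_def using c(3) by blast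
  show "tact_bij X i" if "i \<ge> int n + 1" for i
    by (rule coh_zero_tact_bij[OF c(1) c(2) c(2)]) (use that in simp_all)
qed

text \<open>The assumption that the difference is a morphism guarantees that its class is nonempty,
  which provides representatives of \<phi> and \<psi> with a common left leg. On these the induced
  maps subtract.\<close>

lemma D_coh_minus:
  fixes X Y :: "('k::field, 'u::infinite) dgm"
  assumes X: "dg_module X" and Y: "dg_module Y" and \<phi>: "\<phi> \<in> D_hom X Y" and \<psi>: "\<psi> \<in> D_hom X Y"
    and m: "D_minus X Y \<phi> \<psi> \<in> D_hom X Y" and x: "D_coh X Y \<phi> i x y" "D_coh X Y \<psi> i x y'"
  shows "D_coh X Y (D_minus X Y \<phi> \<psi>) i x (y - y')"
proof -
  obtain c where c: "c \<in> D_minus X Y \<phi> \<psi>"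
    using D_homE[OF X Y m] cls_self[OF X Y] by metis
  then obtain W s f g where f: "\<lparr>apex = W, den = s, num = f\<rparr> \<in> \<phi>" and g: "\<lparr>apex = W, den = s, num = g\<rparr> \<in> \<psi>"
    and rel: "(\<lparr>apex = W, den = s, num = (\<lambda>i x. f i x - g i x)\<rparr>, c) \<in> roof_rel X Y"
    unfolding D_minus_def by blast
  let ?f = "\<lparr>apex = W, den = s, num = f\<rparr>" and ?g = "\<lparr>apex = W, den = s, num = g\<rparr>"
    and ?m = "\<lparr>apex = W, den = s, num = (\<lambda>i x. f i x - g i x)\<rparr>"
  note F = D_hom_mem[OF X Y \<phi> f] and G = D_hom_mem[OF X Y \<psi> g]
  have W: "dg_module W" and s: "s \<in> quasi_iso W X" and f': "f \<in> dg_hom W Y" and g': "g \<in> dg_hom W Y"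
    using roofsD[OF F(1)] roofsD[OF G(1)] by simp_all
  obtain w where w: "x \<in> cocycles X i" "y \<in> cocycles Y i" "w \<in> cocycles W i" "x - s i w \<in> coboundaries X i" "y - f i w \<in> coboundaries Y i"
    using x(1) unfolding F(2) D_coh_cls[OF X Y F(1)] by (rule cohrelE) simp
  obtain v where v: "y' \<in> cocycles Y i" "v \<in> cocycles W i" "x - s i v \<in> coboundaries X i" "y' - g i v \<in> coboundaries Y i"
    using x(2) unfolding G(2) D_coh_cls[OF X Y G(1)] by (rule cohrelE) simp
  have "s i v - s i w \<in> coboundaries X i" by (rule cob_diff_trans[OF X cob_diff_sym[OF X v(3)] w(4)])
  then have "v - w \<in> coboundaries W i" by (rule quasi_iso_diff[OF s W X v(2) w(3)])
  then have "g i v - g i w \<in> coboundaries Y i" by (rule hom_cob_diff[OF g' W cocycle_cpt[OF v(2)] cocycle_cpt[OF w(3)]])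
  then have "y' - g i w \<in> coboundaries Y i" by (rule cob_diff_trans[OF Y v(4)])
  note d = cob_add_cong(2)[OF Y w(5) this]
  have "cohrel X Y ?m i x (y - y')"
    by (rule cohrelI[of _ _ _ _ _ w]) (use w v d Y in simp_all)
  then have "cohrel X Y c i x (y - y')" by (rule cohrel_cong[OF X Y rel])
  then show ?thesis unfolding D_coh_def by (rule bexI[OF _ c])
qed

text \<open>Homotopy colimits along systems with one-dimensional cohomology. No assumption on the transition
  morphisms is needed: if they vanish, then so does the cohomology of the homotopy colimit.\<close>

lemma hocolim_artinian:
  fixes E :: "('k::field, 'u::infinite) dgm"
  assumes E: "is_hocolim Y \<phi> E"
    and z0: "\<And>i d. d < - m \<Longrightarrow> coh_zero (Y i) d"
    and dep: "\<And>i d. dep_mod (cocycles (Y i) d) (coboundaries (Y i) d) 2"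
    and ts: "\<And>i d z. d \<le> int i - m \<Longrightarrow> z \<in> cocycles (Y i) (d - 1) \<Longrightarrow>
      \<exists>z'\<in>cocycles (Y i) d. z - tact (Y i) d z' \<in> coboundaries (Y i) (d - 1)"
  shows "dg_module E" "artinian E"
proof -
  have Y: "dg_module (Y i)" and \<phi>: "\<phi> i \<in> D_hom (Y i) (Y (Suc i))" for i
    using E by (simp_all add: is_hocolim_def)
  obtain B \<iota> \<theta> \<psi> \<chi> where B': "is_dsum UNIV Y B \<iota>" and \<theta>: "\<theta> \<in> D_hom B B"
    and \<theta>\<iota>: "\<And>i. D_comp (Y i) B B \<theta> (D_of (Y i) B (\<iota> i)) =
          D_minus (Y i) B (D_of (Y i) B (\<iota> i))
            (D_comp (Y i) (Y (Suc i)) B (D_of (Y (Suc i)) B (\<iota> (Suc i))) (\<phi> i))"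
    and tri: "dist_triangle B B E \<theta> \<psi> \<chi>"
    using E unfolding is_hocolim_def by blast
  have Em: "dg_module E" and \<psi>: "\<psi> \<in> D_hom B E" using tri by (simp_all add: dist_triangle_def)
  show "dg_module E" by (rule Em)
  have Y': "\<forall>i\<in>UNIV. dg_module (Y i)" using Y by simp
  let ?D = "dsum UNIV Y"
  have D: "dg_module ?D" by (rule dg_module_dsum[OF Y'])
  obtain p where B: "dg_module B" and \<iota>0: "\<And>i. i \<in> UNIV \<Longrightarrow> \<iota> i \<in> dg_hom (Y i) B" and p: "p \<in> dg_iso B ?D"
    and pi0: "\<And>i n x. i \<in> UNIV \<Longrightarrow> x \<in> cpt (Y i) n \<Longrightarrow> p n (\<iota> i n x) = dsum_incl i n x"
    by (rule is_dsumE[OF B' Y']) blast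
  have \<iota>: "\<iota> i \<in> dg_hom (Y i) B" and pi: "x \<in> cpt (Y i) n \<Longrightarrow> p n (\<iota> i n x) = dsum_incl i n x" for i n x
    using \<iota>0 pi0 by simp_all
  note p' = dg_iso_hom[OF p]
  have pinj: "b = b'" if "b \<in> cpt B n" "b' \<in> cpt B n" "p n b = p n b'" for b b' n
  proof -
    have "inj_on (p n) (cpt B n)" using p by (simp add: dg_iso_def bij_betw_def)
    then show ?thesis by (rule inj_onD[OF _ that(3,1,2)])
  qed
  have \<iota>c: "\<iota> i n x \<in> cocycles B n" if "x \<in> cocycles (Y i) n" for i n x
    by (rule hom_cocycle[OF \<iota> Y that])
  have \<iota>of: "D_of (Y i) B (\<iota> i) \<in> D_hom (Y i) B" for i by (rule D_of_hom[OF Y B \<iota>])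
  \<comment> \<open>The defining equation of \<theta>, evaluated on cohomology: the class of x in
    stage i goes to itself minus its image in stage i + 1.\<close>
  have \<theta>step: "D_coh B B \<theta> d (\<iota> i d x) (\<iota> i d x - \<iota> (Suc i) d x')" if x: "D_coh (Y i) (Y (Suc i)) (\<phi> i) d x x'" for i d x x'
  proof -
    have xc: "x \<in> cocycles (Y i) d" "x' \<in> cocycles (Y (Suc i)) d" by (rule D_coh_cocycles[OF x])+
    let ?c = "D_comp (Y i) (Y (Suc i)) B (D_of (Y (Suc i)) B (\<iota> (Suc i))) (\<phi> i)"
    have c: "?c \<in> D_hom (Y i) B" by (rule D_comp_hom[OF Y Y B \<phi> \<iota>of])
    have "D_coh (Y (Suc i)) B (D_of (Y (Suc i)) B (\<iota> (Suc i))) d x' (\<iota> (Suc i) d x')"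
      unfolding D_coh_of[OF Y B \<iota>] using xc \<iota>c B by simp
    then have 2: "D_coh (Y i) B ?c d x (\<iota> (Suc i) d x')"
      unfolding D_coh_comp[OF Y Y B \<phi> \<iota>of] using x by blast
    have 1: "D_coh (Y i) B (D_of (Y i) B (\<iota> i)) d x (\<iota> i d x)"
      unfolding D_coh_of[OF Y B \<iota>] using xc \<iota>c B by simp
    have l: "D_comp (Y i) B B \<theta> (D_of (Y i) B (\<iota> i)) \<in> D_hom (Y i) B" by (rule D_comp_hom[OF Y B B \<iota>of \<theta>])
    have "D_coh (Y i) B (D_comp (Y i) B B \<theta> (D_of (Y i) B (\<iota> i))) d x (\<iota> i d x - \<iota> (Suc i) d x')"
      unfolding \<theta>\<iota> by (rule D_coh_minus[OF Y B \<iota>of c l[unfolded \<theta>\<iota>] 1 2])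
    then obtain b where b: "D_coh (Y i) B (D_of (Y i) B (\<iota> i)) d x b" "D_coh B B \<theta> d b (\<iota> i d x - \<iota> (Suc i) d x')"
      unfolding D_coh_comp[OF Y B B \<iota>of \<theta>] by blast
    have "b - \<iota> i d x \<in> coboundaries B d" using b(1) unfolding D_coh_of[OF Y B \<iota>] by simp
    then show ?thesis
      by (intro D_coh_cong[OF B B \<theta> b(2) \<iota>c[OF xc(1)] cob_diff_sym[OF B] D_coh_cocycles(2)[OF b(2)]]) (simp_all add: B)
  qed
  have decomp: "\<exists>N x. b = (\<Sum>i<N. \<iota> i d (x i)) \<and> (\<forall>i\<ge>N. x i = 0) \<and> (\<forall>i. x i \<in> cocycles (Y i) d)"
    if b: "b \<in> cocycles B d" for b d
  proof -
    have z: "p d b \<in> cocycles ?D d" by (rule hom_cocycle[OF p' B b])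
    then have s: "sec (p d b) i \<in> cocycles (Y i) d" for i by (simp add: dsum_cocycle_iff[OF Y'])
    have "finite {i. sec (p d b) i \<noteq> 0}" using cocycle_cpt[OF z] by (simp add: dsum_cpt)
    then obtain N where N: "\<And>i. sec (p d b) i \<noteq> 0 \<Longrightarrow> i < N"
      unfolding finite_nat_set_iff_bounded by blast
    have m: "\<iota> i d (sec (p d b) i) \<in> cpt B d" for i using \<iota>c[OF s] by simp
    have "p d (\<Sum>i<N. \<iota> i d (sec (p d b) i)) = (\<Sum>i<N. p d (\<iota> i d (sec (p d b) i)))"
      by (rule hom_sum[OF p' B m])
    also have "\<dots> = (\<Sum>i<N. dsum_incl i d (sec (p d b) i))" using pi[OF cocycle_cpt[OF s]] by simp
    also have "\<dots> = p d b" by (rule dsum_decomp[OF Y' cocycle_cpt[OF z], symmetric]) (use N in auto)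
    finally have e: "p d (\<Sum>i<N. \<iota> i d (sec (p d b) i)) = p d b" .
    have sm: "(\<Sum>i<N. \<iota> i d (sec (p d b) i)) \<in> cpt B d" by (rule cpt_sum[OF B m])
    have "b = (\<Sum>i<N. \<iota> i d (sec (p d b) i))" by (rule pinj[OF cocycle_cpt[OF b] sm e[symmetric]])
    moreover have "\<forall>i\<ge>N. sec (p d b) i = 0" using N by (meson not_le)
    ultimately show ?thesis using s by blast
  qed
  \<comment> \<open>Injectivity of id - shift on the cohomology of the coproduct. It makes the long
    exact sequence break into short ones, so that H(E) is the cokernel, that is the direct
    limit.\<close>
  have inj: "b \<in> coboundaries B d" if bc: "D_coh B B \<theta> d b c" and c: "c \<in> coboundaries B d" for b c d
  proof -
    have b: "b \<in> cocycles B d" by (rule D_coh_cocycles(1)[OF bc])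
    obtain N x where N: "b = (\<Sum>i<N. \<iota> i d (x i))" "\<And>i. i \<ge> N \<Longrightarrow> x i = 0" and x: "\<And>i. x i \<in> cocycles (Y i) d"
      using decomp[OF b] by blast
    have "\<exists>x'. D_coh (Y i) (Y (Suc i)) (\<phi> i) d (x i) x'" for i
      by (rule D_coh_total[OF Y Y \<phi> x]) blast
    then obtain x' where x': "\<And>i. D_coh (Y i) (Y (Suc i)) (\<phi> i) d (x i) (x' i)" by metis
    have x'c: "x' i \<in> cocycles (Y (Suc i)) d" for i by (rule D_coh_cocycles(2)[OF x'])
    let ?t = "\<lambda>K. \<Sum>i<K. \<iota> i d (x i) - \<iota> (Suc i) d (x' i)"
    have "D_coh B B \<theta> d (\<Sum>i<K. \<iota> i d (x i)) (?t K)" for K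
    proof (induction K)
      case 0
      obtain y where "D_coh B B \<theta> d 0 y" by (rule D_coh_total[OF B B \<theta>, of 0]) (simp add: B)
      from D_coh_scale[OF B B \<theta> this, of 0] show ?case by simp
    next
      case (Suc K)
      show ?case unfolding sum.lessThan_Suc by (rule D_coh_add[OF B B \<theta> Suc \<theta>step[OF x']])
    qed
    then have "D_coh B B \<theta> d b (?t N)" using N(1) by simp
    from D_coh_diff[OF B B \<theta> this bc] have "D_coh B B \<theta> d 0 (?t N - c)" by simp
    then have "?t N - c \<in> coboundaries B d" by (rule D_coh_cob[OF B B \<theta>]) (simp add: B)
    then have t: "?t N \<in> coboundaries B d" by (rule cob_diff_mem[OF B _ c])
    have tm: "\<iota> i d (x i) - \<iota> (Suc i) d (x' i) \<in> cpt B d" for i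
      using \<iota>c[OF x] \<iota>c[OF x'c] B by simp
    have pt: "p d (?t N) = (\<Sum>i<N. dsum_incl i d (x i) - dsum_incl (Suc i) d (x' i))"
    proof -
      have 1: "p d (\<iota> i d (x i) - \<iota> (Suc i) d (x' i)) = dsum_incl i d (x i) - dsum_incl (Suc i) d (x' i)" for i
        using hom_diff[OF p' B cocycle_cpt[OF \<iota>c[OF x]] cocycle_cpt[OF \<iota>c[OF x'c]]]
          pi[OF cocycle_cpt[OF x]] pi[OF cocycle_cpt[OF x'c]] by simp
      have "p d (?t N) = (\<Sum>i<N. p d (\<iota> i d (x i) - \<iota> (Suc i) d (x' i)))" by (rule hom_sum[OF p' B tm])
      then show ?thesis by (simp only: 1)
    qed
    have sect: "sec (p d (?t N)) k \<in> coboundaries (Y k) d" for k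
      using hom_cob[OF dsum_proj_hom[OF Y', of k] hom_cob[OF p' t]] by simp
    \<comment> \<open>The section at 0 of the image is x 0, and the section at k + 1 is x (k + 1)
      minus the image of x k. Starting from the lowest stage, all x k are coboundaries by induction;
      stages from N on are zero.\<close>
    have xcob: "x k \<in> coboundaries (Y k) d" for k
    proof (induction k)
      case 0
      have "sec (p d (?t N)) 0 = (\<Sum>i<N. if 0 = i then x i else 0)"
        unfolding pt by (simp add: sec_sum)
      also have "\<dots> = (if 0 < N then x 0 else 0)" by (simp add: sum.delta')
      finally show ?case using sect[of 0] N(2)[of 0] Y by (cases "0 < N") auto
    next
      case (Suc k)
      show ?case
      proof (cases "Suc k < N")
        case True
        have "sec (p d (?t N)) (Suc k) = (\<Sum>i<N. if Suc k = i then x i else 0) - (\<Sum>i<N. if k = i then x' i else 0)"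
          unfolding pt by (simp add: sec_sum sum_subtractf)
        also have "\<dots> = x (Suc k) - x' k" using True by (simp add: sum.delta')
        finally have "x (Suc k) - x' k \<in> coboundaries (Y (Suc k)) d" using sect[of "Suc k"] by simp
        moreover have "x' k \<in> coboundaries (Y (Suc k)) d" by (rule D_coh_cob[OF Y Y \<phi> x' Suc])
        ultimately show ?thesis by (rule cob_diff_mem[OF Y])
      next
        case False
        then show ?thesis using N(2)[of "Suc k"] Y by simp
      qed
    qed
    have "\<iota> i d (x i) \<in> coboundaries B d" for i by (rule hom_cob[OF \<iota> xcob])
    then have "(\<Sum>i<N. \<iota> i d (x i)) \<in> coboundaries B d" by (intro fvec.subspace_sum[OF coboundaries_subspace[OF B]])
    then show ?thesis using N(1) by simp
  qed
  have surj: "\<exists>y. D_coh B E \<psi> d y e" if "e \<in> cocycles E d" for d e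
    by (rule dist_triangle_coh(1)[OF tri _ that]) (erule (1) inj)
  have comp: "z \<in> coboundaries E d" if "D_coh B B \<theta> d x y" "D_coh B E \<psi> d y z" for d x y z
    by (rule dist_triangle_coh(2)[OF tri _ that]) (erule (1) inj)
  \<comment> \<open>A class in stage k and its image in stage k + 1 differ by an element of the
    image of id - shift, so they have the same image in E.\<close>
  have push1: "\<exists>y\<in>cocycles (Y k) d. \<forall>e. D_coh B E \<psi> d (\<iota> i d x) e \<longrightarrow> D_coh B E \<psi> d (\<iota> k d y) e"
    if "i \<le> k" "x \<in> cocycles (Y i) d" for i k x d
    using that(1)
  proof (induction k rule: dec_induct)
    case base
    then show ?case using that(2) by blast
  next
    case (step k)
    then obtain y where y: "y \<in> cocycles (Y k) d" "\<And>e. D_coh B E \<psi> d (\<iota> i d x) e \<Longrightarrow> D_coh B E \<psi> d (\<iota> k d y) e" by blast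
    obtain y' where y': "D_coh (Y k) (Y (Suc k)) (\<phi> k) d y y'" by (rule D_coh_total[OF Y Y \<phi> y(1)])
    note y'c = D_coh_cocycles(2)[OF y']
    show ?case
    proof (intro bexI[OF _ y'c] allI impI)
      fix e assume "D_coh B E \<psi> d (\<iota> i d x) e"
      then have e: "D_coh B E \<psi> d (\<iota> k d y) e" by (rule y(2))
      obtain e' where e': "D_coh B E \<psi> d (\<iota> (Suc k) d y') e'" by (rule D_coh_total[OF B Em \<psi> \<iota>c[OF y'c]])
      have "e - e' \<in> coboundaries E d" by (rule comp[OF \<theta>step[OF y'] D_coh_diff[OF B Em \<psi> e e']])
      then show "D_coh B E \<psi> d (\<iota> (Suc k) d y') e"
        by (intro D_coh_cong[OF B Em \<psi> e' \<iota>c[OF y'c] _ D_coh_cocycles(2)[OF e]]) (simp_all add: B)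
    qed
  qed
  have pushN: "\<exists>y\<in>cocycles (Y k) d. D_coh B E \<psi> d (\<iota> k d y) e"
    if Nk: "N \<le> k" and xY: "\<And>i. x i \<in> cocycles (Y i) d" and De: "D_coh B E \<psi> d (\<Sum>i<N. \<iota> i d (x i)) e" for N k x d e
    using Nk De
  proof (induction N arbitrary: e)
    case 0
    then show ?case using Y B hom_zero[OF \<iota> Y] by (intro bexI[of _ 0]) simp_all
  next
    case (Suc N)
    have xc: "(\<Sum>i<N. \<iota> i d (x i)) \<in> cocycles B d"
      by (rule fvec.subspace_sum[OF cocycles_subspace[OF B]]) (rule \<iota>c[OF xY])
    obtain e1 where e1: "D_coh B E \<psi> d (\<Sum>i<N. \<iota> i d (x i)) e1" by (rule D_coh_total[OF B Em \<psi> xc])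
    obtain e2 where e2: "D_coh B E \<psi> d (\<iota> N d (x N)) e2" by (rule D_coh_total[OF B Em \<psi> \<iota>c[OF xY]])
    obtain y1 where y1: "y1 \<in> cocycles (Y k) d" "D_coh B E \<psi> d (\<iota> k d y1) e1" using Suc.IH[OF _ e1] Suc.prems(1) by auto
    obtain y2 where y2: "y2 \<in> cocycles (Y k) d" "D_coh B E \<psi> d (\<iota> k d y2) e2"
      using push1[of N k "x N" d] xY e2 Suc.prems(1) by auto
    have "D_coh B E \<psi> d (\<Sum>i<Suc N. \<iota> i d (x i)) (e1 + e2)"
      unfolding sum.lessThan_Suc by (rule D_coh_add[OF B Em \<psi> e1 e2])
    from D_coh_diff[OF B Em \<psi> Suc.prems(2) this] have "D_coh B E \<psi> d 0 (e - (e1 + e2))" by simp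
    then have diff: "e - (e1 + e2) \<in> coboundaries E d" by (rule D_coh_cob[OF B Em \<psi>]) (simp add: B)
    have yc: "y1 + y2 \<in> cocycles (Y k) d" using y1(1) y2(1) Y by simp
    have D12: "D_coh B E \<psi> d (\<iota> k d (y1 + y2)) (e1 + e2)"
      using D_coh_add[OF B Em \<psi> y1(2) y2(2)] hom_add[OF \<iota> cocycle_cpt[OF y1(1)] cocycle_cpt[OF y2(1)]] by simp
    have "D_coh B E \<psi> d (\<iota> k d (y1 + y2)) e"
      by (rule D_coh_cong[OF B Em \<psi> D12 \<iota>c[OF yc] _ D_coh_cocycles(2)[OF Suc.prems(2)] diff]) (simp add: B)
    then show ?case by (rule bexI[OF _ yc])
  qed
  \<comment> \<open>Every class of E comes from a single stage, and from every sufficiently late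
    one. This is how properties of the stages pass to the limit.\<close>
  have reach: "\<exists>K. \<forall>k\<ge>K. \<exists>y\<in>cocycles (Y k) d. D_coh B E \<psi> d (\<iota> k d y) e" if e: "e \<in> cocycles E d" for d e
  proof -
    obtain b where b: "D_coh B E \<psi> d b e" using surj[OF e] by blast
    obtain N x where N: "b = (\<Sum>i<N. \<iota> i d (x i))" "\<And>i. x i \<in> cocycles (Y i) d"
      using decomp[OF D_coh_cocycles(1)[OF b]] by blast
    have "D_coh B E \<psi> d (\<Sum>i<N. \<iota> i d (x i)) e" using b N(1) by simp
    then show ?thesis using pushN[OF _ N(2)] by blast
  qed
  have Ez: "coh_zero E d" if d: "d < - m" for d
    unfolding coh_zero_def
  proof
    fix e assume "e \<in> cocycles E d"
    then obtain k y where y: "y \<in> cocycles (Y k) d" "D_coh B E \<psi> d (\<iota> k d y) e" using reach by blast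
    have "y \<in> coboundaries (Y k) d" using z0[OF d] y(1) unfolding coh_zero_def by blast
    then show "e \<in> coboundaries E d" by (rule D_coh_cob[OF B Em \<psi> y(2) hom_cob[OF \<iota>]])
  qed
  have Edep: "dep_mod (cocycles E d) (coboundaries E d) 2" for d
    unfolding dep_mod_2
  proof (intro ballI)
    fix e1 e2 assume e1: "e1 \<in> cocycles E d" and e2: "e2 \<in> cocycles E d"
    obtain K1 where K1: "\<And>k. k \<ge> K1 \<Longrightarrow> \<exists>y\<in>cocycles (Y k) d. D_coh B E \<psi> d (\<iota> k d y) e1" using reach[OF e1] by blast
    obtain K2 where K2: "\<And>k. k \<ge> K2 \<Longrightarrow> \<exists>y\<in>cocycles (Y k) d. D_coh B E \<psi> d (\<iota> k d y) e2" using reach[OF e2] by blast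
    let ?k = "max K1 K2"
    obtain y1 where y1: "y1 \<in> cocycles (Y ?k) d" "D_coh B E \<psi> d (\<iota> ?k d y1) e1" using K1[of ?k] by auto
    obtain y2 where y2: "y2 \<in> cocycles (Y ?k) d" "D_coh B E \<psi> d (\<iota> ?k d y2) e2" using K2[of ?k] by auto
    obtain a b where ab: "a \<noteq> 0 \<or> b \<noteq> 0" "fscale a y1 + fscale b y2 \<in> coboundaries (Y ?k) d"
      using dep[of ?k d] y1(1) y2(1) unfolding dep_mod_2 by blast
    have "\<iota> ?k d (fscale a y1 + fscale b y2) = fscale a (\<iota> ?k d y1) + fscale b (\<iota> ?k d y2)"
      using hom_add[OF \<iota> cpt_scale[OF Y cocycle_cpt[OF y1(1)]] cpt_scale[OF Y cocycle_cpt[OF y2(1)]]]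
        hom_scale[OF \<iota> cocycle_cpt[OF y1(1)]] hom_scale[OF \<iota> cocycle_cpt[OF y2(1)]] by simp
    then have "fscale a (\<iota> ?k d y1) + fscale b (\<iota> ?k d y2) \<in> coboundaries B d"
      using hom_cob[OF \<iota> ab(2)] by simp
    then have "fscale a e1 + fscale b e2 \<in> coboundaries E d"
      by (rule D_coh_cob[OF B Em \<psi> D_coh_add[OF B Em \<psi> D_coh_scale[OF B Em \<psi> y1(2)] D_coh_scale[OF B Em \<psi> y2(2)]]])
    then show "\<exists>a b. (a \<noteq> 0 \<or> b \<noteq> 0) \<and> fscale a e1 + fscale b e2 \<in> coboundaries E d" using ab(1) by blast
  qed
  have Esurj: "\<exists>e'\<in>cocycles E (d + 1). e - tact E (d + 1) e' \<in> coboundaries E d" if e: "e \<in> cocycles E d" for d e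
  proof -
    obtain K where K: "\<And>k. k \<ge> K \<Longrightarrow> \<exists>y\<in>cocycles (Y k) d. D_coh B E \<psi> d (\<iota> k d y) e" using reach[OF e] by blast
    \<comment> \<open>The stage must be late enough to represent e and also to satisfy d + 1 \<le> k
      - m, the range in which the stages are divisible by T.\<close>
    define k where "k = max K (nat (d + 1 + m))"
    have k: "d + 1 \<le> int k - m" by (simp add: k_def)
    obtain y where y: "y \<in> cocycles (Y k) d" "D_coh B E \<psi> d (\<iota> k d y) e" using K[of k] by (auto simp: k_def)
    obtain y' where y': "y' \<in> cocycles (Y k) (d + 1)" "y - tact (Y k) (d + 1) y' \<in> coboundaries (Y k) d"
      using ts[OF k, of y] y(1) by auto
    have ty': "tact (Y k) (d + 1) y' \<in> cpt (Y k) d" using y'(1) Y by simp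
    obtain e' where e': "D_coh B E \<psi> (d + 1) (\<iota> k (d + 1) y') e'" by (rule D_coh_total[OF B Em \<psi> \<iota>c[OF y'(1)]])
    have "tact B (d + 1) (\<iota> k (d + 1) y') = \<iota> k d (tact (Y k) (d + 1) y')"
      using hom_tact[OF \<iota> cocycle_cpt[OF y'(1)], of d] by simp
    then have "D_coh B E \<psi> d (\<iota> k d (tact (Y k) (d + 1) y')) (tact E (d + 1) e')"
      using D_coh_tact[OF B Em \<psi> e'] by simp
    note D_coh_diff[OF B Em \<psi> y(2) this]
    moreover have "\<iota> k d y - \<iota> k d (tact (Y k) (d + 1) y') \<in> coboundaries B d"
      by (rule hom_cob_diff[OF \<iota> Y cocycle_cpt[OF y(1)] ty' y'(2)])
    ultimately have "e - tact E (d + 1) e' \<in> coboundaries E d" by (rule D_coh_cob[OF B Em \<psi>])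
    then show ?thesis by (rule bexI[OF _ D_coh_cocycles(2)[OF e']])
  qed
  have Edep': "coh_dep E d" for d unfolding coh_dep_def using Edep by blast
  show "artinian E"
  \<comment> \<open>If all cohomology vanishes there is nothing to show. Otherwise surjectivity of T
    keeps all higher degrees nonzero, and a surjection between one-dimensional spaces is
    bijective.\<close>
  proof (cases "\<forall>d. coh_zero E d")
    case True
    then show ?thesis by (intro artinianI[of 0] coh_zero_tact_bij[OF Em] coh_zero_dep) simp_all
  next
    case False
    then obtain d0 where d0: "\<not> coh_zero E d0" by blast
    have nz: "\<not> coh_zero E d" if "d \<ge> d0" for d
      using that
    proof (induction d rule: int_ge_induct)
      case base show ?case by (rule d0)
    next
      case (step d)
      show ?case
      proof
        assume z: "coh_zero E (d + 1)"
        have "coh_zero E d" unfolding coh_zero_def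
        proof
          fix e assume "e \<in> cocycles E d"
          then obtain e' where e': "e' \<in> cocycles E (d + 1)" "e - tact E (d + 1) e' \<in> coboundaries E d" using Esurj by blast
          have "e' \<in> coboundaries E (d + 1)" using z e'(1) unfolding coh_zero_def by blast
          then have "tact E (d + 1) e' \<in> coboundaries E d" using Em by simp
          then show "e \<in> coboundaries E d" by (rule cob_diff_mem[OF Em e'(2)])
        qed
        then show False using step.IH by blast
      qed
    qed
    show ?thesis
    proof (rule artinianI[of "max m d0"])
      fix d assume d: "d \<ge> max m d0"
      obtain u where u: "u \<in> cocycles E d" "u \<notin> coboundaries E d" using nz[of d] d unfolding coh_zero_def by auto
      obtain v where v: "v \<in> cocycles E (d + 1)" "u - tact E (d + 1) v \<in> coboundaries E d" using Esurj[OF u(1)] by blast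
      show "tact_bij E d"
      proof (rule tact_bijI)
        show "\<exists>z\<in>cocycles E (d + 1). y - tact E (d + 1) z \<in> coboundaries E d" if "y \<in> cocycles E d" for y
          by (rule Esurj[OF that])
        fix z assume z: "z \<in> cocycles E (d + 1)" "tact E (d + 1) z \<in> coboundaries E d"
        \<comment> \<open>z is in the kernel of T while T v represents the nonzero class of u.
          Applying T to a relation between z and v forces b = 0, so z itself is a
          coboundary.\<close>
        obtain a b where ab: "a \<noteq> 0 \<or> b \<noteq> 0" "fscale a z + fscale b v \<in> coboundaries E (d + 1)"
          using Edep[of "d + 1"] z(1) v(1) unfolding dep_mod_2 by blast
        have "tact E (d + 1) (fscale a z + fscale b v) \<in> coboundaries E d" using ab(2) Em by simp
        then have "fscale a (tact E (d + 1) z) + fscale b (tact E (d + 1) v) \<in> coboundaries E d"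
          using z(1) v(1) Em by simp
        from cob_closed(3)[OF Em this cob_closed(5)[OF Em z(2), of a]]
        have bv: "fscale b (tact E (d + 1) v) \<in> coboundaries E d" by simp
        have "b = 0"
        proof (rule ccontr)
          assume "b \<noteq> 0"
          then have "tact E (d + 1) v \<in> coboundaries E d" using cob_closed(5)[OF Em bv, of "1 / b"] by simp
          then have "u \<in> coboundaries E d" by (rule cob_diff_mem[OF Em v(2)])
          then show False using u(2) by blast
        qed
        then have "a \<noteq> 0" "fscale a z \<in> coboundaries E (d + 1)" using ab by simp_all
        then show "z \<in> coboundaries E (d + 1)" using cob_closed(5)[OF Em, of "fscale a z" "d + 1" "1 / a"] by simp
      qed
    qed (use Ez Edep' in simp_all)
  qed
qed

text \<open>Degree d of stage i is degree d + (m - i) of X_i. Hence the stages vanish below the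
  common bound - m, and divisibility by T, valid in X_i up to degree 0, holds up to degree i -
  m.\<close>

lemma is_E_artinian:
  fixes E :: "('k::field, 'u::infinite) dgm"
  assumes "is_E m E" shows "dg_module E" "artinian E"
proof -
  obtain X Y \<phi> where X: "\<And>i. is_X i (X i)" and Y: "\<And>i. Y i = shift (m - int i) (X i)" and h: "is_hocolim Y \<phi> E"
    using assms unfolding is_E_def by blast
  note c = is_X_coh[OF X]
  have z0: "coh_zero (Y i) d" if "d < - m" for i d
    using c(2)[of "d + (m - int i)" i] that c(1)[of i] unfolding Y coh_zero_def by simp
  have dep: "dep_mod (cocycles (Y i) d) (coboundaries (Y i) d) 2" for i d
    using c(3)[of i "d + (m - int i)"] c(1)[of i] unfolding Y by simp
  have ts: "\<exists>z'\<in>cocycles (Y i) d. z - tact (Y i) d z' \<in> coboundaries (Y i) (d - 1)"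
    if "d \<le> int i - m" "z \<in> cocycles (Y i) (d - 1)" for i d z
  proof -
    have e: "d - 1 + (m - int i) = d + (m - int i) - 1" by simp
    show ?thesis using c(4)[of "d + (m - int i)" z i] that c(1)[of i] unfolding Y by (simp add: e)
  qed
  show "dg_module E" by (rule hocolim_artinian(1)[OF h z0 dep ts])
  show "artinian E" by (rule hocolim_artinian(2)[OF h z0 dep ts])
qed

lemma Dbar_artinian:
  fixes X :: "('k::field, 'u::infinite) dgm"
  assumes "X \<in> Dbar" shows "dg_module X \<and> artinian X"
  using assms unfolding Dbar_def
proof (rule artinian_add_closure[rotated])
  fix X :: "('k, 'u) dgm" assume "X \<in> {shift i X |i n X. is_X n X} \<union> {E. \<exists>m. is_E m E}"
  then show "dg_module X \<and> artinian X"
    using is_X_coh(1) is_X_artinian is_E_artinian by (auto intro!: artinian_shift)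
qed

section \<open>Interval modules as explicit models of X_n and E_m\<close>

section \<open>Bar modules\<close>

text \<open>The zero-differential module that is one-dimensional in the degrees in J, with T acting as the
  identity wherever possible; the scalar line is embedded at an arbitrary point of the universe.\<close>

definition bar :: "int set \<Rightarrow> ('k::field, 'u) dgm" where
  "bar J = \<lparr>cpt = (\<lambda>i. {x. (\<forall>u. u \<noteq> undefined \<longrightarrow> x u = 0) \<and> (i \<notin> J \<longrightarrow> x = 0)}),
     dif = (\<lambda>i x. 0), tact = (\<lambda>i x. if i - 1 \<in> J then x else 0)\<rparr>"

lemma bar_cpt: "x \<in> cpt (bar J) i \<longleftrightarrow> (\<forall>u. u \<noteq> undefined \<longrightarrow> x u = 0) \<and> (i \<notin> J \<longrightarrow> x = 0)"
  and bar_dif [simp]: "dif (bar J) i x = 0"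
  and bar_tact [simp]: "tact (bar J) i x = (if i - 1 \<in> J then x else 0)"
  by (simp_all add: bar_def)

lemma dg_module_bar [simp]: "dg_module (bar J :: ('k::field, 'u) dgm)"
proof (rule dg_moduleI)
  show "fvec.subspace (cpt (bar J :: ('k, 'u) dgm) i)" for i
    by (rule subspaceI) (auto simp: bar_cpt pointwise fscale_def)
qed (auto simp: bar_cpt pointwise)

lemma bar_cob: "x \<in> coboundaries (bar J :: ('k::field, 'u) dgm) i \<longleftrightarrow> x = 0"
proof
  assume "x = 0"
  then show "x \<in> coboundaries (bar J :: ('k, 'u) dgm) i" by simp
qed (auto elim: coboundaryE)

lemma bar_cocycle: "x \<in> cocycles (bar J) i \<longleftrightarrow> x \<in> cpt (bar J) i"
  by (simp add: cocycles_mem del: cocycle_cpt cocycle_dif)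

lemma bar_cpt_mono: "x \<in> cpt (bar J) i \<Longrightarrow> (i \<in> J \<Longrightarrow> i \<in> J') \<Longrightarrow> x \<in> cpt (bar J') i"
  by (auto simp: bar_cpt pointwise)

lemma shift_bar: "shift n (bar J) = (bar {i. i + n \<in> J} :: ('k::field, 'u) dgm)"
proof (rule dgm.equality)
  have e: "i + n - 1 = i - 1 + n" for i by simp
  show "tact (shift n (bar J)) = tact (bar {i. i + n \<in> J} :: ('k, 'u) dgm)"
    by (intro ext) (simp add: e)
  show "dif (shift n (bar J)) = dif (bar {i. i + n \<in> J} :: ('k, 'u) dgm)"
    by (intro ext) simp
  show "cpt (shift n (bar J)) = cpt (bar {i. i + n \<in> J} :: ('k, 'u) dgm)"
    by (intro ext) (simp add: bar_def)
qed simp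

text \<open>Since T lowers degrees, the degrees in J span a submodule of \<open>bar J'\<close>
  exactly under the condition that J is closed under predecessors lying in J'.\<close>

lemma bar_incl_hom:
  assumes "J \<subseteq> J'" "\<And>i. i \<in> J \<Longrightarrow> i - 1 \<in> J' \<Longrightarrow> i - 1 \<in> J"
  shows "(\<lambda>i x. x) \<in> dg_hom (bar J) (bar J')"
proof (rule dg_homI)
  fix i x assume x: "x \<in> cpt (bar J) i"
  show "tact (bar J) i x = tact (bar J') i x"
    using x assms by (cases "i \<in> J") (auto simp: bar_cpt pointwise)
qed (use assms in \<open>auto simp: bar_cpt pointwise\<close>)

text \<open>A short exact sequence of modules with zero differential: the cone of the inclusion of a
  submodule is quasi-isomorphic to the quotient, here the part in degrees J' - J.\<close>

lemma bar_triangle: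
  assumes J: "J \<subseteq> J'" "\<And>i. i \<in> J \<Longrightarrow> i - 1 \<in> J' \<Longrightarrow> i - 1 \<in> J"
  shows "\<exists>\<psi> \<chi>. dist_triangle (bar J :: ('k::field, 'u::infinite) dgm) (bar J') (bar (J' - J))
    (D_of (bar J) (bar J') (\<lambda>i x. x)) \<psi> \<chi>"
proof -
  let ?M = "bar J :: ('k, 'u) dgm" and ?N = "bar J' :: ('k, 'u) dgm" and ?Z = "bar (J' - J) :: ('k, 'u) dgm"
  have f: "(\<lambda>i x. x) \<in> dg_hom ?M ?N" (is "?f \<in> _") by (rule bar_incl_hom[OF J])
  let ?C = "cone ?M ?N ?f"
  \<comment> \<open>Projection of the cone to the quotient: forget the component from the submodule
    and restrict to degrees outside J.\<close>
  let ?q = "\<lambda>i z. if i \<in> J' - J then z \<circ> Inl else 0"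
  have q: "?q \<in> dg_hom ?C ?Z"
  proof (rule dg_homI)
    fix i z assume "z \<in> cpt ?C i"
    then obtain y x where z: "z = case_sum y x" "y \<in> cpt ?N i" "x \<in> cpt ?M (i + 1)" by (rule cone_cptE)
    show "?q i z \<in> cpt ?Z i" using z by (auto simp: bar_cpt pointwise)
    show "?q i (fscale c z) = fscale c (?q i z)" for c by (simp add: comp_arith)
    show "?q i (z + z') = ?q i z + ?q i z'" for z' by (simp add: comp_arith)
    show "?q (i - 1) (tact ?C i z) = tact ?Z i (?q i z)"
      using z(2) J(2)[of i] unfolding z(1) by (cases "i \<in> J'") (auto simp: bar_cpt pointwise)
    have "x = 0" if "i + 1 \<in> J' - J" using z(3) that by (simp add: bar_cpt)
    then show "?q (i + 1) (dif ?C i z) = dif ?Z i (?q i z)" unfolding z(1) by simp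
  qed
  have C: "dg_module ?C" by (rule dg_module_cone[OF _ _ f]) simp_all
  have "?q \<in> quasi_iso ?C ?Z"
  proof (rule quasi_isoI[OF C _ q])
    fix i z assume z: "z \<in> cocycles ?C i" and qz: "?q i z \<in> coboundaries ?Z i"
    obtain y x where yx: "z = case_sum y x" "y \<in> cpt ?N i" "dif ?N i y = - x"
      using cone_cocycleE[OF _ _ f z] by auto
    have x: "x = 0" using yx(3) by simp
    have y: "y \<in> cpt ?M i" using yx(2) qz unfolding yx(1) by (auto simp: bar_cob bar_cpt split: if_splits)
    show "z \<in> coboundaries ?C i" using cone_cob_f[OF _ _ f y] by (simp add: yx(1) x)
  next
    fix i y assume "y \<in> cocycles ?Z i"
    then have y: "y \<in> cpt ?Z i" by simp
    then have "case_sum y 0 \<in> cocycles ?C i"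
      by (subst cone_cocycle[OF _ _ f]) (auto simp: bar_cpt pointwise)
    moreover have "y - ?q i (case_sum y 0) = 0" using y by (auto simp: bar_cpt pointwise)
    ultimately show "\<exists>z\<in>cocycles ?C i. y - ?q i z \<in> coboundaries ?Z i"
      unfolding bar_cob by blast
  qed simp
  then show ?thesis by (intro cone_triangle f) simp_all
qed

text \<open>R itself is the interval of all degrees up to 0, and its suspension by n + 1 is the
  interval up to -(n + 1). Multiplication by T^(n+1) becomes the inclusion, whose quotient is the
  interval from -n to 0.\<close>

lemma is_X_bar: "is_X n (bar {- int n..0} :: ('k::field, 'u::infinite) dgm)"
proof -
  let ?P = "bar {..0} :: ('k, 'u) dgm" and ?s = "int n + 1"
  \<comment> \<open>In degree i the polynomial is determined by its coefficient at T^(-i), which is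
    placed at the chosen point of the universe; g is the inverse.\<close>
  define \<rho> where "\<rho> i x = (\<lambda>u::'u. if u = undefined then x (nat (- i)) else 0)" for i and x :: "nat \<Rightarrow> 'k"
  define g where "g i y = (\<lambda>k. if int k = - i then y undefined else 0)" for i and y :: "'u \<Rightarrow> 'k"
  have out: "x k = 0" if "x \<in> cpt dg_R i" "int k \<noteq> - i" for x :: "nat \<Rightarrow> 'k" and i k
    using that unfolding dg_R_cpt by blast
  have h: "\<rho> \<in> dg_hom dg_R ?P"
  proof (rule dg_homI)
    fix i :: int and x :: "nat \<Rightarrow> 'k" assume x: "x \<in> cpt dg_R i"
    show "\<rho> i x \<in> cpt ?P i" using out[OF x, of 0] by (auto simp: bar_cpt \<rho>_def fun_eq_iff pointwise)
    show "\<rho> (i - 1) (tact dg_R i x) = tact ?P i (\<rho> i x)"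
    proof (cases "i \<le> 0")
      case True
      then have "nat (1 - i) - 1 = nat (- i)" "\<not> nat (1 - i) < 1" by simp_all
      then show ?thesis using True by (simp add: \<rho>_def mult_T_app[OF x] fun_eq_iff)
    next
      case False
      then have "x k = 0" for k using out[OF x, of k] by simp
      then show ?thesis by (auto simp: \<rho>_def mult_T_app[OF x] fun_eq_iff pointwise)
    qed
  qed (auto simp: \<rho>_def fun_eq_iff pointwise fscale_def)
  have \<rho>: "\<rho> \<in> dg_iso dg_R ?P"
  proof (rule dg_isoI[OF h, where g = g])
    show "g i x \<in> cpt dg_R i" for i x by (simp add: dg_R_cpt g_def)
    show "g i (\<rho> i x) = x" if "x \<in> cpt dg_R i" for i x
    proof
      fix k
      have "nat (- i) = k" if "int k = - i" using that by linarith
      then show "g i (\<rho> i x) k = x k" using out[OF that, of k] by (simp add: g_def \<rho>_def)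
    qed
    show "\<rho> i (g i x) = x" if "x \<in> cpt ?P i" for i x
      using that by (auto simp: g_def \<rho>_def fun_eq_iff bar_cpt pointwise)
  qed
  have sP: "shift ?s ?P = bar {..- ?s}"
  proof -
    have "{i. i + ?s \<in> {..0}} = {..- ?s}" by auto
    then show ?thesis by (simp only: shift_bar)
  qed
  have \<tau>: "(\<lambda>i x. x) \<in> dg_hom (shift ?s ?P) ?P"
    unfolding sP by (rule bar_incl_hom) auto
  have \<tau>\<rho>: "\<rho> (i + ?s) x = \<rho> i (mult_T (n + 1) x)" if x: "x \<in> cpt dg_R (i + ?s)" for i x
  proof (cases "i + ?s \<le> 0")
    case True
    then have "nat (- i) - (n + 1) = nat (- (i + ?s))" "\<not> nat (- i) < n + 1" by linarith+
    then show ?thesis by (simp add: \<rho>_def mult_T_app[OF x] fun_eq_iff)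
  next
    case False
    then have "x k = 0" for k using out[OF x, of k] by simp
    then show ?thesis by (auto simp: \<rho>_def mult_T_app[OF x] fun_eq_iff)
  qed
  have "{..0} - {..- ?s} = {- int n..0}" by auto
  then obtain \<psi> \<chi> where "dist_triangle (shift ?s ?P) ?P (bar {- int n..0}) (D_of (shift ?s ?P) ?P (\<lambda>i x. x)) \<psi> \<chi>"
    using bar_triangle[of "{..- ?s}" "{..0}", where 'k = 'k and 'u = 'u] unfolding sP by auto
  then show ?thesis unfolding is_X_def
    by (intro exI[of _ ?P] exI[of _ \<rho>] exI[of _ "\<lambda>i x. x"] exI[of _ \<psi>] exI[of _ \<chi>] conjI \<rho> \<tau>)
      (simp_all add: \<tau>\<rho>)
qed

text \<open>The suspended models of the X_i are the intervals from - m to i - m, an increasing chain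
  with union the ray from - m. For inclusions, id - shift is injective on the coproduct itself and
  its cokernel is the union, so the cone is quasi-isomorphic to the ray.\<close>

lemma is_E_bar: "is_E m (bar {- m..} :: ('k::field, 'u::infinite) dgm)"
proof -
  define X where "X i = (bar {- int i..0} :: ('k, 'u) dgm)" for i
  define Y where "Y i = (bar {- m..int i - m} :: ('k, 'u) dgm)" for i
  have YX: "Y i = shift (m - int i) (X i)" for i
  proof -
    have "{d. d + (m - int i) \<in> {- int i..0}} = {- m..int i - m}" by auto
    then show ?thesis by (simp only: X_def Y_def shift_bar)
  qed
  have Y: "dg_module (Y i)" for i by (simp add: Y_def)
  have Y': "\<forall>i\<in>UNIV. dg_module (Y i)" using Y by simp
  have Ymono: "x \<in> cpt (Y j) n" if "x \<in> cpt (Y i) n" "i \<le> j" for i j n x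
    using that unfolding Y_def by (auto intro: bar_cpt_mono)
  have Ydif: "dif (Y i) n x = 0" for i n x by (simp add: Y_def)
  have Ytact: "tact (Y i) n x = tact (Y j) n x" if "x \<in> cpt (Y i) n" "i \<le> j" for i j n x
    using that by (cases "n \<in> {- m..int i - m}") (auto simp: Y_def bar_cpt pointwise)
  let ?f = "\<lambda>(n::int) (x :: 'u \<Rightarrow> 'k). x"
  have f: "?f \<in> dg_hom (Y i) (Y (Suc i))" for i
    unfolding Y_def by (rule bar_incl_hom) auto
  define \<phi> where "\<phi> i = D_of (Y i) (Y (Suc i)) ?f" for i
  have \<phi>: "\<phi> i \<in> D_hom (Y i) (Y (Suc i))" for i unfolding \<phi>_def by (rule D_of_hom[OF Y Y f])
  \<comment> \<open>Degree - m belongs to every interval, and the inclusion is nonzero on cohomology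
    there.\<close>
  have \<phi>0: "\<phi> i \<noteq> D_zero (Y i) (Y (Suc i))" for i
  proof
    assume eq: "\<phi> i = D_zero (Y i) (Y (Suc i))"
    let ?x = "\<lambda>u::'u. if u = undefined then 1 else (0 :: 'k)"
    have x: "?x \<in> cocycles (Y j) (- m)" for j unfolding Y_def bar_cocycle by (simp add: bar_cpt)
    have "D_coh (Y i) (Y (Suc i)) (\<phi> i) (- m) ?x ?x"
      unfolding \<phi>_def D_coh_of[OF Y Y f] using x Y by simp
    then have "?x - 0 \<in> coboundaries (Y (Suc i)) (- m)"
      unfolding eq D_zero_def D_coh_of[OF Y Y zero_hom[OF Y]] by simp
    then have "?x = 0" by (simp add: Y_def bar_cob)
    from fun_cong[OF this, of undefined] show False by (simp add: pointwise)
  qed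
  let ?D = "dsum UNIV Y"
  have D: "dg_module ?D" by (rule dg_module_dsum[OF Y'])
  obtain e1 :: "nat \<Rightarrow> 'u" where "inj e1" using ex_inj_nat by blast
  then obtain e :: "nat \<times> 'u \<Rightarrow> 'u" where e: "inj e" using ex_inj_prod[of e1 "\<lambda>x. x"] by auto
  define B where "B = push e ?D"
  define \<iota> where "\<iota> = (\<lambda>i (n::int) (x :: 'u \<Rightarrow> 'k). enc e (dsum_incl (i::nat) n x))"
  have B': "is_dsum UNIV Y B \<iota>" unfolding B_def \<iota>_def by (rule is_dsum_push[OF Y' e])
  have B: "dg_module B" unfolding B_def by (rule dg_module_push[OF e D])
  have en: "(\<lambda>i. enc e) \<in> dg_iso ?D B" and de: "(\<lambda>i y. y \<circ> e) \<in> dg_iso B ?D"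
    unfolding B_def using dg_iso_push[OF e D] .
  note en' = dg_iso_hom[OF en] and de' = dg_iso_hom[OF de]
  have Bel: "b \<in> cpt B n \<longleftrightarrow> (\<exists>z\<in>cpt ?D n. b = enc e z)" for b n by (simp add: B_def push_cpt)
  have Ddif: "dif ?D n z = 0" for n z by (rule sec_ext) (simp add: Ydif)
  have Bdif: "dif B n b = 0" for n b by (simp add: B_def push_def Ddif enc_arith)
  \<comment> \<open>The map id - shift in coordinates: the section at i becomes z_i - z_(i-1), where
    z_(-1) is read as 0.\<close>
  define \<theta>0 where "\<theta>0 = (\<lambda>(n::int) z (i, u::'u). z (i, u) - (if i = 0 then (0 :: 'k) else z (i - 1 :: nat, u)))"
  have s\<theta>: "sec (\<theta>0 n z) i = sec z i - (if i = 0 then 0 else sec z (i - 1))" for n z i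
    by (auto simp: \<theta>0_def sec_def fun_eq_iff pointwise)
  have \<theta>0: "\<theta>0 \<in> dg_hom ?D ?D"
  proof (rule dg_homI)
    fix n z assume z: "z \<in> cpt ?D n"
    then have zs: "sec z i \<in> cpt (Y i) n" "finite {i. sec z i \<noteq> 0}" for i by (simp_all add: dsum_cpt)
    have zs': "sec z (i - 1) \<in> cpt (Y i) n" for i using Ymono[OF zs(1)] by simp
    have "finite {i. sec (\<theta>0 n z) i \<noteq> 0}"
    proof (rule finite_subset)
      show "{i. sec (\<theta>0 n z) i \<noteq> 0} \<subseteq> {i. sec z i \<noteq> 0} \<union> Suc ` {i. sec z i \<noteq> 0}"
      proof
        fix i assume "i \<in> {i. sec (\<theta>0 n z) i \<noteq> 0}"
        then show "i \<in> {i. sec z i \<noteq> 0} \<union> Suc ` {i. sec z i \<noteq> 0}" by (cases i) (auto simp: s\<theta>)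
      qed
    qed (use zs(2) in simp)
    then show "\<theta>0 n z \<in> cpt ?D n" using zs(1) zs' Y by (simp add: dsum_cpt s\<theta>)
    show "\<theta>0 (n - 1) (tact ?D n z) = tact ?D n (\<theta>0 n z)"
    proof (rule sec_ext)
      fix i
      show "sec (\<theta>0 (n - 1) (tact ?D n z)) i = sec (tact ?D n (\<theta>0 n z)) i"
        using tact_diff[OF Y zs(1) zs', of i] Ytact[OF zs(1), of "i - 1" i] by (simp add: s\<theta>)
    qed
    show "\<theta>0 n (fscale c z) = fscale c (\<theta>0 n z)" for c by (rule sec_ext) (simp add: s\<theta> fscale_distribs)
    show "\<theta>0 n (z + z') = \<theta>0 n z + \<theta>0 n z'" for z' by (rule sec_ext) (simp add: s\<theta>)
    show "\<theta>0 (n + 1) (dif ?D n z) = dif ?D n (\<theta>0 n z)" by (rule sec_ext) (simp add: Ddif s\<theta>)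
  qed
  define \<theta> where "\<theta> = gcomp (\<lambda>i. enc e) (gcomp \<theta>0 (\<lambda>i y. y \<circ> e))"
  have \<theta>: "\<theta> \<in> dg_hom B B" unfolding \<theta>_def by (rule gcomp_hom[OF gcomp_hom[OF de' \<theta>0] en'])
  have \<theta>enc: "\<theta> n (enc e z) = enc e (\<theta>0 n z)" for n z by (simp add: \<theta>_def e)
  have \<iota>hom: "\<iota> i \<in> dg_hom (Y i) B" for i
    using gcomp_hom[OF dsum_incl_hom[OF Y', of i] en'] by (simp add: \<iota>_def gcomp_def)
  have enc_diff: "enc e z - enc e z' = enc e (z - z')" for z z'
    using enc_arith(1)[of e "z - z'" z'] by simp
  have \<theta>\<iota>: "D_comp (Y i) B B (D_of B B \<theta>) (D_of (Y i) B (\<iota> i)) =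
      D_minus (Y i) B (D_of (Y i) B (\<iota> i)) (D_comp (Y i) (Y (Suc i)) B (D_of (Y (Suc i)) B (\<iota> (Suc i))) (\<phi> i))" for i
  proof -
    have g: "gcomp (\<iota> (Suc i)) ?f \<in> dg_hom (Y i) B" by (rule gcomp_hom[OF f \<iota>hom])
    have "\<theta>0 n (dsum_incl i n x) = dsum_incl i n x - dsum_incl (Suc i) n x" for n x
      by (rule sec_ext) (auto simp: s\<theta>)
    then have eq: "gcomp \<theta> (\<iota> i) n x = \<iota> i n x - gcomp (\<iota> (Suc i)) ?f n x" for n x
      by (simp add: \<iota>_def \<theta>enc enc_diff)
    have "D_of (Y i) B (gcomp \<theta> (\<iota> i)) = D_of (Y i) B (\<lambda>n x. \<iota> i n x - gcomp (\<iota> (Suc i)) ?f n x)"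
      by (rule D_of_cong[OF Y B gcomp_hom[OF \<iota>hom \<theta>] diff_hom[OF B \<iota>hom g] eq])
    then show ?thesis
      unfolding \<phi>_def by (simp only: D_comp_of[OF Y B B \<iota>hom \<theta>] D_comp_of[OF Y Y B f \<iota>hom] D_minus_of[OF Y B \<iota>hom g])
  qed
  let ?E = "bar {- m..} :: ('k, 'u) dgm"
  have E: "dg_module ?E" by simp
  \<comment> \<open>The canonical map from the coproduct to the union: add up the finitely many
    nonzero sections.\<close>
  define q0 where "q0 = (\<lambda>z :: nat \<times> 'u \<Rightarrow> 'k. \<Sum>i | sec z i \<noteq> 0. sec z i)"
  have q0: "q0 z = (\<Sum>i\<in>S. sec z i)" if "finite S" "\<And>i. sec z i \<noteq> 0 \<Longrightarrow> i \<in> S" for z S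
    unfolding q0_def by (rule sum.mono_neutral_left) (use that in auto)
  have Dbound: "\<exists>K. \<forall>i\<ge>K. sec z i = 0" if "z \<in> cpt ?D n" for z n
  proof -
    have "finite {i. sec z i \<noteq> 0}" using that by (simp add: dsum_cpt)
    then obtain K where "\<And>i. sec z i \<noteq> 0 \<Longrightarrow> i < K" unfolding finite_nat_set_iff_bounded by blast
    then show ?thesis by (meson not_le)
  qed
  have q0K: "q0 z = (\<Sum>i<K. sec z i)" if "\<forall>i\<ge>K. sec z i = 0" for z K
    by (rule q0) (use that in \<open>auto simp: not_le[symmetric]\<close>)
  have YE: "x \<in> cpt ?E n" if "x \<in> cpt (Y i) n" for x n i
    using that unfolding Y_def by (auto intro: bar_cpt_mono)
  have q0hom: "(\<lambda>n. q0) \<in> dg_hom ?D ?E"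
  proof (rule dg_homI)
    fix n z assume z: "z \<in> cpt ?D n"
    then have zs: "sec z i \<in> cpt (Y i) n" for i by (simp add: dsum_cpt)
    obtain K where K: "\<forall>i\<ge>K. sec z i = 0" using Dbound[OF z] by blast
    show "q0 z \<in> cpt ?E n" unfolding q0K[OF K] by (rule cpt_sum[OF E YE[OF zs]])
    have "q0 (fscale c z) = (\<Sum>i<K. sec (fscale c z) i)" for c by (rule q0K) (use K in simp)
    then show "q0 (fscale c z) = fscale c (q0 z)" for c by (simp add: q0K[OF K] fscale_sum)
    show "q0 (dif ?D n z) = dif ?E n (q0 z)" by (simp add: Ddif q0_def)
    have "q0 (tact ?D n z) = (\<Sum>i<K. sec (tact ?D n z) i)" by (rule q0K) (use K Y in simp)
    also have "\<dots> = (\<Sum>i<K. tact ?E n (sec z i))"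
    proof (rule sum.cong[OF refl])
      fix i
      show "sec (tact ?D n z) i = tact ?E n (sec z i)"
        using zs[of i] by (cases "n \<in> {- m..int i - m}") (auto simp: Y_def bar_cpt pointwise)
    qed
    also have "\<dots> = tact ?E n (q0 z)" unfolding q0K[OF K]
      by (rule lin_maps_sum[OF tact_lin[OF E] E YE[OF zs], symmetric])
    finally show "q0 (tact ?D n z) = tact ?E n (q0 z)" .
    fix z' assume z': "z' \<in> cpt ?D n"
    obtain K' where K': "\<forall>i\<ge>K'. sec z' i = 0" using Dbound[OF z'] by blast
    let ?K = "max K K'"
    have "q0 (z + z') = (\<Sum>i<?K. sec (z + z') i)" by (rule q0K) (use K K' in simp)
    moreover have "q0 z = (\<Sum>i<?K. sec z i)" "q0 z' = (\<Sum>i<?K. sec z' i)"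
      by (rule q0K, use K K' in simp)+
    ultimately show "q0 (z + z') = q0 z + q0 z'" by (simp add: sum.distrib)
  qed
  \<comment> \<open>Telescoping shows that q0 annihilates the image of \<theta>0.\<close>
  have tele: "(\<Sum>i<Suc K. sec z i - (if i = 0 then 0 else sec z (i - 1))) = sec z K" for z :: "nat \<times> 'u \<Rightarrow> 'k" and K
    by (induction K) simp_all
  have q0\<theta>: "q0 (\<theta>0 n z) = 0" if z: "z \<in> cpt ?D n" for n z
  proof -
    obtain K where K: "\<forall>i\<ge>K. sec z i = 0" using Dbound[OF z] by blast
    have "q0 (\<theta>0 n z) = (\<Sum>i<Suc K. sec (\<theta>0 n z) i)" by (rule q0K) (use K in \<open>auto simp: s\<theta>\<close>)
    then show ?thesis using K by (simp only: s\<theta> tele)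
  qed
  let ?C = "cone B B \<theta>"
  have C: "dg_module ?C" by (rule dg_module_cone[OF B B \<theta>])
  let ?q = "\<lambda>(n::int) z. q0 ((z \<circ> Inl) \<circ> e)"
  have qB: "gcomp (\<lambda>n. q0) (\<lambda>i y. y \<circ> e) \<in> dg_hom B ?E" by (rule gcomp_hom[OF de' q0hom])
  have q: "?q \<in> dg_hom ?C ?E"
  proof (rule dg_homI)
    fix n z assume "z \<in> cpt ?C n"
    then obtain y x where z: "z = case_sum y x" "y \<in> cpt B n" "x \<in> cpt B (n + 1)" by (rule cone_cptE)
    show "?q n z \<in> cpt ?E n" using hom_mem[OF qB z(2)] by (simp add: z(1))
    show "?q n (fscale c z) = fscale c (?q n z)" for c
      using hom_scale[OF qB z(2)] by (simp add: z(1) case_sum_arith)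
    show "?q (n - 1) (tact ?C n z) = tact ?E n (?q n z)"
      using hom_tact[OF qB z(2), of "n - 1"] by (simp add: z(1))
    obtain v where v: "v \<in> cpt ?D (n + 1)" "x = enc e v" using z(3) Bel by blast
    show "?q (n + 1) (dif ?C n z) = dif ?E n (?q n z)"
      using q0\<theta>[OF v(1)] by (simp add: z(1) Bdif v(2) \<theta>enc e)
    fix z' assume "z' \<in> cpt ?C n"
    then obtain y' x' where z': "z' = case_sum y' x'" "y' \<in> cpt B n" by (rule cone_cptE)
    show "?q n (z + z') = ?q n z + ?q n z'"
      using hom_add[OF qB z(2) z'(2)] by (simp add: z(1) z'(1) case_sum_arith)
  qed
  have "?q \<in> quasi_iso ?C ?E"
  proof (rule quasi_isoI[OF C E q])
    fix n z assume z: "z \<in> cocycles ?C n" and qz: "?q n z \<in> coboundaries ?E n"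
    obtain y x where yx: "z = case_sum y x" "y \<in> cpt B n" "x \<in> cocycles B (n + 1)" "dif B n y = - \<theta> (n + 1) x"
      by (rule cone_cocycleE[OF B B \<theta> z])
    obtain v where v: "v \<in> cpt ?D (n + 1)" "x = enc e v" using cocycle_cpt[OF yx(3)] Bel by blast
    obtain w where w: "w \<in> cpt ?D n" "y = enc e w" using yx(2) Bel by blast
    have "enc e (\<theta>0 (n + 1) v) = 0" using yx(4) by (simp add: Bdif v(2) \<theta>enc)
    then have "\<theta>0 (n + 1) v = 0" using enc_comp[OF e, of "\<theta>0 (n + 1) v"] by (simp add: comp_arith)
    then have \<theta>v: "sec v i - (if i = 0 then 0 else sec v (i - 1)) = 0" for i
      using s\<theta>[of "n + 1" v i] by simp
    have "sec v i = 0" for i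
    proof (induction i)
      case 0 show ?case using \<theta>v[of 0] by simp
    next
      case (Suc i) then show ?case using \<theta>v[of "Suc i"] by simp
    qed
    then have "v = 0" by (intro sec_ext) simp
    then have x0: "x = 0" by (simp add: v(2) enc_arith)
    \<comment> \<open>Partial sums of w invert \<theta>0. They are eventually equal to the total sum
      q0 w, which is zero, so c has finite support; this is exactness in the middle.\<close>
    define c where "c = (\<lambda>(i, u). (\<Sum>j\<le>i. sec w j) u)"
    have sc: "sec c i = (\<Sum>j\<le>i. sec w j)" for i by (simp add: c_def sec_def)
    obtain K where K: "\<forall>i\<ge>K. sec w i = 0" using Dbound[OF w(1)] by blast
    have "q0 w = 0" using qz unfolding bar_cob by (simp add: yx(1) w(2) e)
    then have "(\<Sum>i<K. sec w i) = 0" using q0K[OF K] by simp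
    then have "sec c i = 0" if "i \<ge> K" for i
    proof -
      have "(\<Sum>j\<le>i. sec w j) = (\<Sum>j<K. sec w j)"
        by (rule sum.mono_neutral_right) (use K that in auto)
      then show ?thesis using \<open>(\<Sum>i<K. sec w i) = 0\<close> sc by simp
    qed
    then have "{i. sec c i \<noteq> 0} \<subseteq> {..<K}" by (auto simp: not_le[symmetric])
    then have "finite {i. sec c i \<noteq> 0}" using finite_subset by blast
    moreover have "sec c i \<in> cpt (Y i) n" for i
      unfolding sc
    proof (rule cpt_sum[OF Y])
      fix j assume j: "j \<in> {..i}"
      have "sec w j \<in> cpt (Y j) n" using w(1) by (simp add: dsum_cpt)
      then show "sec w j \<in> cpt (Y i) n" by (rule Ymono) (use j in simp)
    qed
    ultimately have c: "c \<in> cpt ?D n" by (simp add: dsum_cpt)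
    have "\<theta>0 n c = w"
    proof (rule sec_ext)
      fix i show "sec (\<theta>0 n c) i = sec w i"
        by (cases i) (simp_all add: s\<theta> sc)
    qed
    then have "\<theta> n (enc e c) = y" by (simp add: \<theta>enc w(2))
    moreover have "enc e c \<in> cpt B n" using c Bel by blast
    ultimately show "z \<in> coboundaries ?C n"
      using cone_cob_f[OF B B \<theta>, of "enc e c" n] by (simp add: yx(1) x0 Bdif)
  next
    fix n y assume "y \<in> cocycles ?E n"
    then have y: "y \<in> cpt ?E n" by simp
    \<comment> \<open>For n \<ge> - m this is the first stage whose interval reaches degree n. Below
      - m the element y is zero and any stage serves.\<close>
    define i where "i = nat (n + m)"
    have yY: "y \<in> cpt (Y i) n" using y unfolding Y_def i_def by (auto simp: bar_cpt pointwise)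
    have b: "\<iota> i n y \<in> cpt B n" by (rule hom_mem[OF \<iota>hom yY])
    have c: "case_sum (\<iota> i n y) 0 \<in> cocycles ?C n"
      unfolding cone_cocycle[OF B B \<theta>] using b B \<theta> by (simp add: Bdif)
    have "q0 (dsum_incl i n y) = (\<Sum>j\<in>{i}. sec (dsum_incl i n y) j)" by (rule q0) (auto split: if_splits)
    then have "y - ?q n (case_sum (\<iota> i n y) 0) = 0" by (simp add: \<iota>_def e)
    then show "\<exists>z\<in>cocycles ?C n. y - ?q n z \<in> coboundaries ?E n"
      unfolding bar_cob by (rule bexI[OF _ c])
  qed
  then obtain \<psi> \<chi> where tri: "dist_triangle B B ?E (D_of B B \<theta>) \<psi> \<chi>"
    using cone_triangle[OF B B E \<theta>] by blast
  have "is_hocolim Y \<phi> ?E" unfolding is_hocolim_def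
    by (intro conjI allI Y \<phi> exI[of _ B] exI[of _ \<iota>] exI[of _ "D_of B B \<theta>"] exI[of _ \<psi>] exI[of _ \<chi>] B' D_of_hom B \<theta> \<theta>\<iota> tri)
  moreover have "is_X i (X i)" for i unfolding X_def by (rule is_X_bar)
  ultimately show ?thesis unfolding is_E_def
    by (intro exI[of _ X] exI[of _ Y] exI[of _ \<phi>] conjI allI YX \<phi> \<phi>0)
qed

section \<open>Formality of DG modules over k[T]\<close>

section \<open>Formality\<close>

interpretation fpair: vector_space_pair "fscale :: 'k::field \<Rightarrow> ('u \<Rightarrow> 'k) \<Rightarrow> ('u \<Rightarrow> 'k)"
    "fscale :: 'k::field \<Rightarrow> ('u \<Rightarrow> 'k) \<Rightarrow> ('u \<Rightarrow> 'k)" ..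

abbreviation flinear :: "(('u \<Rightarrow> 'k::field) \<Rightarrow> ('u \<Rightarrow> 'k)) \<Rightarrow> bool" where
  "flinear \<equiv> Vector_Spaces.linear fscale fscale"

lemma flinear_simps:
  assumes "flinear g"
  shows "g (x + y) = g x + g y" "g (fscale c x) = fscale c (g x)" "g 0 = 0" "g (x - y) = g x - g y"
  using fpair.linear_add[OF assms] fpair.linear_scale[OF assms] fpair.linear_0[OF assms] fpair.linear_diff[OF assms]
  by auto

lemma span_ind:
  fixes b :: "('u \<Rightarrow> 'k::field) set"
  assumes "x \<in> fvec.span b" "P 0" "\<And>x y. P x \<Longrightarrow> P y \<Longrightarrow> P (x + y)" "\<And>c x. P x \<Longrightarrow> P (fscale c x)"
    "\<And>x. x \<in> b \<Longrightarrow> P x"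
  shows "P x"
  using assms(1)
proof (rule fvec.span_induct)
  show "fvec.subspace (Collect P)" by (rule subspaceI) (use assms in auto)
qed (rule assms(5))

text \<open>With B the coboundaries and Z the cocycles, l is a linear choice of representatives of
  cohomology classes, extended to all of C without enlarging its image. It comes from extending a
  basis of B to one of Z and then to one of C.\<close>

lemma ex_class_map:
  fixes B Z C :: "('u \<Rightarrow> 'k::field) set"
  assumes B: "fvec.subspace B" and Z: "fvec.subspace Z" and C: "fvec.subspace C" and BZ: "B \<subseteq> Z" and ZC: "Z \<subseteq> C"
  shows "\<exists>l. flinear l \<and> (\<forall>x\<in>B. l x = 0) \<and> (\<forall>z\<in>Z. l z - z \<in> B) \<and> (\<forall>x\<in>C. l x \<in> l ` Z)"
proof -
  obtain b where b: "b \<subseteq> B" "fvec.independent b" "B \<subseteq> fvec.span b"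
    by (rule fvec.maximal_independent_subset)
  obtain c where c: "b \<subseteq> c" "c \<subseteq> Z" "fvec.independent c" "Z \<subseteq> fvec.span c"
    by (rule fvec.maximal_independent_subset_extend[of b Z]) (use b BZ in auto)
  obtain d where d: "c \<subseteq> d" "d \<subseteq> C" "fvec.independent d" "C \<subseteq> fvec.span d"
    by (rule fvec.maximal_independent_subset_extend[of c C]) (use c ZC in auto)
  \<comment> \<open>Identity on the basis vectors that complement B in Z, zero on those of B and on
    those outside Z.\<close>
  obtain l where l: "flinear l" "\<forall>x\<in>d. l x = (if x \<in> c - b then x else 0)"
    using fpair.linear_independent_extend[OF d(3), of "\<lambda>x. if x \<in> c - b then x else 0"] by blast
  note ls = flinear_simps[OF l(1)]
  have 1: "l x = 0" if "x \<in> B" for x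
  proof (rule span_ind[of x b])
    show "x \<in> fvec.span b" using that b by blast
    show "l x = 0" if "x \<in> b" for x using that l(2) c(1) d(1) by auto
  qed (simp_all add: ls)
  have 2: "l z - z \<in> B" if "z \<in> Z" for z
  proof (rule span_ind[of z c])
    show "z \<in> fvec.span c" using that c by blast
    show "l x - x \<in> B" if "x \<in> c" for x
    proof (cases "x \<in> b")
      case True
      then have "l x = 0" using 1 b(1) by blast
      then show ?thesis using fvec.subspace_neg[OF B, of x] b(1) True by auto
    next
      case False
      then have "l x = x" using that l(2) d(1) by auto
      then show ?thesis using fvec.subspace_0[OF B] by simp
    qed
    show "l (x + y) - (x + y) \<in> B" if "l x - x \<in> B" "l y - y \<in> B" for x y
      using fvec.subspace_add[OF B that] by (simp add: ls algebra_simps)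
    show "l (fscale c x) - fscale c x \<in> B" if "l x - x \<in> B" for c x
      using fvec.subspace_scale[OF B that, of c] by (simp add: ls fscale_distribs)
  qed (simp add: ls fvec.subspace_0[OF B])
  have 3: "l x \<in> l ` Z" if "x \<in> C" for x
  proof (rule span_ind[of x d "\<lambda>x. l x \<in> l ` Z"])
    show "x \<in> fvec.span d" using that d by blast
    show "l 0 \<in> l ` Z" by (rule imageI) (rule fvec.subspace_0[OF Z])
    show "l x \<in> l ` Z" if "x \<in> d" for x
    proof (cases "x \<in> c - b")
      case True then show ?thesis using c(2) by blast
    next
      case False
      then have "l x = l 0" unfolding bspec[OF l(2) that] ls(3) by (rule if_not_P)
      then show ?thesis using fvec.subspace_0[OF Z] by (simp only: imageI)
    qed
    show "l (x + y) \<in> l ` Z" if xy: "l x \<in> l ` Z" "l y \<in> l ` Z" for x y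
    proof -
      obtain x' y' where x': "x' \<in> Z" "l x = l x'" and y': "y' \<in> Z" "l y = l y'" using xy by blast
      have "l (x + y) = l (x' + y')" using x' y' by (simp add: ls)
      then show ?thesis using fvec.subspace_add[OF Z x'(1) y'(1)] by (rule image_eqI)
    qed
    show "l (fscale a x) \<in> l ` Z" if xy: "l x \<in> l ` Z" for a x
    proof -
      obtain x' where x': "x' \<in> Z" "l x = l x'" using xy by blast
      have "l (fscale a x) = l (fscale a x')" using x' by (simp add: ls)
      then show ?thesis using fvec.subspace_scale[OF Z x'(1)] by (rule image_eqI)
    qed
  qed
  show ?thesis using l(1) 1 2 3 by blast
qed

text \<open>A map h that vanishes on the kernel of \<delta> descends to the image of \<delta>. The
  descended map is extended by zero on a basis complement, so its values on C stay in S.\<close>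

lemma ex_factor:
  fixes A C S :: "('u \<Rightarrow> 'k::field) set" and \<delta> h :: "('u \<Rightarrow> 'k) \<Rightarrow> ('u \<Rightarrow> 'k)"
  assumes A: "fvec.subspace A" and C: "fvec.subspace C" and S: "fvec.subspace S"
    and \<delta>: "\<And>x. x \<in> A \<Longrightarrow> \<delta> x \<in> C" "\<And>x y. x \<in> A \<Longrightarrow> y \<in> A \<Longrightarrow> \<delta> (x + y) = \<delta> x + \<delta> y"
      "\<And>c x. x \<in> A \<Longrightarrow> \<delta> (fscale c x) = fscale c (\<delta> x)"
    and h: "\<And>x. x \<in> A \<Longrightarrow> h x \<in> S" "\<And>x y. x \<in> A \<Longrightarrow> y \<in> A \<Longrightarrow> h (x + y) = h x + h y"
      "\<And>c x. x \<in> A \<Longrightarrow> h (fscale c x) = fscale c (h x)"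
    and ker: "\<And>x. x \<in> A \<Longrightarrow> \<delta> x = 0 \<Longrightarrow> h x = 0"
  shows "\<exists>g. flinear g \<and> (\<forall>x\<in>A. g (\<delta> x) = h x) \<and> (\<forall>x\<in>C. g x \<in> S)"
proof -
  have A0: "0 \<in> A" by (rule fvec.subspace_0[OF A])
  have z: "\<delta> 0 = 0" "h 0 = 0" using \<delta>(3)[OF A0, of 0] h(3)[OF A0, of 0] by simp_all
  have im: "fvec.subspace (\<delta> ` A)"
  proof (rule subspaceI)
    show "0 \<in> \<delta> ` A" using A0 z(1) by (metis imageI)
    show "x + y \<in> \<delta> ` A" if xy: "x \<in> \<delta> ` A" "y \<in> \<delta> ` A" for x y
    proof -
      obtain x' y' where "x' \<in> A" "x = \<delta> x'" "y' \<in> A" "y = \<delta> y'" using xy by blast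
      then show ?thesis using \<delta>(2)[of x' y'] fvec.subspace_add[OF A, of x' y'] by (metis imageI)
    qed
    show "fscale c x \<in> \<delta> ` A" if xy: "x \<in> \<delta> ` A" for c x
    proof -
      obtain x' where "x' \<in> A" "x = \<delta> x'" using xy by blast
      then show ?thesis using \<delta>(3)[of x' c] fvec.subspace_scale[OF A, of x' c] by (metis imageI)
    qed
  qed
  obtain b where b: "b \<subseteq> \<delta> ` A" "fvec.independent b" "\<delta> ` A \<subseteq> fvec.span b"
    by (rule fvec.maximal_independent_subset)
  obtain d where d: "b \<subseteq> d" "d \<subseteq> C" "fvec.independent d" "C \<subseteq> fvec.span d"
    by (rule fvec.maximal_independent_subset_extend[of b C]) (use b \<delta>(1) in auto)
  \<comment> \<open>Preimages under \<delta> are chosen only for basis vectors of the image; the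
    condition on kernels makes g independent of this choice.\<close>
  have "\<exists>y. y \<in> A \<and> \<delta> y = x" if "x \<in> b" for x using b(1) that by blast
  then obtain s where s: "\<And>x. x \<in> b \<Longrightarrow> s x \<in> A" "\<And>x. x \<in> b \<Longrightarrow> \<delta> (s x) = x" by metis
  obtain g where g: "flinear g" "\<forall>x\<in>d. g x = (if x \<in> b then h (s x) else 0)"
    using fpair.linear_independent_extend[OF d(3), of "\<lambda>x. if x \<in> b then h (s x) else 0"] by blast
  note gs = flinear_simps[OF g(1)]
  have g_ex: "\<exists>y\<in>A. \<delta> y = x \<and> g x = h y" if "x \<in> \<delta> ` A" for x
  proof (rule span_ind[of x b "\<lambda>x. \<exists>y\<in>A. \<delta> y = x \<and> g x = h y"])
    show "x \<in> fvec.span b" using that b(3) by blast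
    show "\<exists>y\<in>A. \<delta> y = 0 \<and> g 0 = h y" using A0 z gs(3) by auto
    show "\<exists>y\<in>A. \<delta> y = x \<and> g x = h y" if "x \<in> b" for x
      using s[OF that] g(2) d(1) that by (intro bexI[of _ "s x"]) auto
    show "\<exists>w\<in>A. \<delta> w = x + y \<and> g (x + y) = h w"
      if xy: "\<exists>w\<in>A. \<delta> w = x \<and> g x = h w" "\<exists>w\<in>A. \<delta> w = y \<and> g y = h w" for x y
    proof -
      obtain v w where "v \<in> A" "\<delta> v = x" "g x = h v" "w \<in> A" "\<delta> w = y" "g y = h w" using xy by blast
      then show ?thesis using \<delta>(2)[of v w] h(2)[of v w] fvec.subspace_add[OF A, of v w]
        by (intro bexI[of _ "v + w"]) (simp_all add: gs)
    qed
    show "\<exists>w\<in>A. \<delta> w = fscale c x \<and> g (fscale c x) = h w" if xy: "\<exists>w\<in>A. \<delta> w = x \<and> g x = h w" for c x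
    proof -
      obtain v where "v \<in> A" "\<delta> v = x" "g x = h v" using xy by blast
      then show ?thesis using \<delta>(3)[of v c] h(3)[of v c] fvec.subspace_scale[OF A, of v c]
        by (intro bexI[of _ "fscale c v"]) (simp_all add: gs)
    qed
  qed
  have "g (\<delta> x) = h x" if x: "x \<in> A" for x
  proof -
    obtain y where y: "y \<in> A" "\<delta> y = \<delta> x" "g (\<delta> x) = h y" using g_ex[of "\<delta> x"] x by blast
    have ny: "fscale (- 1) y \<in> A" by (rule fvec.subspace_scale[OF A y(1)])
    have "\<delta> (x + fscale (- 1) y) = 0" using \<delta>(2)[OF x ny] \<delta>(3)[OF y(1), of "- 1"] y(2) by simp
    then have "h (x + fscale (- 1) y) = 0" using ker fvec.subspace_add[OF A x ny] by blast
    then have "h x = h y" using h(2)[OF x ny] h(3)[OF y(1), of "- 1"] by simp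
    then show ?thesis using y(3) by simp
  qed
  moreover have "g x \<in> S" if "x \<in> C" for x
  proof (rule span_ind[of x d "\<lambda>x. g x \<in> S"])
    show "x \<in> fvec.span d" using that d(4) by blast
    show "g x \<in> S" if "x \<in> d" for x
      using g(2) that h(1)[OF s(1)] fvec.subspace_0[OF S] by auto
  qed (simp_all add: gs fvec.subspace_0[OF S] fvec.subspace_add[OF S] fvec.subspace_scale[OF S])
  ultimately show ?thesis using g(1) by blast
qed

text \<open>The power T^j applied to x; the starting degree i is carried along because
  \<open>tact\<close> is indexed by degree.\<close>

primrec tp :: "('k, 'u) dgm \<Rightarrow> int \<Rightarrow> nat \<Rightarrow> ('u \<Rightarrow> 'k) \<Rightarrow> 'u \<Rightarrow> 'k" where
  "tp M i 0 x = x"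
| "tp M i (Suc j) x = tact M (i - int j) (tp M i j x)"

context
  fixes M :: "('k::field, 'u) dgm" assumes M: "dg_module M"
begin

lemma tp_mem: "x \<in> cpt M i \<Longrightarrow> k = i - int j \<Longrightarrow> tp M i j x \<in> cpt M k"
  by (induction j arbitrary: k) (simp_all add: M)

lemma tp_add: "x \<in> cpt M i \<Longrightarrow> y \<in> cpt M i \<Longrightarrow> tp M i j (x + y) = tp M i j x + tp M i j y"
  by (induction j) (simp_all add: M tp_mem)

lemma tp_scale: "x \<in> cpt M i \<Longrightarrow> tp M i j (fscale c x) = fscale c (tp M i j x)"
  by (induction j) (simp_all add: M tp_mem)

lemma tp_zero: "tp M i j 0 = 0"
  by (induction j) (simp_all add: M)

lemma tp_diff: "x \<in> cpt M i \<Longrightarrow> y \<in> cpt M i \<Longrightarrow> tp M i j (x - y) = tp M i j x - tp M i j y"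
  by (induction j) (simp_all add: M tp_mem)

lemma tp_tact: "tp M (i - 1) j (tact M i x) = tp M i (Suc j) x"
  by (induction j) (simp_all add: algebra_simps)

lemma tp_dif: "x \<in> cpt M i \<Longrightarrow> k = i - int j \<Longrightarrow> dif M k (tp M i j x) = tp M (i + 1) j (dif M i x)"
proof (induction j arbitrary: k)
  case (Suc j)
  have "dif M k (tp M i (Suc j) x) = tact M (i - int j + 1) (dif M (i - int j) (tp M i j x))"
    unfolding tp.simps by (rule dif_tact[OF M tp_mem]) (use Suc.prems in simp_all)
  then show ?case using Suc.IH[OF Suc.prems(1) refl] by (simp add: algebra_simps)
qed simp

lemma tp_cocycle:
  assumes z: "z \<in> cocycles M i" and k: "k = i - int j" shows "tp M i j z \<in> cocycles M k"
  using tp_mem[OF cocycle_cpt[OF z] k] tp_dif[OF cocycle_cpt[OF z] k] z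
  by (simp add: cocycles_mem tp_zero del: cocycle_cpt cocycle_dif)

end

definition mkseq :: "('i \<Rightarrow> 'w \<Rightarrow> 'k) \<Rightarrow> 'i \<times> 'w \<Rightarrow> 'k" where
  "mkseq f = (\<lambda>(j, u). f j u)"

lemma sec_mkseq [simp]: "sec (mkseq f) j = f j"
  by (simp add: sec_def mkseq_def)

text \<open>The fibre of the map from the cofree module on S to the cofree module on the double suspension
  of S that has kernel S. A cofree module consists of sequences, T being the shift, so that a map
  to it is a map of graded vector spaces to S.\<close>

definition cof :: "('k::field, 'u) dgm \<Rightarrow> ('k, (nat \<times> 'u) + (nat \<times> 'u)) dgm" where
  "cof S = \<lparr>cpt = (\<lambda>i. {case_sum a b | a b. (\<forall>j. sec a j \<in> cpt S (i - int j)) \<and> (\<forall>j. sec b j \<in> cpt S (i - 2 - int j))}),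
     dif = (\<lambda>i z. case_sum 0 (mkseq (\<lambda>j. tact S (i - int j) (sec (z \<circ> Inl) j) - sec (z \<circ> Inl) (Suc j)))),
     tact = (\<lambda>i z. case_sum (mkseq (\<lambda>j. sec (z \<circ> Inl) (Suc j))) (mkseq (\<lambda>j. sec (z \<circ> Inr) (Suc j))))\<rparr>"

lemma cof_sel:
  "case_sum a b \<in> cpt (cof S) i \<longleftrightarrow> (\<forall>j. sec a j \<in> cpt S (i - int j)) \<and> (\<forall>j. sec b j \<in> cpt S (i - 2 - int j))"
  "dif (cof S) i (case_sum a b) = case_sum 0 (mkseq (\<lambda>j. tact S (i - int j) (sec a j) - sec a (Suc j)))"
  "tact (cof S) i (case_sum a b) = case_sum (mkseq (\<lambda>j. sec a (Suc j))) (mkseq (\<lambda>j. sec b (Suc j)))"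
  by (auto simp: cof_def case_sum_inject)

lemma cof_cptE:
  assumes "z \<in> cpt (cof S) i"
  obtains a b where "z = case_sum a b" "\<forall>j. sec a j \<in> cpt S (i - int j)" "\<forall>j. sec b j \<in> cpt S (i - 2 - int j)"
  using assms by (auto simp: cof_def)

lemma case_sum_sec_eq:
  "case_sum a b = case_sum a' b' \<longleftrightarrow> (\<forall>j. sec a j = sec a' j) \<and> (\<forall>j. sec b j = sec b' j)"
  unfolding case_sum_inject by (auto intro: sec_ext)

lemma dg_module_cof:
  fixes S :: "('k::field, 'u) dgm"
  assumes S: "dg_module S" shows "dg_module (cof S)"
proof (rule dg_moduleI)
  fix i
  show "fvec.subspace (cpt (cof S) i)"
    by (rule subspaceI; (elim cof_cptE)?) (use S in \<open>simp_all add: case_sum_arith cof_sel\<close>)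
  fix z assume "z \<in> cpt (cof S) i"
  then obtain a b where z': "z = case_sum a b" "\<forall>j. sec a j \<in> cpt S (i - int j)" "\<forall>j. sec b j \<in> cpt S (i - 2 - int j)"
    by (rule cof_cptE)
  note z = z'[rule_format]
  have z2: "sec a (Suc j) \<in> cpt S (i - int j - 1)" "sec b (Suc j) \<in> cpt S (i - 3 - int j)" for j
    using z(2)[of "Suc j"] z(3)[of "Suc j"] by (simp_all add: algebra_simps)
  have e: "i + 1 - 2 - int j = i - int j - 1" "i - 1 - 2 - int j = i - 3 - int j" "i - 1 - int j = i - int j - 1" for j
    by simp_all
  show "dif (cof S) i z \<in> cpt (cof S) (i + 1)"
    unfolding z(1) cof_sel using z(2) z2 S by (simp add: e)
  show "tact (cof S) i z \<in> cpt (cof S) (i - 1)"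
    unfolding z(1) cof_sel using z2 by (simp add: e)
  show "dif (cof S) i (fscale c z) = fscale c (dif (cof S) i z)" for c
    unfolding z(1) case_sum_arith cof_sel case_sum_sec_eq using z(2) S by (simp add: fscale_distribs)
  show "tact (cof S) i (fscale c z) = fscale c (tact (cof S) i z)" for c
    unfolding z(1) case_sum_arith cof_sel case_sum_sec_eq by simp
  show "dif (cof S) (i + 1) (dif (cof S) i z) = 0"
    unfolding z(1) cof_sel case_sum_arith(5) case_sum_sec_eq using S by simp
  show "dif (cof S) (i - 1) (tact (cof S) i z) = tact (cof S) (i + 1) (dif (cof S) i z)"
    unfolding z(1) cof_sel case_sum_sec_eq by (simp add: algebra_simps)
  fix z' assume "z' \<in> cpt (cof S) i"
  then obtain a' b' where w: "z' = case_sum a' b'" "\<forall>j. sec a' j \<in> cpt S (i - int j)" by (rule cof_cptE)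
  note z' = w[rule_format]
  show "dif (cof S) i (z + z') = dif (cof S) i z + dif (cof S) i z'"
    unfolding z(1) z'(1) case_sum_arith cof_sel case_sum_sec_eq using z(2) z'(2) S by simp
  show "tact (cof S) i (z + z') = tact (cof S) i z + tact (cof S) i z'"
    unfolding z(1) z'(1) case_sum_arith cof_sel case_sum_sec_eq by simp
qed

text \<open>A map into a cofree module is determined by its zeroth component, so F is built from l
  and m by inserting the powers of T. The map l is compatible with T only on cocycles; m records the
  failure elsewhere, and the equation for m is exactly what makes F commute with the
  differentials.\<close>

lemma cof_quasi_iso:
  fixes M S :: "('k::field, 'u) dgm"
  assumes M: "dg_module M" and S: "dg_module S"
    and l: "\<And>i. flinear (l i)" "\<And>i x. x \<in> cpt M i \<Longrightarrow> l i x \<in> cpt S i"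
    and l0: "\<And>i x. x \<in> coboundaries M i \<Longrightarrow> l i x = 0"
    and linj: "\<And>i z. z \<in> cocycles M i \<Longrightarrow> l i z = 0 \<Longrightarrow> z \<in> coboundaries M i"
    and lsurj: "\<And>i s. s \<in> cpt S i \<Longrightarrow> \<exists>z\<in>cocycles M i. l i z = s"
    and lT: "\<And>i z. z \<in> cocycles M i \<Longrightarrow> l (i - 1) (tact M i z) = tact S i (l i z)"
    and m: "\<And>i. flinear (m i)" "\<And>i x. x \<in> cpt M i \<Longrightarrow> m i x \<in> cpt S (i - 2)"
    and md: "\<And>i y. y \<in> cpt M i \<Longrightarrow> m (i + 1) (dif M i y) = tact S i (l i y) - l (i - 1) (tact M i y)"
  shows "\<exists>f. f \<in> quasi_iso M (cof S)"
proof -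
  let ?V = "cof S"
  have V: "dg_module ?V" by (rule dg_module_cof[OF S])
  define F where "F i x = case_sum (mkseq (\<lambda>j. l (i - int j) (tp M i j x))) (mkseq (\<lambda>j. m (i - int j) (tp M i j x)))" for i x
  have F: "F \<in> dg_hom M ?V"
  proof (rule dg_homI)
    fix i x assume x: "x \<in> cpt M i"
    note t = tp_mem[OF M x refl]
    show "F i x \<in> cpt ?V i" unfolding F_def cof_sel using l(2)[OF t] m(2)[OF t] by (simp add: algebra_simps)
    show "F i (fscale c x) = fscale c (F i x)" for c
      unfolding F_def case_sum_arith case_sum_sec_eq
      by (simp add: tp_scale[OF M x] flinear_simps[OF l(1)] flinear_simps[OF m(1)])
    show "F i (x + y) = F i x + F i y" if y: "y \<in> cpt M i" for y
      unfolding F_def case_sum_arith case_sum_sec_eq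
      by (simp add: tp_add[OF M x y] flinear_simps[OF l(1)] flinear_simps[OF m(1)])
    show "F (i - 1) (tact M i x) = tact ?V i (F i x)"
      unfolding F_def cof_sel case_sum_sec_eq by (simp add: tp_tact[OF M] algebra_simps)
    have d: "tp M (i + 1) j (dif M i x) = dif M (i - int j) (tp M i j x)" for j
      using tp_dif[OF M x refl] by simp
    have e: "i + 1 - int j = i - int j + 1" for j by simp
    have "l (i - int j + 1) (dif M (i - int j) (tp M i j x)) = 0" for j
      by (rule l0[OF dif_cob[OF M t refl]])
    moreover have "m (i - int j + 1) (dif M (i - int j) (tp M i j x)) =
        tact S (i - int j) (l (i - int j) (tp M i j x)) - l (i - int (Suc j)) (tp M i (Suc j) x)" for j
      unfolding md[OF t] by (simp add: algebra_simps)
    ultimately show "F (i + 1) (dif M i x) = dif ?V i (F i x)"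
      unfolding F_def cof_sel case_sum_sec_eq d e by simp
  qed
  have lTj: "l (i - int (Suc j)) (tp M i (Suc j) z) = tact S (i - int j) (l (i - int j) (tp M i j z))"
    if "z \<in> cocycles M i" for i j z
    using lT[OF tp_cocycle[OF M that refl], of j] by (simp add: algebra_simps)
  have "F \<in> quasi_iso M ?V"
  proof (rule quasi_isoI[OF M V F])
    fix i z assume z: "z \<in> cocycles M i" and c: "F i z \<in> coboundaries ?V i"
    obtain v where v: "v \<in> cpt ?V (i - 1)" "F i z = dif ?V (i - 1) v" using c by (rule coboundaryE)
    obtain a b where ab: "v = case_sum a b" using v(1) by (rule cof_cptE)
    have "l i z = 0" using v(2) unfolding ab F_def cof_sel case_sum_sec_eq by (auto dest: spec[of _ 0])
    then show "z \<in> coboundaries M i" by (rule linj[OF z])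
  next
    fix i y assume y: "y \<in> cocycles ?V i"
    obtain a b where ab': "y = case_sum a b" "\<forall>j. sec a j \<in> cpt S (i - int j)" "\<forall>j. sec b j \<in> cpt S (i - 2 - int j)"
      using cocycle_cpt[OF y] by (rule cof_cptE)
    note ab = ab'[rule_format]
    have "dif ?V i y = 0" using y by simp
    then have aS: "sec a (Suc j) = tact S (i - int j) (sec a j)" for j
      unfolding ab(1) cof_sel case_sum_arith(5) case_sum_sec_eq by simp
    obtain z where z: "z \<in> cocycles M i" "l i z = sec a 0" using lsurj[OF ab(2)[of 0]] by auto
    have la: "l (i - int j) (tp M i j z) = sec a j" for j
    proof (induction j)
      case (Suc j)
      then show ?case unfolding lTj[OF z(1)] by (simp add: aS)
    qed (simp add: z(2))
    define b' where "b' = (\<lambda>j. sec b j - m (i - int j) (tp M i j z))"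
    have b': "b' j \<in> cpt S (i - 2 - int j)" for j
    proof -
      have "m (i - int j) (tp M i j z) \<in> cpt S (i - int j - 2)" by (rule m(2)[OF tp_mem[OF M cocycle_cpt[OF z(1)] refl]])
      then show ?thesis unfolding b'_def using ab(3)[of j] S by (simp add: algebra_simps)
    qed
    \<comment> \<open>Surjectivity of the map between the two cofree modules: the equation T c_j -
      c_(j+1) = b'_j is solved recursively, starting from c_0 = 0.\<close>
    define c where "c = rec_nat 0 (\<lambda>j x. tact S (i - 1 - int j) x - b' j)"
    have c0: "c 0 = 0" and cS: "c (Suc j) = tact S (i - 1 - int j) (c j) - b' j" for j by (simp_all add: c_def)
    have c: "c j \<in> cpt S (i - 1 - int j)" for j
    proof (induction j)
      case (Suc j)
      have "tact S (i - 1 - int j) (c j) \<in> cpt S (i - 2 - int j)" using Suc S by simp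
      then show ?case unfolding cS using b'[of j] S by (simp add: algebra_simps)
    qed (simp add: c0 S)
    let ?w = "case_sum (mkseq c) (0 :: nat \<times> 'u \<Rightarrow> 'k)"
    have w: "?w \<in> cpt ?V (i - 1)" unfolding cof_sel using c S by simp
    have "y - F i z = dif ?V (i - 1) ?w"
      unfolding ab(1) F_def case_sum_arith cof_sel case_sum_sec_eq by (simp add: la cS b'_def)
    then have "y - F i z \<in> coboundaries ?V i" using coboundaryI[OF w] by simp
    then show "\<exists>z\<in>cocycles M i. y - F i z \<in> coboundaries ?V i" by (rule bexI[OF _ z(1)])
  qed
  then show ?thesis by blast
qed

lemma flinear_id: "flinear (\<lambda>x. x)" and flinear_zero: "flinear (\<lambda>x. 0)"
  using fvec.linear_id fpair.linear_zero by (simp_all add: id_def)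

text \<open>The length-one cofree resolution of the cohomology S receives quasi-isomorphisms both
  from S and from M. For M, the obstruction T l - l T vanishes on cocycles and so factors through
  the differential; no higher obstruction occurs because the resolution has length one.\<close>

lemma formality:
  fixes M :: "('k::field, 'u) dgm"
  assumes M: "dg_module M"
  obtains S :: "('k, 'u) dgm" and f g where "dg_module S" "\<And>i x. dif S i x = 0"
    "f \<in> quasi_iso M (cof S)" "g \<in> quasi_iso S (cof S)"
proof -
  have "\<exists>l. flinear l \<and> (\<forall>x\<in>coboundaries M i. l x = 0) \<and> (\<forall>z\<in>cocycles M i. l z - z \<in> coboundaries M i) \<and>
      (\<forall>x\<in>cpt M i. l x \<in> l ` cocycles M i)" for i
    by (rule ex_class_map[OF coboundaries_subspace[OF M] cocycles_subspace[OF M] cpt_subspace[OF M]])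
      (use cob_cocycle[OF M] in auto)
  then obtain l where l: "\<And>i. flinear (l i)" and l0: "\<And>i x. x \<in> coboundaries M i \<Longrightarrow> l i x = 0"
    and lz: "\<And>i z. z \<in> cocycles M i \<Longrightarrow> l i z - z \<in> coboundaries M i"
    and lm: "\<And>i x. x \<in> cpt M i \<Longrightarrow> l i x \<in> l i ` cocycles M i"
    by metis
  note ls = flinear_simps[OF l]
  have lc: "l i z \<in> cocycles M i" if z: "z \<in> cocycles M i" for i z
  proof -
    have "(l i z - z) + z \<in> cocycles M i" by (rule cocycles_closed(2)[OF M cob_cocycle[OF M lz[OF z]] z])
    then show ?thesis by simp
  qed
  have lcong: "l i z = l i z'" if "z - z' \<in> coboundaries M i" for i z z'
    using l0[OF that] ls(4)[of i z z'] by simp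
  \<comment> \<open>The cohomology of M, realised by the representatives selected by l. Since T need
    not preserve the chosen representatives, its action on S is followed by l.\<close>
  define S where "S = (\<lparr>cpt = (\<lambda>i. l i ` cocycles M i), dif = (\<lambda>i x. 0), tact = (\<lambda>i x. l (i - 1) (tact M i x))\<rparr> :: ('k, 'u) dgm)"
  have Ssel: "cpt S i = l i ` cocycles M i" "dif S i x = 0" "tact S i x = l (i - 1) (tact M i x)" for i x
    by (simp_all add: S_def)
  have SM: "x \<in> cocycles M i" if "x \<in> cpt S i" for x i using that lc by (auto simp: Ssel)
  have S: "dg_module S"
  proof (rule dg_moduleI)
    show "fvec.subspace (cpt S i)" for i
      unfolding Ssel by (rule fpair.linear_subspace_image[OF l cocycles_subspace[OF M]])
    fix i x assume x: "x \<in> cpt S i"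
    have xM: "x \<in> cpt M i" using SM[OF x] by simp
    show "tact S i x \<in> cpt S (i - 1)" unfolding Ssel using SM[OF x] M by (intro imageI) simp
    show "tact S i (fscale c x) = fscale c (tact S i x)" for c unfolding Ssel using xM M by (simp add: ls)
    show "tact S i (x + y) = tact S i x + tact S i y" if "y \<in> cpt S i" for y
      unfolding Ssel using xM SM[OF that] M by (simp add: ls)
    have "0 = l (i + 1) 0" by (simp add: ls)
    then show "dif S i x \<in> cpt S (i + 1)" unfolding Ssel by (rule image_eqI[of _ "l (i + 1)" 0]) (simp add: M)
  qed (simp_all add: Ssel ls M)
  have lT: "l (i - 1) (tact M i z) = tact S i (l i z)" if z: "z \<in> cocycles M i" for i z
  proof -
    have "tact M i (l i z) - tact M i z \<in> coboundaries M (i - 1)"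
      by (rule tact_cob_diff[OF M _ _ lz[OF z]]) (use z lc[OF z] in simp_all)
    from lcong[OF this] show ?thesis by (simp add: Ssel)
  qed
  \<comment> \<open>This produces the correction m in each degree: T l - l T is factored through the
    differential by \<open>ex_factor\<close>.\<close>
  have "\<exists>g. flinear g \<and> (\<forall>y\<in>cpt M (i - 1). g (dif M (i - 1) y) = tact S (i - 1) (l (i - 1) y) - l (i - 2) (tact M (i - 1) y)) \<and>
      (\<forall>x\<in>cpt M i. g x \<in> cpt S (i - 2))" for i
  proof (rule ex_factor[OF cpt_subspace[OF M] cpt_subspace[OF M] cpt_subspace[OF S]])
    fix x assume x: "x \<in> cpt M (i - 1)"
    have lx: "l (i - 1) x \<in> cpt S (i - 1)" using lm[OF x] by (simp add: Ssel)
    have ltx: "l (i - 2) (tact M (i - 1) x) \<in> cpt S (i - 2)"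
      using lm[of "tact M (i - 1) x" "i - 2"] x M by (simp add: Ssel)
    show "dif M (i - 1) x \<in> cpt M i" using x M by simp
    show "dif M (i - 1) (fscale c x) = fscale c (dif M (i - 1) x)" for c using x M by simp
    show "dif M (i - 1) (x + y) = dif M (i - 1) x + dif M (i - 1) y" if "y \<in> cpt M (i - 1)" for y using x that M by simp
    show "tact S (i - 1) (l (i - 1) x) - l (i - 2) (tact M (i - 1) x) \<in> cpt S (i - 2)"
      using lx ltx S by simp
    show "tact S (i - 1) (l (i - 1) (fscale c x)) - l (i - 2) (tact M (i - 1) (fscale c x)) =
        fscale c (tact S (i - 1) (l (i - 1) x) - l (i - 2) (tact M (i - 1) x))" for c
      using lx S x M by (simp add: ls fscale_distribs)
    show "tact S (i - 1) (l (i - 1) (x + y)) - l (i - 2) (tact M (i - 1) (x + y)) =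
        (tact S (i - 1) (l (i - 1) x) - l (i - 2) (tact M (i - 1) x)) +
        (tact S (i - 1) (l (i - 1) y) - l (i - 2) (tact M (i - 1) y))" if y: "y \<in> cpt M (i - 1)" for y
    proof -
      have "l (i - 1) y \<in> cpt S (i - 1)" using lm[OF y] by (simp add: Ssel)
      then show ?thesis using lx S x y M by (simp add: ls algebra_simps)
    qed
    show "tact S (i - 1) (l (i - 1) x) - l (i - 2) (tact M (i - 1) x) = 0" if "dif M (i - 1) x = 0"
    proof -
      have "x \<in> cocycles M (i - 1)" using x that by (simp add: cocycles_mem del: cocycle_cpt cocycle_dif)
      from lT[OF this] show ?thesis by simp
    qed
  qed
  then obtain m where m: "\<And>i. flinear (m i)"
    "\<And>i. \<forall>y\<in>cpt M (i - 1). m i (dif M (i - 1) y) = tact S (i - 1) (l (i - 1) y) - l (i - 2) (tact M (i - 1) y)"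
    "\<And>i x. x \<in> cpt M i \<Longrightarrow> m i x \<in> cpt S (i - 2)"
    by metis
  have "\<exists>f. f \<in> quasi_iso M (cof S)"
  proof (rule cof_quasi_iso[OF M S l _ l0 _ _ lT m(1,3)])
    show "l i x \<in> cpt S i" if "x \<in> cpt M i" for i x using lm[OF that] by (simp add: Ssel)
    show "z \<in> coboundaries M i" if "z \<in> cocycles M i" "l i z = 0" for i z
      using lz[OF that(1)] that(2) cob_closed(4)[OF M, of "- z" i] by simp
    show "\<exists>z\<in>cocycles M i. l i z = s" if "s \<in> cpt S i" for i s using that by (auto simp: Ssel)
    show "m (i + 1) (dif M i y) = tact S i (l i y) - l (i - 1) (tact M i y)" if "y \<in> cpt M i" for i y
    proof -
      have "i + 1 - 1 = i" "i + 1 - 2 = i - 1" by simp_all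
      then show ?thesis using m(2)[of "i + 1"] that by simp
    qed
  qed
  then obtain f where f: "f \<in> quasi_iso M (cof S)" by blast
  have cobS: "x = 0" if "x \<in> coboundaries S i" for x i using that by (auto elim: coboundaryE simp: Ssel(2))
  have cocS: "x \<in> cocycles S i \<longleftrightarrow> x \<in> cpt S i" for x i by (simp add: cocycles_mem Ssel(2) del: cocycle_cpt cocycle_dif)
  have "\<exists>g. g \<in> quasi_iso S (cof S)"
    by (rule cof_quasi_iso[of S S "\<lambda>i x. x" "\<lambda>i x. 0"])
      (use cobS in \<open>simp_all add: S flinear_id flinear_zero cocS Ssel(2)\<close>)
  then show thesis using that[OF S Ssel(2) f] by blast
qed

section \<open>Structure of Artinian graded k[T]-modules\<close>

section \<open>Decomposition of Artinian graded modules\<close>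

text \<open>Says that S is the internal direct sum of the interval modules \<open>bar (J k)\<close>,
  embedded by the maps \<kappa> k. Only bounded nonempty intervals and upward rays occur.\<close>

definition bar_decomposes ::
  "('k::field, 'u) dgm \<Rightarrow> nat \<Rightarrow> (nat \<Rightarrow> int set) \<Rightarrow> (nat \<Rightarrow> ('k, 'u, 'u) gmap) \<Rightarrow> bool" where
  "bar_decomposes S n J \<kappa> \<longleftrightarrow>
     (\<forall>k<n. ((\<exists>a b. a \<le> b \<and> J k = {a..b}) \<or> (\<exists>a. J k = {a..})) \<and> \<kappa> k \<in> dg_hom (bar (J k)) S) \<and>
     (\<forall>i. \<forall>s\<in>cpt S i. \<exists>x. (\<forall>k<n. x k \<in> cpt (bar (J k) :: ('k, 'u) dgm) i) \<and> s = (\<Sum>k<n. \<kappa> k i (x k))) \<and>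
     (\<forall>i x. (\<forall>k<n. x k \<in> cpt (bar (J k) :: ('k, 'u) dgm) i) \<longrightarrow> (\<Sum>k<n. \<kappa> k i (x k)) = 0 \<longrightarrow> (\<forall>k<n. x k = 0))"

text \<open>Among the nonzero elements of lowest degree d, one that is divisible by the highest power of T
  starts a chain that splits off.\<close>

lemma ex_chain:
  fixes S :: "('k::field, 'u) dgm"
  assumes S: "dg_module S" and d: "d \<le> N" and nz: "x0 \<in> cpt S d" "x0 \<noteq> 0"
    and surj: "\<And>i y. i \<ge> N \<Longrightarrow> y \<in> cpt S i \<Longrightarrow> \<exists>z\<in>cpt S (i + 1). tact S (i + 1) z = y"
  shows "\<exists>J y. ((\<exists>a b. a \<le> b \<and> J = {a..b}) \<or> (\<exists>a. J = {a..})) \<and> d \<in> J \<and> y d \<noteq> 0 \<and>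
    (\<forall>i\<in>J. d \<le> i \<and> y i \<in> cpt S i \<and> (i \<noteq> d \<longrightarrow> i - 1 \<in> J \<and> tact S i (y i) = y (i - 1))) \<and>
    (\<forall>i\<ge>d. i \<notin> J \<longrightarrow> (\<forall>s\<in>cpt S i. tp S i (nat (i - d)) s = 0))"
proof -
  define K where "K = nat (N - d)"
  \<comment> \<open>Some element of degree d + j reaches a nonzero element of degree d under T^j.
    This property passes from j + 1 to j.\<close>
  define Q where "Q j \<longleftrightarrow> (\<exists>s\<in>cpt S (d + int j). tp S (d + int j) j s \<noteq> 0)" for j
  have Q0: "Q 0" using nz by (auto simp: Q_def)
  have Qdown: "Q j" if "Q (Suc j)" for j
  proof -
    obtain s where s: "s \<in> cpt S (d + int (Suc j))" "tp S (d + int (Suc j)) (Suc j) s \<noteq> 0" using \<open>Q (Suc j)\<close> unfolding Q_def by blast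
    have "tp S (d + int j) j (tact S (d + int (Suc j)) s) \<noteq> 0"
      using s(2) tp_tact[OF S, of "d + int (Suc j)" j s] by (simp add: algebra_simps)
    moreover have "tact S (d + int (Suc j)) s \<in> cpt S (d + int j)" using s(1) S by simp
    ultimately show ?thesis unfolding Q_def by blast
  qed
  show ?thesis
  proof (cases "Q K")
    case True
    have dK: "d + int K = N" using d by (simp add: K_def)
    obtain s where s: "s \<in> cpt S N" "tp S N K s \<noteq> 0" using True unfolding Q_def dK by blast
    have "\<exists>z. v \<in> cpt S (N + int j) \<longrightarrow> z \<in> cpt S (N + int (Suc j)) \<and> tact S (N + int (Suc j)) z = v" for j v
    proof (cases "v \<in> cpt S (N + int j)")
      case True
      then obtain z where "z \<in> cpt S (N + int j + 1)" "tact S (N + int j + 1) z = v" using surj[of "N + int j" v] by auto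
      then have "z \<in> cpt S (N + int (Suc j)) \<and> tact S (N + int (Suc j)) z = v" by (simp add: ac_simps)
      then show ?thesis by (rule exI[of _ z, OF impI])
    qed simp
    note ex = this
    \<comment> \<open>From degree N on T is surjective, so a chain that reaches degree N can be
      continued upwards forever by choosing preimages; this gives the ray.\<close>
    define nxt where "nxt j v = (SOME z. v \<in> cpt S (N + int j) \<longrightarrow> z \<in> cpt S (N + int (Suc j)) \<and> tact S (N + int (Suc j)) z = v)" for j v
    have nxt: "nxt j v \<in> cpt S (N + int (Suc j)) \<and> tact S (N + int (Suc j)) (nxt j v) = v" if "v \<in> cpt S (N + int j)" for j v
      using someI_ex[OF ex[of v j]] that unfolding nxt_def[symmetric] by (rule mp)
    define w where "w = rec_nat s nxt"
    have w0: "w 0 = s" and wS: "w (Suc j) = nxt j (w j)" for j by (simp_all add: w_def)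
    have wm: "w j \<in> cpt S (N + int j)" for j
    proof (induction j)
      case (Suc j) then show ?case unfolding wS using nxt by blast
    qed (simp add: w0 s)
    have wT: "tact S (N + int (Suc j)) (w (Suc j)) = w j" for j unfolding wS using nxt wm by blast
    define y where "y i = (if i \<ge> N then w (nat (i - N)) else tp S N (nat (N - i)) s)" for i
    have yN: "y i = tp S N (nat (N - i)) s" if "i \<le> N" for i using that by (cases "i = N") (simp_all add: y_def w0)
    have ym: "y i \<in> cpt S i" for i
    proof (cases "i \<ge> N")
      case True then show ?thesis using wm[of "nat (i - N)"] by (simp add: y_def)
    next
      case False
      then show ?thesis unfolding y_def by (simp add: tp_mem[OF S s(1)])
    qed
    have yT: "tact S i (y i) = y (i - 1)" for i
    proof (cases "i > N")
      case True
      define j where "j = nat (i - 1 - N)"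
      have j: "i = N + int (Suc j)" using True by (simp add: j_def)
      have "nat (i - N) = Suc j" "nat (i - 1 - N) = j" using True by (simp_all add: j_def)
      then have "y i = w (Suc j)" "y (i - 1) = w j" unfolding y_def using True by simp_all
      then show ?thesis using wT[of j] j by simp
    next
      case False
      have "nat (N - (i - 1)) = Suc (nat (N - i))" "N - int (nat (N - i)) = i" using False by simp_all
      then show ?thesis using False by (simp add: yN)
    qed
    have "y d \<noteq> 0" using s(2) d by (simp add: yN K_def)
    then show ?thesis using ym yT by (intro exI[of _ "{d..}"] exI[of _ y]) auto
  next
    case False
    \<comment> \<open>A chain that cannot reach degree N stops at a largest height j, giving the
      interval from d to d + j. Maximality says that nothing above the interval maps nontrivially to
      degree d.\<close>
    have "\<exists>j. Q j \<and> \<not> Q (Suc j)"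
    proof (rule ccontr)
      assume "\<not> (\<exists>j. Q j \<and> \<not> Q (Suc j))"
      then have "Q j" for j by (induction j) (use Q0 in auto)
      then show False using False by blast
    qed
    then obtain j where j: "Q j" "\<not> Q (Suc j)" by blast
    have nQ: "\<not> Q i" if "i > j" for i
      using that
    proof (induction i)
      case (Suc i) then show ?case using j(2) Qdown[of i] by (cases "i = j") auto
    qed simp
    obtain s where s: "s \<in> cpt S (d + int j)" "tp S (d + int j) j s \<noteq> 0" using j(1) unfolding Q_def by blast
    define y where "y i = tp S (d + int j) (nat (d + int j - i)) s" for i
    have ym: "y i \<in> cpt S i" if "i \<le> d + int j" for i unfolding y_def by (rule tp_mem[OF S s(1)]) (use that in simp)
    have yT: "tact S i (y i) = y (i - 1)" if "i \<le> d + int j" for i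
    proof -
      have "nat (d + int j - (i - 1)) = Suc (nat (d + int j - i))" "d + int j - int (nat (d + int j - i)) = i" using that by simp_all
      then show ?thesis by (simp add: y_def)
    qed
    have yd: "y d \<noteq> 0" using s(2) by (simp add: y_def)
    have z: "tp S i (nat (i - d)) t = 0" if "i \<ge> d" "i \<notin> {d..d + int j}" "t \<in> cpt S i" for i t
    proof -
      have "d + int (nat (i - d)) = i" "nat (i - d) > j" using that by auto
      then show ?thesis using nQ[of "nat (i - d)"] that(3) unfolding Q_def by auto
    qed
    show ?thesis
      by (intro exI[of _ "{d..d + int j}"] exI[of _ y]) (use ym yT yd z in auto)
  qed
qed

text \<open>Here r i bounds the dimension in degree i, and the induction is on the total bound over
  the window from - N to N. A maximal chain through the lowest nonzero degree splits off; its
  complement satisfies the same hypotheses, with a smaller bound in that degree. Outside the window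
  nothing has to be counted: below it S vanishes, and above it T is bijective.\<close>

lemma ex_bar_decomposition_aux:
  fixes S :: "('k::field, 'u) dgm" and r :: "int \<Rightarrow> nat" and N :: int
  assumes "dg_module S" and "\<And>i x. x \<in> cpt S i \<Longrightarrow> dif S i x = 0"
    and "\<And>i x. i < - N \<Longrightarrow> x \<in> cpt S i \<Longrightarrow> x = 0"
    and "\<And>i. dep_mod (cpt S i) {0} (Suc (r i))"
    and "\<And>i z. i \<ge> N \<Longrightarrow> z \<in> cpt S (i + 1) \<Longrightarrow> tact S (i + 1) z = 0 \<Longrightarrow> z = 0"
    and "\<And>i y. i \<ge> N \<Longrightarrow> y \<in> cpt S i \<Longrightarrow> \<exists>z\<in>cpt S (i + 1). tact S (i + 1) z = y"
    and "(\<Sum>i\<in>{- N..N}. r i) = m"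
  shows "\<exists>n J \<kappa>. bar_decomposes S n J \<kappa>"
  using assms
proof (induction m arbitrary: S r rule: less_induct)
  case (less m)
  note S = less.prems(1) and dif0 = less.prems(2) and low = less.prems(3) and dep = less.prems(4)
    and Tinj = less.prems(5) and Tsurj = less.prems(6) and sum = less.prems(7)
  show ?case
  proof (cases "\<forall>i\<in>{- N..N}. \<forall>x\<in>cpt S i. x = 0")
    case True
    \<comment> \<open>T is injective above N, so vanishing in degree N propagates to all higher
      degrees.\<close>
    have up: "\<forall>x\<in>cpt S i. x = 0" if "i \<ge> N" for i
      using that
    proof (induction i rule: int_ge_induct)
      case base
      show ?case using True low[of N] by (cases "N \<ge> 0") auto
    next
      case (step i)
      show ?case
      proof
        fix x assume x: "x \<in> cpt S (i + 1)"
        have "tact S (i + 1) x \<in> cpt S i" using x S by simp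
        then show "x = 0" using step.IH Tinj[OF step.hyps x] by blast
      qed
    qed
    have "x = 0" if "x \<in> cpt S i" for i x
      using True low up that by (metis atLeastAtMost_iff linorder_not_le nle_le)
    then show ?thesis by (intro exI[of _ 0] exI[of _ "\<lambda>_. {}"] exI[of _ "\<lambda>_ _ _. 0"]) (simp add: bar_decomposes_def)
  next
    case False
    define D where "D = {i \<in> {- N..N}. \<exists>x\<in>cpt S i. x \<noteq> 0}"
    define d where "d = Min D"
    have "finite D" unfolding D_def by (rule finite_subset[of _ "{- N..N}"]) auto
    moreover have "D \<noteq> {}" using False by (auto simp: D_def)
    ultimately have dD: "d \<in> D" and dmin: "\<And>i. i \<in> D \<Longrightarrow> d \<le> i" by (auto simp: d_def)
    obtain x0 where dN: "- N \<le> d" "d \<le> N" and x0: "x0 \<in> cpt S d" "x0 \<noteq> 0" using dD by (auto simp: D_def)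
    have below: "x = 0" if "i < d" "x \<in> cpt S i" for i x
    proof (rule ccontr)
      assume x: "x \<noteq> 0"
      then have "i \<ge> - N" using low that by force
      then have "i \<in> D" using x that dN by (auto simp: D_def)
      then show False using dmin that(1) by force
    qed
    obtain J y where Jint: "(\<exists>a b. a \<le> b \<and> J = {a..b}) \<or> (\<exists>a. J = {a..})" and dJ: "d \<in> J" and yd: "y d \<noteq> 0"
      and J: "\<forall>i\<in>J. d \<le> i \<and> y i \<in> cpt S i \<and> (i \<noteq> d \<longrightarrow> i - 1 \<in> J \<and> tact S i (y i) = y (i - 1))"
      and Jout: "\<forall>i\<ge>d. i \<notin> J \<longrightarrow> (\<forall>s\<in>cpt S i. tp S i (nat (i - d)) s = 0)"
      using ex_chain[OF S dN(2) x0 Tsurj] by blast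
    have Jd: "d \<le> i" and ym: "y i \<in> cpt S i" if "i \<in> J" for i using J that by blast+
    have yT: "i - 1 \<in> J" "tact S i (y i) = y (i - 1)" if "i \<in> J" "i \<noteq> d" for i using J that by blast+
    \<comment> \<open>Evaluation at u0 is a linear functional on degree d that is nonzero on y d.
      Composed with powers of T it gives functionals q i compatible with T, each taking the value y
      d u0 on the chain.\<close>
    obtain u0 where u0: "y d u0 \<noteq> 0" using yd by (auto simp: fun_eq_iff pointwise)
    define q where "q i s = tp S i (nat (i - d)) s u0" for i s
    have q_add: "q i (x + y) = q i x + q i y" and q_scale: "q i (fscale c x) = c * q i x" and q_diff: "q i (x - y) = q i x - q i y"
      if "x \<in> cpt S i" "y \<in> cpt S i" for i x y c
      using that by (simp_all add: q_def tp_add[OF S] tp_scale[OF S] tp_diff[OF S]) (simp_all add: pointwise fscale_def)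
    have q_zero: "q i 0 = 0" for i by (simp add: q_def tp_zero[OF S] pointwise)
    have q_tact: "q (i - 1) (tact S i s) = q i s" if "i > d" for i s
    proof -
      have "nat (i - d) = Suc (nat (i - 1 - d))" using that by simp
      then show ?thesis unfolding q_def using tp_tact[OF S] by metis
    qed
    have q_y: "q i (y i) = y d u0" if "i \<in> J" for i
    proof -
      have "i \<in> J \<longrightarrow> q i (y i) = y d u0" if "d \<le> i" for i
        using that
      proof (induction i rule: int_ge_induct)
        case base show ?case by (simp add: q_def)
      next
        case (step i)
        show ?case
        proof
          assume i: "i + 1 \<in> J"
          have "i \<in> J" "tact S (i + 1) (y (i + 1)) = y i" using yT[OF i] step.hyps by simp_all
          then show "q (i + 1) (y (i + 1)) = y d u0"
            using step q_tact[of "i + 1" "y (i + 1)"] by simp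
        qed
      qed
      then show ?thesis using Jd that by blast
    qed
    \<comment> \<open>The common kernel of the functionals q. It is stable under T because q is, and
      it complements the chain because q is nonzero on every y i with i in J and vanishes in the
      degrees i \<ge> d outside J.\<close>
    define C where "C = S\<lparr>cpt := \<lambda>i. {s \<in> cpt S i. d \<le> i \<longrightarrow> q i s = 0}\<rparr>"
    have Csel: "s \<in> cpt C i \<longleftrightarrow> s \<in> cpt S i \<and> (d \<le> i \<longrightarrow> q i s = 0)" "dif C = dif S" "tact C = tact S" for s i
      by (simp_all add: C_def)
    have CT: "tact S i s \<in> cpt C (i - 1)" if "s \<in> cpt C i" for i s
      using that q_tact[of i s] S by (auto simp: Csel)
    have C: "dg_module C"
    proof (rule dg_moduleI)
      show "fvec.subspace (cpt C i)" for i
        by (rule subspaceI) (use S in \<open>auto simp: Csel q_zero q_add q_scale\<close>)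
    qed (use S CT in \<open>auto simp: Csel dif0 q_zero\<close>)
    have incl: "f \<in> dg_hom X C \<Longrightarrow> f \<in> dg_hom X S" for f and X :: "('k, 'u) dgm"
      by (rule dg_homI) (use hom_mem[of f X C] hom_tact[of f X C] hom_dif[of f X C] hom_add[of f X C] hom_scale[of f X C] in \<open>auto simp: Csel\<close>)
    have rd: "r d \<noteq> 0"
    proof
      assume "r d = 0"
      then have "dep_mod (cpt S d) {0} 1" using dep[of d] by simp
      then obtain c :: "nat \<Rightarrow> 'k" and j where "j < 1" "c j \<noteq> 0" "(\<Sum>j<1. fscale (c j) x0) \<in> {0}"
        by (rule dep_modE[of _ _ _ "\<lambda>_. x0"]) (use x0 in auto)
      then have c: "c 0 \<noteq> 0" "fscale (c 0) x0 = 0" by simp_all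
      then have "fscale (1 / c 0) (fscale (c 0) x0) = 0" by simp
      then show False using c(1) x0(2) by simp
    qed
    define r' where "r' = r(d := r d - 1)"
    have lt: "(\<Sum>i\<in>{- N..N}. r' i) < m"
      unfolding sum[symmetric] by (rule sum_strict_mono_ex1) (use rd dN in \<open>auto simp: r'_def\<close>)
    have dep': "dep_mod (cpt C i) {0} (Suc (r' i))" for i
    proof (cases "i = d")
      case False
      then show ?thesis using dep[of i] unfolding dep_mod_def Csel by (simp add: r'_def)
    next
      case True
      have "dep_mod (cpt C d) {0} (r d)"
      proof (rule dep_modI)
        fix z assume z: "\<And>j. j < r d \<Longrightarrow> z j \<in> cpt C d"
        have z': "z j \<in> cpt S d" "z j u0 = 0" if "j < r d" for j using z[OF that] by (simp_all add: Csel q_def)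
        \<comment> \<open>A family in the complement is enlarged by y d. In the resulting relation
          the coordinate u0 sees only y d, so its coefficient is zero and the relation already holds
          in the complement. This lowers the bound by one.\<close>
        let ?z = "z(r d := y d)"
        obtain c j where c: "j < Suc (r d)" "c j \<noteq> 0" "(\<Sum>j<Suc (r d). fscale (c j) (?z j)) \<in> {0}"
          by (rule dep_modE[OF dep[of d], of ?z]) (use z'(1) ym[OF dJ] in \<open>auto simp: less_Suc_eq\<close>)
        have s: "(\<Sum>j<r d. fscale (c j) (z j)) + fscale (c (r d)) (y d) = 0" using c(3) by simp
        have "(\<Sum>j<k. fscale (c j) (z j)) u0 = 0" if "k \<le> r d" for k
          using that
        proof (induction k)
          case (Suc k) then show ?case using z'(2)[of k] by (simp add: pointwise fscale_def)
        qed (simp add: pointwise)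
        from this[OF le_refl] have "c (r d) * y d u0 = 0"
          using fun_cong[OF s, of u0] by (simp add: pointwise fscale_def)
        then have c0: "c (r d) = 0" using u0 by simp
        then have "j < r d" using c(1,2) by (metis less_SucE)
        moreover have "(\<Sum>j<r d. fscale (c j) (z j)) = 0" using s c0 by simp
        ultimately show "\<exists>c. (\<exists>j<r d. c j \<noteq> 0) \<and> (\<Sum>j<r d. fscale (c j) (z j)) \<in> {0}" using c(2) by blast
      qed
      then show ?thesis using rd True by (simp add: r'_def)
    qed
    have "\<exists>n J \<kappa>. bar_decomposes C n J \<kappa>"
    proof (rule less.IH[OF lt C _ _ dep'])
      show "dif C i x = 0" if "x \<in> cpt C i" for i x using that dif0 by (simp add: Csel)
      show "x = 0" if "i < - N" "x \<in> cpt C i" for i x using that low by (simp add: Csel)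
      show "z = 0" if "N \<le> i" "z \<in> cpt C (i + 1)" "tact C (i + 1) z = 0" for i z
        using that Tinj by (simp add: Csel)
      show "\<exists>z\<in>cpt C (i + 1). tact C (i + 1) z = y" if i: "N \<le> i" and y: "y \<in> cpt C i" for i y
      proof -
        obtain z where z: "z \<in> cpt S (i + 1)" "tact S (i + 1) z = y" using Tsurj[OF i, of y] y by (auto simp: Csel)
        have "q (i + 1) z = 0" using q_tact[of "i + 1" z] z(2) y i dN by (simp add: Csel)
        then show ?thesis using z by (auto simp: Csel)
      qed
    qed simp
    then obtain n J' \<kappa>' where dec: "bar_decomposes C n J' \<kappa>'" by blast
    have J': "(\<exists>a b. a \<le> b \<and> J' k = {a..b}) \<or> (\<exists>a. J' k = {a..})" and \<kappa>': "\<kappa>' k \<in> dg_hom (bar (J' k)) C" if "k < n" for k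
      using dec that unfolding bar_decomposes_def by blast+
    have gen': "\<exists>x. (\<forall>k<n. x k \<in> cpt (bar (J' k) :: ('k, 'u) dgm) i) \<and> s = (\<Sum>k<n. \<kappa>' k i (x k))" if "s \<in> cpt C i" for i s
      using dec that unfolding bar_decomposes_def by blast
    have ind': "x k = 0" if "\<forall>k<n. x k \<in> cpt (bar (J' k) :: ('k, 'u) dgm) i" "(\<Sum>k<n. \<kappa>' k i (x k)) = 0" "k < n" for i x k
      using dec that unfolding bar_decomposes_def by blast
    define \<kappa> where "\<kappa> i x = (if i \<in> J then fscale (x undefined) (y i) else 0)" for i and x :: "'u \<Rightarrow> 'k"
    have \<kappa>: "\<kappa> \<in> dg_hom (bar J) S"
    proof (rule dg_homI)
      fix i x assume x: "x \<in> cpt (bar J :: ('k, 'u) dgm) i"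
      show "\<kappa> i x \<in> cpt S i" using ym S by (simp add: \<kappa>_def)
      show "\<kappa> i (x + x') = \<kappa> i x + \<kappa> i x'" for x' by (simp add: \<kappa>_def pointwise fscale_distribs)
      show "\<kappa> i (fscale c x) = fscale c (\<kappa> i x)" for c by (auto simp: \<kappa>_def fscale_def pointwise fun_eq_iff)
      show "\<kappa> (i + 1) (dif (bar J) i x) = dif S i (\<kappa> i x)"
        using dif0[of "\<kappa> i x" i] ym S by (auto simp: \<kappa>_def pointwise)
      show "\<kappa> (i - 1) (tact (bar J) i x) = tact S i (\<kappa> i x)"
      proof (cases "i \<in> J")
        case iJ: True
        show ?thesis
        proof (cases "i = d")
          case True
          have "tact S i (y i) \<in> cpt S (i - 1)" using ym[OF iJ] S by simp
          then have "tact S i (y i) = 0" using below[of "i - 1"] True by simp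
          moreover have "i - 1 \<notin> J" using Jd[of "i - 1"] True by auto
          ultimately show ?thesis using iJ ym[OF iJ] S by (simp add: \<kappa>_def)
        next
          case False
          then show ?thesis using yT[OF iJ False] iJ ym[OF iJ] S by (simp add: \<kappa>_def)
        qed
      next
        case False
        then have "x = 0" using x by (simp add: bar_cpt)
        then show ?thesis using False S by (auto simp: \<kappa>_def pointwise)
      qed
    qed
    let ?J = "J'(n := J)" and ?\<kappa> = "\<kappa>'(n := \<kappa>)"
    have sum_upd: "(\<Sum>k<Suc n. ?\<kappa> k i (x k)) = (\<Sum>k<n. \<kappa>' k i (x k)) + \<kappa> i (x n)" for i x
      by (simp add: sum.lessThan_Suc)
    have "bar_decomposes S (Suc n) ?J ?\<kappa>" unfolding bar_decomposes_def
    proof (intro conjI allI impI ballI)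
      fix k assume k: "k < Suc n"
      show "(\<exists>a b. a \<le> b \<and> ?J k = {a..b}) \<or> (\<exists>a. ?J k = {a..})" using k J' Jint by (cases "k = n") auto
      show "?\<kappa> k \<in> dg_hom (bar (?J k)) S" using k \<kappa> incl[OF \<kappa>'] by (cases "k = n") auto
    next
      fix i s assume s: "s \<in> cpt S i"
      \<comment> \<open>The coefficient of y i for which the remainder is annihilated by q
        i.\<close>
      define c where "c = (if i \<in> J then q i s / y d u0 else 0)"
      let ?xn = "\<lambda>u::'u. if u = undefined then c else 0"
      have xn: "?xn \<in> cpt (bar J) i" by (auto simp: bar_cpt c_def fun_eq_iff pointwise)
      have \<kappa>xn: "\<kappa> i ?xn \<in> cpt S i" by (rule hom_mem[OF \<kappa> xn])
      have "s - \<kappa> i ?xn \<in> cpt C i"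
      proof (cases "i \<in> J")
        case True
        have "q i (s - fscale c (y i)) = q i s - c * q i (y i)"
          using q_diff[OF s cpt_scale[OF S ym[OF True]]] q_scale[OF ym[OF True] ym[OF True]] by simp
        then have "q i (s - fscale c (y i)) = 0" using q_y[OF True] True u0 by (simp add: c_def)
        then show ?thesis using True s \<kappa>xn S by (simp add: Csel \<kappa>_def)
      next
        case False
        have "q i s = 0" if "d \<le> i" using Jout that False s by (auto simp: q_def pointwise)
        then show ?thesis using False s by (simp add: Csel \<kappa>_def)
      qed
      then obtain x where x: "\<forall>k<n. x k \<in> cpt (bar (J' k) :: ('k, 'u) dgm) i" "s - \<kappa> i ?xn = (\<Sum>k<n. \<kappa>' k i (x k))"
        using gen' by blast
      have "s = (\<Sum>k<n. \<kappa>' k i ((x(n := ?xn)) k)) + \<kappa> i ((x(n := ?xn)) n)"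
        using x(2) by (simp add: algebra_simps)
      then have "s = (\<Sum>k<Suc n. ?\<kappa> k i ((x(n := ?xn)) k))" unfolding sum_upd .
      moreover have "\<forall>k<Suc n. (x(n := ?xn)) k \<in> cpt (bar (?J k) :: ('k, 'u) dgm) i"
        using x(1) xn by (auto simp: less_Suc_eq)
      ultimately show "\<exists>x. (\<forall>k<Suc n. x k \<in> cpt (bar (?J k) :: ('k, 'u) dgm) i) \<and> s = (\<Sum>k<Suc n. ?\<kappa> k i (x k))" by blast
    next
      fix i x k assume x: "\<forall>k<Suc n. x k \<in> cpt (bar (?J k) :: ('k, 'u) dgm) i"
        and 0: "(\<Sum>k<Suc n. ?\<kappa> k i (x k)) = 0" and k: "k < Suc n"
      have x': "\<forall>k<n. x k \<in> cpt (bar (J' k) :: ('k, 'u) dgm) i"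
      proof (intro allI impI)
        fix k assume "k < n"
        then show "x k \<in> cpt (bar (J' k) :: ('k, 'u) dgm) i" using spec[OF x, of k] by simp
      qed
      have xn: "x n \<in> cpt (bar J :: ('k, 'u) dgm) i" using spec[OF x, of n] by simp
      have z: "(\<Sum>k<n. \<kappa>' k i (x k)) + \<kappa> i (x n) = 0" using 0 unfolding sum_upd .
      have zC: "(\<Sum>k<n. \<kappa>' k i (x k)) \<in> cpt C i" by (rule cpt_sum[OF C]) (use hom_mem[OF \<kappa>'] x' in auto)
      have xn0: "x n = 0"
      proof (cases "i \<in> J")
        case True
        \<comment> \<open>Applying q isolates the coefficient on the new chain, as all other
          summands lie in its kernel; the relation then reduces to one inside C.\<close>
        have "q i ((\<Sum>k<n. \<kappa>' k i (x k)) + \<kappa> i (x n)) = x n undefined * y d u0"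
          using q_add[of "\<Sum>k<n. \<kappa>' k i (x k)" i "\<kappa> i (x n)"] zC hom_mem[OF \<kappa> xn] Jd[OF True]
            q_scale[OF ym[OF True] ym[OF True]] q_y[OF True] True by (simp add: Csel \<kappa>_def)
        then have "x n undefined = 0" using u0 unfolding z by (simp add: q_zero)
        moreover have "\<forall>u. u \<noteq> undefined \<longrightarrow> x n u = 0" using xn by (simp add: bar_cpt)
        ultimately show ?thesis by (metis ext zero_fun_apply)
      qed (use xn in \<open>simp add: bar_cpt\<close>)
      have "\<kappa> i (x n) = 0" unfolding xn0 by (rule hom_zero[OF \<kappa>]) simp
      then have "(\<Sum>k<n. \<kappa>' k i (x k)) = 0" using z by simp
      then show "x k = 0" using ind'[OF x'] xn0 k by (cases "k = n") auto
    qed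
    then show ?thesis by blast
  qed
qed

text \<open>With zero differential, cocycles are all elements and coboundaries are zero, so the
  Artinian conditions on cohomology become conditions on S itself.\<close>

lemma ex_bar_decomposition:
  fixes S :: "('k::field, 'u) dgm"
  assumes S: "dg_module S" and dif0: "\<And>i x. dif S i x = 0" and art: "artinian S"
  shows "\<exists>n J \<kappa>. bar_decomposes S n J \<kappa>"
proof -
  have coc: "x \<in> cocycles S i \<longleftrightarrow> x \<in> cpt S i" for x i by (simp add: cocycles_mem dif0 del: cocycle_cpt cocycle_dif)
  have cob: "x \<in> coboundaries S i \<longleftrightarrow> x = 0" for x i
    using S by (auto elim: coboundaryE simp: dif0)
  have cob': "coboundaries S i = {0}" and coc': "cocycles S i = cpt S i" for i using cob coc by auto
  obtain N where N': "N \<ge> 0" "\<forall>i. i < - N \<longrightarrow> coh_zero S i" "\<forall>i. coh_dep S i" "\<forall>i. i \<ge> N \<longrightarrow> tact_bij S i"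
    by (rule artinianE[OF art, of 0])
  have "\<exists>n. dep_mod (cpt S i) {0} (Suc n)" for i
  proof -
    obtain n where n: "dep_mod (cpt S i) {0} n" using N'(3) unfolding coh_dep_def cob' coc' by blast
    \<comment> \<open>\<open>dep_mod\<close> asks for an index below n, which rules out n = 0; the
      successor form makes r i a bound on the dimension.\<close>
    then have "n \<noteq> 0" unfolding dep_mod_def by auto
    then show ?thesis using n by (cases n) auto
  qed
  then have "\<forall>i. \<exists>n. dep_mod (cpt S i) {0} (Suc n)" by (rule allI)
  from choice[OF this] obtain r where r: "\<forall>i. dep_mod (cpt S i) {0} (Suc (r i))" by (rule exE)
  show ?thesis
  proof (rule ex_bar_decomposition_aux[where S = S and r = r and N = N and m = "\<Sum>i\<in>{- N..N}. r i"])
    show "dep_mod (cpt S i) {0} (Suc (r i))" for i using r by (rule spec)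
    show "x = 0" if "i < - N" "x \<in> cpt S i" for i x
    proof -
      have "coh_zero S i" using N'(2) that(1) by simp
      then show ?thesis using that(2) unfolding coh_zero_def coc' cob' by auto
    qed
    show "z = 0" if "N \<le> i" "z \<in> cpt S (i + 1)" "tact S (i + 1) z = 0" for i z
    proof -
      have "tact_bij S i" using N'(4) that(1) by simp
      then show ?thesis using that(2,3) unfolding tact_bij_def coc' cob' by auto
    qed
    show "\<exists>z\<in>cpt S (i + 1). tact S (i + 1) z = y" if "N \<le> i" "y \<in> cpt S i" for i y
    proof -
      have "tact_bij S i" using N'(4) that(1) by simp
      then show ?thesis using that(2) unfolding tact_bij_def coc' cob' by fastforce
    qed
  qed (use S dif0 in simp_all)
qed

section \<open>Identification of the class \<open>Dbar\<close>, and the conclusion\<close>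

section \<open>The triangulated subcategory\<close>

text \<open>M and the direct sum of the interval modules of its cohomology both map by
  quasi-isomorphisms to the cofree resolution. This cospan is turned into a roof, and each interval
  module is a suspension of an X_n or is an E_m.\<close>

lemma artinian_Dbar:
  fixes M :: "('k::field, 'u::infinite) dgm"
  assumes M: "dg_module M" and art: "artinian M"
  shows "M \<in> Dbar"
proof -
  obtain S :: "('k, 'u) dgm" and f g where S: "dg_module S" and dif0: "\<And>i x. dif S i x = 0"
    and f: "f \<in> quasi_iso M (cof S)" and g: "g \<in> quasi_iso S (cof S)" using formality[OF M] by metis
  let ?V = "cof S"
  have V: "dg_module ?V" by (rule dg_module_cof[OF S])
  have artS: "artinian S" using artinian_quasi_iso[OF M V f] artinian_quasi_iso[OF S V g] art by blast
  obtain n J \<kappa> where dec: "bar_decomposes S n J \<kappa>" using ex_bar_decomposition[OF S dif0 artS] by blast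
  define A where "A k = (bar (J k) :: ('k, 'u) dgm)" for k
  have A: "\<forall>k\<in>{..<n}. dg_module (A k)" by (simp add: A_def)
  have \<kappa>: "\<kappa> k \<in> dg_hom (A k) S" if "k < n" for k using dec that unfolding bar_decomposes_def A_def by blast
  obtain e1 :: "nat \<Rightarrow> 'u" where e1: "inj e1" using ex_inj_nat by blast
  have id: "inj (\<lambda>x :: 'u. x)" by simp
  obtain e2 :: "nat \<times> 'u \<Rightarrow> 'u" where e2: "inj e2" using ex_inj_prod[OF e1 id] by blast
  obtain e3 :: "bool \<Rightarrow> 'u" where e3: "inj e3" using ex_inj_bool by blast
  obtain e4 :: "bool \<times> 'u \<Rightarrow> 'u" where e4: "inj e4" using ex_inj_prod[OF e3 id] by blast
  obtain e5 :: "(nat \<times> 'u) + (nat \<times> 'u) \<Rightarrow> 'u" where e5: "inj e5" using ex_inj_sum[OF e2 e2] by blast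
  let ?B0 = "dsum {..<n} A"
  have B0: "dg_module ?B0" by (rule dg_module_dsum[OF A])
  define B where "B = push e2 ?B0"
  have B: "dg_module B" unfolding B_def by (rule dg_module_push[OF e2 B0])
  have Bsum: "is_dsum {..<n} A B (\<lambda>i n x. enc e2 (dsum_incl i n x))" unfolding B_def by (rule is_dsum_push[OF A e2])
  have cobS: "x \<in> coboundaries S i \<longleftrightarrow> x = 0" for x i using S by (auto elim: coboundaryE simp: dif0)
  \<comment> \<open>Adding up the embedded components turns the internal decomposition into a map
    from the external direct sum; it is bijective in each degree.\<close>
  define \<sigma> where "\<sigma> i z = (\<Sum>k<n. \<kappa> k i (sec z k))" for i and z :: "nat \<times> 'u \<Rightarrow> 'k"
  have \<sigma>: "\<sigma> \<in> dg_hom ?B0 S"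
  proof (rule dg_homI)
    fix i z assume z: "z \<in> cpt ?B0 i"
    then have zs: "sec z k \<in> cpt (A k) i" if "k < n" for k using that by (simp add: dsum_cpt)
    note kz = hom_mem[OF \<kappa> zs]
    show "\<sigma> i z \<in> cpt S i" unfolding \<sigma>_def by (rule cpt_sum[OF S]) (use kz in simp)
    show "\<sigma> i (fscale c z) = fscale c (\<sigma> i z)" for c
      unfolding \<sigma>_def fscale_sum by (rule sum.cong[OF refl]) (use hom_scale[OF \<kappa> zs] in simp)
    show "\<sigma> i (z + z') = \<sigma> i z + \<sigma> i z'" if z': "z' \<in> cpt ?B0 i" for z'
    proof -
      have zs': "sec z' k \<in> cpt (A k) i" if "k < n" for k using that z' by (simp add: dsum_cpt)
      show ?thesis unfolding \<sigma>_def sum.distrib[symmetric]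
        by (rule sum.cong[OF refl]) (use hom_add[OF \<kappa> zs zs'] in simp)
    qed
    have "\<sigma> (i - 1) (tact ?B0 i z) = (\<Sum>k<n. tact S i (\<kappa> k i (sec z k)))"
      unfolding \<sigma>_def by (rule sum.cong[OF refl]) (use hom_tact[OF \<kappa> zs refl] in simp)
    also have "\<dots> = tact S i (\<sigma> i z)" unfolding \<sigma>_def
      by (rule lin_maps_sum[OF tact_lin[OF S] S, symmetric]) (use kz in simp)
    finally show "\<sigma> (i - 1) (tact ?B0 i z) = tact S i (\<sigma> i z)" .
    have "\<sigma> (i + 1) (dif ?B0 i z) = 0"
      unfolding \<sigma>_def by (rule sum.neutral) (use hom_zero[OF \<kappa>] A in \<open>simp add: A_def\<close>)
    then show "\<sigma> (i + 1) (dif ?B0 i z) = dif S i (\<sigma> i z)" by (simp add: dif0)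
  qed
  have \<sigma>q: "\<sigma> \<in> quasi_iso ?B0 S"
  proof (rule quasi_isoI[OF B0 S \<sigma>])
    fix i z assume z: "z \<in> cocycles ?B0 i" and 0: "\<sigma> i z \<in> coboundaries S i"
    have zm: "z \<in> cpt ?B0 i" using z by simp
    have "\<forall>k<n. sec z k \<in> cpt (bar (J k) :: ('k, 'u) dgm) i" using zm by (simp add: dsum_cpt A_def)
    moreover have "(\<Sum>k<n. \<kappa> k i (sec z k)) = 0" using 0 by (simp add: cobS \<sigma>_def)
    ultimately have "\<forall>k<n. sec z k = 0" using dec unfolding bar_decomposes_def by blast
    then have "z = 0" using zm by (intro sec_ext) (simp add: dsum_cpt, metis)
    then show "z \<in> coboundaries ?B0 i" using B0 by simp
  next
    fix i y assume "y \<in> cocycles S i"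
    then have "y \<in> cpt S i" by simp
    then obtain x where x: "\<forall>k<n. x k \<in> cpt (A k) i" "y = (\<Sum>k<n. \<kappa> k i (x k))"
      using dec unfolding bar_decomposes_def A_def by blast
    define z where "z = mkseq (\<lambda>k. if k < n then x k else 0)"
    have zs: "sec z k = (if k < n then x k else 0)" for k by (simp add: z_def)
    have "{k. sec z k \<noteq> 0} \<subseteq> {..<n}" by (auto simp: zs)
    then have "finite {k. sec z k \<noteq> 0}" using finite_subset by blast
    then have "z \<in> cpt ?B0 i" using x(1) by (simp add: dsum_cpt zs)
    moreover have "sec z k \<in> cocycles (A k) i" if "k < n" for k
      using x(1) that unfolding A_def bar_cocycle by (simp add: zs)
    ultimately have z: "z \<in> cocycles ?B0 i" by (simp add: dsum_cocycle_iff[OF A])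
    have "\<sigma> i z = y" unfolding \<sigma>_def x(2) by (rule sum.cong) (simp_all add: zs)
    then have "y - \<sigma> i z \<in> coboundaries S i" by (simp add: cobS)
    then show "\<exists>z\<in>cocycles ?B0 i. y - \<sigma> i z \<in> coboundaries S i" by (rule bexI[OF _ z])
  qed
  define V' where "V' = push e5 ?V"
  have V': "dg_module V'" unfolding V'_def by (rule dg_module_push[OF e5 V])
  have enV: "(\<lambda>i. enc e5) \<in> quasi_iso ?V V'"
    unfolding V'_def by (rule dg_iso_quasi_iso[OF dg_iso_push(1)[OF e5 V] V dg_module_push[OF e5 V]])
  have deB: "(\<lambda>i y. y \<circ> e2) \<in> quasi_iso B ?B0"
    unfolding B_def by (rule dg_iso_quasi_iso[OF dg_iso_push(2)[OF e2 B0] dg_module_push[OF e2 B0] B0])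
  have BV: "gcomp (\<lambda>i. enc e5) (gcomp g (gcomp \<sigma> (\<lambda>i y. y \<circ> e2))) \<in> quasi_iso B V'"
    by (rule quasi_iso_comp[OF B V V' quasi_iso_comp[OF B S V quasi_iso_comp[OF B B0 S deB \<sigma>q] g] enV])
  \<comment> \<open>\<open>add_closure\<close> speaks of direct summands, so M is exhibited as a
    summand of its sum with the zero module.\<close>
  let ?Z = "bar {} :: ('k, 'u) dgm"
  let ?Y = "\<lambda>b. if b then M else ?Z"
  have Y: "\<forall>b\<in>UNIV. dg_module (?Y b)" using M by simp
  let ?P0 = "dsum UNIV ?Y"
  have P0: "dg_module ?P0" by (rule dg_module_dsum[OF Y])
  define P where "P = push e4 ?P0"
  have P: "dg_module P" unfolding P_def by (rule dg_module_push[OF e4 P0])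
  have Psum: "is_dsum UNIV ?Y P (\<lambda>i n x. enc e4 (dsum_incl i n x))" unfolding P_def by (rule is_dsum_push[OF Y e4])
  have deP: "(\<lambda>i y. y \<circ> e4) \<in> quasi_iso P ?P0"
    unfolding P_def by (rule dg_iso_quasi_iso[OF dg_iso_push(2)[OF e4 P0] dg_module_push[OF e4 P0] P0])
  have pr: "(\<lambda>n z. sec z True) \<in> dg_hom ?P0 M" using dsum_proj_hom[OF Y, of True] by simp
  have prq: "(\<lambda>n z. sec z True) \<in> quasi_iso ?P0 M"
  proof (rule quasi_isoI[OF P0 M pr])
    fix i z assume z: "z \<in> cocycles ?P0 i" and c: "sec z True \<in> coboundaries M i"
    have zm: "z \<in> cpt ?P0 i" using z by simp
    have "sec z False \<in> cpt (?Y False) i" using zm unfolding dsum_cpt by blast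
    then have F: "sec z False = 0" by (simp add: bar_cpt)
    show "z \<in> coboundaries ?P0 i"
    proof (rule dsum_cob[OF Y zm])
      fix b show "sec z b \<in> coboundaries (?Y b) i" using c F by (cases b) simp_all
    qed
  next
    fix i y assume y: "y \<in> cocycles M i"
    have "dsum_incl True \<in> dg_hom M ?P0" using dsum_incl_hom[OF Y, of True] by simp
    from hom_cocycle[OF this M y] have "dsum_incl True i y \<in> cocycles ?P0 i" .
    then show "\<exists>z\<in>cocycles ?P0 i. y - sec z True \<in> coboundaries M i"
      by (rule bexI[rotated]) (simp add: M)
  qed
  have PV: "gcomp (\<lambda>i. enc e5) (gcomp f (gcomp (\<lambda>n z. sec z True) (\<lambda>i y. y \<circ> e4))) \<in> quasi_iso P V'"
    by (rule quasi_iso_comp[OF P V V' quasi_iso_comp[OF P M V quasi_iso_comp[OF P P0 M deP prq] f] enV])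
  \<comment> \<open>The two quasi-isomorphisms into V' are completed to a square. By
    two-out-of-three both legs of the resulting roof are quasi-isomorphisms, so P and B are
    isomorphic in the derived category.\<close>
  obtain W :: "('k, 'u) dgm" and t h where W: "dg_module W" and t: "t \<in> quasi_iso W P" and h: "h \<in> dg_hom W B"
    and hom: "homotopic W V' (gcomp (gcomp (\<lambda>i. enc e5) (gcomp f (gcomp (\<lambda>n z. sec z True) (\<lambda>i y. y \<circ> e4)))) t)
      (gcomp (gcomp (\<lambda>i. enc e5) (gcomp g (gcomp \<sigma> (\<lambda>i y. y \<circ> e2)))) h)"
    by (rule ore[OF P B V' quasi_iso_hom[OF PV] BV])
  have "h \<in> quasi_iso W B"
    by (rule quasi_iso_cancel_left[OF W B V' h BV quasi_iso_homotopic[OF W V' quasi_iso_comp[OF W P V' t PV]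
          gcomp_hom[OF h quasi_iso_hom[OF BV]] hom]])
  then have iso: "isomorphic_D P B" unfolding isomorphic_D_def using roof_iso[OF P B W t] by blast
  have gens: "A k \<in> {shift i X |i n X. is_X n X} \<union> {E. \<exists>m. is_E m E}" if k: "k < n" for k
  proof -
    have "(\<exists>a b. a \<le> b \<and> J k = {a..b}) \<or> (\<exists>a. J k = {a..})" using dec k unfolding bar_decomposes_def by blast
    then show ?thesis
    proof (elim disjE exE conjE)
      fix a b assume ab: "a \<le> b" "J k = {a..b}"
      \<comment> \<open>The interval from a to b is the one from -(b - a) to 0, moved up by b, which
        is the suspension by - b.\<close>
      have "{i. i - b \<in> {- int (nat (b - a))..0}} = {a..b}" using ab(1) by auto
      then have "A k = shift (- b) (bar {- int (nat (b - a))..0})" unfolding shift_bar A_def ab(2) by simp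
      then show ?thesis using is_X_bar by blast
    next
      fix a assume "J k = {a..}"
      then have "A k = bar {- (- a)..}" by (simp add: A_def)
      then have "is_E (- a) (A k)" by (simp only: is_E_bar)
      then show ?thesis by blast
    qed
  qed
  show ?thesis unfolding Dbar_def add_closure_def mem_Collect_eq
    by (intro conjI M exI[of _ ?Z] exI[of _ P] exI[of _ "\<lambda>i n x. enc e4 (dsum_incl i n x)"] exI[of _ n] exI[of _ A]
        exI[of _ B] exI[of _ "\<lambda>i n x. enc e2 (dsum_incl i n x)"] Psum Bsum iso dg_module_bar allI impI gens)
qed

lemma Dbar_iff:
  fixes M :: "('k::field, 'u::infinite) dgm"
  shows "M \<in> Dbar \<longleftrightarrow> dg_module M \<and> artinian M"
  using artinian_Dbar Dbar_artinian by blast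

theorem theorem1p19:
  shows "triangulated_subcategory (Dbar :: ('k::alg_closed_field, 'u::infinite) dgm set)"
  unfolding triangulated_subcategory_def
proof (intro conjI ballI allI impI)
  fix X :: "('k, 'u) dgm" assume X: "X \<in> Dbar"
  then show "dg_module X" by (simp add: Dbar_iff)
  fix Y :: "('k, 'u) dgm" assume "dg_module Y \<and> isomorphic_D X Y"
  then obtain \<phi> where Y: "dg_module Y" and \<phi>: "\<phi> \<in> D_iso X Y" by (auto simp: isomorphic_D_def)
  show "Y \<in> Dbar" using X Y artinian_isomorphic_D[OF _ Y \<phi>] by (simp add: Dbar_iff)
next
  \<comment> \<open>The interval module on the empty set of degrees is the zero module.\<close>
  let ?Z = "bar {} :: ('k, 'u) dgm"
  have z: "x = 0" if "x \<in> cpt ?Z i" for x i using that by (simp add: bar_cpt)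
  have "coh_zero ?Z i" for i
    unfolding coh_zero_def
  proof
    fix x assume "x \<in> cocycles ?Z i"
    then show "x \<in> coboundaries ?Z i" using z[OF cocycle_cpt[of x ?Z i]] by simp
  qed
  then have "artinian ?Z" by (intro artinianI[of 0] coh_zero_dep coh_zero_tact_bij) simp_all
  moreover have "D_id ?Z = D_zero ?Z ?Z" unfolding D_id_def D_zero_def
    by (rule D_of_cong) (use z in \<open>simp_all add: pointwise\<close>)
  ultimately show "\<exists>Z\<in>Dbar :: ('k, 'u) dgm set. zero_object Z"
    by (intro bexI[of _ ?Z]) (simp_all add: zero_object_def Dbar_iff)
next
  fix X Y :: "('k, 'u) dgm" assume X: "X \<in> Dbar" and Y: "Y \<in> Dbar"
  let ?Y = "\<lambda>b. if b then X else Y"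
  have Y': "\<forall>b\<in>UNIV. dg_module (?Y b)" using X Y by (simp add: Dbar_iff)
  obtain e3 :: "bool \<Rightarrow> 'u" where e3: "inj e3" using ex_inj_bool by blast
  obtain e :: "bool \<times> 'u \<Rightarrow> 'u" where e: "inj e" using ex_inj_prod[OF e3, of "\<lambda>x. x"] by auto
  note B = is_dsum_push[OF Y' e]
  have "artinian (push e (dsum UNIV ?Y))"
    by (rule artinian_is_dsum[OF B Y']) (use X Y in \<open>auto simp: Dbar_iff\<close>)
  moreover have "dg_module (push e (dsum UNIV ?Y))" using B by (simp add: is_dsum_def)
  ultimately have "push e (dsum UNIV ?Y) \<in> Dbar" by (simp add: Dbar_iff)
  then show "\<exists>B\<in>Dbar. \<exists>\<iota>. is_dsum UNIV ?Y B \<iota>" using B by blast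
next
  fix X :: "('k, 'u) dgm" assume X: "dg_module X"
  show "(shift 1 X \<in> Dbar) = (X \<in> Dbar)"
    \<comment> \<open>Both directions of the equivalence come from suspensions, by 1 and by
      -1.\<close>
    using artinian_shift[OF X, of 1] artinian_shift[OF dg_module_shift[OF X, of 1], of "- 1"] X
    by (auto simp: Dbar_iff shift_shift)
next
  fix X Y Z :: "('k, 'u) dgm" and \<phi> \<psi> \<chi>
  assume X: "X \<in> Dbar" and Y: "Y \<in> Dbar" and t: "dist_triangle X Y Z \<phi> \<psi> \<chi>"
  have "artinian Z" by (rule artinian_dist_triangle[OF t]) (use X Y in \<open>simp_all add: Dbar_iff\<close>)
  moreover have "dg_module Z" using t by (simp add: dist_triangle_def)
  ultimately show "Z \<in> Dbar" by (simp add: Dbar_iff)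
qed

end
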